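(* Under assumptions (A1)-(A3) and (B1)-(B3) listed in the context, for every $\delta>0$ it holds that $$\Pi\left(\sum_{k>K}w_k>\frac{1}{n^{1/2-\delta}}\ \Big|\ X_{1:n}\right)\to0\quad\text{as } n\to\infty \text{ in } Q^{(\infty)}\text{-probability}.$$
   Context: Let $D\ge 1$, let $\|\cdot\|$ be the Euclidean norm, and let $f$ be a probability density on $\mathbb{R}^D$ (w.r.t. Lebesgue measure). For a probability measure $P$ on $\mathbb{R}^D$ write $Pf(x)=\int f(x-\theta)\,P(d\theta)$. Prior: $\alpha>0$, $P_0$ is a probability measure on $\Theta\subset\mathbb{R}^D$, and $\Pi$ is the law of the Dirichlet process $P\sim \mathrm{DP}(\alpha,P_0)$ in stick-breaking form, $P=\sum_{k\ge1}w_k\delta_{\theta_k}$, $w_k=v_k\prod_{j=1}^{k-1}(1-v_j)$, $v_k$ i.i.d. $\mathrm{Beta}(1,\alpha)$, $\theta_k$ i.i.d. $P_0$, the two sequences being independent; $\Pi$ is identified with the joint law of $(w_k)_{k\ge1},(\theta_k)_{k\ge1}$. The posterior is $\Pi(B\mid X_{1:n})=\int_B\prod_{i=1}^nPf(X_i)\,\Pi(dP)\big/\int\prod_{i=1}^nPf(X_i)\,\Pi(dP)$. Assumptions: (A1) $X_1,X_2,\dots$ are i.i.d. from $Q(dx)=P^*f(x)\,dx$, where $P^*=\sum_{k=1}^K w_k^*\delta_{\theta_k^*}$, $K<\infty$, $(w_1^*,\dots,w_K^* )$ is a probability vector, and $P^*$ has exactly $K$ support points (the $\theta_k^*$ are distinct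 and $w_k^*>0$). (A2) $\Theta\subset\mathbb{R}^D$ is compact and $\theta_k^*\in\Theta$ for all $k=1,\dots,K$. (A3) $P_0$ has a continuous bounded density $p_0$ on $\Theta$ w.r.t. Lebesgue measure, with $p_0(\theta_k^* )>0$ for all $k=1,\dots,K$. (B1) $f\in C^3(\mathbb{R}^D)$ and there is a constant $F$ with $0<f(x)<F$ for all $x$. (B2) There are $R>0$, $\gamma\ge0$ with $\|\nabla\log f(x)\|\le R(1+\|x\|)^\gamma$ and $\|\nabla^2\log f(x)\|\le R(1+\|x\|)^\gamma$ for all $x$, and $\int e^{M\|x\|^\gamma}f(x)\,dx<\infty$ for every $M>0$. (B3) There are $C,r>0$ with $\|\nabla^g f(x)\|\le C(1+\|x\|)^{-(D+r)}$ for all $x$ and $g=1,2,3$. $Q^{(\infty)}$ is the law of the i.i.d. sequence $(X_i)_{i\ge1}$, and $X_{1:n}=(X_1,\dots,X_n)$.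
   Formalization: Adds to (A2)-(A3) that Θ has positive lower Lebesgue density at each true atom θ*_k (automatic for interior points or convex bodies); without it the claim fails, e.g. if θ*_k is an isolated point of Θ. *)

theory Defs
  imports "HOL-Probability.Probability"
begin

(* Frechet derivative as a bounded linear map.  Iterating it gives the derivative tensors
   \<nabla>f, \<nabla>^2 f, \<nabla>^3 f with the operator norm; for a real-valued f the operator norm of
   total_deriv f x is the Euclidean norm of the gradient.  Meaningful only where the
   function is differentiable. *)
definition total_deriv ::
  "('a::real_normed_vector \<Rightarrow> 'b::real_normed_vector) \<Rightarrow> 'a \<Rightarrow> ('a \<Rightarrow>\<^sub>L 'b)" where
  "total_deriv f x = Blinfun (frechet_derivative f (at x))"

definition C3 :: "('a::real_normed_vector \<Rightarrow> 'b::real_normed_vector) \<Rightarrow> bool" where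
  "C3 f \<longleftrightarrow>
     f differentiable_on UNIV \<and>
     total_deriv f differentiable_on UNIV \<and>
     total_deriv (total_deriv f) differentiable_on UNIV \<and>
     continuous_on UNIV (total_deriv (total_deriv (total_deriv f)))"

(* The measure \<Sum>k\<in>I. w k \<delta>_{\<theta> k}, as the image under \<theta> of the weights w on I. *)
definition discrete_measure ::
  "nat set \<Rightarrow> (nat \<Rightarrow> real) \<Rightarrow> (nat \<Rightarrow> 'a::euclidean_space) \<Rightarrow> 'a measure" where
  "discrete_measure I w \<theta> =
     distr (density (count_space I) (\<lambda>k. ennreal (w k))) borel \<theta>"

(* The mixture density Pf. *)
definition mixture :: "'a::euclidean_space measure \<Rightarrow> ('a \<Rightarrow> real) \<Rightarrow> 'a \<Rightarrow> real" where
  "mixture P f x = (\<integral>\<theta>. f (x - \<theta>) \<partial>P)"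

definition likelihood ::
  "('a::euclidean_space \<Rightarrow> real) \<Rightarrow> nat \<Rightarrow> (nat \<Rightarrow> 'a) \<Rightarrow> 'a measure \<Rightarrow> real" where
  "likelihood f n X P = (\<Prod>i<n. mixture P f (X i))"

definition beta_density :: "real \<Rightarrow> real \<Rightarrow> real \<Rightarrow> real" where
  "beta_density a b x =
     (if 0 < x \<and> x < 1 then x powr (a - 1) * (1 - x) powr (b - 1) / Beta a b else 0)"

definition beta_distribution :: "real \<Rightarrow> real \<Rightarrow> real measure" where
  "beta_distribution a b = density lborel (\<lambda>x. ennreal (beta_density a b x))"

(* Sequences are indexed from 0: index k here is index k + 1 in the usual notation
   w_1, w_2, \<dots>; in particular the sum over k > K there is the sum over k \<ge> K here. *)
definition stick_breaking :: "(nat \<Rightarrow> real) \<Rightarrow> nat \<Rightarrow> real" where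
  "stick_breaking v k = v k * (\<Prod>j<k. 1 - v j)"

(* The joint law of the stick-breaking weights and the atoms. *)
definition DP_prior ::
  "real \<Rightarrow> 'a::euclidean_space measure \<Rightarrow> ((nat \<Rightarrow> real) \<times> (nat \<Rightarrow> 'a)) measure" where
  "DP_prior \<alpha> P0 =
     distr (PiM UNIV (\<lambda>_. beta_distribution 1 \<alpha>) \<Otimes>\<^sub>M PiM UNIV (\<lambda>_. P0))
           (PiM UNIV (\<lambda>_. borel) \<Otimes>\<^sub>M PiM UNIV (\<lambda>_. borel))
           (\<lambda>(v, \<theta>). (stick_breaking v, \<theta>))"

definition posterior ::
  "((nat \<Rightarrow> real) \<times> (nat \<Rightarrow> 'a::euclidean_space)) measure \<Rightarrow> ('a \<Rightarrow> real) \<Rightarrow>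
   nat \<Rightarrow> (nat \<Rightarrow> 'a) \<Rightarrow> ((nat \<Rightarrow> real) \<times> (nat \<Rightarrow> 'a)) set \<Rightarrow> real" where
  "posterior \<pi> f n X B =
     (LINT p:B|\<pi>. likelihood f n X (discrete_measure UNIV (fst p) (snd p))) /
     (LINT p|\<pi>. likelihood f n X (discrete_measure UNIV (fst p) (snd p)))"

definition tendsto_in_probability ::
  "'s measure \<Rightarrow> (nat \<Rightarrow> 's \<Rightarrow> real) \<Rightarrow> real \<Rightarrow> bool" where
  "tendsto_in_probability M Z l \<longleftrightarrow>
     (\<forall>\<epsilon>>0. (\<lambda>n. measure M {\<omega> \<in> space M. \<bar>Z n \<omega> - l\<bar> > \<epsilon>}) \<longlonglongrightarrow> 0)"

end

theory Submission
  imports Defs "HOL-Real_Asymp.Real_Asymp"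
begin

text \<open>
  Write \<open>t = n\<^bsup>-1/2+\<eta>\<^esup>\<close> for a small \<open>\<eta> > 0\<close>; every bound below may lose powers \<open>n\<^bsup>O(\<eta>)\<^esup>\<close>.

  Denominator. On the event that the first \<open>K\<close> weights and atoms are within \<open>n\<^bsup>-1/2-\<eta>\<^esup>\<close> of the truth
  and the remaining stick is at most \<open>n\<^bsup>-1/2-\<eta>\<^esup>\<close>, the likelihood ratio has second moment \<open>1 + o(1)\<close>, so its
  average over the event is close to \<open>1\<close>. The evidence relative to the truth is therefore at least half the
  prior mass of the event, which is of order \<open>n\<^bsup>-(1/2+\<eta>)(KD+K-1+\<alpha>)\<^esup>\<close>.

  Numerator. The characteristic function of \<open>f\<close> does not vanish near the origin, hence every trigonometric
  polynomial \<open>H\<close> of small frequency is of the form \<open>H(\<theta>) = \<integral> g(x) f(x - \<theta>) dx\<close> with \<open>g\<close> bounded, and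
  exponential tests force \<open>\<bar>\<integral> H d(P - P\<^sup>*)\<bar> \<le> t\<close>. Finitely many such \<open>H\<close>, built from
  \<open>1 - cos(e(\<theta> - \<theta>\<^sub>k\<^sup>*))\<close> and vanishing to second order at the true atoms, show that the squared distance to the
  true atoms has \<open>P\<close>-integral \<open>O(t)\<close> and that the masses and the first moments of the \<open>K\<close> clusters of atoms
  are correct up to \<open>O(t)\<close>. A heaviest atom in each cluster then is determined up to \<open>O(t)\<close> by the others,
  the weights of these \<open>K\<close> atoms satisfy \<open>K - 1\<close> further constraints, and the remaining stick is small: together
  these have prior mass \<open>t\<^bsup>KD+K-1+\<alpha>\<^esup>\<close>. If the stick remaining after \<open>K\<close> atoms exceeds
  \<open>\<epsilon> = n\<^bsup>-1/2+\<delta>\<^esup>\<close>, an additional atom has to lie within \<open>O((t/w)\<^bsup>1/2\<^esup>)\<close> of a true atom, where \<open>w\<close> is its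
  weight, and this costs the additional factor \<open>(t/\<epsilon>)\<^bsup>1/2\<^esup>\<close> which makes the ratio vanish.
\<close>

section \<open>Resampling coordinates of product measures\<close>

text \<open>The prior masses in numerator and denominator have the same exponent KD + K - 1 +
  \<alpha>, so only factors n^(O(\<eta>)) may be lost; a crude rate such as n^(-1/4) for the atoms
  would already spoil the comparison. Hence the test functions must match the cluster functionals to
  second order: precision t controls only squared distances, and a first-order error would cost
  t^(1/2). The labelling of atoms is arbitrary: the heavy atoms of the K clusters may sit anywhere
  among the first m indices, so the bad event is covered by finitely many labelled events. If the
  heavy atoms skip an index, the skipped atom is the additional one; its weight w has no lower
  bound, but the cost w^(-1/2) is integrable against the prior. If they are exactly the first K
  atoms, the long stick behind them contains an atom of weight of order \<epsilon>. The infinite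
  tail is cut at m: either little stick is left after m atoms, or each of m independent atoms falls
  near the truth or takes a tiny share, which is negligible for large fixed m. No sieve is required,
  since one event on the data, built from finitely many averages, tests all remaining parameters at
  once.\<close>

lemma nn_integral_PiM_split:
  fixes N :: "'i \<Rightarrow> 'a measure"
  assumes N: "\<And>i. prob_space (N i)"
    and F[measurable]: "F \<in> borel_measurable (PiM UNIV N)"
  shows "(\<integral>\<^sup>+u. F u \<partial>PiM UNIV N) =
    (\<integral>\<^sup>+u. (\<integral>\<^sup>+y. F (u(j := y)) \<partial>N j) \<partial>PiM (UNIV - {j}) N)"
proof -
  have ins: "insert j (UNIV - {j}) = (UNIV :: 'i set)" by auto
  interpret P: prob_space "PiM (UNIV - {j}) N" by (intro prob_space_PiM N)
  interpret J: prob_space "N j" by (rule N)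
  interpret pair_sigma_finite "N j" "PiM (UNIV - {j}) N" ..
  have m[measurable]: "(\<lambda>(x, X). X(j := x)) \<in> measurable (N j \<Otimes>\<^sub>M PiM (UNIV - {j}) N) (PiM UNIV N)"
    using measurable_add_dim[of j "UNIV - {j}" N]
    by (subst measurable_pair_swap_iff) (simp add: ins split_beta)
  have "(\<integral>\<^sup>+u. F u \<partial>PiM UNIV N) =
    (\<integral>\<^sup>+u. F u \<partial>distr (N j \<Otimes>\<^sub>M PiM (UNIV - {j}) N) (PiM UNIV N) (\<lambda>(x, X). X(j := x)))"
    using distr_pair_PiM_eq_PiM[of "UNIV - {j}" N j] N by (simp add: ins)
  also have "\<dots> = (\<integral>\<^sup>+z. F ((snd z)(j := fst z)) \<partial>(N j \<Otimes>\<^sub>M PiM (UNIV - {j}) N))"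
    by (subst nn_integral_distr) (auto simp: split_beta)
  also have "\<dots> = (\<integral>\<^sup>+u. (\<integral>\<^sup>+y. F (u(j := y)) \<partial>N j) \<partial>PiM (UNIV - {j}) N)"
    using m by (subst nn_integral_snd[symmetric]) (auto simp: split_beta)
  finally show ?thesis .
qed

lemma measurable_fun_upd_PiM:
  fixes N :: "'i \<Rightarrow> 'a measure"
  assumes "\<And>i. i \<noteq> j \<Longrightarrow> N' i = N i"
  shows "(\<lambda>(u, y). u(j := y)) \<in> measurable (PiM UNIV N \<Otimes>\<^sub>M N' j) (PiM UNIV N')"
proof (rule measurable_PiM_single')
  fix i :: 'i
  show "(\<lambda>z. (case z of (u, y) \<Rightarrow> u(j := y)) i) \<in> measurable (PiM UNIV N \<Otimes>\<^sub>M N' j) (N' i)"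
    using assms by (cases "i = j") (auto simp: split_beta)
qed (use assms in \<open>auto simp: space_pair_measure space_PiM PiE_def Pi_def extensional_def split: if_splits; metis\<close>)

text \<open>The inner integral redraws coordinate \<open>j\<close>, so the law which the outer
  product gives to it is immaterial. This allows one factor of a product measure to be exchanged for
  another, later a Beta law for the uniform one.\<close>

lemma nn_integral_PiM_resample:
  fixes N N' :: "'i \<Rightarrow> 'a measure"
  assumes N: "\<And>i. prob_space (N i)" and N': "prob_space (N' j)" "\<And>i. i \<noteq> j \<Longrightarrow> N' i = N i"
    and F[measurable]: "F \<in> borel_measurable (PiM UNIV N')"
  shows "(\<integral>\<^sup>+u. F u \<partial>PiM UNIV N') =
    (\<integral>\<^sup>+u. (\<integral>\<^sup>+y. F (u(j := y)) \<partial>N' j) \<partial>PiM UNIV N)"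
proof -
  have ps: "prob_space (N' i)" for i using N N' by (cases "i = j") auto
  interpret J: prob_space "N' j" by (rule ps)
  interpret J': prob_space "N j" by (rule N)
  note [measurable] = measurable_fun_upd_PiM[of j N' N, OF N'(2)]
  have [measurable]: "(\<lambda>(u, y). F (u(j := y))) \<in> borel_measurable (PiM UNIV N \<Otimes>\<^sub>M N' j)"
    using measurable_compose[OF measurable_fun_upd_PiM[of j N' N, OF N'(2)] F] by (simp add: split_beta)
  have "(\<integral>\<^sup>+u. (\<integral>\<^sup>+y. F (u(j := y)) \<partial>N' j) \<partial>PiM UNIV N) =
     (\<integral>\<^sup>+u. (\<integral>\<^sup>+x. (\<integral>\<^sup>+y. F (u(j := y)) \<partial>N' j) \<partial>N j) \<partial>PiM (UNIV - {j}) N)"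
    by (subst nn_integral_PiM_split[OF N, where j=j]) auto
  also have "\<dots> = (\<integral>\<^sup>+u. (\<integral>\<^sup>+y. F (u(j := y)) \<partial>N' j) \<partial>PiM (UNIV - {j}) N)"
    by (simp add: J'.emeasure_space_1)
  also have "PiM (UNIV - {j}) N = PiM (UNIV - {j}) N'"
    using N' by (intro PiM_cong) auto
  finally show ?thesis
    unfolding nn_integral_PiM_split[OF ps F, where j=j] by (rule sym)
qed

text \<open>Coordinates in \<open>J\<close> are integrated out one after the other. The factor of
  \<open>j\<close> may depend on coordinates outside \<open>J\<close> but, apart from its own
  argument, on none inside; so one integration leaves the other factors untouched and costs at most
  \<open>b\<close>, uniformly in the rest.\<close>

lemma nn_integral_PiM_peel:
  fixes N :: "'i \<Rightarrow> 'a measure"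
  assumes N: "\<And>i. prob_space (N i)" and J: "finite J"
    and s[measurable]: "\<And>j. j \<in> J \<Longrightarrow> (\<lambda>u. s j u (u j)) \<in> borel_measurable (PiM UNIV N)"
    and G[measurable]: "G \<in> borel_measurable (PiM UNIV N)"
    and s_indep: "\<And>i j u y z. i \<in> J \<Longrightarrow> j \<in> J \<Longrightarrow> s j (u(i := y)) z = s j u z"
    and G_indep: "\<And>i u y. i \<in> J \<Longrightarrow> G (u(i := y)) = (G u :: ennreal)"
    and b: "\<And>j u. j \<in> J \<Longrightarrow> u \<in> space (PiM UNIV N) \<Longrightarrow> (\<integral>\<^sup>+y. s j u y \<partial>N j) \<le> b"
  shows "(\<integral>\<^sup>+u. (\<Prod>j\<in>J. s j u (u j)) * G u \<partial>PiM UNIV N) \<le> b ^ card J * (\<integral>\<^sup>+u. G u \<partial>PiM UNIV N)"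
  using J s s_indep G_indep b
proof (induction J rule: finite_induct)
  case empty
  then show ?case by simp
next
  case (insert j J)
  let ?H = "\<lambda>u. (\<Prod>j\<in>J. s j u (u j)) * G u"
  note insert.prems(1)[measurable]
  have H[measurable]: "?H \<in> borel_measurable (PiM UNIV N)"
    by measurable
  have sj: "s j (u(j := y)) z = s j u z" for u y z using insert.prems(2) by blast
  have H_ind: "?H (u(j := y)) = ?H u" for u y
  proof -
    have "(\<Prod>i\<in>J. s i (u(j := y)) ((u(j := y)) i)) = (\<Prod>i\<in>J. s i u (u i))"
    proof (intro prod.cong refl)
      fix i assume "i \<in> J"
      then show "s i (u(j := y)) ((u(j := y)) i) = s i u (u i)"
        using insert.prems(2)[of j i u y] \<open>j \<notin> J\<close> by (metis fun_upd_other insertCI)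
    qed
    moreover have "G (u(j := y)) = G u" using insert.prems(3) by blast
    ultimately show ?thesis by simp
  qed
  have upd: "(\<lambda>y. u(j := y)) \<in> measurable (N j) (PiM UNIV N)" if "u \<in> space (PiM UNIV N)" for u
    using measurable_compose[OF measurable_Pair1'[OF that] measurable_fun_upd_PiM[of j N N]] by simp
  have "(\<integral>\<^sup>+u. (\<Prod>j\<in>insert j J. s j u (u j)) * G u \<partial>PiM UNIV N) =
     (\<integral>\<^sup>+u. s j u (u j) * ?H u \<partial>PiM UNIV N)"
    using insert by (simp add: mult.assoc)
  also have "\<dots> = (\<integral>\<^sup>+u. (\<integral>\<^sup>+y. s j (u(j := y)) y * ?H (u(j := y)) \<partial>N j) \<partial>PiM UNIV N)"
    using insert.prems(1) by (subst nn_integral_PiM_resample[OF N, of N j]) (auto intro: N)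
  also have "\<dots> = (\<integral>\<^sup>+u. (\<integral>\<^sup>+y. s j u y * ?H u \<partial>N j) \<partial>PiM UNIV N)"
    by (intro nn_integral_cong) (simp only: sj H_ind)
  also have "\<dots> = (\<integral>\<^sup>+u. (\<integral>\<^sup>+y. s j u y \<partial>N j) * ?H u \<partial>PiM UNIV N)"
  proof (intro nn_integral_cong nn_integral_multc)
    fix u assume u: "u \<in> space (PiM UNIV N)"
    show "s j u \<in> borel_measurable (N j)"
      using measurable_compose[OF upd[OF u] insert.prems(1)[OF insertI1]] by (simp only: sj fun_upd_same)
  qed
  also have "\<dots> \<le> (\<integral>\<^sup>+u. b * ?H u \<partial>PiM UNIV N)"
    using insert.prems(4) by (intro nn_integral_mono mult_right_mono) auto
  also have "\<dots> = b * (\<integral>\<^sup>+u. ?H u \<partial>PiM UNIV N)"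
    by (intro nn_integral_cmult) auto
  also have "\<dots> \<le> b * (b ^ card J * (\<integral>\<^sup>+u. G u \<partial>PiM UNIV N))"
    using insert by (intro mult_left_mono insert.IH) auto
  finally show ?case using insert by (simp add: mult.assoc)
qed

lemma nn_integral_PiM_prod:
  fixes N :: "'i \<Rightarrow> 'a measure"
  assumes N: "\<And>i. prob_space (N i)" and J: "finite J"
    and h[measurable]: "\<And>j. j \<in> J \<Longrightarrow> h j \<in> borel_measurable (N j)"
  shows "(\<integral>\<^sup>+u. (\<Prod>j\<in>J. h j (u j)) \<partial>PiM UNIV N) = (\<Prod>j\<in>J. (\<integral>\<^sup>+y. h j y \<partial>N j))"
  using J h
proof (induction J rule: finite_induct)
  case empty
  interpret prob_space "PiM UNIV N" by (intro prob_space_PiM N)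
  show ?case by (simp add: emeasure_space_1)
next
  case (insert j J)
  note insert.prems[measurable]
  have "(\<integral>\<^sup>+u. (\<Prod>j\<in>insert j J. h j (u j)) \<partial>PiM UNIV N) =
    (\<integral>\<^sup>+u. (\<integral>\<^sup>+y. h j y * (\<Prod>i\<in>J. h i ((u(j := y)) i)) \<partial>N j) \<partial>PiM UNIV N)"
    using insert by (subst nn_integral_PiM_resample[OF N, of N j]) (auto intro: N)
  also have "\<dots> = (\<integral>\<^sup>+u. (\<integral>\<^sup>+y. h j y * (\<Prod>i\<in>J. h i (u i)) \<partial>N j) \<partial>PiM UNIV N)"
    using insert by (intro nn_integral_cong arg_cong2[where f="(*)"] prod.cong refl) auto
  also have "\<dots> = (\<integral>\<^sup>+u. (\<integral>\<^sup>+y. h j y \<partial>N j) * (\<Prod>i\<in>J. h i (u i)) \<partial>PiM UNIV N)"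
    by (intro nn_integral_cong nn_integral_multc) auto
  also have "\<dots> = (\<integral>\<^sup>+y. h j y \<partial>N j) * (\<integral>\<^sup>+u. (\<Prod>i\<in>J. h i (u i)) \<partial>PiM UNIV N)"
    by (intro nn_integral_cmult) auto
  finally show ?case using insert by simp
qed

section \<open>The distribution Beta(1, \<alpha>)\<close>

lemma Beta_1_left:
  assumes "\<alpha> > (0::real)" shows "Beta 1 \<alpha> = 1 / \<alpha>"
proof -
  have "Gamma (\<alpha> + 1) = \<alpha> * Gamma \<alpha>"
    using assms by (intro Gamma_plus1) (auto dest: nonpos_Ints_nonpos)
  moreover have "Gamma \<alpha> > 0" using assms by (rule Gamma_real_pos)
  ultimately show ?thesis by (simp add: Beta_def add.commute)
qed

lemma beta_density_1:
  assumes "\<alpha> > 0"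
  shows "beta_density 1 \<alpha> x = (if 0 < x \<and> x < 1 then \<alpha> * (1 - x) powr (\<alpha> - 1) else 0)"
  using assms by (simp add: beta_density_def Beta_1_left)

lemma sets_beta_distribution[measurable_cong, simp]: "sets (beta_distribution a b) = sets borel"
  by (simp add: beta_distribution_def)

lemma space_beta_distribution[simp]: "space (beta_distribution a b) = UNIV"
  by (simp add: beta_distribution_def)

lemma nn_integral_beta_1:
  assumes \<alpha>: "\<alpha> > 0" and F[measurable]: "F \<in> borel_measurable borel"
  shows "(\<integral>\<^sup>+v. F v \<partial>beta_distribution 1 \<alpha>) =
    (\<integral>\<^sup>+v. ennreal (\<alpha> * (1 - v) powr (\<alpha> - 1)) * F v * indicator {0<..<1} v \<partial>lborel)"
  unfolding beta_distribution_def
  by (subst nn_integral_density)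
     (auto simp: beta_density_1[OF \<alpha>] indicator_def intro!: nn_integral_cong)

lemma nn_integral_lborel_reflect:
  fixes F :: "real \<Rightarrow> ennreal"
  assumes [measurable]: "F \<in> borel_measurable borel"
  shows "(\<integral>\<^sup>+x. F (r - x) \<partial>lborel) = (\<integral>\<^sup>+x. F x \<partial>lborel)"
  using nn_integral_real_affine[of F "-1" r] by simp

text \<open>What is left of the stick is a product of variables 1 - v, so the computations run in y
  = 1 - v, whose density is the pure power \<alpha> y^(\<alpha> - 1).\<close>

lemma nn_integral_beta_1_reflect:
  assumes \<alpha>: "\<alpha> > 0" and F[measurable]: "F \<in> borel_measurable borel"
  shows "(\<integral>\<^sup>+v. F (1 - v) \<partial>beta_distribution 1 \<alpha>) =
    (\<integral>\<^sup>+y. ennreal (\<alpha> * y powr (\<alpha> - 1)) * F y * indicator {0<..<1} y \<partial>lborel)"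
proof -
  have "(\<integral>\<^sup>+v. F (1 - v) \<partial>beta_distribution 1 \<alpha>) =
    (\<integral>\<^sup>+v. ennreal (\<alpha> * (1 - v) powr (\<alpha> - 1)) * F (1 - v) * indicator {0<..<1} (1 - v) \<partial>lborel)"
    by (subst nn_integral_beta_1[OF \<alpha>]) (auto simp: indicator_def intro!: nn_integral_cong)
  also have "\<dots> = (\<integral>\<^sup>+y. ennreal (\<alpha> * y powr (\<alpha> - 1)) * F y * indicator {0<..<1} y \<partial>lborel)"
    by (rule nn_integral_lborel_reflect) simp
  finally show ?thesis .
qed

lemma nn_integral_powr_from_0:
  fixes a c :: real
  assumes "a > 0" "c \<ge> 0"
  shows "(\<integral>\<^sup>+x. ennreal (x powr (a - 1)) * indicator {0<..<c} x \<partial>lborel) = ennreal (c powr a / a)"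
proof -
  have "((\<lambda>x. x powr (a - 1)) has_integral (c powr (a - 1 + 1) / (a - 1 + 1))) {0..c}"
    using assms by (intro has_integral_powr_from_0) auto
  then have "((\<lambda>x. x powr (a - 1)) has_integral (c powr a / a)) {0..c}" by simp
  then have "((\<lambda>x. x powr (a - 1)) has_integral (c powr a / a)) {0<..<c}"
    using has_integral_Icc_iff_Ioo by blast
  then have "((\<lambda>x. x powr (a - 1) * indicator {0<..<c} x) has_integral (c powr a / a)) UNIV"
    by (subst (asm) has_integral_restrict_UNIV[symmetric])
       (auto simp: indicator_def of_bool_def if_distrib cong: if_cong)
  then have "(\<integral>\<^sup>+x. ennreal (x powr (a - 1) * indicator {0<..<c} x) \<partial>lborel) = ennreal (c powr a / a)"
    by (intro nn_integral_has_integral_lborel) auto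
  then show ?thesis
    by (simp add: ennreal_mult ennreal_indicator)
qed

text \<open>The power y^(\<alpha> - a - 1) is integrable at 0 because a < \<alpha>. The sign of
  \<open>a\<close> is free: a = 0 gives the probability c^\<alpha> of an almost complete break (and
  total mass 1 for c = 1), a = -1 gives the mean of 1 - v.\<close>

lemma nn_integral_beta_1_powr:
  assumes "\<alpha> > 0" "a < \<alpha>" "0 \<le> c" "c \<le> 1"
  shows "(\<integral>\<^sup>+v. ennreal ((1 - v) powr (- a)) * indicator {0<..<c} (1 - v) \<partial>beta_distribution 1 \<alpha>)
    = ennreal (\<alpha> / (\<alpha> - a) * c powr (\<alpha> - a))"
proof -
  have "(\<integral>\<^sup>+v. ennreal ((1 - v) powr (- a)) * indicator {0<..<c} (1 - v) \<partial>beta_distribution 1 \<alpha>) =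
    (\<integral>\<^sup>+y. ennreal \<alpha> * (ennreal (y powr (\<alpha> - a - 1)) * indicator {0<..<c} y) \<partial>lborel)"
    using assms
    by (subst nn_integral_beta_1_reflect)
       (auto simp: indicator_def ennreal_mult[symmetric] mult.assoc powr_add[symmetric] algebra_simps
             intro!: nn_integral_cong)
  also have "\<dots> = ennreal \<alpha> * ennreal (c powr (\<alpha> - a) / (\<alpha> - a))"
    using assms by (subst nn_integral_cmult) (auto simp: nn_integral_powr_from_0)
  also have "\<dots> = ennreal (\<alpha> / (\<alpha> - a) * c powr (\<alpha> - a))"
    using assms by (subst ennreal_mult[symmetric]) auto
  finally show ?thesis .
qed

lemma AE_beta_1: "\<alpha> > 0 \<Longrightarrow> AE v in beta_distribution 1 \<alpha>. 0 < v \<and> v < 1"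
  unfolding beta_distribution_def by (subst AE_density) (auto simp: beta_density_1)

lemma prob_space_beta_1:
  assumes "\<alpha> > 0" shows "prob_space (beta_distribution 1 \<alpha>)"
proof
  have "emeasure (beta_distribution 1 \<alpha>) (space (beta_distribution 1 \<alpha>)) =
    (\<integral>\<^sup>+v. 1 \<partial>beta_distribution 1 \<alpha>)" by simp
  also have "\<dots> = (\<integral>\<^sup>+v. ennreal ((1 - v) powr (- 0)) * indicator {0<..<1} (1 - v) \<partial>beta_distribution 1 \<alpha>)"
    by (intro nn_integral_cong_AE, use AE_beta_1[OF assms] in eventually_elim) auto
  also have "\<dots> = 1" using assms by (subst nn_integral_beta_1_powr) auto
  finally show "emeasure (beta_distribution 1 \<alpha>) (space (beta_distribution 1 \<alpha>)) = 1" .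
qed

lemma nn_integral_beta_1_moment:
  assumes "\<alpha> > 0" "a < \<alpha>"
  shows "(\<integral>\<^sup>+v. ennreal ((1 - v) powr (- a)) \<partial>beta_distribution 1 \<alpha>) = ennreal (\<alpha> / (\<alpha> - a))"
proof -
  have "(\<integral>\<^sup>+v. ennreal ((1 - v) powr (- a)) \<partial>beta_distribution 1 \<alpha>) =
    (\<integral>\<^sup>+v. ennreal ((1 - v) powr (- a)) * indicator {0<..<1} (1 - v) \<partial>beta_distribution 1 \<alpha>)"
    by (intro nn_integral_cong_AE, use AE_beta_1[OF assms(1)] in eventually_elim) auto
  with nn_integral_beta_1_powr[OF assms, of 1] show ?thesis by simp
qed

lemma emeasure_beta_1_near_1:
  assumes "\<alpha> > 0" "0 \<le> c" "c \<le> 1"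
  shows "emeasure (beta_distribution 1 \<alpha>) {v. 1 - v < c} = ennreal (c powr \<alpha>)"
proof -
  have "emeasure (beta_distribution 1 \<alpha>) {v. 1 - v < c} =
    (\<integral>\<^sup>+v. indicator {v. 1 - v < c} v \<partial>beta_distribution 1 \<alpha>)"
    by (subst nn_integral_indicator) auto
  also have "\<dots> = (\<integral>\<^sup>+v. ennreal ((1 - v) powr (- 0)) * indicator {0<..<c} (1 - v) \<partial>beta_distribution 1 \<alpha>)"
    by (intro nn_integral_cong_AE, use AE_beta_1[OF assms(1)] in eventually_elim)
       (auto simp: indicator_def)
  also have "\<dots> = ennreal (c powr \<alpha>)"
    using assms by (subst nn_integral_beta_1_powr) auto
  finally show ?thesis .
qed

text \<open>For \<open>c\<close> at most 1/2 the density is bounded by \<alpha> max(1, 2^(1 -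
  \<alpha>)), the second term serving \<alpha> < 1. For larger \<open>c\<close> the summand 2 makes
  the right side at least 1.\<close>

lemma emeasure_beta_1_near_0:
  assumes "\<alpha> > 0" "0 \<le> c"
  shows "emeasure (beta_distribution 1 \<alpha>) {v. v \<le> c} \<le> ennreal ((2 * \<alpha> * max 1 (2 powr (1 - \<alpha>)) + 2) * c)"
proof (cases "c \<le> 1/2")
  case True
  have b: "(1 - v) powr (\<alpha> - 1) \<le> max 1 (2 powr (1 - \<alpha>))" if "0 < v" "v \<le> c" for v :: real
  proof (cases "\<alpha> \<ge> 1")
    case True
    then have "(1 - v) powr (\<alpha> - 1) \<le> 1" using that \<open>c \<le> 1/2\<close> by (intro powr_le1) auto
    then show ?thesis by simp
  next
    case False
    then have "(1 - v) powr (\<alpha> - 1) \<le> (1/2) powr (\<alpha> - 1)"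
      using that True by (intro powr_mono2') auto
    also have "\<dots> = 2 powr (1 - \<alpha>)" by (simp add: powr_divide powr_diff)
    finally show ?thesis by simp
  qed
  have "emeasure (beta_distribution 1 \<alpha>) {v. v \<le> c} =
    (\<integral>\<^sup>+v. indicator {v. v \<le> c} v \<partial>beta_distribution 1 \<alpha>)"
    by (subst nn_integral_indicator) auto
  also have "\<dots> \<le> (\<integral>\<^sup>+v. ennreal (\<alpha> * max 1 (2 powr (1 - \<alpha>))) * indicator {0..c} v \<partial>lborel)"
    using b assms
    by (subst nn_integral_beta_1, simp, simp, intro nn_integral_mono) (auto simp: indicator_def intro!: ennreal_leI mult_left_mono)
  also have "\<dots> = ennreal (\<alpha> * max 1 (2 powr (1 - \<alpha>)) * c)"
    using assms by (subst nn_integral_cmult) (auto simp: ennreal_mult)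
  also have "\<dots> \<le> ennreal ((2 * \<alpha> * max 1 (2 powr (1 - \<alpha>)) + 2) * c)"
    using assms by (intro ennreal_leI mult_right_mono) auto
  finally show ?thesis .
next
  case False
  interpret prob_space "beta_distribution 1 \<alpha>" by (intro prob_space_beta_1 assms)
  have "emeasure (beta_distribution 1 \<alpha>) {v. v \<le> c} \<le> ennreal 1"
    using measure_le_1 by simp
  also have "\<dots> \<le> ennreal ((2 * \<alpha> * max 1 (2 powr (1 - \<alpha>)) + 2) * c)"
  proof (rule ennreal_leI)
    have "1 \<le> 2 * c" using False by simp
    also have "\<dots> \<le> (2 * \<alpha> * max 1 (2 powr (1 - \<alpha>)) + 2) * c"
      using assms by (intro mult_right_mono) auto
    finally show "1 \<le> (2 * \<alpha> * max 1 (2 powr (1 - \<alpha>)) + 2) * c" .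
  qed
  finally show ?thesis .
qed

lemma emeasure_beta_1_interior:
  assumes \<alpha>: "\<alpha> > 0" and p: "0 < p" "p < 1"
  shows "\<exists>c>0. \<exists>d>0. \<forall>\<tau>. 0 < \<tau> \<longrightarrow> \<tau> < d \<longrightarrow>
    ennreal (c * \<tau>) \<le> emeasure (beta_distribution 1 \<alpha>) {v. \<bar>v - p\<bar> \<le> \<tau>}"
proof -
  define d where "d = min p (1 - p) / 2"
  \<comment> \<open>The two terms are lower bounds for (1 - v)^(\<alpha> - 1) on the window: the
    first when \<alpha> is at least 1 and the power increases in 1 - v, the second when \<alpha> < 1
    and it decreases.\<close>
  define m where "m = min (((1 - p) / 2) powr (\<alpha> - 1)) (1 powr (\<alpha> - 1))"
  have d: "d > 0" "d \<le> p / 2" "d \<le> (1 - p) / 2" using p by (auto simp: d_def)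
  have m: "m > 0" using p by (auto simp: m_def)
  have lb: "m \<le> (1 - v) powr (\<alpha> - 1)" if "\<bar>v - p\<bar> \<le> d" for v
  proof (cases "\<alpha> \<ge> 1")
    case True
    have "((1 - p) / 2) powr (\<alpha> - 1) \<le> (1 - v) powr (\<alpha> - 1)"
      using True that d p by (intro powr_mono2) (auto simp: field_simps abs_le_iff)
    then show ?thesis by (simp add: m_def)
  next
    case False
    have "1 powr (\<alpha> - 1) \<le> (1 - v) powr (\<alpha> - 1)"
      using False that d p by (intro powr_mono2') (auto simp: abs_le_iff)
    then show ?thesis by (simp add: m_def)
  qed
  have "ennreal (2 * \<alpha> * m * \<tau>) \<le> emeasure (beta_distribution 1 \<alpha>) {v. \<bar>v - p\<bar> \<le> \<tau>}"
    if \<tau>: "0 < \<tau>" "\<tau> < d" for \<tau>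
  proof -
    have "ennreal (2 * \<alpha> * m * \<tau>) = (\<integral>\<^sup>+v. ennreal (\<alpha> * m) * indicator {p - \<tau>..p + \<tau>} v \<partial>lborel)"
      using \<tau> \<alpha> m by (subst nn_integral_cmult) (auto simp: ennreal_mult[symmetric] mult_ac)
    also have "\<dots> \<le> (\<integral>\<^sup>+v. ennreal (\<alpha> * (1 - v) powr (\<alpha> - 1)) * indicator {v. \<bar>v - p\<bar> \<le> \<tau>} v * indicator {0<..<1} v \<partial>lborel)"
      using \<tau> lb \<alpha> d p
      by (intro nn_integral_mono) (auto simp: indicator_def abs_le_iff intro!: ennreal_leI mult_left_mono)
    also have "\<dots> = (\<integral>\<^sup>+v. indicator {v. \<bar>v - p\<bar> \<le> \<tau>} v \<partial>beta_distribution 1 \<alpha>)"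
      by (subst nn_integral_beta_1[OF \<alpha>]) auto
    also have "\<dots> = emeasure (beta_distribution 1 \<alpha>) {v. \<bar>v - p\<bar> \<le> \<tau>}"
      by (subst nn_integral_indicator) auto
    finally show ?thesis .
  qed
  then show ?thesis using d m \<alpha> by (intro exI[of _ "2 * \<alpha> * m"] exI[of _ d]) auto
qed

section \<open>Stick breaking\<close>

definition stick_rest :: "(nat \<Rightarrow> real) \<Rightarrow> nat \<Rightarrow> real" where
  "stick_rest v k = (\<Prod>j<k. 1 - v j)"

lemma stick_breaking_rest: "stick_breaking v k = v k * stick_rest v k"
  by (simp add: stick_breaking_def stick_rest_def)

lemma stick_rest_0 [simp]: "stick_rest v 0 = 1"
  by (simp add: stick_rest_def)

lemma stick_rest_Suc: "stick_rest v (Suc k) = stick_rest v k * (1 - v k)"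
  by (simp add: stick_rest_def)

lemma sum_stick_breaking: "(\<Sum>k<m. stick_breaking v k) = 1 - stick_rest v m"
  by (induction m) (auto simp: stick_breaking_rest stick_rest_Suc algebra_simps)

lemma sum_stick_breaking_from: "(\<Sum>i<m. stick_breaking v (k + i)) = stick_rest v k - stick_rest v (k + m)"
  by (induction m) (auto simp: stick_breaking_rest stick_rest_Suc algebra_simps)

text \<open>A set of full prior measure on which all sticks and weights are strictly positive, so
  that their negative powers are meaningful.\<close>

definition stick_dom :: "(nat \<Rightarrow> real) set" where
  "stick_dom = {v. \<forall>k. 0 < v k \<and> v k < 1}"

lemma stick_rest_pos: "v \<in> stick_dom \<Longrightarrow> stick_rest v k > 0"
  by (auto simp: stick_rest_def stick_dom_def intro!: prod_pos)

lemma stick_rest_antimono: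
  assumes "v \<in> stick_dom" "i \<le> k"
  shows "stick_rest v k \<le> stick_rest v i"
  using assms(2)
proof (induction k rule: dec_induct)
  case (step k)
  have "stick_rest v (Suc k) \<le> stick_rest v k * 1"
    unfolding stick_rest_Suc using assms stick_rest_pos[of v k]
    by (intro mult_left_mono) (auto simp: stick_dom_def less_imp_le)
  with step show ?case by simp
qed simp

lemma stick_rest_le_1: "v \<in> stick_dom \<Longrightarrow> stick_rest v k \<le> 1"
  using stick_rest_antimono[of v 0 k] by simp

lemma stick_breaking_pos: "v \<in> stick_dom \<Longrightarrow> stick_breaking v k > 0"
  using stick_rest_pos[of v k] by (auto simp: stick_breaking_rest stick_dom_def)

lemma stick_breaking_le_1: "v \<in> stick_dom \<Longrightarrow> stick_breaking v k \<le> 1"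
  using stick_rest_pos[of v k] stick_rest_le_1[of v k]
  by (auto simp: stick_breaking_rest stick_dom_def less_imp_le intro!: mult_le_one)

lemma summable_stick_breaking:
  assumes "v \<in> stick_dom" shows "summable (\<lambda>i. stick_breaking v (k + i))"
proof (rule summableI_nonneg_bounded)
  show "0 \<le> stick_breaking v (k + i)" for i using stick_breaking_pos[OF assms] by (simp add: less_imp_le)
  show "(\<Sum>i<m. stick_breaking v (k + i)) \<le> stick_rest v k" for m
    using stick_rest_pos[OF assms, of "k + m"] by (simp add: sum_stick_breaking_from)
qed

lemma suminf_stick_breaking_le:
  assumes "v \<in> stick_dom" shows "(\<Sum>i. stick_breaking v (k + i)) \<le> stick_rest v k"
proof (rule suminf_le_const[OF summable_stick_breaking[OF assms]])
  show "(\<Sum>i<m. stick_breaking v (k + i)) \<le> stick_rest v k" for m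
    using stick_rest_pos[OF assms, of "k + m"] by (simp add: sum_stick_breaking_from)
qed

lemma sets_PiM_borel:
  assumes "\<And>i. sets (N i) = sets borel"
  shows "sets (PiM UNIV N) = sets (PiM UNIV (\<lambda>_. borel))"
  using assms by (intro sets_PiM_cong) auto

lemma measurable_stick_rest[measurable]: "(\<lambda>v. stick_rest v k) \<in> borel_measurable (PiM UNIV (\<lambda>_. borel))"
  unfolding stick_rest_def by measurable

lemma measurable_stick_breaking[measurable]:
  "(\<lambda>v. stick_breaking v k) \<in> borel_measurable (PiM UNIV (\<lambda>_. borel))"
  unfolding stick_breaking_def by measurable

abbreviation stick_prior :: "real \<Rightarrow> (nat \<Rightarrow> real) measure" where
  "stick_prior \<alpha> \<equiv> PiM UNIV (\<lambda>_. beta_distribution 1 \<alpha>)"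

lemma sets_stick_prior[measurable_cong]: "sets (stick_prior \<alpha>) = sets (PiM UNIV (\<lambda>_. borel))"
  by (rule sets_PiM_borel) simp

lemma AE_stick_dom: "\<alpha> > 0 \<Longrightarrow> AE v in stick_prior \<alpha>. v \<in> stick_dom"
  unfolding stick_dom_def mem_Collect_eq AE_all_countable
  by (intro allI AE_PiM_component prob_space_beta_1 AE_beta_1) auto

lemma nn_integral_stick_rest:
  assumes "\<alpha> > 0"
  shows "(\<integral>\<^sup>+v. ennreal (stick_rest v m) \<partial>stick_prior \<alpha>) = ennreal ((\<alpha> / (\<alpha> + 1)) ^ m)"
proof -
  have "(\<integral>\<^sup>+v. ennreal (stick_rest v m) \<partial>stick_prior \<alpha>) =
    (\<integral>\<^sup>+v. (\<Prod>j<m. ennreal ((1 - v j) powr (- (- 1)))) \<partial>stick_prior \<alpha>)"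
    by (intro nn_integral_cong_AE, use AE_stick_dom[OF assms] in eventually_elim)
       (auto simp: stick_rest_def stick_dom_def prod_ennreal less_imp_le)
  also have "\<dots> = (\<Prod>j<m. (\<integral>\<^sup>+v. ennreal ((1 - v) powr (- (- 1))) \<partial>beta_distribution 1 \<alpha>))"
    using assms by (intro nn_integral_PiM_prod prob_space_beta_1) auto
  also have "\<dots> = ennreal ((\<alpha> / (\<alpha> + 1)) ^ m)"
    using assms by (subst nn_integral_beta_1_moment) (auto simp: ennreal_power)
  finally show ?thesis .
qed

text \<open>The infimum of the remaining sticks has expectation at most (\<alpha> / (\<alpha> +
  1))^m for every m, hence vanishes almost surely; as the sticks decrease, the infimum is their
  limit.\<close>

lemma AE_stick_rest_tendsto_0:
  assumes "\<alpha> > 0"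
  shows "AE v in stick_prior \<alpha>. stick_rest v \<longlonglongrightarrow> 0"
proof -
  have "(\<integral>\<^sup>+v. (INF m. ennreal (stick_rest v m)) \<partial>stick_prior \<alpha>) \<le> ennreal ((\<alpha> / (\<alpha> + 1)) ^ m)" for m
    unfolding nn_integral_stick_rest[OF assms, symmetric]
    by (intro nn_integral_mono INF_lower) auto
  moreover have "(\<lambda>m. ennreal ((\<alpha> / (\<alpha> + 1)) ^ m)) \<longlonglongrightarrow> ennreal 0"
    using assms by (intro tendsto_ennrealI LIMSEQ_power_zero) auto
  ultimately have "(\<integral>\<^sup>+v. (INF m. ennreal (stick_rest v m)) \<partial>stick_prior \<alpha>) \<le> 0"
    by (intro LIMSEQ_le_const) auto
  then have "AE v in stick_prior \<alpha>. (INF m. ennreal (stick_rest v m)) = 0"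
    by (subst (asm) le_zero_eq, subst (asm) nn_integral_0_iff_AE) auto
  then show ?thesis using AE_stick_dom[OF assms]
  proof eventually_elim
    case (elim v)
    obtain L where L: "stick_rest v \<longlonglongrightarrow> L" "\<And>i. L \<le> stick_rest v i"
      using decseq_convergent[of "stick_rest v" 0] stick_rest_antimono[OF elim(2)] stick_rest_pos[OF elim(2)]
      by (auto simp: decseq_def less_imp_le)
    have "ennreal L \<le> (INF m. ennreal (stick_rest v m))"
      using L by (intro INF_greatest ennreal_leI) auto
    then have "L \<le> 0" using elim(1) by (simp add: ennreal_eq_0_iff)
    moreover have "L \<ge> 0" using L(1) stick_rest_pos[OF elim(2)]
      by (intro LIMSEQ_le_const[OF L(1)]) (auto simp: less_imp_le)
    ultimately show ?case using L by simp
  qed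
qed

lemma AE_stick_breaking_sums:
  assumes "\<alpha> > 0"
  shows "AE v in stick_prior \<alpha>. stick_breaking v sums 1"
  using AE_stick_rest_tendsto_0[OF assms]
proof eventually_elim
  case (elim v)
  have "(\<lambda>m. 1 - stick_rest v m) \<longlonglongrightarrow> 1 - 0" by (intro tendsto_intros elim)
  then show ?case by (simp add: sums_def sum_stick_breaking)
qed

section \<open>From sticks to weights\<close>

definition unif01 :: "real measure" where
  "unif01 = density lborel (indicator {0..1})"

lemma sets_unif01[measurable_cong, simp]: "sets unif01 = sets borel"
  by (simp add: unif01_def)

lemma space_unif01[simp]: "space unif01 = UNIV"
  by (simp add: unif01_def)

lemma prob_space_unif01: "prob_space unif01"
  by standard (simp add: unif01_def emeasure_density)

lemma nn_integral_unif01: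
  assumes [measurable]: "F \<in> borel_measurable borel"
  shows "(\<integral>\<^sup>+y. F y \<partial>unif01) = (\<integral>\<^sup>+y. F y * indicator {0..1} y \<partial>lborel)"
  unfolding unif01_def by (subst nn_integral_density) (auto simp: mult.commute)

text \<open>With \<open>r\<close> the stick before a break, the weight r v has density (\<alpha> /
  r) (1 - v)^(\<alpha> - 1). The indicator keeps r (1 - v) at least \<open>c\<close>, and r \<le> 1
  turns this into 1 - v \<ge> c, which tames the singularity at v = 1 for \<alpha> < 1; c \<le> r
  bounds 1 / r.\<close>

lemma nn_integral_beta_1_scale:
  fixes F :: "real \<Rightarrow> ennreal"
  assumes \<alpha>: "\<alpha> > 0" and c: "0 < c" "c \<le> r" "r \<le> 1" and [measurable]: "F \<in> borel_measurable borel"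
  shows "(\<integral>\<^sup>+v. F (r * v) * indicator {v. r * (1 - v) \<ge> c} v \<partial>beta_distribution 1 \<alpha>)
    \<le> ennreal (\<alpha> * max 1 (c powr (\<alpha> - 1)) / c) * (\<integral>\<^sup>+y. F y \<partial>unif01)"
proof -
  let ?A = "\<alpha> * max 1 (c powr (\<alpha> - 1))"
  have b: "(1 - v) powr (\<alpha> - 1) \<le> max 1 (c powr (\<alpha> - 1))" if "0 < v" "v < 1" "c \<le> r * (1 - v)" for v
  proof -
    have cv: "c \<le> 1 - v"
    proof -
      have "r * (1 - v) \<le> 1 * (1 - v)" using that c by (intro mult_right_mono) auto
      from order_trans[OF that(3) this] show ?thesis by simp
    qed
    show ?thesis
    proof (cases "\<alpha> \<ge> 1")
      case True
      then have "(1 - v) powr (\<alpha> - 1) \<le> 1" using that by (intro powr_le1) auto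
      then show ?thesis by simp
    next
      case False
      then have "(1 - v) powr (\<alpha> - 1) \<le> c powr (\<alpha> - 1)"
        using cv c by (intro powr_mono2') auto
      then show ?thesis by simp
    qed
  qed
  have "(\<integral>\<^sup>+v. F (r * v) * indicator {v. r * (1 - v) \<ge> c} v \<partial>beta_distribution 1 \<alpha>)
     \<le> (\<integral>\<^sup>+v. ennreal ?A * (F (0 + r * v) * indicator {0..1} (0 + r * v)) \<partial>lborel)"
    using b c \<alpha>
    by (subst nn_integral_beta_1, simp, simp, intro nn_integral_mono)
       (auto simp: indicator_def mult_le_one intro!: mult_right_mono ennreal_leI mult_left_mono)
  also have "\<dots> = ennreal ?A * (\<integral>\<^sup>+v. F (0 + r * v) * indicator {0..1} (0 + r * v) \<partial>lborel)"
    by (intro nn_integral_cmult) auto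
  also have "(\<integral>\<^sup>+v. F (0 + r * v) * indicator {0..1} (0 + r * v) \<partial>lborel) \<le> ennreal (1 / c) * (\<integral>\<^sup>+y. F y \<partial>unif01)"
  proof -
    have "(\<integral>\<^sup>+v. F (0 + r * v) * indicator {0..1} (0 + r * v) \<partial>lborel) =
       ennreal (1 / r) * (ennreal \<bar>r\<bar> * (\<integral>\<^sup>+v. F (0 + r * v) * indicator {0..1} (0 + r * v) \<partial>lborel))"
      using c by (simp add: mult.assoc[symmetric] ennreal_mult[symmetric])
    also have "\<dots> = ennreal (1 / r) * (\<integral>\<^sup>+y. F y \<partial>unif01)"
      using c by (subst nn_integral_real_affine[symmetric]) (auto simp: nn_integral_unif01)
    also have "\<dots> \<le> ennreal (1 / c) * (\<integral>\<^sup>+y. F y \<partial>unif01)"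
      using c by (intro mult_right_mono ennreal_leI) (auto simp: frac_le)
    finally show ?thesis .
  qed
  finally have "(\<integral>\<^sup>+v. F (r * v) * indicator {v. r * (1 - v) \<ge> c} v \<partial>beta_distribution 1 \<alpha>)
    \<le> ennreal ?A * (ennreal (1 / c) * (\<integral>\<^sup>+y. F y \<partial>unif01))"
    by (simp add: mult_left_mono)
  also have "\<dots> = ennreal (?A / c) * (\<integral>\<^sup>+y. F y \<partial>unif01)"
    using c \<alpha> by (simp add: mult.assoc[symmetric] ennreal_mult[symmetric])
  finally show ?thesis .
qed

text \<open>The stick r (1 - v) after the break may be arbitrarily short here: its density is a pure
  power, so scaling by \<open>r\<close> multiplies it exactly by r^(-\<alpha>) and shortens its
  range. The \<alpha>-power behaviour near a vanishing stick, which supplies the \<alpha> in the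
  exponent, survives.\<close>

lemma nn_integral_beta_1_reflect_scale:
  fixes F :: "real \<Rightarrow> ennreal"
  assumes \<alpha>: "\<alpha> > 0" and c: "0 < c" "c \<le> r" "r \<le> 1" and [measurable]: "F \<in> borel_measurable borel"
  shows "(\<integral>\<^sup>+v. F (r * (1 - v)) \<partial>beta_distribution 1 \<alpha>)
    \<le> ennreal (c powr (- \<alpha>)) * (\<integral>\<^sup>+v. F (1 - v) \<partial>beta_distribution 1 \<alpha>)"
proof -
  let ?G = "\<lambda>x. ennreal (\<alpha> * x powr (\<alpha> - 1)) * F x * indicator {0<..<1} x"
  have "(\<integral>\<^sup>+v. F (r * (1 - v)) \<partial>beta_distribution 1 \<alpha>) =
     (\<integral>\<^sup>+y. ennreal (\<alpha> * y powr (\<alpha> - 1)) * F (r * y) * indicator {0<..<1} y \<partial>lborel)"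
    by (subst nn_integral_beta_1_reflect[of \<alpha> "\<lambda>y. F (r * y)"]) (use \<alpha> in auto)
  also have "\<dots> \<le> (\<integral>\<^sup>+y. ennreal (r powr (1 - \<alpha>)) * ?G (0 + r * y) \<partial>lborel)"
  proof (intro nn_integral_mono)
    fix y :: real
    show "ennreal (\<alpha> * y powr (\<alpha> - 1)) * F (r * y) * indicator {0<..<1} y \<le>
      ennreal (r powr (1 - \<alpha>)) * ?G (0 + r * y)"
    proof (cases "0 < y \<and> y < 1")
      case True
      have ry: "r * y < 1"
      proof -
        have "r * y \<le> 1 * y" using c True by (intro mult_right_mono) auto
        with True show ?thesis by linarith
      qed
      have "r powr (1 - \<alpha>) * (\<alpha> * (r * y) powr (\<alpha> - 1)) = \<alpha> * (r powr (1 - \<alpha> + (\<alpha> - 1))) * y powr (\<alpha> - 1)"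
        using True c by (simp only: powr_mult powr_add) (simp add: mult_ac)
      also have "\<dots> = \<alpha> * y powr (\<alpha> - 1)" using c by simp
      finally have "ennreal (\<alpha> * y powr (\<alpha> - 1)) = ennreal (r powr (1 - \<alpha>)) * ennreal (\<alpha> * (r * y) powr (\<alpha> - 1))"
        using \<alpha> by (subst ennreal_mult[symmetric]) auto
      then show ?thesis using True c ry by (simp add: mult_ac)
    qed simp
  qed
  also have "\<dots> = ennreal (r powr (1 - \<alpha>)) * (\<integral>\<^sup>+y. ?G (0 + r * y) \<partial>lborel)"
    by (intro nn_integral_cmult) auto
  also have "\<dots> = ennreal (r powr (- \<alpha>)) * (ennreal \<bar>r\<bar> * (\<integral>\<^sup>+y. ?G (0 + r * y) \<partial>lborel))"
    using c by (simp add: mult.assoc[symmetric] ennreal_mult[symmetric] powr_diff powr_minus_divide)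
  also have "\<dots> = ennreal (r powr (- \<alpha>)) * (\<integral>\<^sup>+y. ?G y \<partial>lborel)"
    using c by (subst nn_integral_real_affine[symmetric]) auto
  also have "\<dots> = ennreal (r powr (- \<alpha>)) * (\<integral>\<^sup>+v. F (1 - v) \<partial>beta_distribution 1 \<alpha>)"
    by (subst nn_integral_beta_1_reflect) (use \<alpha> in auto)
  also have "\<dots> \<le> ennreal (c powr (- \<alpha>)) * (\<integral>\<^sup>+v. F (1 - v) \<partial>beta_distribution 1 \<alpha>)"
    using c \<alpha> by (intro mult_right_mono ennreal_leI powr_mono2') auto
  finally show ?thesis .
qed

text \<open>The dominating law after \<open>m\<close> exchanges: the first \<open>m\<close>
  coordinates are weights, the others are still stick proportions.\<close>

definition stick_mixed :: "real \<Rightarrow> nat \<Rightarrow> nat \<Rightarrow> real measure" where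
  "stick_mixed \<alpha> m i = (if i < m then unif01 else beta_distribution 1 \<alpha>)"

lemma sets_stick_mixed[measurable_cong, simp]: "sets (stick_mixed \<alpha> m i) = sets borel"
  by (simp add: stick_mixed_def)

lemma prob_space_stick_mixed: "\<alpha> > 0 \<Longrightarrow> prob_space (stick_mixed \<alpha> m i)"
  by (simp add: stick_mixed_def prob_space_unif01 prob_space_beta_1)

lemma sets_PiM_stick_mixed[measurable_cong]:
  "sets (PiM UNIV (stick_mixed \<alpha> m)) = sets (PiM UNIV (\<lambda>_. borel))"
  by (rule sets_PiM_borel) simp

definition partial_stick :: "nat \<Rightarrow> (nat \<Rightarrow> real) \<Rightarrow> nat \<Rightarrow> real" where
  "partial_stick m v k = (if k < m then stick_breaking v k else v k)"

lemma measurable_partial_stick[measurable]: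
  "partial_stick m \<in> measurable (PiM UNIV (\<lambda>_. borel)) (PiM UNIV (\<lambda>_. borel))"
proof (rule measurable_PiM_single')
  show "(\<lambda>v. partial_stick m v i) \<in> borel_measurable (PiM UNIV (\<lambda>_. borel))" for i
    unfolding partial_stick_def by measurable
qed (auto simp: space_PiM)

lemma sum_partial_stick: "1 - (\<Sum>k<m. partial_stick m v k) = stick_rest v m"
  by (simp add: partial_stick_def sum_stick_breaking)

lemma measurable_upd_borel[measurable]:
  assumes [measurable]: "h \<in> borel_measurable (PiM UNIV (\<lambda>_::nat. borel :: real measure))"
  shows "(\<lambda>y. y(m := h y)) \<in> measurable (PiM UNIV (\<lambda>_::nat. borel :: real measure)) (PiM UNIV (\<lambda>_. borel))"
proof (rule measurable_PiM_single')
  show "(\<lambda>y. (y(m := h y)) i) \<in> borel_measurable (PiM UNIV (\<lambda>_. borel))" for i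
    by (cases "i = m") auto
qed (auto simp: space_PiM)

lemma measurable_upd_const[measurable]:
  "(\<lambda>y. u(m := y)) \<in> measurable borel (PiM UNIV (\<lambda>_::nat. borel :: real measure))"
proof (rule measurable_PiM_single')
  show "(\<lambda>y. (u(m := y)) i) \<in> borel_measurable borel" for i
    by (cases "i = m") auto
qed (auto simp: space_PiM)

text \<open>Sticks are exchanged for weights one coordinate at a time: as long as the remaining stick is at least \<open>c\<close>, the
  weight has a bounded density given the previous ones.\<close>

lemma nn_integral_partial_stick:
  assumes \<alpha>: "\<alpha> > 0" and c: "0 < c" and F: "F \<in> borel_measurable (PiM UNIV (\<lambda>_. borel))"
  shows "(\<integral>\<^sup>+v. F (partial_stick m v) * indicator {v. stick_rest v m \<ge> c} v \<partial>stick_prior \<alpha>)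
    \<le> ennreal (\<alpha> * max 1 (c powr (\<alpha> - 1)) / c) ^ m * (\<integral>\<^sup>+y. F y \<partial>PiM UNIV (stick_mixed \<alpha> m))"
  using F
proof (induction m arbitrary: F)
  case 0
  have "(\<integral>\<^sup>+v. F (partial_stick 0 v) * indicator {v. stick_rest v 0 \<ge> c} v \<partial>stick_prior \<alpha>) \<le>
     (\<integral>\<^sup>+v. F v \<partial>stick_prior \<alpha>)"
    by (intro nn_integral_mono) (auto simp: partial_stick_def[abs_def] indicator_def)
  then show ?case by (simp add: stick_mixed_def[abs_def])
next
  case (Suc m)
  let ?C = "ennreal (\<alpha> * max 1 (c powr (\<alpha> - 1)) / c)"
  note [measurable] = Suc.prems
  define r where "r y = 1 - (\<Sum>k<m. y k)" for y :: "nat \<Rightarrow> real"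
  have [measurable]: "r \<in> borel_measurable (PiM UNIV (\<lambda>_. borel))"
    unfolding r_def by measurable
  \<comment> \<open>\<open>F'\<close> performs the exchange at coordinate \<open>m\<close> on a
    sequence whose first \<open>m\<close> entries are already weights; the stick \<open>r y\<close>
    before the break is one minus their sum. The indicators put both sticks into the range of
    \<open>nn_integral_beta_1_scale\<close>.\<close>
  define F' where "F' y = F (y(m := r y * y m)) * indicator {y. c \<le> r y \<and> r y \<le> 1} y
     * indicator {y. c \<le> r y * (1 - y m)} y" for y
  have F'[measurable]: "F' \<in> borel_measurable (PiM UNIV (\<lambda>_. borel))"
    unfolding F'_def by measurable
  have ps: "prob_space (stick_mixed \<alpha> k i)" for k i using \<alpha> by (rule prob_space_stick_mixed)
  have r_upd: "r (u(m := y)) = r u" for u y by (simp add: r_def)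
  have "(\<integral>\<^sup>+v. F (partial_stick (Suc m) v) * indicator {v. stick_rest v (Suc m) \<ge> c} v \<partial>stick_prior \<alpha>)
    = (\<integral>\<^sup>+v. F' (partial_stick m v) * indicator {v. stick_rest v m \<ge> c} v \<partial>stick_prior \<alpha>)"
  proof (intro nn_integral_cong_AE, use AE_stick_dom[OF \<alpha>] in eventually_elim)
    case (elim v)
    have 1: "r (partial_stick m v) = stick_rest v m"
      by (simp add: r_def sum_partial_stick)
    have 2: "(partial_stick m v)(m := stick_rest v m * v m) = partial_stick (Suc m) v"
      by (auto simp: partial_stick_def fun_eq_iff stick_breaking_rest)
    have 3: "c \<le> stick_rest v (Suc m) \<Longrightarrow> c \<le> stick_rest v m"
      using stick_rest_antimono[OF elim, of m "Suc m"] by simp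
    have 4: "partial_stick m v m = v m" by (simp add: partial_stick_def)
    show ?case
      using stick_rest_le_1[OF elim, of m] 3
      by (auto simp: F'_def 1 2 4 stick_rest_Suc[symmetric] indicator_def)
  qed
  also have "\<dots> \<le> ?C ^ m * (\<integral>\<^sup>+y. F' y \<partial>PiM UNIV (stick_mixed \<alpha> m))"
    by (rule Suc.IH[OF F'])
  \<comment> \<open>From here on the outer product has the uniform law at coordinate
    \<open>m\<close>, while the inner integral still draws that coordinate from the Beta
    law.\<close>
  also have "(\<integral>\<^sup>+y. F' y \<partial>PiM UNIV (stick_mixed \<alpha> m)) =
     (\<integral>\<^sup>+u. (\<integral>\<^sup>+y. F' (u(m := y)) \<partial>stick_mixed \<alpha> m m) \<partial>PiM UNIV (stick_mixed \<alpha> (Suc m)))"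
    using \<alpha> by (intro nn_integral_PiM_resample ps) (auto simp: stick_mixed_def)
  also have "\<dots> \<le> (\<integral>\<^sup>+u. ?C * (\<integral>\<^sup>+y. F (u(m := y)) \<partial>unif01) \<partial>PiM UNIV (stick_mixed \<alpha> (Suc m)))"
  proof (intro nn_integral_mono)
    fix u :: "nat \<Rightarrow> real"
    show "(\<integral>\<^sup>+y. F' (u(m := y)) \<partial>stick_mixed \<alpha> m m) \<le> ?C * (\<integral>\<^sup>+y. F (u(m := y)) \<partial>unif01)"
    proof (cases "c \<le> r u \<and> r u \<le> 1")
      case True
      then show ?thesis
        using nn_integral_beta_1_scale[OF \<alpha> c, of "r u" "\<lambda>y. F (u(m := y))"]
        by (simp add: stick_mixed_def F'_def r_upd indicator_def)
    qed (auto simp: F'_def r_upd indicator_def)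
  qed
  also have "\<dots> = ?C * (\<integral>\<^sup>+u. (\<integral>\<^sup>+y. F (u(m := y)) \<partial>unif01) \<partial>PiM UNIV (stick_mixed \<alpha> (Suc m)))"
  proof (intro nn_integral_cmult)
    interpret U: prob_space unif01 by (rule prob_space_unif01)
    have "(\<lambda>(u, y). u(m := y)) \<in> measurable (PiM UNIV (stick_mixed \<alpha> (Suc m)) \<Otimes>\<^sub>M unif01) (PiM UNIV (stick_mixed \<alpha> (Suc m)))"
      using measurable_fun_upd_PiM[of m "stick_mixed \<alpha> (Suc m)" "stick_mixed \<alpha> (Suc m)"] by (simp add: stick_mixed_def)
    from measurable_compose[OF this, of F borel]
    have [measurable]: "(\<lambda>(u, y). F (u(m := y))) \<in> borel_measurable (PiM UNIV (stick_mixed \<alpha> (Suc m)) \<Otimes>\<^sub>M unif01)"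
      by (simp add: split_beta)
    show "(\<lambda>u. \<integral>\<^sup>+y. F (u(m := y)) \<partial>unif01) \<in> borel_measurable (PiM UNIV (stick_mixed \<alpha> (Suc m)))"
      by measurable
  qed
  also have "(\<integral>\<^sup>+u. (\<integral>\<^sup>+y. F (u(m := y)) \<partial>unif01) \<partial>PiM UNIV (stick_mixed \<alpha> (Suc m))) =
    (\<integral>\<^sup>+u. F u \<partial>PiM UNIV (stick_mixed \<alpha> (Suc m)))"
    using nn_integral_PiM_resample[where N="stick_mixed \<alpha> (Suc m)" and N'="stick_mixed \<alpha> (Suc m)" and j=m and F=F, OF ps ps refl] by (simp add: stick_mixed_def)
  finally show ?case
    by (simp add: mult_left_mono mult.assoc power_Suc2 del: power_Suc)
qed

text \<open>Coordinate \<open>m\<close> stores the stick remaining after it (in the form \<open>1 - rest\<close>), which keeps its Beta law up to a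
  bounded density even when it is close to \<open>0\<close>.\<close>

lemma nn_integral_partial_stick':
  assumes \<alpha>: "\<alpha> > 0" and c: "0 < c" and F[measurable]: "F \<in> borel_measurable (PiM UNIV (\<lambda>_. borel))"
  shows "(\<integral>\<^sup>+v. F ((partial_stick m v)(m := 1 - stick_rest v (Suc m))) * indicator {v. stick_rest v m \<ge> c} v \<partial>stick_prior \<alpha>)
    \<le> ennreal (\<alpha> * max 1 (c powr (\<alpha> - 1)) / c) ^ m * (ennreal (c powr (- \<alpha>)) *
       (\<integral>\<^sup>+y. F y \<partial>PiM UNIV (stick_mixed \<alpha> m)))"
proof -
  let ?C = "ennreal (\<alpha> * max 1 (c powr (\<alpha> - 1)) / c)"
  let ?S = "PiM UNIV (stick_mixed \<alpha> m)"
  define r where "r y = 1 - (\<Sum>k<m. y k)" for y :: "nat \<Rightarrow> real"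
  have [measurable]: "r \<in> borel_measurable (PiM UNIV (\<lambda>_. borel))"
    unfolding r_def by measurable
  \<comment> \<open>Only the stick before break \<open>m\<close> is bounded below. The coordinate
    becomes one minus the stick after the break, so the Beta law remains its reference law.\<close>
  define F' where "F' y = F (y(m := 1 - r y * (1 - y m))) * indicator {y. c \<le> r y \<and> r y \<le> 1} y" for y
  have F'[measurable]: "F' \<in> borel_measurable (PiM UNIV (\<lambda>_. borel))"
    unfolding F'_def by measurable
  have ps: "prob_space (stick_mixed \<alpha> k i)" for k i using \<alpha> by (rule prob_space_stick_mixed)
  have r_upd: "r (u(m := y)) = r u" for u y by (simp add: r_def)
  have "(\<integral>\<^sup>+v. F ((partial_stick m v)(m := 1 - stick_rest v (Suc m))) * indicator {v. stick_rest v m \<ge> c} v \<partial>stick_prior \<alpha>)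
    = (\<integral>\<^sup>+v. F' (partial_stick m v) * indicator {v. stick_rest v m \<ge> c} v \<partial>stick_prior \<alpha>)"
  proof (intro nn_integral_cong_AE, use AE_stick_dom[OF \<alpha>] in eventually_elim)
    case (elim v)
    have 1: "r (partial_stick m v) = stick_rest v m"
      by (simp add: r_def sum_partial_stick)
    have 4: "partial_stick m v m = v m" by (simp add: partial_stick_def)
    show ?case
      using stick_rest_le_1[OF elim, of m]
      by (auto simp: F'_def 1 4 stick_rest_Suc[symmetric] indicator_def)
  qed
  also have "\<dots> \<le> ?C ^ m * (\<integral>\<^sup>+y. F' y \<partial>?S)"
    by (rule nn_integral_partial_stick[OF \<alpha> c F'])
  finally have le: "(\<integral>\<^sup>+v. F ((partial_stick m v)(m := 1 - stick_rest v (Suc m))) * indicator {v. stick_rest v m \<ge> c} v \<partial>stick_prior \<alpha>)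
    \<le> ?C ^ m * (\<integral>\<^sup>+y. F' y \<partial>?S)" .
  have "(\<integral>\<^sup>+y. F' y \<partial>?S) = (\<integral>\<^sup>+u. (\<integral>\<^sup>+y. F' (u(m := y)) \<partial>stick_mixed \<alpha> m m) \<partial>?S)"
    using ps by (intro nn_integral_PiM_resample) auto
  also have "\<dots> \<le> (\<integral>\<^sup>+u. ennreal (c powr (- \<alpha>)) * (\<integral>\<^sup>+y. F (u(m := y)) \<partial>stick_mixed \<alpha> m m) \<partial>?S)"
  proof (intro nn_integral_mono)
    fix u :: "nat \<Rightarrow> real"
    show "(\<integral>\<^sup>+y. F' (u(m := y)) \<partial>stick_mixed \<alpha> m m) \<le> ennreal (c powr (- \<alpha>)) * (\<integral>\<^sup>+y. F (u(m := y)) \<partial>stick_mixed \<alpha> m m)"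
    proof (cases "c \<le> r u \<and> r u \<le> 1")
      case True
      then show ?thesis
        using nn_integral_beta_1_reflect_scale[OF \<alpha> c, of "r u" "\<lambda>x. F (u(m := 1 - x))"]
        by (simp add: stick_mixed_def F'_def r_upd indicator_def)
    qed (auto simp: F'_def r_upd indicator_def)
  qed
  also have "\<dots> = ennreal (c powr (- \<alpha>)) * (\<integral>\<^sup>+u. (\<integral>\<^sup>+y. F (u(m := y)) \<partial>stick_mixed \<alpha> m m) \<partial>?S)"
  proof (intro nn_integral_cmult)
    interpret U: prob_space "stick_mixed \<alpha> m m" by (rule ps)
    from measurable_compose[OF measurable_fun_upd_PiM[of m "stick_mixed \<alpha> m" "stick_mixed \<alpha> m"], of F borel]
    have [measurable]: "(\<lambda>(u, y). F (u(m := y))) \<in> borel_measurable (?S \<Otimes>\<^sub>M stick_mixed \<alpha> m m)"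
      by (simp add: split_beta)
    show "(\<lambda>u. \<integral>\<^sup>+y. F (u(m := y)) \<partial>stick_mixed \<alpha> m m) \<in> borel_measurable ?S"
      by measurable
  qed
  also have "(\<integral>\<^sup>+u. (\<integral>\<^sup>+y. F (u(m := y)) \<partial>stick_mixed \<alpha> m m) \<partial>?S) = (\<integral>\<^sup>+u. F u \<partial>?S)"
    using nn_integral_PiM_resample[where N="stick_mixed \<alpha> m" and N'="stick_mixed \<alpha> m" and j=m and F=F, OF ps ps refl] by simp
  finally show ?thesis
    by (intro order_trans[OF le] mult_left_mono) auto
qed

lemma stick_rest_split: "k \<le> M \<Longrightarrow> stick_rest v M = stick_rest v k * (\<Prod>i\<in>{k..<M}. 1 - v i)"
  unfolding stick_rest_def lessThan_atLeast0 by (subst prod.atLeastLessThan_concat) auto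

text \<open>With coordinate \<open>m\<close> storing one minus the stick after break
  \<open>m\<close>, the first factor of the product already contains all earlier factors 1 -
  v.\<close>

lemma prod_partial_stick:
  assumes "m < M"
  shows "(\<Prod>i\<in>{m..<M}. 1 - ((partial_stick m v)(m := 1 - stick_rest v (Suc m))) i) = stick_rest v M"
    (is "(\<Prod>i\<in>_. 1 - ?w i) = _")
proof -
  have "(\<Prod>i\<in>{m..<M}. 1 - ?w i) = (1 - ?w m) * (\<Prod>i\<in>{Suc m..<M}. 1 - ?w i)"
    using assms by (subst prod.atLeast_Suc_lessThan) auto
  also have "(\<Prod>i\<in>{Suc m..<M}. 1 - ?w i) = (\<Prod>i\<in>{Suc m..<M}. 1 - v i)"
    by (intro prod.cong) (auto simp: partial_stick_def)
  also have "(1 - ?w m) * (\<Prod>i\<in>{Suc m..<M}. 1 - v i) = stick_rest v M"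
    using assms by (subst stick_rest_split[of "Suc m" M]) auto
  finally show ?thesis .
qed

text \<open>In the application \<open>J\<close> contains the heaviest atoms of all clusters but one, the functions \<open>g\<close> express the cluster
  masses, and the powers \<open>-1/2\<close> come from the location of an additional atom.\<close>

lemma stick_mass_bound:
  fixes g :: "nat \<Rightarrow> (nat \<Rightarrow> real) \<Rightarrow> real"
  assumes \<alpha>: "\<alpha> > 0" and c: "0 < c" and a: "0 < a" "a < \<alpha>" and m: "m < M" and J: "J \<subseteq> {..<m}"
    and g[measurable]: "\<And>k. k \<in> J \<Longrightarrow> g k \<in> borel_measurable (PiM UNIV (\<lambda>_. borel))"
    and g_indep: "\<And>i k y x. i \<in> J \<Longrightarrow> k \<in> J \<Longrightarrow> g k (y(i := x)) = g k y"
    and \<rho>: "\<rho> > 0" "\<rho>' \<ge> 0"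
  shows "(\<integral>\<^sup>+v. (\<Prod>k\<in>J. indicator {z. \<bar>z + g k ((partial_stick m v)(m := 1 - stick_rest v (Suc m)))\<bar> \<le> \<rho>'} (stick_breaking v k)) *
       ((\<Prod>k\<in>{..<m} - J. ennreal (stick_breaking v k powr (- (1 / 2)))) * indicator {v. stick_rest v M \<le> \<rho>} v)
       * indicator {v. stick_rest v m \<ge> c} v \<partial>stick_prior \<alpha>)
   \<le> ennreal (\<alpha> * max 1 (c powr (\<alpha> - 1)) / c) ^ m * (ennreal (c powr (- \<alpha>)) *
       (ennreal (2 * \<rho>') ^ card J * (2 ^ card ({..<m} - J) * ennreal (\<alpha> / (\<alpha> - a)) ^ (M - m) * ennreal (\<rho> powr a))))"
proof -
  define w where "w v = (partial_stick m v)(m := 1 - stick_rest v (Suc m))" for v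
  define s where "s k y = (indicator {z. \<bar>z + g k y\<bar> \<le> \<rho>'} :: real \<Rightarrow> ennreal)" for k y
  \<comment> \<open>Both powers have finite expectation: the power -1/2 of a weight under the
    uniform law, and the power -a of 1 - v under the Beta law because a < \<alpha>.\<close>
  define h where "h k z = (if k < m then ennreal (z powr (- (1 / 2))) else ennreal ((1 - z) powr (- a)))" for k :: nat and z :: real
  define I where "I = ({..<m} - J) \<union> {m..<M}"
  define G where "G y = (\<Prod>k\<in>I. h k (y k)) * ennreal (\<rho> powr a)" for y
  define F where "F y = (\<Prod>k\<in>J. s k y (y k)) * G y" for y
  have finJ: "finite J" using J finite_subset by blast
  have finI: "finite I" by (simp add: I_def)
  have [measurable]: "h k \<in> borel_measurable borel" for k
    unfolding h_def by (cases "k < m") auto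
  have s_meas[measurable]: "(\<lambda>y. s k y (y k)) \<in> borel_measurable (PiM UNIV (\<lambda>_. borel))" if "k \<in> J" for k
    using that unfolding s_def indicator_def by simp
  have G[measurable]: "G \<in> borel_measurable (PiM UNIV (\<lambda>_. borel))"
    unfolding G_def by measurable
  have F[measurable]: "F \<in> borel_measurable (PiM UNIV (\<lambda>_. borel))"
    unfolding F_def by measurable
  have ps: "prob_space (stick_mixed \<alpha> m i)" for i using \<alpha> by (rule prob_space_stick_mixed)
  have le: "(\<Prod>k\<in>J. indicator {z. \<bar>z + g k (w v)\<bar> \<le> \<rho>'} (stick_breaking v k)) *
       ((\<Prod>k\<in>{..<m} - J. ennreal (stick_breaking v k powr (- (1 / 2)))) * indicator {v. stick_rest v M \<le> \<rho>} v)
     \<le> F (w v)" if v: "v \<in> stick_dom" for v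
  proof -
    have wk: "w v k = stick_breaking v k" if "k < m" for k
      using that by (simp add: w_def partial_stick_def)
    have 1: "(\<Prod>k\<in>J. indicator {z. \<bar>z + g k (w v)\<bar> \<le> \<rho>'} (stick_breaking v k)) = (\<Prod>k\<in>J. s k (w v) (w v k))"
      using J wk by (intro prod.cong) (auto simp: s_def)
    have 2: "(\<Prod>i\<in>{m..<M}. 1 - w v i) = stick_rest v M"
      unfolding w_def using m by (rule prod_partial_stick)
    have "(\<Prod>i\<in>{m..<M}. h i (w v i)) = ennreal (\<Prod>i\<in>{m..<M}. (1 - w v i) powr (- a))"
      by (subst prod_ennreal[symmetric]) (auto simp: h_def intro!: prod.cong)
    also have "(\<Prod>i\<in>{m..<M}. (1 - w v i) powr (- a)) = stick_rest v M powr (- a)"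
      unfolding 2[symmetric] by (rule prod_powr_distrib[symmetric])
    finally have 3: "(\<Prod>i\<in>{m..<M}. h i (w v i)) = ennreal (stick_rest v M powr (- a))" .
    \<comment> \<open>A bound of Markov type: if the stick R is at most \<rho>, then (R /
      \<rho>)^(-a) is at least 1. It replaces an indicator coupling many coordinates by a product of
      functions of single coordinates.\<close>
    have 4: "indicator {v. stick_rest v M \<le> \<rho>} v \<le> ennreal (stick_rest v M powr (- a)) * ennreal (\<rho> powr a)"
    proof (cases "stick_rest v M \<le> \<rho>")
      case True
      have "\<rho> powr (- a) \<le> stick_rest v M powr (- a)"
        using True a stick_rest_pos[OF v, of M] by (intro powr_mono2') auto
      then have "\<rho> powr (- a) * \<rho> powr a \<le> stick_rest v M powr (- a) * \<rho> powr a"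
        by (intro mult_right_mono) auto
      then have "1 \<le> stick_rest v M powr (- a) * \<rho> powr a"
        using \<rho> by (simp add: powr_add[symmetric])
      then have "ennreal 1 \<le> ennreal (stick_rest v M powr (- a) * \<rho> powr a)" by (rule ennreal_leI)
      then show ?thesis using True by (simp add: ennreal_mult[symmetric])
    qed simp
    have 5: "(\<Prod>k\<in>I. h k (w v k)) =
      (\<Prod>k\<in>{..<m} - J. ennreal (stick_breaking v k powr (- (1 / 2)))) * ennreal (stick_rest v M powr (- a))"
    proof -
      have "(\<Prod>k\<in>I. h k (w v k)) = (\<Prod>k\<in>{..<m} - J. h k (w v k)) * (\<Prod>k\<in>{m..<M}. h k (w v k))"
        unfolding I_def by (intro prod.union_disjoint) auto
      also have "(\<Prod>k\<in>{..<m} - J. h k (w v k)) = (\<Prod>k\<in>{..<m} - J. ennreal (stick_breaking v k powr (- (1 / 2))))"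
        by (intro prod.cong) (auto simp: h_def wk)
      finally show ?thesis by (simp add: 3)
    qed
    show ?thesis
      unfolding F_def G_def 5 1 using 4 by (auto simp: mult.assoc intro!: mult_left_mono)
  qed
  have "(\<integral>\<^sup>+v. (\<Prod>k\<in>J. indicator {z. \<bar>z + g k (w v)\<bar> \<le> \<rho>'} (stick_breaking v k)) *
       ((\<Prod>k\<in>{..<m} - J. ennreal (stick_breaking v k powr (- (1 / 2)))) * indicator {v. stick_rest v M \<le> \<rho>} v)
       * indicator {v. stick_rest v m \<ge> c} v \<partial>stick_prior \<alpha>)
     \<le> (\<integral>\<^sup>+v. F (w v) * indicator {v. stick_rest v m \<ge> c} v \<partial>stick_prior \<alpha>)"
    by (intro nn_integral_mono_AE, use AE_stick_dom[OF \<alpha>] in eventually_elim)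
       (auto intro!: mult_right_mono le)
  also have "\<dots> \<le> ennreal (\<alpha> * max 1 (c powr (\<alpha> - 1)) / c) ^ m * (ennreal (c powr (- \<alpha>)) *
       (\<integral>\<^sup>+y. F y \<partial>PiM UNIV (stick_mixed \<alpha> m)))"
    unfolding w_def by (rule nn_integral_partial_stick'[OF \<alpha> c F])
  finally have le1: "(\<integral>\<^sup>+v. (\<Prod>k\<in>J. indicator {z. \<bar>z + g k (w v)\<bar> \<le> \<rho>'} (stick_breaking v k)) *
       ((\<Prod>k\<in>{..<m} - J. ennreal (stick_breaking v k powr (- (1 / 2)))) * indicator {v. stick_rest v M \<le> \<rho>} v)
       * indicator {v. stick_rest v m \<ge> c} v \<partial>stick_prior \<alpha>)
     \<le> ennreal (\<alpha> * max 1 (c powr (\<alpha> - 1)) / c) ^ m * (ennreal (c powr (- \<alpha>)) *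
       (\<integral>\<^sup>+y. F y \<partial>PiM UNIV (stick_mixed \<alpha> m)))" .
  have "(\<integral>\<^sup>+y. F y \<partial>PiM UNIV (stick_mixed \<alpha> m)) \<le> ennreal (2 * \<rho>') ^ card J * (\<integral>\<^sup>+y. G y \<partial>PiM UNIV (stick_mixed \<alpha> m))"
    unfolding F_def
  proof (rule nn_integral_PiM_peel[OF ps finJ])
    show "s j (u(i := y)) z = s j u z" if "i \<in> J" "j \<in> J" for i j u y z
      unfolding s_def using g_indep[OF that, of u y] by metis
    show "G (u(i := y)) = G u" if "i \<in> J" for i u y
    proof -
      have "(\<Prod>k\<in>I. h k ((u(i := y)) k)) = (\<Prod>k\<in>I. h k (u k))"
        using that J by (intro prod.cong) (auto simp: I_def)
      then show ?thesis unfolding G_def by (rule arg_cong)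
    qed
    show "(\<integral>\<^sup>+y. s j u y \<partial>stick_mixed \<alpha> m j) \<le> ennreal (2 * \<rho>')" if "j \<in> J" for j u
    proof -
      have "(\<integral>\<^sup>+y. s j u y \<partial>stick_mixed \<alpha> m j) = (\<integral>\<^sup>+y. s j u y \<partial>unif01)"
        using that J by (auto simp: stick_mixed_def)
      also have "\<dots> \<le> (\<integral>\<^sup>+y. indicator {- g j u - \<rho>'..- g j u + \<rho>'} y \<partial>lborel)"
        unfolding s_def
        by (subst nn_integral_unif01, measurable, intro nn_integral_mono) (auto simp: indicator_def)
      also have "\<dots> = ennreal (2 * \<rho>')" using \<rho> by simp
      finally show ?thesis .
    qed
  qed (auto intro: s_meas)
  also have "(\<integral>\<^sup>+y. G y \<partial>PiM UNIV (stick_mixed \<alpha> m)) =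
     (\<Prod>k\<in>I. (\<integral>\<^sup>+z. h k z \<partial>stick_mixed \<alpha> m k)) * ennreal (\<rho> powr a)"
  proof -
    have "(\<integral>\<^sup>+y. (\<Prod>k\<in>I. h k (y k)) \<partial>PiM UNIV (stick_mixed \<alpha> m)) = (\<Prod>k\<in>I. (\<integral>\<^sup>+z. h k z \<partial>stick_mixed \<alpha> m k))"
      by (rule nn_integral_PiM_prod[OF ps finI]) measurable
    then show ?thesis unfolding G_def by (subst nn_integral_multc) auto
  qed
  also have "(\<Prod>k\<in>I. (\<integral>\<^sup>+z. h k z \<partial>stick_mixed \<alpha> m k)) =
     (\<Prod>k\<in>{..<m} - J. (\<integral>\<^sup>+z. h k z \<partial>stick_mixed \<alpha> m k)) * (\<Prod>k\<in>{m..<M}. (\<integral>\<^sup>+z. h k z \<partial>stick_mixed \<alpha> m k))"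
    unfolding I_def by (intro prod.union_disjoint) auto
  also have "(\<Prod>k\<in>{..<m} - J. (\<integral>\<^sup>+z. h k z \<partial>stick_mixed \<alpha> m k)) = (\<Prod>k\<in>{..<m} - J. 2)"
  proof (intro prod.cong refl)
    fix k assume "k \<in> {..<m} - J"
    then have "(\<integral>\<^sup>+z. h k z \<partial>stick_mixed \<alpha> m k) = (\<integral>\<^sup>+z. ennreal (z powr (- (1 / 2))) \<partial>unif01)"
      by (simp add: h_def stick_mixed_def)
    also have "\<dots> = (\<integral>\<^sup>+z. ennreal (z powr (1/2 - 1)) * indicator {0<..<1} z \<partial>lborel)"
    proof (subst nn_integral_unif01)
      have "AE z::real in lborel. z \<noteq> 1" by (rule AE_lborel_singleton)
      then show "(\<integral>\<^sup>+z. ennreal (z powr (- (1 / 2))) * indicator {0..1} z \<partial>lborel) =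
        (\<integral>\<^sup>+z. ennreal (z powr (1/2 - 1)) * indicator {0<..<1} z \<partial>lborel)"
        by (intro nn_integral_cong_AE, eventually_elim) (auto simp: indicator_def)
    qed auto
    also have "\<dots> = 2" by (subst nn_integral_powr_from_0) auto
    finally show "(\<integral>\<^sup>+z. h k z \<partial>stick_mixed \<alpha> m k) = 2" .
  qed
  also have "(\<Prod>k\<in>{m..<M}. (\<integral>\<^sup>+z. h k z \<partial>stick_mixed \<alpha> m k)) = (\<Prod>k\<in>{m..<M}. ennreal (\<alpha> / (\<alpha> - a)))"
    using a by (intro prod.cong) (auto simp: h_def[abs_def] stick_mixed_def nn_integral_beta_1_moment[OF \<alpha>])
  finally have le2: "(\<integral>\<^sup>+y. F y \<partial>PiM UNIV (stick_mixed \<alpha> m)) \<le>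
    ennreal (2 * \<rho>') ^ card J * (2 ^ card ({..<m} - J) * ennreal (\<alpha> / (\<alpha> - a)) ^ (M - m) * ennreal (\<rho> powr a))"
    by (simp only: prod_constant card_atLeastLessThan)
  show ?thesis
    by (rule order_trans[OF le1 mult_left_mono[OF mult_left_mono[OF le2 zero_le] zero_le], unfolded w_def])
qed

section \<open>Prior mass of cluster configurations\<close>

text \<open>Among the first \<open>M\<close> atoms, atom \<open>k\<close> belongs to the cluster \<open>l k\<close>, and \<open>\<kappa> j\<close> is a heavy atom of cluster \<open>j\<close>.\<close>

definition cluster_event where
  "cluster_event K M l \<kappa> ws \<theta>s c B \<rho> \<epsilon> = {(v, \<theta> :: nat \<Rightarrow> 'a::euclidean_space).
     (\<forall>j<K. c \<le> stick_breaking v (\<kappa> j)) \<and>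
     (\<forall>j<K. \<bar>(\<Sum>k\<in>{k. k < M \<and> l k = j}. stick_breaking v k) - ws j\<bar> \<le> B) \<and>
     (\<forall>j<K. norm (\<Sum>k\<in>{k. k < M \<and> l k = j}. stick_breaking v k *\<^sub>R (\<theta> k - \<theta>s j)) \<le> B) \<and>
     (\<forall>k<M. stick_breaking v k * (norm (\<theta> k - \<theta>s (l k)))\<^sup>2 \<le> B) \<and>
     stick_rest v M \<le> \<rho> \<and> stick_rest v K > \<epsilon>}"

lemma sets_cluster_event[measurable]:
  "cluster_event K M l \<kappa> ws \<theta>s c B \<rho> \<epsilon> \<in> sets (PiM UNIV (\<lambda>_. borel) \<Otimes>\<^sub>M PiM UNIV (\<lambda>_. borel :: 'a::euclidean_space measure))"
proof -
  let ?M = "PiM UNIV (\<lambda>_. borel) \<Otimes>\<^sub>M PiM UNIV (\<lambda>_. borel :: 'a measure)"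
  have "cluster_event K M l \<kappa> ws \<theta>s c B \<rho> \<epsilon> = {p \<in> space ?M.
     (\<forall>j<K. c \<le> stick_breaking (fst p) (\<kappa> j)) \<and>
     (\<forall>j<K. \<bar>(\<Sum>k\<in>{k. k < M \<and> l k = j}. stick_breaking (fst p) k) - ws j\<bar> \<le> B) \<and>
     (\<forall>j<K. norm (\<Sum>k\<in>{k. k < M \<and> l k = j}. stick_breaking (fst p) k *\<^sub>R (snd p k - \<theta>s j)) \<le> B) \<and>
     (\<forall>k<M. stick_breaking (fst p) k * (norm (snd p k - \<theta>s (l k)))\<^sup>2 \<le> B) \<and>
     stick_rest (fst p) M \<le> \<rho> \<and> stick_rest (fst p) K > \<epsilon>}"
    by (auto simp: cluster_event_def space_pair_measure space_PiM)
  also have "\<dots> \<in> sets ?M" by measurable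
  finally show ?thesis .
qed

lemma sum_except:
  fixes f :: "nat \<Rightarrow> 'b::comm_monoid_add"
  assumes "k < M"
  shows "(\<Sum>i\<in>{i. i < M \<and> l i = l k}. f i) = f k + (\<Sum>i\<in>{i. i < M \<and> l i = l k \<and> i \<noteq> k}. f i)"
proof -
  have "{i. i < M \<and> l i = l k} = insert k {i. i < M \<and> l i = l k \<and> i \<noteq> k}" using assms by auto
  then show ?thesis by simp
qed

text \<open>The weights are fixed here. The first moment of cluster \<open>j\<close> confines the
  heavy atom \<open>\<kappa> j\<close> to a ball of radius at most B / c about a point determined by
  the rest of its cluster, which gives K factors (B / c)^D. The additional atom \<open>e\<close> is
  confined by its second moment to a ball of radius (B / w)^(1/2).\<close>

lemma nn_integral_cluster_atoms:
  fixes P0 :: "'a::euclidean_space measure"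
  assumes P0: "prob_space P0" "sets P0 = sets borel"
    and b: "b \<ge> 1" "\<And>x r. r \<ge> 0 \<Longrightarrow> emeasure P0 (cball x r) \<le> ennreal (b * r ^ DIM('a))"
    and \<kappa>: "\<And>j. j < K \<Longrightarrow> \<kappa> j < M \<and> l (\<kappa> j) = j"
    and c: "c > 0" "\<And>j. j < K \<Longrightarrow> c \<le> w (\<kappa> j)"
    and e: "e < M" "e \<notin> \<kappa> ` {..<K}" "w e > 0" and B: "B > 0"
  shows "(\<integral>\<^sup>+\<theta>. indicator {\<theta>. (\<forall>j<K. norm (\<Sum>k\<in>{k. k < M \<and> l k = j}. w k *\<^sub>R (\<theta> k - \<theta>s j)) \<le> B) \<and>
     (\<forall>k<M. w k * (norm (\<theta> k - \<theta>s (l k)))\<^sup>2 \<le> B)} \<theta> \<partial>PiM UNIV (\<lambda>_::nat. P0))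
    \<le> ennreal ((b * (B / c) ^ DIM('a)) ^ K * (b * sqrt (B / w e)))"
proof -
  interpret P0: prob_space P0 by (rule P0)
  have [measurable_cong]: "sets P0 = sets borel" by (rule P0)
  have sp: "space P0 = UNIV" using P0(2) sets_eq_imp_space_eq by fastforce
  have S[measurable_cong]: "sets (PiM UNIV (\<lambda>_::nat. P0)) = sets (PiM UNIV (\<lambda>_. borel))"
    by (rule sets_PiM_borel) (rule P0)
  define J where "J = \<kappa> ` {..<K}"
  have inj: "inj_on \<kappa> {..<K}" using \<kappa> by (intro inj_onI) (metis lessThan_iff)
  have card: "card J = K" unfolding J_def using inj by (simp add: card_image)
  define rst where "rst k \<theta> = (\<Sum>i\<in>{i. i < M \<and> l i = l k \<and> i \<noteq> k}. w i *\<^sub>R (\<theta> i - \<theta>s (l k)))" for k :: nat and \<theta> :: "nat \<Rightarrow> 'a"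
  define s where "s k \<theta> z = (indicator {z. norm (w k *\<^sub>R (z - \<theta>s (l k)) + rst k \<theta>) \<le> B} z :: ennreal)" for k \<theta> z
  define G where "G \<theta> = (indicator (cball (\<theta>s (l e)) (sqrt (B / w e))) (\<theta> e) :: ennreal)" for \<theta> :: "nat \<Rightarrow> 'a"
  have [measurable]: "rst k \<in> borel_measurable (PiM UNIV (\<lambda>_. borel))" for k
    unfolding rst_def by measurable
  have [measurable]: "G \<in> borel_measurable (PiM UNIV (\<lambda>_. borel))"
    unfolding G_def by (rule measurable_compose[OF measurable_component_singleton borel_measurable_indicator]) auto
  have s[measurable]: "(\<lambda>\<theta>. s k \<theta> (\<theta> k)) \<in> borel_measurable (PiM UNIV (\<lambda>_. borel))" for k
    unfolding s_def indicator_def by simp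
  have "(\<integral>\<^sup>+\<theta>. indicator {\<theta>. (\<forall>j<K. norm (\<Sum>k\<in>{k. k < M \<and> l k = j}. w k *\<^sub>R (\<theta> k - \<theta>s j)) \<le> B) \<and>
     (\<forall>k<M. w k * (norm (\<theta> k - \<theta>s (l k)))\<^sup>2 \<le> B)} \<theta> \<partial>PiM UNIV (\<lambda>_::nat. P0))
    \<le> (\<integral>\<^sup>+\<theta>. (\<Prod>k\<in>J. s k \<theta> (\<theta> k)) * G \<theta> \<partial>PiM UNIV (\<lambda>_::nat. P0))"
  proof (intro nn_integral_mono)
    fix \<theta> :: "nat \<Rightarrow> 'a"
    show "indicator {\<theta>. (\<forall>j<K. norm (\<Sum>k\<in>{k. k < M \<and> l k = j}. w k *\<^sub>R (\<theta> k - \<theta>s j)) \<le> B) \<and>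
     (\<forall>k<M. w k * (norm (\<theta> k - \<theta>s (l k)))\<^sup>2 \<le> B)} \<theta> \<le> (\<Prod>k\<in>J. s k \<theta> (\<theta> k)) * G \<theta>"
    proof (cases "(\<forall>j<K. norm (\<Sum>k\<in>{k. k < M \<and> l k = j}. w k *\<^sub>R (\<theta> k - \<theta>s j)) \<le> B) \<and>
       (\<forall>k<M. w k * (norm (\<theta> k - \<theta>s (l k)))\<^sup>2 \<le> B)")
      case True
      have "s k \<theta> (\<theta> k) = 1" if "k \<in> J" for k
      proof -
        from that obtain j where j: "j < K" "k = \<kappa> j" unfolding J_def by auto
        with \<kappa>[of j] have k: "k < M" "l k = j" by auto
        have "norm (\<Sum>i\<in>{i. i < M \<and> l i = l k}. w i *\<^sub>R (\<theta> i - \<theta>s (l k))) \<le> B"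
          using True j k by auto
        then show ?thesis
          unfolding s_def rst_def sum_except[OF k(1)] by simp
      qed
      moreover have "G \<theta> = 1"
      proof -
        have "(norm (\<theta> e - \<theta>s (l e)))\<^sup>2 \<le> B / w e" using True e by (auto simp: field_simps)
        then have "norm (\<theta> e - \<theta>s (l e)) \<le> sqrt (B / w e)" by (rule real_le_rsqrt)
        then show ?thesis by (simp add: G_def dist_norm norm_minus_commute)
      qed
      ultimately show ?thesis by (simp add: indicator_def)
    qed simp
  qed
  also have "\<dots> \<le> ennreal (b * (B / c) ^ DIM('a)) ^ card J * (\<integral>\<^sup>+\<theta>. G \<theta> \<partial>PiM UNIV (\<lambda>_::nat. P0))"
  proof (rule nn_integral_PiM_peel)
    show "prob_space P0" by (rule P0)
    show "finite J" by (simp add: J_def)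
    show "s j (u(i := y)) z = s j u z" if "i \<in> J" "j \<in> J" for i j u y z
    proof -
      \<comment> \<open>Members of \<open>J\<close> belong to different clusters, so the rest of a
        cluster contains no further member of \<open>J\<close>.\<close>
      have "i' \<noteq> i" if i': "l i' = l j" "i' \<noteq> j" for i'
        using that \<open>i \<in> J\<close> \<open>j \<in> J\<close> \<kappa> unfolding J_def by auto
      then have "rst j (u(i := y)) = rst j u" unfolding rst_def by (intro sum.cong) auto
      then show ?thesis unfolding s_def by presburger
    qed
    show "G (u(i := y)) = G u" if "i \<in> J" for i u y
      using that e unfolding J_def G_def by (metis fun_upd_other)
    show "(\<integral>\<^sup>+y. s j u y \<partial>P0) \<le> ennreal (b * (B / c) ^ DIM('a))" if "j \<in> J" for j u
    proof -
      have wj: "w j \<ge> c" using that c by (auto simp: J_def)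
      \<comment> \<open>The centre comes from dividing the first-moment constraint by the weight of
        atom \<open>j\<close>.\<close>
      let ?x = "\<theta>s (l j) - (1 / w j) *\<^sub>R rst j u"
      have "(\<integral>\<^sup>+y. s j u y \<partial>P0) \<le> (\<integral>\<^sup>+y. indicator (cball ?x (B / c)) y \<partial>P0)"
      proof (intro nn_integral_mono)
        fix y
        show "s j u y \<le> indicator (cball ?x (B / c)) y"
        proof (cases "norm (w j *\<^sub>R (y - \<theta>s (l j)) + rst j u) \<le> B")
          case True
          have "w j *\<^sub>R (y - \<theta>s (l j)) + rst j u = w j *\<^sub>R (y - ?x)"
            using wj c by (simp add: algebra_simps)
          then have "w j * norm (y - ?x) \<le> B" using True wj c by simp
          moreover have "c * norm (y - ?x) \<le> w j * norm (y - ?x)" using wj by (intro mult_right_mono) auto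
          ultimately have "norm (y - ?x) \<le> B / c" using c by (simp add: field_simps)
          then have "y \<in> cball ?x (B / c)" by (simp add: dist_norm norm_minus_commute)
          then show ?thesis by (simp add: s_def indicator_def)
        qed (simp add: s_def)
      qed
      also have "\<dots> = emeasure P0 (cball ?x (B / c))" by (rule nn_integral_indicator) simp
      also have "\<dots> \<le> ennreal (b * (B / c) ^ DIM('a))" using b B c by auto
      finally show ?thesis .
    qed
  qed auto
  also have "(\<integral>\<^sup>+\<theta>. G \<theta> \<partial>PiM UNIV (\<lambda>_::nat. P0)) = emeasure P0 (cball (\<theta>s (l e)) (sqrt (B / w e)))"
  proof -
    have [measurable]: "(indicator (cball (\<theta>s (l e)) (sqrt (B / w e))) :: 'a \<Rightarrow> ennreal) \<in> borel_measurable P0"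
      using borel_measurable_indicator[of "cball (\<theta>s (l e)) (sqrt (B / w e))" borel] P0(2)
      by (simp cong: measurable_cong_sets)
    show ?thesis
      using nn_integral_PiM_prod[of "\<lambda>_. P0" "{e}" "\<lambda>_. indicator (cball (\<theta>s (l e)) (sqrt (B / w e)))"] P0
      by (simp add: G_def)
  qed
  also have "\<dots> \<le> ennreal (b * sqrt (B / w e))"
  \<comment> \<open>Only the first power of the radius is kept, which suffices in every dimension; a
    radius above 1 falls under the trivial bound for a probability.\<close>
  proof (cases "sqrt (B / w e) \<le> 1")
    case True
    have "emeasure P0 (cball (\<theta>s (l e)) (sqrt (B / w e))) \<le> ennreal (b * sqrt (B / w e) ^ DIM('a))"
      using b B e by auto
    also have "\<dots> \<le> ennreal (b * sqrt (B / w e) ^ 1)"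
      using b B e True by (intro ennreal_leI mult_left_mono power_decreasing) (auto simp: Suc_le_eq)
    finally show ?thesis by simp
  next
    case False
    have "emeasure P0 (cball (\<theta>s (l e)) (sqrt (B / w e))) \<le> ennreal 1"
      using P0.measure_le_1 by simp
    also have "\<dots> \<le> ennreal (b * sqrt (B / w e))"
    proof (rule ennreal_leI)
      have "1 * 1 \<le> b * sqrt (B / w e)" using b False by (intro mult_mono) auto
      then show "1 \<le> b * sqrt (B / w e)" by simp
    qed
    finally show ?thesis .
  qed
  finally have "(\<integral>\<^sup>+\<theta>. indicator {\<theta>. (\<forall>j<K. norm (\<Sum>k\<in>{k. k < M \<and> l k = j}. w k *\<^sub>R (\<theta> k - \<theta>s j)) \<le> B) \<and>
     (\<forall>k<M. w k * (norm (\<theta> k - \<theta>s (l k)))\<^sup>2 \<le> B)} \<theta> \<partial>PiM UNIV (\<lambda>_::nat. P0))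
    \<le> ennreal (b * (B / c) ^ DIM('a)) ^ K * ennreal (b * sqrt (B / w e))"
    by (simp only: card mult_left_mono zero_le)
  also have "\<dots> = ennreal ((b * (B / c) ^ DIM('a)) ^ K * (b * sqrt (B / w e)))"
    using b B c e by (subst ennreal_mult) (auto simp: ennreal_power)
  finally show ?thesis .
qed

text \<open>The first moments contribute B^(DK), the short stick \<rho>^a, and the additional atom
  the square root. The K cluster masses add up to one up to the remaining stick, so K - 1 of them
  are free and contribute B^(K - 1); they are taken for the clusters that do not contain the heavy
  atom \<open>m\<close> of largest index.\<close>

lemma emeasure_cluster_event:
  fixes P0 :: "'a::euclidean_space measure"
  assumes \<alpha>: "\<alpha> > 0" and a: "0 < a" "a < \<alpha>"
    and P0: "prob_space P0" "sets P0 = sets borel"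
    and b: "b \<ge> 1" "\<And>x r. r \<ge> 0 \<Longrightarrow> emeasure P0 (cball x r) \<le> ennreal (b * r ^ DIM('a))"
    and K: "K \<ge> 1" and \<kappa>: "\<And>j. j < K \<Longrightarrow> \<kappa> j < M \<and> l (\<kappa> j) = j"
    and c: "c > 0"
  shows "\<exists>C\<ge>0. \<forall>B \<rho> \<epsilon>. 0 < B \<longrightarrow> 0 < \<rho> \<longrightarrow> 2 * \<rho> \<le> \<epsilon> \<longrightarrow> \<epsilon> \<le> 1 \<longrightarrow>
    emeasure (stick_prior \<alpha> \<Otimes>\<^sub>M PiM UNIV (\<lambda>_. P0)) (cluster_event K M l \<kappa> ws \<theta>s c B \<rho> \<epsilon>)
      \<le> ennreal (C * (B ^ (DIM('a) * K + K - 1) * \<rho> powr a * sqrt (B / \<epsilon>)))"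
proof -
  interpret P0: prob_space P0 by (rule P0)
  interpret P: prob_space "PiM UNIV (\<lambda>_::nat. P0)" by (intro prob_space_PiM P0)
  have [measurable_cong]: "sets P0 = sets borel" by (rule P0)
  have S[measurable_cong]: "sets (PiM UNIV (\<lambda>_::nat. P0)) = sets (PiM UNIV (\<lambda>_. borel))"
    by (rule sets_PiM_borel) (rule P0)
  have inj: "inj_on \<kappa> {..<K}" using \<kappa> by (intro inj_onI) (metis lessThan_iff)
  define m where "m = Max (\<kappa> ` {..<K})"
  have ne: "\<kappa> ` {..<K} \<noteq> {}" using K by (auto simp: lessThan_empty_iff)
  have m_in: "m \<in> \<kappa> ` {..<K}" unfolding m_def using ne by (intro Max_in) auto
  then obtain j0 where j0: "j0 < K" "m = \<kappa> j0" by auto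
  have m_max: "\<kappa> j \<le> m" if "j < K" for j unfolding m_def using that by (intro Max_ge) auto
  have mM: "m < M" using j0 \<kappa> by auto
  \<comment> \<open>All members of \<open>J\<close> have index below \<open>m\<close>, so their
    weights are exchanged coordinates with bounded density.\<close>
  define J where "J = \<kappa> ` {..<K} - {m}"
  have J: "J \<subseteq> {..<m}" using m_max unfolding J_def by (auto simp: le_less)
  have cardJ: "card J = K - 1" unfolding J_def using m_in inj by (simp add: card_image)
  \<comment> \<open>\<open>W i\<close> recovers weight i from the exchanged coordinates; for i > m
    the product starts at \<open>m\<close>, since that coordinate stores the stick after break
    \<open>m\<close>. At i = m it is not the weight, but \<open>m\<close> shares no cluster with a
    member of \<open>J\<close>.\<close>
  define W where "W i y = (if i < m then y i else y i * (\<Prod>j\<in>{m..<i}. 1 - y j))" for i and y :: "nat \<Rightarrow> real"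
  define g where "g k y = (\<Sum>i\<in>{i. i < M \<and> l i = l k \<and> i \<noteq> k}. W i y) - ws (l k)" for k y
  have W_eq: "W i ((partial_stick m v)(m := 1 - stick_rest v (Suc m))) = stick_breaking v i" if "i \<noteq> m" for i v
  proof (cases "i < m")
    case False
    with that have "m < i" by simp
    then show ?thesis
      unfolding W_def prod_partial_stick[OF \<open>m < i\<close>] by (simp add: partial_stick_def stick_breaking_rest)
  qed (simp add: W_def partial_stick_def)
  have lJ: "l k < K \<and> l k \<noteq> l m \<and> k < M \<and> k = \<kappa> (l k)" if "k \<in> J" for k
    using that \<kappa> j0 unfolding J_def by auto
  have [measurable]: "W i \<in> borel_measurable (PiM UNIV (\<lambda>_. borel))" for i
    unfolding W_def by (cases "i < m") simp_all
  have g_meas[measurable]: "g k \<in> borel_measurable (PiM UNIV (\<lambda>_. borel))" for k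
    unfolding g_def by measurable
  have W_upd: "W i (y(k := x)) = W i y" if "k < m" "i \<noteq> k" for i k y x
  proof -
    have "(\<Prod>j\<in>{m..<i}. 1 - (y(k := x)) j) = (\<Prod>j\<in>{m..<i}. 1 - y j)"
      using that by (intro prod.cong) auto
    then show ?thesis using that unfolding W_def by (metis fun_upd_other)
  qed
  have g_indep: "g k (y(i := x)) = g k y" if "i \<in> J" "k \<in> J" for i k y x
  proof -
    have "i' \<noteq> i" if "l i' = l k" "i' \<noteq> k" for i'
      using that lJ \<open>i \<in> J\<close> \<open>k \<in> J\<close> by metis
    moreover have "i < m" using \<open>i \<in> J\<close> J by auto
    ultimately show ?thesis unfolding g_def by (intro arg_cong2[where f="(-)"] sum.cong W_upd) auto
  qed
  define X where "X B \<epsilon> = (b * (B / c) ^ DIM('a)) ^ K * (b * sqrt (2 * M * B / \<epsilon>))" for B \<epsilon> :: real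
  define C0 where "C0 = (\<alpha> * max 1 (c powr (\<alpha> - 1)) / c) ^ m * (c powr (- \<alpha>) *
       (2 ^ (K - 1) * (2 ^ card ({..<m} - J) * (\<alpha> / (\<alpha> - a)) ^ (M - m))))"
  define C where "C = C0 * ((b / c ^ DIM('a)) ^ K * (b * sqrt (2 * M)))"
  have C0: "C0 \<ge> 0" unfolding C0_def using \<alpha> a c by simp
  have C: "C \<ge> 0" unfolding C_def using C0 b c by simp
  have "emeasure (stick_prior \<alpha> \<Otimes>\<^sub>M PiM UNIV (\<lambda>_. P0)) (cluster_event K M l \<kappa> ws \<theta>s c B \<rho> \<epsilon>)
      \<le> ennreal (C * (B ^ (DIM('a) * K + K - 1) * \<rho> powr a * sqrt (B / \<epsilon>)))"
    if B: "0 < B" and \<rho>: "0 < \<rho>" and \<epsilon>: "2 * \<rho> \<le> \<epsilon>" "\<epsilon> \<le> 1" for B \<rho> \<epsilon>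
  proof -
    let ?E = "cluster_event K M l \<kappa> ws \<theta>s c B \<rho> \<epsilon>"
    define H where "H v = (\<Prod>k\<in>J. indicator {z. \<bar>z + g k ((partial_stick m v)(m := 1 - stick_rest v (Suc m)))\<bar> \<le> B} (stick_breaking v k)) *
       ((\<Prod>k\<in>{..<m} - J. ennreal (stick_breaking v k powr (- (1 / 2)))) * indicator {v. stick_rest v M \<le> \<rho>} v)
       * indicator {v. stick_rest v m \<ge> c} v" for v
    have [measurable]: "?E \<in> sets (stick_prior \<alpha> \<Otimes>\<^sub>M PiM UNIV (\<lambda>_. P0))"
      using sets_cluster_event[of K M l \<kappa> ws \<theta>s c B \<rho> \<epsilon>] sets_pair_measure_cong[OF sets_stick_prior S] by simp
    have "emeasure (stick_prior \<alpha> \<Otimes>\<^sub>M PiM UNIV (\<lambda>_. P0)) ?E =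
       (\<integral>\<^sup>+v. (\<integral>\<^sup>+\<theta>. indicator ?E (v, \<theta>) \<partial>PiM UNIV (\<lambda>_. P0)) \<partial>stick_prior \<alpha>)"
      by (rule P.emeasure_pair_measure) simp
    also have "\<dots> \<le> (\<integral>\<^sup>+v. ennreal (X B \<epsilon>) * H v \<partial>stick_prior \<alpha>)"
    proof (intro nn_integral_mono_AE, use AE_stick_dom[OF \<alpha>] in eventually_elim)
      case (elim v)
      let ?w = "stick_breaking v"
      have wpos: "?w k > 0" "?w k \<le> 1" for k using stick_breaking_pos[OF elim] stick_breaking_le_1[OF elim] by auto
      show ?case
      proof (cases "(\<forall>j<K. c \<le> ?w (\<kappa> j)) \<and> (\<forall>j<K. \<bar>(\<Sum>k\<in>{k. k < M \<and> l k = j}. ?w k) - ws j\<bar> \<le> B) \<and>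
          stick_rest v M \<le> \<rho> \<and> stick_rest v K > \<epsilon>")
        case False
        then have "indicator ?E (v, \<theta>) = (0 :: ennreal)" for \<theta>
          by (auto simp: cluster_event_def indicator_def)
        then show ?thesis by simp
      next
        case True
        \<comment> \<open>All factors are at least 1, because weights are at most 1; so any single
          one may be singled out and bounded by \<open>p\<close>.\<close>
        define p where "p = (\<Prod>k\<in>{..<m} - J. ?w k powr (- (1 / 2)))"
        have w1: "1 \<le> ?w k powr (- (1 / 2))" for k
          using wpos[of k] ge_one_powr_ge_zero[of "1 / ?w k" "1/2"] by (simp add: powr_divide powr_minus_divide)
        have p1: "1 \<le> p" unfolding p_def using w1 by (intro prod_ge_1) auto
        have "s \<in> J \<Longrightarrow> \<bar>?w s + g s ((partial_stick m v)(m := 1 - stick_rest v (Suc m)))\<bar> \<le> B" for s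
        proof -
          assume s: "s \<in> J"
          have "(\<Sum>i\<in>{i. i < M \<and> l i = l s \<and> i \<noteq> s}. W i ((partial_stick m v)(m := 1 - stick_rest v (Suc m)))) =
             (\<Sum>i\<in>{i. i < M \<and> l i = l s \<and> i \<noteq> s}. ?w i)"
            using lJ[OF s] by (intro sum.cong W_eq) auto
          moreover have "(\<Sum>k\<in>{k. k < M \<and> l k = l s}. ?w k) = ?w s + (\<Sum>i\<in>{i. i < M \<and> l i = l s \<and> i \<noteq> s}. ?w i)"
            using lJ[OF s] by (intro sum_except) auto
          moreover have "\<bar>(\<Sum>k\<in>{k. k < M \<and> l k = l s}. ?w k) - ws (l s)\<bar> \<le> B"
            using True lJ[OF s] by blast
          ultimately show ?thesis unfolding g_def by linarith
        qed
        moreover have "c \<le> stick_rest v m"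
        proof -
          have "c \<le> ?w m" using True j0 by auto
          also have "\<dots> \<le> 1 * stick_rest v m"
            unfolding stick_breaking_rest using elim stick_rest_pos[OF elim, of m]
            by (intro mult_right_mono) (auto simp: stick_dom_def less_imp_le)
          finally show ?thesis by simp
        qed
        ultimately have H: "H v = ennreal p"
          unfolding H_def p_def using True by (simp add: prod_ennreal)
        \<comment> \<open>The choice of the additional atom. If some index below \<open>m\<close> is
          not heavy, that atom serves, and its possibly tiny weight is paid for by its own factor in
          \<open>p\<close>. Otherwise the heavy atoms are exactly those with index below K, and an
          atom of sizeable weight is found in the stick behind them.\<close>
        have "\<exists>e. e < M \<and> e \<notin> \<kappa> ` {..<K} \<and> sqrt (B / ?w e) \<le> sqrt (2 * M * B / \<epsilon>) * p"
        proof (cases "{..<m} - J = {}")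
          case False
          then obtain e where e: "e < m" "e \<notin> J" by auto
          have "?w e powr (- (1 / 2)) = (\<Prod>k\<in>{e}. ?w k powr (- (1 / 2)))" by simp
          also have "\<dots> \<le> p" unfolding p_def using w1 e
            by (intro prod_mono2) auto
          finally have pe: "?w e powr (- (1 / 2)) \<le> p" .
          have "sqrt (B / ?w e) = sqrt B * ?w e powr (- (1 / 2))"
            using wpos[of e] B by (simp add: real_sqrt_divide powr_minus_divide powr_half_sqrt)
          also have "\<dots> \<le> sqrt B * p" using pe B by (intro mult_left_mono) auto
          also have "\<dots> \<le> sqrt (2 * M * B / \<epsilon>) * p"
          proof (intro mult_right_mono real_sqrt_le_mono)
            have "B * \<epsilon> \<le> B * (2 * M)" using B \<epsilon> mM by (intro mult_left_mono) auto
            then show "B \<le> 2 * M * B / \<epsilon>" using \<epsilon> \<rho> by (simp add: field_simps)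
          qed (use p1 in auto)
          finally show ?thesis using e mM unfolding J_def by (intro exI[of _ e]) auto
        next
          case empty: True
          then have Jm: "J = {..<m}" using J by auto
          then have "K - 1 = m" using cardJ by simp
          then have Km: "K = Suc m" using K by simp
          have KM: "K < M"
          proof (rule ccontr)
            assume "\<not> K < M"
            with Km mM have "K = M" by simp
            with True \<epsilon> \<rho> show False by auto
          qed
          \<comment> \<open>The stick exceeds \<epsilon> after K atoms and is at most \<rho> \<le>
            \<epsilon> / 2 after M atoms, so fewer than M atoms share a mass above \<epsilon> /
            2.\<close>
          have "\<exists>i<M - K. ?w (K + i) \<ge> \<epsilon> / (2 * M)"
          proof (rule ccontr)
            assume "\<not> ?thesis"
            then have "(\<Sum>i<M - K. ?w (K + i)) \<le> (\<Sum>i<M - K. \<epsilon> / (2 * M))"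
              by (intro sum_mono) (auto simp: not_le less_imp_le)
            also have "\<dots> = real (M - K) * \<epsilon> / (2 * M)" by simp
            also have "\<dots> \<le> real M * \<epsilon> / (2 * M)"
              using \<epsilon> \<rho> by (intro divide_right_mono mult_right_mono) auto
            also have "\<dots> = \<epsilon> / 2" using mM by simp
            finally have "stick_rest v K - stick_rest v M \<le> \<epsilon> / 2"
              using KM by (simp add: sum_stick_breaking_from)
            with True \<epsilon> show False by auto
          qed
          then obtain i where i: "i < M - K" "?w (K + i) \<ge> \<epsilon> / (2 * M)" by auto
          have "sqrt (B / ?w (K + i)) \<le> sqrt (2 * M * B / \<epsilon>) * 1"
          proof -
            have "B / ?w (K + i) \<le> B / (\<epsilon> / (2 * M))"
              using i B \<epsilon> \<rho> mM by (intro divide_left_mono mult_pos_pos wpos) auto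
            also have "\<dots> = 2 * M * B / \<epsilon>" by simp
            finally show ?thesis by simp
          qed
          also have "\<dots> \<le> sqrt (2 * M * B / \<epsilon>) * p"
            using p1 B \<epsilon> \<rho> by (intro mult_left_mono) auto
          finally have "sqrt (B / ?w (K + i)) \<le> sqrt (2 * M * B / \<epsilon>) * p" .
          moreover have "K + i \<notin> \<kappa> ` {..<K}"
          proof
            assume "K + i \<in> \<kappa> ` {..<K}"
            then obtain x where "x < K" "K + i = \<kappa> x" by auto
            with m_max[of x] Km show False by linarith
          qed
          ultimately show ?thesis using i by (intro exI[of _ "K + i"]) auto
        qed
        then obtain e where e: "e < M" "e \<notin> \<kappa> ` {..<K}" "sqrt (B / ?w e) \<le> sqrt (2 * M * B / \<epsilon>) * p" by blast
        have "(\<integral>\<^sup>+\<theta>. indicator ?E (v, \<theta>) \<partial>PiM UNIV (\<lambda>_. P0)) \<le>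
          (\<integral>\<^sup>+\<theta>. indicator {\<theta>. (\<forall>j<K. norm (\<Sum>k\<in>{k. k < M \<and> l k = j}. ?w k *\<^sub>R (\<theta> k - \<theta>s j)) \<le> B) \<and>
             (\<forall>k<M. ?w k * (norm (\<theta> k - \<theta>s (l k)))\<^sup>2 \<le> B)} \<theta> \<partial>PiM UNIV (\<lambda>_::nat. P0))"
          by (intro nn_integral_mono) (auto simp: cluster_event_def indicator_def)
        also have "\<dots> \<le> ennreal ((b * (B / c) ^ DIM('a)) ^ K * (b * sqrt (B / ?w e)))"
          using True by (intro nn_integral_cluster_atoms[OF P0 b \<kappa> c _ e(1,2) _ B]) (auto simp: wpos)
        also have "\<dots> \<le> ennreal (X B \<epsilon> * p)"
        proof -
          have "(b * (B / c) ^ DIM('a)) ^ K * (b * sqrt (B / ?w e)) \<le>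
            (b * (B / c) ^ DIM('a)) ^ K * (b * (sqrt (2 * M * B / \<epsilon>) * p))"
            using e(3) b B c by (intro mult_left_mono) auto
          then show ?thesis unfolding X_def by (intro ennreal_leI) (simp add: mult_ac)
        qed
        also have "\<dots> = ennreal (X B \<epsilon>) * H v"
          unfolding H using p1 b B c \<epsilon> \<rho> by (intro ennreal_mult) (auto simp: X_def)
        finally show ?thesis .
      qed
    qed
    also have "\<dots> = ennreal (X B \<epsilon>) * (\<integral>\<^sup>+v. H v \<partial>stick_prior \<alpha>)"
    proof (rule nn_integral_cmult)
      have [measurable]: "(\<lambda>v. (partial_stick m v)(m := 1 - stick_rest v (Suc m))) \<in>
          measurable (PiM UNIV (\<lambda>_. borel)) (PiM UNIV (\<lambda>_. borel))"
      proof (rule measurable_PiM_single')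
        show "(\<lambda>v. ((partial_stick m v)(m := 1 - stick_rest v (Suc m))) i) \<in> borel_measurable (PiM UNIV (\<lambda>_. borel))" for i
          by (cases "i = m") (auto simp: partial_stick_def)
      qed (auto simp: space_PiM)
      show "H \<in> borel_measurable (stick_prior \<alpha>)"
        unfolding H_def indicator_def mem_Collect_eq by measurable
    qed
    also have "\<dots> \<le> ennreal (X B \<epsilon>) * (ennreal (\<alpha> * max 1 (c powr (\<alpha> - 1)) / c) ^ m * (ennreal (c powr (- \<alpha>)) *
       (ennreal (2 * B) ^ card J * (2 ^ card ({..<m} - J) * ennreal (\<alpha> / (\<alpha> - a)) ^ (M - m) * ennreal (\<rho> powr a)))))"
      unfolding H_def using B
      by (intro mult_left_mono stick_mass_bound[OF \<alpha> c a mM J g_meas g_indep \<rho>]) auto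
    also have "\<dots> = ennreal (X B \<epsilon> * ((\<alpha> * max 1 (c powr (\<alpha> - 1)) / c) ^ m * (c powr (- \<alpha>) *
       ((2 * B) ^ (K - 1) * (2 ^ card ({..<m} - J) * (\<alpha> / (\<alpha> - a)) ^ (M - m) * \<rho> powr a)))))"
      using \<alpha> c a B b \<rho> \<epsilon> unfolding cardJ
      by (simp add: ennreal_mult ennreal_power[symmetric] X_def)
    also have "X B \<epsilon> * ((\<alpha> * max 1 (c powr (\<alpha> - 1)) / c) ^ m * (c powr (- \<alpha>) *
       ((2 * B) ^ (K - 1) * (2 ^ card ({..<m} - J) * (\<alpha> / (\<alpha> - a)) ^ (M - m) * \<rho> powr a)))) =
       C * (B ^ (DIM('a) * K + K - 1) * \<rho> powr a * sqrt (B / \<epsilon>))"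
    proof -
      have 1: "X B \<epsilon> = ((b / c ^ DIM('a)) ^ K * (b * sqrt (2 * M))) * (B ^ (DIM('a) * K) * sqrt (B / \<epsilon>))"
        unfolding X_def by (simp add: power_mult_distrib power_divide power_mult real_sqrt_mult real_sqrt_divide)
      have 2: "(2 * B) ^ (K - 1) = 2 ^ (K - 1) * B ^ (K - 1)" by (rule power_mult_distrib)
      have 3: "B ^ (DIM('a) * K + K - 1) = B ^ (DIM('a) * K) * B ^ (K - 1)"
        using K by (simp add: power_add[symmetric])
      show ?thesis unfolding 1 2 3 C_def C0_def by (simp only: mult_ac)
    qed
    finally show ?thesis .
  qed
  then show ?thesis using C by blast
qed

section \<open>Prior mass of rare and of typical configurations\<close>

lemma emeasure_PiM_cylinder:
  assumes N: "prob_space N" and "finite I" and S[measurable]: "\<And>k. k \<in> I \<Longrightarrow> S k \<in> sets N"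
  shows "emeasure (PiM UNIV (\<lambda>_. N)) {u \<in> space (PiM UNIV (\<lambda>_. N)). \<forall>k\<in>I. u k \<in> S k} = (\<Prod>k\<in>I. emeasure N (S k))"
proof -
  interpret product_prob_space "\<lambda>_. N" UNIV by (rule product_prob_spaceI[OF N])
  show ?thesis using assms by (intro emeasure_PiM_Collect) auto
qed

text \<open>While the stick exceeds \<rho>, the condition on atom k gives v_k d^2 \<le> B / \<rho> =
  y^4, with d the distance to a true atom. So v_k \<le> y^2 or d \<le> y, and each alternative has
  probability O(y). Passing to these conditions on v_k and \<theta>_k makes the M factors
  independent; the exponent 1/4 is this choice of y.\<close>

lemma emeasure_many_atoms:
  fixes P0 :: "'a::euclidean_space measure" and K :: nat
  assumes \<alpha>: "\<alpha> > 0" and P0: "prob_space P0" "sets P0 = sets borel"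
    and b: "b \<ge> 1" "\<And>x r. r \<ge> 0 \<Longrightarrow> emeasure P0 (cball x r) \<le> ennreal (b * r ^ DIM('a))"
  shows "\<exists>C\<ge>0. \<forall>M B \<rho>. 0 < B \<longrightarrow> B \<le> \<rho> \<longrightarrow>
    emeasure (stick_prior \<alpha> \<Otimes>\<^sub>M PiM UNIV (\<lambda>_. P0))
      {(v, \<theta>). stick_rest v M > \<rho> \<and> (\<forall>k<M. \<exists>j<K. stick_breaking v k * (norm (\<theta> k - \<theta>s j :: 'a))\<^sup>2 \<le> B)}
    \<le> ennreal ((C * (B / \<rho>) powr (1/4)) ^ M)"
proof -
  interpret P0: prob_space P0 by (rule P0)
  interpret P: prob_space "PiM UNIV (\<lambda>_::nat. P0)" by (intro prob_space_PiM P0)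
  interpret bt: prob_space "beta_distribution 1 \<alpha>" by (intro prob_space_beta_1 \<alpha>)
  have [measurable_cong]: "sets P0 = sets borel" by (rule P0)
  have S[measurable_cong]: "sets (PiM UNIV (\<lambda>_::nat. P0)) = sets (PiM UNIV (\<lambda>_. borel))"
    by (rule sets_PiM_borel) (rule P0)
  define q where "q = 2 * \<alpha> * max 1 (2 powr (1 - \<alpha>)) + 2"
  have q: "q \<ge> 0" unfolding q_def using \<alpha> by simp
  define C where "C = q + real K * b"
  have "emeasure (stick_prior \<alpha> \<Otimes>\<^sub>M PiM UNIV (\<lambda>_. P0))
      {(v, \<theta>). stick_rest v M > \<rho> \<and> (\<forall>k<M. \<exists>j<K. stick_breaking v k * (norm (\<theta> k - \<theta>s j :: 'a))\<^sup>2 \<le> B)}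
    \<le> ennreal ((C * (B / \<rho>) powr (1/4)) ^ M)" if B: "0 < B" "B \<le> \<rho>" for M B \<rho>
  proof -
    let ?E = "{(v, \<theta>). stick_rest v M > \<rho> \<and> (\<forall>k<M. \<exists>j<K. stick_breaking v k * (norm (\<theta> k - \<theta>s j :: 'a))\<^sup>2 \<le> B)}"
    let ?B = "PiM UNIV (\<lambda>_. borel) \<Otimes>\<^sub>M PiM UNIV (\<lambda>_. borel :: 'a measure)"
    have "?E = {p \<in> space ?B. stick_rest (fst p) M > \<rho> \<and> (\<forall>k<M. \<exists>j<K. stick_breaking (fst p) k * (norm (snd p k - \<theta>s j :: 'a))\<^sup>2 \<le> B)}"
      by (auto simp: space_pair_measure space_PiM)
    also have "\<dots> \<in> sets ?B" by measurable
    finally have E: "?E \<in> sets ?B" .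
    have [measurable]: "?E \<in> sets (stick_prior \<alpha> \<Otimes>\<^sub>M PiM UNIV (\<lambda>_. P0))"
      using E sets_pair_measure_cong[OF sets_stick_prior S] by simp
    define y where "y = (B / \<rho>) powr (1/4)"
    have \<rho>: "\<rho> > 0" using B by simp
    have y: "0 < y" "y \<le> 1" using B \<rho> by (auto simp: y_def intro!: powr_le1)
    have y4: "B / \<rho> = (y\<^sup>2)\<^sup>2"
    proof -
      have "(y\<^sup>2)\<^sup>2 = y ^ 4" by simp
      also have "\<dots> = (B / \<rho>) powr (1/4 * 4)" unfolding y_def using B \<rho>
        by (simp add: powr_realpow[symmetric] powr_powr)
      finally show ?thesis using B \<rho> by simp
    qed
    define A where "A = (\<Union>j<K. cball (\<theta>s j) y)"
    have A[measurable]: "A \<in> sets borel" unfolding A_def by (intro sets.finite_UN) auto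
    have PA: "emeasure P0 A \<le> ennreal (real K * b * y)"
    proof -
      have "emeasure P0 A \<le> (\<Sum>j<K. emeasure P0 (cball (\<theta>s j) y))"
        unfolding A_def by (intro emeasure_subadditive_finite) (auto simp: P0)
      also have "\<dots> \<le> (\<Sum>j<K. ennreal (b * y))"
      proof (intro sum_mono)
        fix j
        have "emeasure P0 (cball (\<theta>s j) y) \<le> ennreal (b * y ^ DIM('a))" using b y by simp
        also have "\<dots> \<le> ennreal (b * y ^ 1)"
          using b y by (intro ennreal_leI mult_left_mono power_decreasing) (auto simp: Suc_le_eq)
        finally show "emeasure P0 (cball (\<theta>s j) y) \<le> ennreal (b * y)" by simp
      qed
      also have "\<dots> = ennreal (real K * b * y)"
        using b y by (simp add: ennreal_of_nat_eq_real_of_nat ennreal_mult[symmetric] mult_ac)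
      finally show ?thesis .
    qed
    have "emeasure (stick_prior \<alpha> \<Otimes>\<^sub>M PiM UNIV (\<lambda>_. P0)) ?E =
       (\<integral>\<^sup>+v. (\<integral>\<^sup>+\<theta>. indicator ?E (v, \<theta>) \<partial>PiM UNIV (\<lambda>_. P0)) \<partial>stick_prior \<alpha>)"
      by (rule P.emeasure_pair_measure) simp
    also have "\<dots> \<le> (\<integral>\<^sup>+v. (\<integral>\<^sup>+\<theta>. (\<Prod>k<M. indicator {v. v \<le> y\<^sup>2} (v k) + indicator A (\<theta> k)) \<partial>PiM UNIV (\<lambda>_. P0)) \<partial>stick_prior \<alpha>)"
    proof (intro nn_integral_mono_AE, use AE_stick_dom[OF \<alpha>] in eventually_elim)
      case (elim v)
      show ?case
      proof (intro nn_integral_mono)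
        fix \<theta> :: "nat \<Rightarrow> 'a"
        show "indicator ?E (v, \<theta>) \<le> (\<Prod>k<M. indicator {v. v \<le> y\<^sup>2} (v k) + indicator A (\<theta> k) :: ennreal)"
        proof (cases "(v, \<theta>) \<in> ?E")
          case True
          have "(1 :: ennreal) \<le> indicator {v. v \<le> y\<^sup>2} (v k) + indicator A (\<theta> k)" if k: "k < M" for k
          proof -
            obtain j where j: "j < K" "stick_breaking v k * (norm (\<theta> k - \<theta>s j))\<^sup>2 \<le> B" using True k by auto
            have "\<rho> < stick_rest v k" using True stick_rest_antimono[OF elim, of k M] k by auto
            then have "v k * (norm (\<theta> k - \<theta>s j))\<^sup>2 * \<rho> \<le> v k * (norm (\<theta> k - \<theta>s j))\<^sup>2 * stick_rest v k"
              using elim by (intro mult_left_mono) (auto simp: stick_dom_def less_imp_le)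
            also have "\<dots> \<le> B" using j by (simp add: stick_breaking_rest mult_ac)
            finally have "v k * (norm (\<theta> k - \<theta>s j))\<^sup>2 \<le> (y\<^sup>2)\<^sup>2"
              unfolding y4[symmetric] using \<rho> by (simp add: field_simps)
            then have le: "v k * (norm (\<theta> k - \<theta>s j))\<^sup>2 \<le> y\<^sup>2 * y\<^sup>2" by (simp add: power2_eq_square)
            show ?thesis
            proof (cases "v k \<le> y\<^sup>2")
              case False
              have "norm (\<theta> k - \<theta>s j) \<le> y"
              proof (rule ccontr)
                assume "\<not> ?thesis"
                then have "y\<^sup>2 < (norm (\<theta> k - \<theta>s j))\<^sup>2"
                  using y by (intro power_strict_mono) auto
                moreover have "0 < v k" using elim by (simp add: stick_dom_def)
                ultimately have "y\<^sup>2 * y\<^sup>2 < v k * (norm (\<theta> k - \<theta>s j))\<^sup>2"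
                  using False y by (intro mult_strict_mono) auto
                with le show False by simp
              qed
              then have "\<theta> k \<in> A" using j unfolding A_def by (auto simp: dist_norm norm_minus_commute)
              then show ?thesis by simp
            qed simp
          qed
          then have "(\<Prod>k<M. 1) \<le> (\<Prod>k<M. indicator {v. v \<le> y\<^sup>2} (v k) + indicator A (\<theta> k) :: ennreal)"
            by (intro prod_mono_ennreal) auto
          then show ?thesis using True by simp
        qed simp
      qed
    qed
    also have "\<dots> = (\<integral>\<^sup>+v. (\<Prod>k<M. (\<integral>\<^sup>+x. indicator {v. v \<le> y\<^sup>2} (v k) + indicator A x \<partial>P0)) \<partial>stick_prior \<alpha>)"
      by (intro nn_integral_cong nn_integral_PiM_prod P0) auto
    also have "\<dots> = (\<integral>\<^sup>+v. (\<Prod>k<M. indicator {v. v \<le> y\<^sup>2} (v k) + emeasure P0 A) \<partial>stick_prior \<alpha>)"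
      using P0 by (intro nn_integral_cong prod.cong refl)
         (subst nn_integral_add, auto simp: P0.emeasure_space_1 nn_integral_indicator)
    also have "\<dots> = (\<Prod>k<M. (\<integral>\<^sup>+x. indicator {v. v \<le> y\<^sup>2} x + emeasure P0 A \<partial>beta_distribution 1 \<alpha>))"
      using \<alpha> by (intro nn_integral_PiM_prod prob_space_beta_1) auto
    also have "\<dots> = (emeasure (beta_distribution 1 \<alpha>) {v. v \<le> y\<^sup>2} + emeasure P0 A) ^ M"
      by (subst nn_integral_add) (auto simp: bt.emeasure_space_1[simplified] nn_integral_indicator)
    also have "\<dots> \<le> ennreal (C * y) ^ M"
    proof (intro power_mono)
      have "emeasure (beta_distribution 1 \<alpha>) {v. v \<le> y\<^sup>2} \<le> ennreal (q * y\<^sup>2)"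
        unfolding q_def using y by (intro emeasure_beta_1_near_0 \<alpha>) auto
      also have "\<dots> \<le> ennreal (q * y)"
        using y q by (intro ennreal_leI mult_left_mono) (auto simp: power2_eq_square mult_left_le)
      finally have "emeasure (beta_distribution 1 \<alpha>) {v. v \<le> y\<^sup>2} + emeasure P0 A \<le> ennreal (q * y) + ennreal (real K * b * y)"
        by (intro add_mono PA)
      also have "\<dots> = ennreal (C * y)"
        unfolding C_def using q y b by (subst ennreal_plus[symmetric]) (auto simp: algebra_simps)
      finally show "emeasure (beta_distribution 1 \<alpha>) {v. v \<le> y\<^sup>2} + emeasure P0 A \<le> ennreal (C * y)" .
    qed simp
    also have "\<dots> = ennreal ((C * (B / \<rho>) powr (1/4)) ^ M)"
      unfolding y_def[symmetric] using q b y by (intro ennreal_power) (auto simp: C_def)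
    finally show ?thesis .
  qed
  moreover have "C \<ge> 0" using q b by (auto simp: C_def)
  ultimately show ?thesis by blast
qed

section \<open>Prior mass of neighbourhoods of the true configuration\<close>

definition weight_sticks :: "(nat \<Rightarrow> real) \<Rightarrow> nat \<Rightarrow> real" where
  "weight_sticks ws k = ws k / (1 - (\<Sum>i<k. ws i))"

lemma rest_weights_pos:
  fixes ws :: "nat \<Rightarrow> real"
  assumes ws: "\<forall>k<K. ws k > (0::real)" "(\<Sum>k<K. ws k) = 1" and k: "k < K"
  shows "1 - (\<Sum>i<k. ws i) \<ge> ws k"
proof -
  have "(\<Sum>i<Suc k. ws i) \<le> (\<Sum>i<K. ws i)"
    using ws k by (intro sum_mono2) (auto simp: less_imp_le)
  then show ?thesis using ws by simp
qed

lemma stick_breaking_weight_sticks: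
  assumes ws: "\<forall>k<K. ws k > 0" "(\<Sum>k<K. ws k) = 1" and "k < K"
  shows "stick_breaking (weight_sticks ws) k = ws k"
  using assms(3)
proof (induction k rule: less_induct)
  case (less k)
  have "stick_rest (weight_sticks ws) k = 1 - (\<Sum>i<k. stick_breaking (weight_sticks ws) i)"
    by (simp add: sum_stick_breaking)
  also have "\<dots> = 1 - (\<Sum>i<k. ws i)" using less by (intro arg_cong2[where f="(-)"] sum.cong) auto
  finally have r: "stick_rest (weight_sticks ws) k = 1 - (\<Sum>i<k. ws i)" .
  have "1 - (\<Sum>i<k. ws i) \<noteq> 0" using rest_weights_pos[OF ws less.prems] ws less.prems by force
  then show ?case unfolding stick_breaking_rest r by (simp add: weight_sticks_def)
qed

lemma weight_sticks_bounds:
  assumes ws: "\<forall>k<K. ws k > 0" "(\<Sum>k<K. ws k) = 1" and "k < K"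
  shows "0 < weight_sticks ws k" "weight_sticks ws k \<le> 1" "Suc k < K \<Longrightarrow> weight_sticks ws k < 1"
proof -
  note p = rest_weights_pos[OF ws \<open>k < K\<close>] ws(1)[rule_format, OF \<open>k < K\<close>]
  then show "0 < weight_sticks ws k" "weight_sticks ws k \<le> 1" by (auto simp: weight_sticks_def field_simps)
  show "weight_sticks ws k < 1" if "Suc k < K"
    using rest_weights_pos[OF ws that] ws(1)[rule_format, OF that] p by (simp add: weight_sticks_def field_simps)
qed

lemma weight_sticks_last:
  assumes ws: "\<forall>k<K. ws k > 0" "(\<Sum>k<K. ws k) = 1" and "Suc k = K"
  shows "weight_sticks ws k = 1"
  using rest_weights_pos[OF ws, of k] assms by (auto simp: weight_sticks_def)

lemma abs_mult_diff_le:
  fixes a b c d :: real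
  assumes "0 \<le> a" "a \<le> 1" "0 \<le> d" "d \<le> 1"
  shows "\<bar>a * b - c * d\<bar> \<le> \<bar>a - c\<bar> + \<bar>b - d\<bar>"
proof -
  have "a * b - c * d = a * (b - d) + (a - c) * d" by (simp add: algebra_simps)
  also have "\<bar>\<dots>\<bar> \<le> \<bar>a\<bar> * \<bar>b - d\<bar> + \<bar>a - c\<bar> * \<bar>d\<bar>"
    by (metis abs_triangle_ineq abs_mult)
  also have "\<dots> \<le> 1 * \<bar>b - d\<bar> + \<bar>a - c\<bar> * 1"
    using assms by (intro add_mono mult_mono) auto
  finally show ?thesis by simp
qed

text \<open>All factors of a weight lie in [0, 1], so replacing them one at a time costs at most
  \<tau> each, and a weight of index below K has at most K factors.\<close>

lemma stick_breaking_close: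
  assumes v: "v \<in> stick_dom" and u: "\<And>i. i < K \<Longrightarrow> 0 \<le> u i \<and> u i \<le> 1"
    and close: "\<And>i. i < K \<Longrightarrow> \<bar>v i - u i\<bar> \<le> \<tau>" and k: "k < K"
  shows "\<bar>stick_breaking v k - stick_breaking u k\<bar> \<le> real K * \<tau>"
proof -
  have ub: "0 \<le> stick_rest u i \<and> stick_rest u i \<le> 1" if "i \<le> K" for i
    unfolding stick_rest_def using u that by (auto intro!: prod_nonneg prod_le_1)
  have vb: "0 \<le> stick_rest v i \<and> stick_rest v i \<le> 1" for i
    using stick_rest_pos[OF v, of i] stick_rest_le_1[OF v, of i] by auto
  have rest: "\<bar>stick_rest v i - stick_rest u i\<bar> \<le> real i * \<tau>" if "i < K" for i
    using that
  proof (induction i)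
    case (Suc i)
    have "\<bar>stick_rest v (Suc i) - stick_rest u (Suc i)\<bar> \<le> \<bar>stick_rest v i - stick_rest u i\<bar> + \<bar>(1 - v i) - (1 - u i)\<bar>"
      unfolding stick_rest_Suc using vb[of i] u[of i] Suc by (intro abs_mult_diff_le) auto
    also have "\<dots> \<le> real i * \<tau> + \<tau>" using Suc close[of i] by (intro add_mono) (auto simp: abs_minus_commute)
    finally show ?case by (simp add: algebra_simps)
  qed simp
  have "\<bar>stick_breaking v k - stick_breaking u k\<bar> \<le> \<bar>v k - u k\<bar> + \<bar>stick_rest v k - stick_rest u k\<bar>"
    unfolding stick_breaking_rest using v ub[of k] k
    by (intro abs_mult_diff_le) (auto simp: stick_dom_def less_imp_le)
  also have "\<dots> \<le> \<tau> + real k * \<tau>" using close rest k by (intro add_mono) auto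
  also have "\<dots> = real (Suc k) * \<tau>" by (simp add: algebra_simps)
  also have "\<dots> \<le> real K * \<tau>" using k close[OF k] by (intro mult_right_mono) auto
  finally show ?thesis .
qed

text \<open>The condition is put on stick proportions instead of weights, which makes the event a
  product set whose mass factorises. The true proportion at index K - 1 is 1, the end of the unit
  interval; hence the one-sided condition there, which also makes the stick left after K atoms at
  most \<tau>.\<close>

definition near_event where
  "near_event K us \<theta>s \<tau> = {(v, \<theta> :: nat \<Rightarrow> 'a::euclidean_space).
     (\<forall>k\<in>{..<K-1}. v k \<in> {v. \<bar>v - us k\<bar> \<le> \<tau>}) \<and> v (K-1) \<in> {v. 1 - v < \<tau>} \<and> (\<forall>k\<in>{..<K}. \<theta> k \<in> ball (\<theta>s k) \<tau>)}"

lemma near_eventD: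
  assumes ws: "\<forall>k<K. ws k > 0" "(\<Sum>k<K. ws k) = 1" and K: "K \<ge> 1"
    and v: "v \<in> stick_dom" and E: "(v, \<theta>) \<in> near_event K (weight_sticks ws) \<theta>s \<tau>"
  shows "\<And>k. k < K \<Longrightarrow> \<bar>stick_breaking v k - ws k\<bar> \<le> real K * \<tau>"
    and "stick_rest v K \<le> \<tau>"
    and "\<And>k. k < K \<Longrightarrow> norm (\<theta> k - \<theta>s k) \<le> \<tau>"
proof -
  have close: "\<bar>v i - weight_sticks ws i\<bar> \<le> \<tau>" if "i < K" for i
  proof (cases "i = K - 1")
    case True
    then have "weight_sticks ws i = 1" using ws K by (intro weight_sticks_last[of K]) auto
    then show ?thesis using E True v by (auto simp: near_event_def stick_dom_def less_imp_le)
  next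
    case False
    then have "i < K - 1" using that by auto
    then show ?thesis using E by (auto simp: near_event_def)
  qed
  show "\<bar>stick_breaking v k - ws k\<bar> \<le> real K * \<tau>" if "k < K" for k
    using stick_breaking_close[OF v _ close that] weight_sticks_bounds[OF ws] stick_breaking_weight_sticks[OF ws that]
    by (simp add: less_imp_le)
  have "stick_rest v K = stick_rest v (K-1) * (1 - v (K-1))" using K stick_rest_Suc[of v "K-1"] by simp
  also have "\<dots> \<le> 1 * (1 - v (K-1))"
    using v stick_rest_le_1[OF v] by (intro mult_right_mono) (auto simp: stick_dom_def less_imp_le)
  also have "\<dots> \<le> \<tau>" using E by (auto simp: near_event_def)
  finally show "stick_rest v K \<le> \<tau>" .
  show "norm (\<theta> k - \<theta>s k) \<le> \<tau>" if "k < K" for k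
    using E that by (auto simp: near_event_def dist_norm norm_minus_commute less_imp_le)
qed

lemma exists_uniform_constants:
  fixes K :: nat
  assumes "\<And>k. k < K \<Longrightarrow> \<exists>c>0. \<exists>d>0. \<forall>\<tau>. 0 < \<tau> \<longrightarrow> \<tau> < d \<longrightarrow> ennreal (c * (h \<tau> :: real)) \<le> (P k \<tau> :: ennreal)"
    and h: "\<And>\<tau>. \<tau> > 0 \<Longrightarrow> h \<tau> \<ge> 0"
  shows "\<exists>c>(0::real). \<exists>d>(0::real). \<forall>\<tau>. 0 < \<tau> \<longrightarrow> \<tau> < d \<longrightarrow> (\<forall>k<K. ennreal (c * h \<tau>) \<le> P k \<tau>)"
  using assms(1)
proof (induction K)
  case 0
  show ?case by (intro exI[of _ "1::real"] conjI) auto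
next
  case (Suc K)
  obtain c d where cd: "c > 0" "d > 0" "\<forall>\<tau>. 0 < \<tau> \<longrightarrow> \<tau> < d \<longrightarrow> (\<forall>k<K. ennreal (c * h \<tau>) \<le> P k \<tau>)"
    using Suc by auto
  obtain c' d' where cd': "c' > 0" "d' > 0" "\<forall>\<tau>. 0 < \<tau> \<longrightarrow> \<tau> < d' \<longrightarrow> ennreal (c' * h \<tau>) \<le> P K \<tau>"
    using Suc.prems[of K] by auto
  have "ennreal (min c c' * h \<tau>) \<le> P k \<tau>" if "0 < \<tau>" "\<tau> < min d d'" "k < Suc K" for k \<tau>
  proof (cases "k = K")
    case True
    have "ennreal (min c c' * h \<tau>) \<le> ennreal (c' * h \<tau>)"
      using h that by (intro ennreal_leI mult_right_mono) auto
    also have "\<dots> \<le> P k \<tau>" using cd' that True by auto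
    finally show ?thesis .
  next
    case False
    have "ennreal (min c c' * h \<tau>) \<le> ennreal (c * h \<tau>)"
      using h that by (intro ennreal_leI mult_right_mono) auto
    also have "\<dots> \<le> P k \<tau>" using cd that False by auto
    finally show ?thesis .
  qed
  then show ?case using cd cd' by (intro exI[of _ "min c c'"] exI[of _ "min d d'"] conjI) auto
qed

lemma sets_near_event[measurable]:
  "near_event K us \<theta>s \<tau> \<in> sets (PiM UNIV (\<lambda>_. borel) \<Otimes>\<^sub>M PiM UNIV (\<lambda>_. borel :: 'a::euclidean_space measure))"
proof -
  let ?M = "PiM UNIV (\<lambda>_. borel) \<Otimes>\<^sub>M PiM UNIV (\<lambda>_. borel :: 'a measure)"
  have "near_event K us \<theta>s \<tau> = {p \<in> space ?M. (\<forall>k\<in>{..<K-1}. \<bar>fst p k - us k\<bar> \<le> \<tau>) \<and> 1 - fst p (K-1) < \<tau> \<and>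
     (\<forall>k\<in>{..<K}. dist (\<theta>s k) (snd p k) < \<tau>)}"
    by (auto simp: near_event_def space_pair_measure space_PiM)
  also have "\<dots> \<in> sets ?M" by measurable
  finally show ?thesis .
qed

text \<open>The first K - 1 proportions have interior targets and contribute \<tau> each, the last
  proportion contributes \<tau>^\<alpha>, and each of the K atoms contributes \<tau>^D. This is the
  exponent met again in \<open>emeasure_cluster_event\<close>, where the power of the short stick
  only comes arbitrarily close to \<alpha>.\<close>

lemma emeasure_near_event:
  fixes P0 :: "'a::euclidean_space measure"
  assumes \<alpha>: "\<alpha> > 0" and P0: "prob_space P0" "sets P0 = sets borel"
    and ws: "\<forall>k<K. ws k > 0" "(\<Sum>k<K. ws k) = 1" and K: "K \<ge> 1"
    and lower: "\<And>k. k < K \<Longrightarrow> \<exists>c>0. \<exists>d>0. \<forall>\<tau>. 0 < \<tau> \<longrightarrow> \<tau> < d \<longrightarrow>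
      ennreal (c * \<tau> ^ DIM('a)) \<le> emeasure P0 (ball (\<theta>s k) \<tau>)"
  shows "\<exists>c>0. \<exists>d>0. \<forall>\<tau>. 0 < \<tau> \<longrightarrow> \<tau> < d \<longrightarrow>
    ennreal (c * (\<tau> ^ (DIM('a) * K + K - 1) * \<tau> powr \<alpha>)) \<le>
      emeasure (stick_prior \<alpha> \<Otimes>\<^sub>M PiM UNIV (\<lambda>_. P0)) (near_event K (weight_sticks ws) \<theta>s \<tau>)"
proof -
  interpret P: prob_space "PiM UNIV (\<lambda>_::nat. P0)" by (intro prob_space_PiM P0)
  have S: "sets (PiM UNIV (\<lambda>_::nat. P0)) = sets (PiM UNIV (\<lambda>_. borel))"
    by (rule sets_PiM_borel) (rule P0)
  have sp: "space P0 = UNIV" using P0(2) sets_eq_imp_space_eq by fastforce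
  let ?us = "weight_sticks ws"
  have "\<exists>c>0. \<exists>d>0. \<forall>\<tau>. 0 < \<tau> \<longrightarrow> \<tau> < d \<longrightarrow> (\<forall>k<K. ennreal (c * \<tau> ^ DIM('a)) \<le> emeasure P0 (ball (\<theta>s k) \<tau>))"
    by (rule exists_uniform_constants[OF lower]) auto
  then obtain c1 d1 where 1: "c1 > 0" "d1 > 0" "\<And>\<tau> k. 0 < \<tau> \<Longrightarrow> \<tau> < d1 \<Longrightarrow> k < K \<Longrightarrow>
      ennreal (c1 * \<tau> ^ DIM('a)) \<le> emeasure P0 (ball (\<theta>s k) \<tau>)" by blast
  have "\<exists>c>0. \<exists>d>0. \<forall>\<tau>. 0 < \<tau> \<longrightarrow> \<tau> < d \<longrightarrow> (\<forall>k<K-1. ennreal (c * \<tau>) \<le> emeasure (beta_distribution 1 \<alpha>) {v. \<bar>v - ?us k\<bar> \<le> \<tau>})"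
  proof (rule exists_uniform_constants)
    fix k assume "k < K - 1"
    then show "\<exists>c>0. \<exists>d>0. \<forall>\<tau>. 0 < \<tau> \<longrightarrow> \<tau> < d \<longrightarrow> ennreal (c * \<tau>) \<le> emeasure (beta_distribution 1 \<alpha>) {v. \<bar>v - ?us k\<bar> \<le> \<tau>}"
      using weight_sticks_bounds[OF ws, of k] by (intro emeasure_beta_1_interior \<alpha>) auto
  qed auto
  then obtain c2 d2 where 2: "c2 > 0" "d2 > 0" "\<And>\<tau> k. 0 < \<tau> \<Longrightarrow> \<tau> < d2 \<Longrightarrow> k < K - 1 \<Longrightarrow>
      ennreal (c2 * \<tau>) \<le> emeasure (beta_distribution 1 \<alpha>) {v. \<bar>v - ?us k\<bar> \<le> \<tau>}" by blast
  have "ennreal (c2 ^ (K - 1) * c1 ^ K * (\<tau> ^ (DIM('a) * K + K - 1) * \<tau> powr \<alpha>)) \<le>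
      emeasure (stick_prior \<alpha> \<Otimes>\<^sub>M PiM UNIV (\<lambda>_. P0)) (near_event K ?us \<theta>s \<tau>)"
    if \<tau>: "0 < \<tau>" "\<tau> < min 1 (min d1 d2)" for \<tau>
  proof -
    define T where "T k = (if k < K - 1 then {v. \<bar>v - ?us k\<bar> \<le> \<tau>} else {v. 1 - v < \<tau>})" for k
    have T[measurable]: "T k \<in> sets borel" for k unfolding T_def by (cases "k < K - 1") simp_all
    let ?V = "{v \<in> space (stick_prior \<alpha>). \<forall>k\<in>{..<K}. v k \<in> T k}"
    let ?W = "{\<theta> \<in> space (PiM UNIV (\<lambda>_::nat. P0)). \<forall>k\<in>{..<K}. \<theta> k \<in> ball (\<theta>s k) \<tau>}"
    have ins: "{..<K} = insert (K - 1) {..<K - 1}" using K by auto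
    have T1: "(\<forall>k\<in>{..<K}. v k \<in> T k) \<longleftrightarrow> (\<forall>k\<in>{..<K-1}. \<bar>v k - ?us k\<bar> \<le> \<tau>) \<and> 1 - v (K-1) < \<tau>" for v
      by (subst ins) (auto simp: T_def)
    have eq: "near_event K ?us \<theta>s \<tau> = ?V \<times> ?W"
      unfolding near_event_def T1 by (auto simp: space_PiM sp)
    have V: "emeasure (stick_prior \<alpha>) ?V = (\<Prod>k\<in>{..<K}. emeasure (beta_distribution 1 \<alpha>) (T k))"
      using \<alpha> by (intro emeasure_PiM_cylinder prob_space_beta_1) auto
    have "ennreal ((c2 * \<tau>) ^ (K - 1) * \<tau> powr \<alpha>) = (\<Prod>k\<in>{..<K-1}. ennreal (c2 * \<tau>)) * ennreal (\<tau> powr \<alpha>)"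
      using 2(1,2) \<tau> by (subst ennreal_mult) (auto simp: ennreal_power)
    also have "\<dots> \<le> (\<Prod>k\<in>{..<K-1}. emeasure (beta_distribution 1 \<alpha>) (T k)) * emeasure (beta_distribution 1 \<alpha>) (T (K - 1))"
    proof (intro mult_mono prod_mono_ennreal)
      show "ennreal (c2 * \<tau>) \<le> emeasure (beta_distribution 1 \<alpha>) (T k)" if "k \<in> {..<K-1}" for k
        using 2(3)[of \<tau> k] that \<tau> by (simp add: T_def)
      show "ennreal (\<tau> powr \<alpha>) \<le> emeasure (beta_distribution 1 \<alpha>) (T (K - 1))"
        using emeasure_beta_1_near_1[OF \<alpha>, of \<tau>] \<tau> by (simp add: T_def)
    qed auto
    also have "\<dots> = emeasure (stick_prior \<alpha>) ?V" unfolding V by (subst ins) (simp add: mult.commute)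
    finally have V_le: "ennreal ((c2 * \<tau>) ^ (K - 1) * \<tau> powr \<alpha>) \<le> emeasure (stick_prior \<alpha>) ?V" .
    have W: "emeasure (PiM UNIV (\<lambda>_. P0)) ?W = (\<Prod>k\<in>{..<K}. emeasure P0 (ball (\<theta>s k) \<tau>))"
      by (intro emeasure_PiM_cylinder P0) (auto simp: P0)
    have "ennreal ((c1 * \<tau> ^ DIM('a)) ^ K) = (\<Prod>k\<in>{..<K}. ennreal (c1 * \<tau> ^ DIM('a)))"
      using 1 \<tau> by (simp add: ennreal_power)
    also have "\<dots> \<le> emeasure (PiM UNIV (\<lambda>_. P0)) ?W"
      unfolding W using 1(3) \<tau> by (intro prod_mono_ennreal) auto
    finally have W_le: "ennreal ((c1 * \<tau> ^ DIM('a)) ^ K) \<le> emeasure (PiM UNIV (\<lambda>_. P0)) ?W" .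
    have "c2 ^ (K - 1) * c1 ^ K * (\<tau> ^ (DIM('a) * K + K - 1) * \<tau> powr \<alpha>) =
      ((c2 * \<tau>) ^ (K - 1) * \<tau> powr \<alpha>) * (c1 * \<tau> ^ DIM('a)) ^ K"
    proof -
      have "\<tau> ^ (DIM('a) * K + K - 1) = \<tau> ^ (DIM('a) * K) * \<tau> ^ (K - 1)"
        using K by (simp add: power_add[symmetric])
      then show ?thesis by (simp add: power_mult_distrib power_mult)
    qed
    then have "ennreal (c2 ^ (K - 1) * c1 ^ K * (\<tau> ^ (DIM('a) * K + K - 1) * \<tau> powr \<alpha>)) =
       ennreal ((c2 * \<tau>) ^ (K - 1) * \<tau> powr \<alpha>) * ennreal ((c1 * \<tau> ^ DIM('a)) ^ K)"
      using 1(1) 2(1) \<tau> by (simp only:) (rule ennreal_mult, auto)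
    also have "\<dots> \<le> emeasure (stick_prior \<alpha>) ?V * emeasure (PiM UNIV (\<lambda>_. P0)) ?W"
      by (intro mult_mono V_le W_le) auto
    also have "\<dots> = emeasure (stick_prior \<alpha> \<Otimes>\<^sub>M PiM UNIV (\<lambda>_. P0)) (?V \<times> ?W)"
    proof (intro P.emeasure_pair_measure_Times[symmetric])
      have [measurable_cong]: "sets P0 = sets borel" by (rule P0)
      show "?V \<in> sets (stick_prior \<alpha>)" by measurable
      show "?W \<in> sets (PiM UNIV (\<lambda>_. P0))" unfolding mem_ball by measurable
    qed
    finally show ?thesis unfolding eq .
  qed
  then show ?thesis using 1 2
    by (intro exI[of _ "c2 ^ (K - 1) * c1 ^ K"] conjI exI[of _ "min 1 (min d1 d2)"]) auto
qed

text \<open>The upper bound on balls comes from the bounded density. For the lower bound at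
  \<open>x\<close>, continuity keeps the density above p0 x / 2 near \<open>x\<close> inside
  \<Theta>, and the assumed share of \<Theta> in small balls turns this into a multiple of \<tau>^D
  even if \<open>x\<close> lies on the boundary.\<close>

lemma P0_density_bounds:
  fixes p0 :: "'a::euclidean_space \<Rightarrow> real"
  assumes P0: "P0 = density lborel (\<lambda>x. ennreal (p0 x) * indicator \<Theta> x)"
    and \<Theta>: "compact \<Theta>" and p0: "continuous_on \<Theta> p0" "bounded (p0 ` \<Theta>)" "\<forall>x\<in>\<Theta>. p0 x \<ge> 0"
  shows "sets P0 = sets borel"
    and "AE x in P0. x \<in> \<Theta>"
    and "\<exists>b\<ge>1. \<forall>x r. r \<ge> 0 \<longrightarrow> emeasure P0 (cball x r) \<le> ennreal (b * r ^ DIM('a))"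
    and "\<And>x c. x \<in> \<Theta> \<Longrightarrow> p0 x > 0 \<Longrightarrow> c > 0 \<Longrightarrow>
      \<forall>\<^sub>F \<epsilon> in at_right 0. measure lborel (\<Theta> \<inter> ball x \<epsilon>) \<ge> c * measure lborel (ball x \<epsilon>) \<Longrightarrow>
      \<exists>c>0. \<exists>d>0. \<forall>\<tau>. 0 < \<tau> \<longrightarrow> \<tau> < d \<longrightarrow> ennreal (c * \<tau> ^ DIM('a)) \<le> emeasure P0 (ball x \<tau>)"
proof -
  have \<Theta>m[measurable]: "\<Theta> \<in> sets borel" using \<Theta> by (intro borel_compact)
  have m[measurable]: "(\<lambda>x. ennreal (p0 x) * indicator \<Theta> x) \<in> borel_measurable borel"
  proof -
    have "(\<lambda>x. ennreal (indicator \<Theta> x *\<^sub>R p0 x)) \<in> borel_measurable borel"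
      using borel_measurable_continuous_on_indicator[OF \<Theta>m p0(1)] by measurable
    also have "(\<lambda>x. ennreal (indicator \<Theta> x *\<^sub>R p0 x)) = (\<lambda>x. ennreal (p0 x) * indicator \<Theta> x)"
      by (auto simp: indicator_def)
    finally show ?thesis .
  qed
  show s: "sets P0 = sets borel" by (simp add: P0)
  show "AE x in P0. x \<in> \<Theta>"
    unfolding P0 by (subst AE_density, measurable, auto simp: indicator_def)
  have em: "emeasure P0 A = (\<integral>\<^sup>+x. ennreal (p0 x) * indicator \<Theta> x * indicator A x \<partial>lborel)" if "A \<in> sets borel" for A
    unfolding P0 using that by (subst emeasure_density) auto
  obtain p where "\<forall>y\<in>p0 ` \<Theta>. norm y \<le> p" using p0(2) unfolding bounded_iff by blast
  then have p: "p0 x \<le> p" if "x \<in> \<Theta>" for x using that by force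
  define b where "b = max 1 (max 0 p * unit_ball_vol (DIM('a)))"
  have "emeasure P0 (cball x r) \<le> ennreal (b * r ^ DIM('a))" if r: "r \<ge> 0" for x r
  proof -
    have "emeasure P0 (cball x r) \<le> (\<integral>\<^sup>+y. ennreal (max 0 p) * indicator (cball x r) y \<partial>lborel)"
      unfolding em[OF borel_closed[OF closed_cball]] using p
      by (intro nn_integral_mono) (auto simp: indicator_def intro!: ennreal_leI le_max_iff_disj[THEN iffD2])
    also have "\<dots> = ennreal (max 0 p) * ennreal (unit_ball_vol (DIM('a)) * r ^ DIM('a))"
      using r by (subst nn_integral_cmult_indicator) (auto simp: emeasure_cball)
    also have "\<dots> = ennreal (max 0 p * unit_ball_vol (DIM('a)) * r ^ DIM('a))"
      using r by (subst ennreal_mult[symmetric]) (auto simp: mult_ac)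
    also have "\<dots> \<le> ennreal (b * r ^ DIM('a))"
      using r by (intro ennreal_leI mult_right_mono) (auto simp: b_def)
    finally show ?thesis .
  qed
  moreover have "b \<ge> 1" by (simp add: b_def)
  ultimately show "\<exists>b\<ge>1. \<forall>x r. r \<ge> 0 \<longrightarrow> emeasure P0 (cball x r) \<le> ennreal (b * r ^ DIM('a))" by blast
  fix x c assume x: "x \<in> \<Theta>" "p0 x > 0" and c: "c > 0"
    and thick: "\<forall>\<^sub>F \<epsilon> in at_right 0. measure lborel (\<Theta> \<inter> ball x \<epsilon>) \<ge> c * measure lborel (ball x \<epsilon>)"
  obtain d1 where d1: "d1 > 0" "\<And>y. 0 < y \<Longrightarrow> y < d1 \<Longrightarrow> measure lborel (\<Theta> \<inter> ball x y) \<ge> c * measure lborel (ball x y)"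
    using thick by (auto simp: eventually_at_right_field)
  obtain d2 where d2: "d2 > 0" "\<And>y. y \<in> \<Theta> \<Longrightarrow> dist y x < d2 \<Longrightarrow> dist (p0 y) (p0 x) < p0 x / 2"
    using p0(1) x unfolding continuous_on_iff by (metis half_gt_zero)
  have lo: "p0 y \<ge> p0 x / 2" if "y \<in> \<Theta>" "dist y x < d2" for y
    using d2(2)[OF that] unfolding dist_real_def by linarith
  have "ennreal (p0 x / 2 * (c * unit_ball_vol (DIM('a))) * \<tau> ^ DIM('a)) \<le> emeasure P0 (ball x \<tau>)"
    if \<tau>: "0 < \<tau>" "\<tau> < min d1 d2" for \<tau>
  proof -
    have "ennreal (p0 x / 2 * (c * unit_ball_vol (DIM('a))) * \<tau> ^ DIM('a)) \<le> ennreal (p0 x / 2 * measure lborel (\<Theta> \<inter> ball x \<tau>))"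
    proof (intro ennreal_leI)
      have "c * (unit_ball_vol (DIM('a)) * \<tau> ^ DIM('a)) \<le> measure lborel (\<Theta> \<inter> ball x \<tau>)"
        using d1(2)[of \<tau>] \<tau> by (simp add: content_ball)
      then have "p0 x / 2 * (c * (unit_ball_vol (DIM('a)) * \<tau> ^ DIM('a))) \<le> p0 x / 2 * measure lborel (\<Theta> \<inter> ball x \<tau>)"
        using x by (intro mult_left_mono) auto
      then show "p0 x / 2 * (c * unit_ball_vol (DIM('a))) * \<tau> ^ DIM('a) \<le> p0 x / 2 * measure lborel (\<Theta> \<inter> ball x \<tau>)"
        by (simp add: mult_ac)
    qed
    also have "\<dots> = ennreal (p0 x / 2) * emeasure lborel (\<Theta> \<inter> ball x \<tau>)"
    proof -
      have "emeasure lborel (\<Theta> \<inter> ball x \<tau>) \<le> emeasure lborel (ball x \<tau>)"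
        by (intro emeasure_mono) auto
      also have "\<dots> < \<infinity>" using \<tau> by (simp add: emeasure_ball)
      finally have "emeasure lborel (\<Theta> \<inter> ball x \<tau>) = ennreal (measure lborel (\<Theta> \<inter> ball x \<tau>))"
        by (intro emeasure_eq_ennreal_measure) auto
      then show ?thesis using x by (simp only:) (rule ennreal_mult, auto)
    qed
    also have "\<dots> = (\<integral>\<^sup>+y. ennreal (p0 x / 2) * indicator (\<Theta> \<inter> ball x \<tau>) y \<partial>lborel)"
      by (subst nn_integral_cmult_indicator) auto
    also have "\<dots> \<le> (\<integral>\<^sup>+y. ennreal (p0 y) * indicator \<Theta> y * indicator (ball x \<tau>) y \<partial>lborel)"
      using lo \<tau> by (intro nn_integral_mono) (auto simp: indicator_def dist_commute intro!: ennreal_leI)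
    also have "\<dots> = emeasure P0 (ball x \<tau>)" by (subst em) auto
    finally show ?thesis .
  qed
  then show "\<exists>c>0. \<exists>d>0. \<forall>\<tau>. 0 < \<tau> \<longrightarrow> \<tau> < d \<longrightarrow> ennreal (c * \<tau> ^ DIM('a)) \<le> emeasure P0 (ball x \<tau>)"
    using x c d1 d2 by (intro exI[of _ "p0 x / 2 * (c * unit_ball_vol (DIM('a)))"] conjI exI[of _ "min d1 d2"]) auto
qed

section \<open>Trigonometric test functions\<close>

text \<open>Real trigonometric polynomials with frequencies of norm at most \<open>r\<close>; the
  phase \<open>b\<close> includes the sines. The inductive form lets closure properties and the
  duality with \<open>f\<close> be proved by induction from single cosines.\<close>

inductive trig :: "real \<Rightarrow> ('a::real_inner \<Rightarrow> real) \<Rightarrow> bool" for r where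
  trig_cos: "norm \<xi> \<le> r \<Longrightarrow> trig r (\<lambda>\<theta>. cos (\<xi> \<bullet> \<theta> + b))"
| trig_add: "trig r G \<Longrightarrow> trig r H \<Longrightarrow> trig r (\<lambda>\<theta>. G \<theta> + H \<theta>)"
| trig_scale: "trig r G \<Longrightarrow> trig r (\<lambda>\<theta>. c * G \<theta>)"

lemma trig_const: "r \<ge> 0 \<Longrightarrow> trig r (\<lambda>\<theta>::'a::real_inner. c)"
  using trig_scale[OF trig_cos[of "0::'a" r 0], of c] by simp

lemma trig_diff: "trig r G \<Longrightarrow> trig r H \<Longrightarrow> trig r (\<lambda>\<theta>. G \<theta> - H \<theta>)"
  using trig_add[OF _ trig_scale[of r H "-1"]] by simp

lemma trig_sum:
  assumes "r \<ge> 0" "finite I" "\<And>i. i \<in> I \<Longrightarrow> trig r (G i)"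
  shows "trig r (\<lambda>\<theta>. \<Sum>i\<in>I. G i \<theta>)"
  using assms(2,3) by (induction I rule: finite_induct) (auto intro!: trig_const trig_add assms(1))

lemma trig_mono: "trig r G \<Longrightarrow> r \<le> s \<Longrightarrow> trig s G"
  by (induction rule: trig.induct) (auto intro: trig.intros)

text \<open>The product-to-sum formula turns frequencies \<xi> and \<eta> into \<xi> - \<eta> and
  \<xi> + \<eta>, so frequency bounds add. The frequency budget of the test functions is computed
  from this.\<close>

lemma trig_mult:
  assumes "trig r G" "trig s H"
  shows "trig (r + s) (\<lambda>\<theta>. G \<theta> * H \<theta>)"
  using assms(1)
proof (induction rule: trig.induct)
  case (trig_cos \<xi> b)
  show ?case using assms(2)
  proof (induction rule: trig.induct)
    case (trig_cos \<eta> d)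
    have "trig (r + s) (\<lambda>\<theta>. (1/2) * (cos ((\<xi> - \<eta>) \<bullet> \<theta> + (b - d)) + cos ((\<xi> + \<eta>) \<bullet> \<theta> + (b + d))))"
      using \<open>norm \<xi> \<le> r\<close> trig_cos
      by (intro trig_scale trig_add trig.trig_cos order_trans[OF norm_triangle_ineq4] order_trans[OF norm_triangle_ineq]) auto
    also have "(\<lambda>\<theta>. (1/2) * (cos ((\<xi> - \<eta>) \<bullet> \<theta> + (b - d)) + cos ((\<xi> + \<eta>) \<bullet> \<theta> + (b + d)))) =
        (\<lambda>\<theta>. cos (\<xi> \<bullet> \<theta> + b) * cos (\<eta> \<bullet> \<theta> + d))"
    proof
      fix \<theta>
      have 1: "(\<xi> - \<eta>) \<bullet> \<theta> + (b - d) = (\<xi> \<bullet> \<theta> + b) - (\<eta> \<bullet> \<theta> + d)"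
        and 2: "(\<xi> + \<eta>) \<bullet> \<theta> + (b + d) = (\<xi> \<bullet> \<theta> + b) + (\<eta> \<bullet> \<theta> + d)"
        by (simp_all add: algebra_simps)
      show "(1/2) * (cos ((\<xi> - \<eta>) \<bullet> \<theta> + (b - d)) + cos ((\<xi> + \<eta>) \<bullet> \<theta> + (b + d))) =
        cos (\<xi> \<bullet> \<theta> + b) * cos (\<eta> \<bullet> \<theta> + d)"
        unfolding 1 2 cos_diff cos_add by simp
    qed
    finally show ?case .
  next
    case (trig_add G H)
    then show ?case using trig.trig_add by (fastforce simp: distrib_left)
  next
    case (trig_scale G c)
    then show ?case using trig.trig_scale[of "r + s" _ c] by (fastforce simp: mult_ac)
  qed
next
  case (trig_add G G')
  then show ?case using trig.trig_add by (fastforce simp: distrib_right)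
next
  case (trig_scale G c)
  then show ?case using trig.trig_scale[of "r + s" _ c] by (fastforce simp: mult_ac)
qed

lemma trig_prod:
  assumes "finite I" "\<And>i. i \<in> I \<Longrightarrow> trig r (G i)" "r \<ge> 0"
  shows "trig (real (card I) * r) (\<lambda>\<theta>. \<Prod>i\<in>I. G i \<theta>)"
  using assms(1,2)
proof (induction I rule: finite_induct)
  case empty
  show ?case by (simp add: trig_const)
next
  case (insert i I)
  have "trig (r + real (card I) * r) (\<lambda>\<theta>. G i \<theta> * (\<Prod>i\<in>I. G i \<theta>))"
    using insert by (intro trig_mult) auto
  then show ?case using insert by (simp add: algebra_simps)
qed

section \<open>Translation of Lebesgue measure and inversion of the convolution with
  \<open>f\<close> at low frequencies\<close>

lemma nn_integral_lborel_shift: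
  fixes F :: "'a::euclidean_space \<Rightarrow> ennreal"
  assumes [measurable]: "F \<in> borel_measurable borel"
  shows "(\<integral>\<^sup>+x. F (x - \<theta>) \<partial>lborel) = (\<integral>\<^sup>+x. F x \<partial>lborel)"
proof -
  have "(\<integral>\<^sup>+x. F x \<partial>lborel) = (\<integral>\<^sup>+x. F x \<partial>distr lborel borel ((+) (- \<theta>)))"
    by (simp add: lborel_distr_plus)
  also have "\<dots> = (\<integral>\<^sup>+x. F (x - \<theta>) \<partial>lborel)"
    by (subst nn_integral_distr) auto
  finally show ?thesis by simp
qed

lemma integrable_lborel_shift:
  fixes F :: "'a::euclidean_space \<Rightarrow> real"
  assumes "integrable lborel F"
  shows "integrable lborel (\<lambda>x. F (x - \<theta>))"
proof -
  have "integrable (distr lborel borel ((+) (- \<theta>))) F"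
    using assms by (simp add: lborel_distr_plus)
  then show ?thesis
    using borel_measurable_integrable[OF assms] by (subst (asm) integrable_distr_eq) auto
qed

lemma integral_lborel_shift:
  fixes F :: "'a::euclidean_space \<Rightarrow> real"
  assumes [measurable]: "F \<in> borel_measurable borel"
  shows "(\<integral>x. F (x - \<theta>) \<partial>lborel) = (\<integral>x. F x \<partial>lborel)"
proof -
  have "(\<integral>x. F x \<partial>lborel) = (\<integral>x. F x \<partial>distr lborel borel ((+) (- \<theta>)))"
    by (simp add: lborel_distr_plus)
  also have "\<dots> = (\<integral>x. F (x - \<theta>) \<partial>lborel)"
    by (subst integral_distr) auto
  finally show ?thesis by simp
qed

locale kernel =
  fixes f :: "'a::euclidean_space \<Rightarrow> real"
  assumes f_meas[measurable]: "f \<in> borel_measurable borel"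
    and f_pos: "\<And>x. f x > 0"
    and f_nn: "(\<integral>\<^sup>+x. ennreal (f x) \<partial>lborel) = 1"
begin

lemma f_integrable: "integrable lborel f"
  using f_nn f_pos by (intro integrableI_nonneg) (auto simp: less_imp_le)

lemma f_integral: "integral\<^sup>L lborel f = 1"
  using f_nn f_pos by (subst integral_eq_nn_integral) (auto simp: less_imp_le)

lemma f_shift_integrable: "integrable lborel (\<lambda>x. f (x - \<theta>))"
  using integrable_lborel_shift[OF f_integrable, of \<theta>] .

lemma f_bdd_integrable:
  assumes [measurable]: "g \<in> borel_measurable borel" and B: "\<And>x. \<bar>g x\<bar> \<le> B"
  shows "integrable lborel (\<lambda>x. g x * f (x - \<theta>))"
proof (rule Bochner_Integration.integrable_bound)
  show "integrable lborel (\<lambda>x. B * f (x - \<theta>))"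
    by (intro integrable_mult_right f_shift_integrable)
  show "AE x in lborel. norm (g x * f (x - \<theta>)) \<le> norm (B * f (x - \<theta>))"
  proof (intro always_eventually allI)
    fix x
    have "\<bar>g x\<bar> * \<bar>f (x - \<theta>)\<bar> \<le> \<bar>B\<bar> * \<bar>f (x - \<theta>)\<bar>"
      using B[of x] by (intro mult_right_mono) auto
    then show "norm (g x * f (x - \<theta>)) \<le> norm (B * f (x - \<theta>))" by (simp add: abs_mult)
  qed
qed simp

text \<open>Real part of the characteristic function of \<open>f\<close>; \<open>sinf\<close> is its
  imaginary part.\<close>

definition cosf where "cosf \<xi> = (\<integral>y. cos (\<xi> \<bullet> y) * f y \<partial>lborel)"
definition sinf where "sinf \<xi> = (\<integral>y. sin (\<xi> \<bullet> y) * f y \<partial>lborel)"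

text \<open>Otherwise frequencies tending to 0 would have \<open>cosf\<close> at most 0, while
  dominated convergence sends these values to the integral of \<open>f\<close>, which is 1.\<close>

lemma cosf_pos_near_0: "\<exists>\<rho>>0. \<forall>\<xi>. norm \<xi> < \<rho> \<longrightarrow> cosf \<xi> > 0"
proof (rule ccontr)
  assume "\<not> ?thesis"
  then have "\<forall>n. \<exists>\<xi>. norm \<xi> < inverse (real (Suc n)) \<and> cosf \<xi> \<le> 0"
    by (metis inverse_positive_iff_positive not_le of_nat_0_less_iff zero_less_Suc)
  then obtain \<xi> where \<xi>: "\<And>n. norm (\<xi> n) < inverse (real (Suc n))" "\<And>n. cosf (\<xi> n) \<le> 0" by metis
  have lim: "\<xi> \<longlonglongrightarrow> 0"
    using \<xi>(1) by (intro Lim_null_comparison[OF _ LIMSEQ_inverse_real_of_nat]) (auto simp: less_imp_le)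
  have "(\<lambda>n. cosf (\<xi> n)) \<longlonglongrightarrow> (\<integral>y. cos (0 \<bullet> y) * f y \<partial>lborel)"
    unfolding cosf_def
  proof (rule integral_dominated_convergence[where w = f])
    show "AE x in lborel. (\<lambda>n. cos (\<xi> n \<bullet> x) * f x) \<longlonglongrightarrow> cos (0 \<bullet> x) * f x"
      by (intro always_eventually allI tendsto_intros lim)
    show "AE x in lborel. norm (cos (\<xi> n \<bullet> x) * f x) \<le> f x" for n
      using f_pos by (intro always_eventually allI) (auto simp: abs_mult less_imp_le intro!: mult_left_le_one_le)
  qed (auto simp: f_integrable)
  then have "(\<lambda>n. cosf (\<xi> n)) \<longlonglongrightarrow> 1" by (simp add: f_integral)
  then have "1 \<le> (0::real)" using \<xi>(2) by (intro LIMSEQ_le_const2) auto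
  then show False by simp
qed

lemma integral_cos_shift:
  "(\<integral>x. cos (\<xi> \<bullet> x + b) * f (x - \<theta>) \<partial>lborel) = cosf \<xi> * cos (\<xi> \<bullet> \<theta> + b) - sinf \<xi> * sin (\<xi> \<bullet> \<theta> + b)"
  "(\<integral>x. sin (\<xi> \<bullet> x + b) * f (x - \<theta>) \<partial>lborel) = sinf \<xi> * cos (\<xi> \<bullet> \<theta> + b) + cosf \<xi> * sin (\<xi> \<bullet> \<theta> + b)"
proof -
  have ci: "integrable lborel (\<lambda>y. cos (\<xi> \<bullet> y) * f y)" and si: "integrable lborel (\<lambda>y. sin (\<xi> \<bullet> y) * f y)"
    using f_bdd_integrable[of "\<lambda>y. cos (\<xi> \<bullet> y)" 1 0] f_bdd_integrable[of "\<lambda>y. sin (\<xi> \<bullet> y)" 1 0] by auto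
  have e: "\<xi> \<bullet> (x + \<theta>) + b = \<xi> \<bullet> x + (\<xi> \<bullet> \<theta> + b)" for x by (simp add: inner_add_right)
  have "(\<integral>x. cos (\<xi> \<bullet> x + b) * f (x - \<theta>) \<partial>lborel) = (\<integral>x. cos (\<xi> \<bullet> (x + \<theta>) + b) * f x \<partial>lborel)"
    using integral_lborel_shift[of "\<lambda>x. cos (\<xi> \<bullet> (x + \<theta>) + b) * f x" \<theta>] by simp
  also have "\<dots> = (\<integral>y. (cos (\<xi> \<bullet> y) * f y) * cos (\<xi> \<bullet> \<theta> + b) - (sin (\<xi> \<bullet> y) * f y) * sin (\<xi> \<bullet> \<theta> + b) \<partial>lborel)"
    unfolding e cos_add by (simp add: algebra_simps)
  also have "\<dots> = cosf \<xi> * cos (\<xi> \<bullet> \<theta> + b) - sinf \<xi> * sin (\<xi> \<bullet> \<theta> + b)"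
    using ci si by (simp add: cosf_def sinf_def)
  finally show "(\<integral>x. cos (\<xi> \<bullet> x + b) * f (x - \<theta>) \<partial>lborel) = cosf \<xi> * cos (\<xi> \<bullet> \<theta> + b) - sinf \<xi> * sin (\<xi> \<bullet> \<theta> + b)" .
  have "(\<integral>x. sin (\<xi> \<bullet> x + b) * f (x - \<theta>) \<partial>lborel) = (\<integral>x. sin (\<xi> \<bullet> (x + \<theta>) + b) * f x \<partial>lborel)"
    using integral_lborel_shift[of "\<lambda>x. sin (\<xi> \<bullet> (x + \<theta>) + b) * f x" \<theta>] by simp
  also have "\<dots> = (\<integral>y. (sin (\<xi> \<bullet> y) * f y) * cos (\<xi> \<bullet> \<theta> + b) + (cos (\<xi> \<bullet> y) * f y) * sin (\<xi> \<bullet> \<theta> + b) \<partial>lborel)"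
    unfolding e sin_add by (simp add: algebra_simps)
  also have "\<dots> = sinf \<xi> * cos (\<xi> \<bullet> \<theta> + b) + cosf \<xi> * sin (\<xi> \<bullet> \<theta> + b)"
    using ci si by (simp add: cosf_def sinf_def)
  finally show "(\<integral>x. sin (\<xi> \<bullet> x + b) * f (x - \<theta>) \<partial>lborel) = sinf \<xi> * cos (\<xi> \<bullet> \<theta> + b) + cosf \<xi> * sin (\<xi> \<bullet> \<theta> + b)" .
qed

text \<open>Integration against translates of \<open>f\<close> acts on the span of cosine and sine
  of one frequency as a rotation with scaling, of determinant
  \<open>(cosf \<xi>)\<^sup>2 + (sinf \<xi>)\<^sup>2\<close>. It is invertible where
  \<open>cosf\<close> is positive, and sums and multiples follow by linearity.\<close>

lemma trig_dual:
  assumes "trig r H" and pos: "\<And>\<xi>. norm \<xi> \<le> r \<Longrightarrow> cosf \<xi> > 0"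
  shows "\<exists>g B. g \<in> borel_measurable borel \<and> (\<forall>x. \<bar>g x\<bar> \<le> B) \<and> (\<forall>\<theta>. (\<integral>x. g x * f (x - \<theta>) \<partial>lborel) = H \<theta>)"
  using assms(1)
proof (induction rule: trig.induct)
  case (trig_cos \<xi> b)
  define d where "d = (cosf \<xi>)\<^sup>2 + (sinf \<xi>)\<^sup>2"
  have d: "d > 0" using pos[OF trig_cos] by (simp add: d_def add_pos_nonneg)
  \<comment> \<open>The coefficients come from solving the two equations of
    \<open>integral_cos_shift\<close> for the pure cosine; the sine terms cancel.\<close>
  define g where "g x = (cosf \<xi> / d) * cos (\<xi> \<bullet> x + b) + (sinf \<xi> / d) * sin (\<xi> \<bullet> x + b)" for x
  have [measurable]: "g \<in> borel_measurable borel" unfolding g_def by measurable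
  moreover have "\<bar>g x\<bar> \<le> \<bar>cosf \<xi> / d\<bar> + \<bar>sinf \<xi> / d\<bar>" for x
    unfolding g_def
    by (intro order_trans[OF abs_triangle_ineq] add_mono) (simp_all only: abs_mult, auto intro!: divide_right_mono mult_left_le)
  moreover have "(\<integral>x. g x * f (x - \<theta>) \<partial>lborel) = cos (\<xi> \<bullet> \<theta> + b)" for \<theta>
  proof -
    let ?u = "\<xi> \<bullet> \<theta> + b"
    have ci: "integrable lborel (\<lambda>x. cos (\<xi> \<bullet> x + b) * f (x - \<theta>))" and si: "integrable lborel (\<lambda>x. sin (\<xi> \<bullet> x + b) * f (x - \<theta>))"
      by (rule f_bdd_integrable[where B=1]; simp)+
    have "(\<integral>x. g x * f (x - \<theta>) \<partial>lborel) =
      (\<integral>x. (cosf \<xi> / d) * (cos (\<xi> \<bullet> x + b) * f (x - \<theta>)) + (sinf \<xi> / d) * (sin (\<xi> \<bullet> x + b) * f (x - \<theta>)) \<partial>lborel)"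
      unfolding g_def by (simp add: algebra_simps)
    also have "\<dots> = (cosf \<xi> / d) * (cosf \<xi> * cos ?u - sinf \<xi> * sin ?u) + (sinf \<xi> / d) * (sinf \<xi> * cos ?u + cosf \<xi> * sin ?u)"
      using ci si by (simp add: integral_cos_shift)
    also have "\<dots> = ((cosf \<xi>)\<^sup>2 + (sinf \<xi>)\<^sup>2) / d * cos ?u"
      by (simp add: add_divide_distrib diff_divide_distrib algebra_simps power2_eq_square)
    also have "\<dots> = cos ?u" unfolding d_def[symmetric] using d by simp
    finally show ?thesis .
  qed
  ultimately show ?case by blast
next
  case (trig_add G H)
  then obtain g B g' B' where *: "g \<in> borel_measurable borel" "\<forall>x. \<bar>g x\<bar> \<le> B" "\<forall>\<theta>. (\<integral>x. g x * f (x - \<theta>) \<partial>lborel) = G \<theta>"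
    "g' \<in> borel_measurable borel" "\<forall>x. \<bar>g' x\<bar> \<le> B'" "\<forall>\<theta>. (\<integral>x. g' x * f (x - \<theta>) \<partial>lborel) = H \<theta>" by blast
  have "\<bar>g x + g' x\<bar> \<le> B + B'" for x using *(2,5)[rule_format, of x] by linarith
  moreover have "(\<integral>x. (g x + g' x) * f (x - \<theta>) \<partial>lborel) = G \<theta> + H \<theta>" for \<theta>
    using * f_bdd_integrable[of g B \<theta>] f_bdd_integrable[of g' B' \<theta>] by (simp add: distrib_right)
  moreover have "(\<lambda>x. g x + g' x) \<in> borel_measurable borel" using * by measurable
  ultimately show ?case by (intro exI[of _ "\<lambda>x. g x + g' x"] exI[of _ "B + B'"]) auto
next
  case (trig_scale G c)
  then obtain g B where *: "g \<in> borel_measurable borel" "\<forall>x. \<bar>g x\<bar> \<le> B" "\<forall>\<theta>. (\<integral>x. g x * f (x - \<theta>) \<partial>lborel) = G \<theta>" by blast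
  have "\<bar>c * g x\<bar> \<le> \<bar>c\<bar> * B" for x using * by (auto simp: abs_mult intro!: mult_left_mono)
  moreover have "(\<integral>x. (c * g x) * f (x - \<theta>) \<partial>lborel) = c * G \<theta>" for \<theta>
    using * f_bdd_integrable[of g B \<theta>] by (simp add: mult.assoc)
  moreover have "(\<lambda>x. c * g x) \<in> borel_measurable borel" using * by measurable
  ultimately show ?case by (intro exI[of _ "\<lambda>x. c * g x"] exI[of _ "\<bar>c\<bar> * B"]) auto
qed

end

section \<open>Trigonometric substitutes for the squared distance\<close>

definition hump :: "real \<Rightarrow> 'a::euclidean_space \<Rightarrow> 'a \<Rightarrow> real" where
  "hump e c \<theta> = (\<Sum>b\<in>Basis. 1 - cos (e * ((\<theta> - c) \<bullet> b)))"

lemma trig_coord: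
  fixes c b :: "'a::euclidean_space"
  assumes "e > 0" "b \<in> Basis"
  shows "trig e (\<lambda>\<theta>. cos (e * ((\<theta> - c) \<bullet> b)))" "trig e (\<lambda>\<theta>. sin (e * ((\<theta> - c) \<bullet> b)))"
proof -
  have n: "norm (e *\<^sub>R b) \<le> e" using assms by simp
  have eq: "e * ((\<theta> - c) \<bullet> b) = (e *\<^sub>R b) \<bullet> \<theta> + (- (e * (c \<bullet> b)))" for \<theta>
    by (simp add: inner_diff_left inner_commute algebra_simps)
  show "trig e (\<lambda>\<theta>. cos (e * ((\<theta> - c) \<bullet> b)))"
    unfolding eq by (rule trig_cos[OF n])
  have "sin (e * ((\<theta> - c) \<bullet> b)) = cos ((e *\<^sub>R b) \<bullet> \<theta> + (- (e * (c \<bullet> b)) - pi / 2))" for \<theta>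
  proof -
    have "(e *\<^sub>R b) \<bullet> \<theta> + (- (e * (c \<bullet> b)) - pi / 2) = e * ((\<theta> - c) \<bullet> b) - pi / 2"
      unfolding eq by simp
    then show ?thesis by (simp only: cos_diff) simp
  qed
  then show "trig e (\<lambda>\<theta>. sin (e * ((\<theta> - c) \<bullet> b)))"
    using trig_cos[OF n] by simp
qed

lemma trig_hump: "e > 0 \<Longrightarrow> trig e (hump e c)"
  unfolding hump_def[abs_def]
  by (intro trig_sum trig_diff trig_const trig_coord) auto

lemma one_minus_cos: "1 - cos u = 2 * (sin (u / 2))\<^sup>2" for u :: real
  using cos_double_sin[of "u / 2"] by simp

lemma sin_minus_id_bound: "\<bar>sin x - x\<bar> \<le> \<bar>x\<bar> ^ 3 / 6" for x :: real
  using Maclaurin_sin_bound[of x 3] by (simp add: sin_coeff_def numeral_eq_Suc)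

text \<open>The cubic error of the sine leaves at least |u| / 4 of |u| / 2, and 2 (|u| / 4)^2 is the
  claimed value.\<close>

lemma one_minus_cos_ge:
  fixes u :: real
  assumes "\<bar>u\<bar> \<le> 1" shows "1 - cos u \<ge> u\<^sup>2 / 8"
proof -
  have "\<bar>u / 2\<bar> ^ 3 / 6 \<le> \<bar>u / 2\<bar> / 2"
  proof -
    have "\<bar>u / 2\<bar> ^ 3 \<le> \<bar>u / 2\<bar> ^ 1" using assms by (intro power_decreasing) auto
    then show ?thesis by simp
  qed
  then have "\<bar>u\<bar> / 4 \<le> \<bar>sin (u / 2)\<bar>"
    using sin_minus_id_bound[of "u / 2"] by linarith
  then have "(\<bar>u\<bar> / 4)\<^sup>2 \<le> (\<bar>sin (u / 2)\<bar>)\<^sup>2" by (intro power_mono) auto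
  then show ?thesis unfolding one_minus_cos by (simp add: power_divide)
qed

lemma one_minus_cos_le: "1 - cos u \<le> u\<^sup>2 / 2" for u :: real
proof -
  have "\<bar>sin (u / 2)\<bar>\<^sup>2 \<le> \<bar>u / 2\<bar>\<^sup>2" by (intro power_mono abs_sin_x_le_abs_x) auto
  then show ?thesis unfolding one_minus_cos by (simp add: power_divide)
qed

lemma norm_sq_Basis: "(norm x)\<^sup>2 = (\<Sum>b\<in>Basis. (x \<bullet> b)\<^sup>2)" for x :: "'a::euclidean_space"
  unfolding power2_norm_eq_inner by (subst euclidean_inner) (simp add: power2_eq_square)

lemma hump_nonneg: "hump e c \<theta> \<ge> 0"
  unfolding hump_def by (intro sum_nonneg) simp

lemma hump_le: "hump e c \<theta> \<le> e\<^sup>2 * (norm (\<theta> - c))\<^sup>2 / 2"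
proof -
  have "hump e c \<theta> \<le> (\<Sum>b\<in>Basis. (e * ((\<theta> - c) \<bullet> b))\<^sup>2 / 2)"
    unfolding hump_def by (intro sum_mono one_minus_cos_le)
  also have "\<dots> = e\<^sup>2 * (norm (\<theta> - c))\<^sup>2 / 2"
    by (simp add: norm_sq_Basis power_mult_distrib sum_distrib_left sum_divide_distrib)
  finally show ?thesis .
qed

lemma hump_le_DIM: "hump e c (\<theta> :: 'a::euclidean_space) \<le> 2 * DIM('a)"
proof -
  have "hump e c \<theta> \<le> (\<Sum>b\<in>(Basis :: 'a set). 2)"
    unfolding hump_def
  proof (intro sum_mono)
    fix b show "1 - cos (e * ((\<theta> - c) \<bullet> b)) \<le> 2" using cos_ge_minus_one[of "e * ((\<theta> - c) \<bullet> b)"] by linarith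
  qed
  then show ?thesis by (simp add: mult.commute)
qed

text \<open>Together with \<open>hump_le\<close> this makes the hump comparable to the squared
  distance as long as the distance is at most 1 / e, although it is a trigonometric polynomial of
  frequency only \<open>e\<close>. Low frequency is thus bought by the factor e^2 in the
  constants.\<close>

lemma hump_ge:
  assumes "e > 0" "e * norm (\<theta> - c) \<le> 1"
  shows "hump e c \<theta> \<ge> e\<^sup>2 * (norm (\<theta> - c))\<^sup>2 / 8"
proof -
  have "e\<^sup>2 * (norm (\<theta> - c))\<^sup>2 / 8 = (\<Sum>b\<in>Basis. (e * ((\<theta> - c) \<bullet> b))\<^sup>2 / 8)"
    by (simp add: norm_sq_Basis power_mult_distrib sum_distrib_left sum_divide_distrib)
  also have "\<dots> \<le> hump e c \<theta>"
    unfolding hump_def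
  proof (intro sum_mono one_minus_cos_ge)
    fix b :: 'a assume "b \<in> Basis"
    have "e * \<bar>(\<theta> - c) \<bullet> b\<bar> \<le> e * norm (\<theta> - c)" using \<open>b \<in> Basis\<close> assms by (intro mult_left_mono Basis_le_norm) auto
    also have "\<dots> \<le> 1" by (rule assms)
    finally show "\<bar>e * ((\<theta> - c) \<bullet> b)\<bar> \<le> 1" using assms by (simp add: abs_mult)
  qed
  finally show ?thesis .
qed

lemma abs_cos_diff_le: "\<bar>cos a - cos b\<bar> \<le> \<bar>a - b\<bar>" for a b :: real
proof -
  have "\<bar>cos a - cos b\<bar> = 2 * \<bar>sin ((a + b) / 2)\<bar> * \<bar>sin ((b - a) / 2)\<bar>"
    by (simp add: cos_diff_cos abs_mult)
  also have "\<dots> \<le> 2 * 1 * \<bar>(b - a) / 2\<bar>"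
    by (intro mult_mono abs_sin_x_le_abs_x) auto
  finally show ?thesis by (simp add: abs_minus_commute)
qed

lemma hump_lipschitz:
  assumes "e > 0"
  shows "\<bar>hump e c \<theta> - hump e c (\<theta>' :: 'a::euclidean_space)\<bar> \<le> real DIM('a) * e * norm (\<theta> - \<theta>')"
proof -
  have "\<bar>hump e c \<theta> - hump e c \<theta>'\<bar> = \<bar>\<Sum>b\<in>Basis. cos (e * ((\<theta>' - c) \<bullet> b)) - cos (e * ((\<theta> - c) \<bullet> b))\<bar>"
    by (simp add: hump_def sum_subtractf[symmetric])
  also have "\<dots> \<le> (\<Sum>b\<in>(Basis :: 'a set). e * norm (\<theta> - \<theta>'))"
  proof (rule order_trans[OF sum_abs sum_mono])
    fix b :: 'a assume b: "b \<in> Basis"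
    have "\<bar>cos (e * ((\<theta>' - c) \<bullet> b)) - cos (e * ((\<theta> - c) \<bullet> b))\<bar> \<le> \<bar>e * ((\<theta>' - c) \<bullet> b) - e * ((\<theta> - c) \<bullet> b)\<bar>"
      by (rule abs_cos_diff_le)
    also have "\<dots> = e * \<bar>(\<theta>' - \<theta>) \<bullet> b\<bar>"
      using assms by (simp add: right_diff_distrib[symmetric] abs_mult inner_diff_left)
    also have "\<dots> \<le> e * norm (\<theta>' - \<theta>)" using assms b by (intro mult_left_mono Basis_le_norm) auto
    finally show "\<bar>cos (e * ((\<theta>' - c) \<bullet> b)) - cos (e * ((\<theta> - c) \<bullet> b))\<bar> \<le> e * norm (\<theta> - \<theta>')"
      by (simp add: norm_minus_commute)
  qed
  finally show ?thesis by simp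
qed

lemma abs_prod_minus_one_le:
  fixes p :: "'i \<Rightarrow> real"
  assumes "finite I" "\<And>i. i \<in> I \<Longrightarrow> \<bar>p i\<bar> \<le> V" "\<And>i. i \<in> I \<Longrightarrow> \<bar>p i - 1\<bar> \<le> \<delta>" "V \<ge> 1" "\<delta> \<ge> 0"
  shows "\<bar>(\<Prod>i\<in>I. p i) - 1\<bar> \<le> real (card I) * V ^ card I * \<delta>"
  using assms(1-3)
proof (induction I rule: finite_induct)
  case (insert i I)
  let ?P = "\<Prod>i\<in>I. p i"
  have "p i * ?P - 1 = p i * (?P - 1) + (p i - 1)" by (simp add: algebra_simps)
  then have "\<bar>p i * ?P - 1\<bar> \<le> \<bar>p i\<bar> * \<bar>?P - 1\<bar> + \<bar>p i - 1\<bar>"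
    by (metis abs_triangle_ineq abs_mult)
  also have "\<dots> \<le> V * (real (card I) * V ^ card I * \<delta>) + V ^ Suc (card I) * \<delta>"
  proof (intro add_mono mult_mono)
    have "1 * \<delta> \<le> V ^ Suc (card I) * \<delta>" using assms by (intro mult_right_mono one_le_power) auto
    then show "\<bar>p i - 1\<bar> \<le> V ^ Suc (card I) * \<delta>" using insert.prems(2)[of i] by simp
  qed (use insert assms in auto)
  also have "\<dots> = real (card (insert i I)) * V ^ card (insert i I) * \<delta>"
    using insert by (simp add: algebra_simps)
  finally show ?case using insert by simp
qed simp

section \<open>Test functions for separated true atoms\<close>

locale separated =
  fixes K :: nat and \<theta>s :: "nat \<Rightarrow> 'a::euclidean_space" and e \<sigma> :: real
  assumes e: "e > 0" and \<sigma>: "\<sigma> > 0"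
    and sep: "\<And>i j. i < K \<Longrightarrow> j < K \<Longrightarrow> i \<noteq> j \<Longrightarrow> 2 * \<sigma> \<le> norm (\<theta>s i - \<theta>s j)"
    and small: "\<And>i j. i < K \<Longrightarrow> j < K \<Longrightarrow> e * norm (\<theta>s i - \<theta>s j) \<le> 1"
begin

text \<open>A relation, because ties may occur; a choice of cluster is made later. The clause on
  \<open>e\<close> keeps all arguments of the humps within [-1, 1], where their quadratic lower
  bounds hold.\<close>

definition nearest :: "'a \<Rightarrow> nat \<Rightarrow> bool" where
  "nearest \<theta> j \<longleftrightarrow> j < K \<and> (\<forall>i<K. norm (\<theta> - \<theta>s j) \<le> norm (\<theta> - \<theta>s i) \<and> e * norm (\<theta> - \<theta>s i) \<le> 1)"

definition H0 :: "'a \<Rightarrow> real" where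
  "H0 \<theta> = (\<Prod>i<K. hump e (\<theta>s i) \<theta>)"

definition u :: "nat \<Rightarrow> nat \<Rightarrow> 'a \<Rightarrow> real" where
  "u k i \<theta> = hump e (\<theta>s i) \<theta> / hump e (\<theta>s i) (\<theta>s k)"

text \<open>Since \<open>1 - u(2 - u) = (1 - u)\<^sup>2\<close>, \<open>S k\<close> agrees with the indicator of cluster \<open>k\<close>
  to second order at all true atoms, and \<open>M k b\<close> with the first moment of cluster \<open>k\<close>.\<close>

definition S :: "nat \<Rightarrow> 'a \<Rightarrow> real" where
  "S k \<theta> = (\<Prod>i\<in>{..<K} - {k}. u k i \<theta> * (2 - u k i \<theta>))"

definition M :: "nat \<Rightarrow> 'a \<Rightarrow> 'a \<Rightarrow> real" where
  "M k b \<theta> = S k \<theta> * (sin (e * ((\<theta> - \<theta>s k) \<bullet> b)) / e)"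

lemma far:
  assumes "nearest \<theta> j" "i < K" "i \<noteq> j" shows "\<sigma> \<le> norm (\<theta> - \<theta>s i)"
proof -
  have "2 * \<sigma> \<le> norm (\<theta>s i - \<theta>s j)" using assms sep by (auto simp: nearest_def)
  also have "\<dots> \<le> norm (\<theta> - \<theta>s j) + norm (\<theta> - \<theta>s i)"
    using norm_triangle_ineq4[of "\<theta> - \<theta>s j" "\<theta> - \<theta>s i"] by simp
  also have "\<dots> \<le> 2 * norm (\<theta> - \<theta>s i)" using assms by (auto simp: nearest_def)
  finally show ?thesis by simp
qed

text \<open>Only the hump at the nearest true atom can be small: the point is at distance at least
  \<sigma> from the other K - 1 atoms, which bounds their humps from below.\<close>

lemma H0_ge:
  assumes "nearest \<theta> j"
  shows "H0 \<theta> \<ge> (e\<^sup>2 * \<sigma>\<^sup>2 / 8) ^ (K - 1) * (e\<^sup>2 / 8) * (norm (\<theta> - \<theta>s j))\<^sup>2"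
proof -
  have j: "j < K" using assms by (simp add: nearest_def)
  have "(e\<^sup>2 * \<sigma>\<^sup>2 / 8) ^ (K - 1) * (e\<^sup>2 * (norm (\<theta> - \<theta>s j))\<^sup>2 / 8) =
    (\<Prod>i\<in>{..<K} - {j}. e\<^sup>2 * \<sigma>\<^sup>2 / 8) * (e\<^sup>2 * (norm (\<theta> - \<theta>s j))\<^sup>2 / 8)"
    using j by simp
  also have "\<dots> \<le> (\<Prod>i\<in>{..<K} - {j}. hump e (\<theta>s i) \<theta>) * hump e (\<theta>s j) \<theta>"
  proof (intro mult_mono prod_mono conjI prod_nonneg hump_ge e)
    fix i assume i: "i \<in> {..<K} - {j}"
    have "e\<^sup>2 * \<sigma>\<^sup>2 / 8 \<le> e\<^sup>2 * (norm (\<theta> - \<theta>s i))\<^sup>2 / 8"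
      using far[OF assms] i \<sigma> by (intro divide_right_mono mult_left_mono power_mono) auto
    also have "\<dots> \<le> hump e (\<theta>s i) \<theta>" using assms i by (intro hump_ge e) (auto simp: nearest_def)
    finally show "e\<^sup>2 * \<sigma>\<^sup>2 / 8 \<le> hump e (\<theta>s i) \<theta>" .
  qed (use assms hump_nonneg in \<open>auto simp: nearest_def\<close>)
  also have "\<dots> = H0 \<theta>" unfolding H0_def using j by (subst (2) prod.remove[of _ j]) auto
  finally show ?thesis by (simp add: mult_ac)
qed

lemma H0_zero: "j < K \<Longrightarrow> H0 (\<theta>s j) = 0"
  unfolding H0_def by (rule prod_zero) (auto simp: hump_def intro!: bexI[of _ j])

text \<open>Three auxiliary constants: \<open>a\<close> bounds below the humps that normalise
  \<open>u\<close>, \<open>U\<close> bounds \<open>u\<close> from above, and \<open>V\<close> bounds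
  each factor of \<open>S\<close>.\<close>

definition a where "a = e\<^sup>2 * (2 * \<sigma>)\<^sup>2 / 8"
definition U where "U = 2 * real DIM('a) / a"
definition V where "V = max 1 (U * (2 + U))"

lemma a_pos: "a > 0" using e \<sigma> by (simp add: a_def)
lemma U_nonneg: "U \<ge> 0" using a_pos by (simp add: U_def)
lemma V_ge: "V \<ge> 1" by (simp add: V_def)

lemma denom_ge: "i < K \<Longrightarrow> k < K \<Longrightarrow> i \<noteq> k \<Longrightarrow> hump e (\<theta>s i) (\<theta>s k) \<ge> a"
proof -
  assume ik: "i < K" "k < K" "i \<noteq> k"
  have "a \<le> e\<^sup>2 * (norm (\<theta>s k - \<theta>s i))\<^sup>2 / 8"
    unfolding a_def using sep[of k i] \<sigma> ik by (intro divide_right_mono mult_left_mono power_mono) auto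
  also have "\<dots> \<le> hump e (\<theta>s i) (\<theta>s k)" using small[of k i] ik by (intro hump_ge e) auto
  finally show ?thesis .
qed

lemma u_bounds:
  assumes "i < K" "k < K" "i \<noteq> k"
  shows "0 \<le> u k i \<theta>" "u k i \<theta> \<le> U" "u k i \<theta> \<le> e\<^sup>2 / (2 * a) * (norm (\<theta> - \<theta>s i))\<^sup>2"
    "\<bar>u k i \<theta> - 1\<bar> \<le> real DIM('a) * e / a * norm (\<theta> - \<theta>s k)" "\<bar>u k i \<theta> * (2 - u k i \<theta>)\<bar> \<le> V"
proof -
  note d = denom_ge[OF assms]
  have dpos: "hump e (\<theta>s i) (\<theta>s k) > 0" using d a_pos by linarith
  show u0: "0 \<le> u k i \<theta>" unfolding u_def using dpos hump_nonneg by (intro divide_nonneg_pos) auto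
  have le: "u k i \<theta> \<le> hump e (\<theta>s i) \<theta> / a"
    unfolding u_def using d a_pos hump_nonneg by (intro divide_left_mono) auto
  also have "\<dots> \<le> U" unfolding U_def using hump_le_DIM a_pos by (intro divide_right_mono) auto
  finally show uU: "u k i \<theta> \<le> U" .
  have "hump e (\<theta>s i) \<theta> / a \<le> e\<^sup>2 * (norm (\<theta> - \<theta>s i))\<^sup>2 / 2 / a"
    using a_pos by (intro divide_right_mono hump_le) auto
  with le show "u k i \<theta> \<le> e\<^sup>2 / (2 * a) * (norm (\<theta> - \<theta>s i))\<^sup>2" by (simp add: field_simps)
  have "u k i \<theta> - 1 = (hump e (\<theta>s i) \<theta> - hump e (\<theta>s i) (\<theta>s k)) / hump e (\<theta>s i) (\<theta>s k)"
    using dpos by (simp add: u_def diff_divide_distrib)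
  then have "\<bar>u k i \<theta> - 1\<bar> = \<bar>hump e (\<theta>s i) \<theta> - hump e (\<theta>s i) (\<theta>s k)\<bar> / hump e (\<theta>s i) (\<theta>s k)"
    using dpos by simp
  also have "\<dots> \<le> (real DIM('a) * e * norm (\<theta> - \<theta>s k)) / a"
    using d a_pos e by (intro frac_le hump_lipschitz) auto
  finally show "\<bar>u k i \<theta> - 1\<bar> \<le> real DIM('a) * e / a * norm (\<theta> - \<theta>s k)" by simp
  have "\<bar>u k i \<theta> * (2 - u k i \<theta>)\<bar> = u k i \<theta> * \<bar>2 - u k i \<theta>\<bar>" using u0 by (simp add: abs_mult)
  also have "\<dots> \<le> U * (2 + U)" using u0 uU by (intro mult_mono) auto
  finally show "\<bar>u k i \<theta> * (2 - u k i \<theta>)\<bar> \<le> V" by (simp add: V_def)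
qed

definition C1 where "C1 = max (V ^ K * (2 + U) * (e\<^sup>2 / (2 * a))) (real K * V ^ K * (real DIM('a) * e / a)\<^sup>2)"

lemma C1_nonneg: "C1 \<ge> 0"
  unfolding C1_def using V_ge U_nonneg a_pos by (intro max.coboundedI1 mult_nonneg_nonneg) auto

text \<open>If k = j, every factor differs from 1 by the square of u - 1, and u is Lipschitz with
  value 1 at the atom. If k \<noteq> j, the factor with index \<open>j\<close> contains a hump
  centred at that atom, which is quadratically small, while the other factors stay bounded.\<close>

lemma S_bound:
  assumes n: "nearest \<theta> j" and k: "k < K"
  shows "\<bar>S k \<theta> - of_bool (k = j)\<bar> \<le> C1 * (norm (\<theta> - \<theta>s j))\<^sup>2"
proof (cases "k = j")
  case True
  let ?\<delta> = "(real DIM('a) * e / a * norm (\<theta> - \<theta>s k))\<^sup>2"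
  have "\<bar>S k \<theta> - 1\<bar> \<le> real (card ({..<K} - {k})) * V ^ card ({..<K} - {k}) * ?\<delta>"
    unfolding S_def
  proof (rule abs_prod_minus_one_le)
    fix i assume "i \<in> {..<K} - {k}"
    then have i: "i < K" "i \<noteq> k" by auto
    show "\<bar>u k i \<theta> * (2 - u k i \<theta>)\<bar> \<le> V" using u_bounds i k by auto
    have "\<bar>u k i \<theta> * (2 - u k i \<theta>) - 1\<bar> = \<bar>u k i \<theta> - 1\<bar>\<^sup>2"
    proof -
      have "u k i \<theta> * (2 - u k i \<theta>) - 1 = - ((u k i \<theta> - 1)\<^sup>2)" by (simp add: power2_eq_square algebra_simps)
      then show ?thesis by simp
    qed
    also have "\<dots> \<le> ?\<delta>" using u_bounds(4)[OF i(1) k i(2)] by (intro power_mono) auto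
    finally show "\<bar>u k i \<theta> * (2 - u k i \<theta>) - 1\<bar> \<le> ?\<delta>" .
  qed (use V_ge in auto)
  also have "\<dots> \<le> real K * V ^ K * ?\<delta>"
    using V_ge k by (intro mult_right_mono mult_mono power_increasing) auto
  also have "\<dots> = real K * V ^ K * (real DIM('a) * e / a)\<^sup>2 * (norm (\<theta> - \<theta>s k))\<^sup>2"
    by (simp add: power_mult_distrib power_divide mult_ac)
  also have "\<dots> \<le> C1 * (norm (\<theta> - \<theta>s k))\<^sup>2"
    unfolding C1_def by (intro mult_right_mono) auto
  finally show ?thesis using True by simp
next
  case False
  have j: "j < K" using n by (simp add: nearest_def)
  have "S k \<theta> = u k j \<theta> * (2 - u k j \<theta>) * (\<Prod>i\<in>{..<K} - {k} - {j}. u k i \<theta> * (2 - u k i \<theta>))"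
    unfolding S_def using j False by (subst prod.remove[of _ j]) auto
  then have "\<bar>S k \<theta>\<bar> = u k j \<theta> * \<bar>2 - u k j \<theta>\<bar> * (\<Prod>i\<in>{..<K} - {k} - {j}. \<bar>u k i \<theta> * (2 - u k i \<theta>)\<bar>)"
    using u_bounds(1)[of j k] j k False by (simp add: abs_mult abs_prod)
  also have "\<dots> \<le> e\<^sup>2 / (2 * a) * (norm (\<theta> - \<theta>s j))\<^sup>2 * (2 + U) * V ^ K"
  proof (intro mult_mono)
    show "u k j \<theta> \<le> e\<^sup>2 / (2 * a) * (norm (\<theta> - \<theta>s j))\<^sup>2" using u_bounds j k False by auto
    show "\<bar>2 - u k j \<theta>\<bar> \<le> 2 + U" using u_bounds(1,2)[of j k \<theta>] j k False by (auto simp: abs_le_iff)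
    have "(\<Prod>i\<in>{..<K} - {k} - {j}. \<bar>u k i \<theta> * (2 - u k i \<theta>)\<bar>) \<le> (\<Prod>i\<in>{..<K} - {k} - {j}. V)"
      using u_bounds(5) k by (intro prod_mono) auto
    also have "\<dots> \<le> V ^ K"
      using V_ge card_mono[of "{..<K}" "{..<K} - {k} - {j}"] by (auto intro!: power_increasing)
    finally show "(\<Prod>i\<in>{..<K} - {k} - {j}. \<bar>u k i \<theta> * (2 - u k i \<theta>)\<bar>) \<le> V ^ K" .
  qed (use a_pos U_nonneg in \<open>auto intro!: prod_nonneg mult_nonneg_nonneg\<close>)
  also have "\<dots> = V ^ K * (2 + U) * (e\<^sup>2 / (2 * a)) * (norm (\<theta> - \<theta>s j))\<^sup>2" by (simp only: mult_ac)
  also have "\<dots> \<le> C1 * (norm (\<theta> - \<theta>s j))\<^sup>2"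
    unfolding C1_def by (intro mult_right_mono) auto
  finally show ?thesis using False by simp
qed

definition C2 where "C2 = C1 / e + e"

text \<open>The error of \<open>S\<close> is quadratic and is multiplied by a function bounded by 1
  / e. Within the own cluster sin(e z) / e differs from z by a cubic term, which is quadratic
  because e |z| \<le> 1.\<close>

lemma M_bound:
  assumes n: "nearest \<theta> j" and k: "k < K" and b: "b \<in> Basis"
  shows "\<bar>M k b \<theta> - (if k = j then (\<theta> - \<theta>s j) \<bullet> b else 0)\<bar> \<le> C2 * (norm (\<theta> - \<theta>s j))\<^sup>2"
proof -
  let ?z = "(\<theta> - \<theta>s k) \<bullet> b"
  let ?s = "sin (e * ?z) / e"
  have s1: "\<bar>?s\<bar> \<le> 1 / e" using e by (simp add: abs_divide divide_right_mono)
  have "\<bar>M k b \<theta> - of_bool (k = j) * ?s\<bar> = \<bar>S k \<theta> - of_bool (k = j)\<bar> * \<bar>?s\<bar>"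
    by (simp only: M_def left_diff_distrib[symmetric] abs_mult)
  also have "\<dots> \<le> C1 * (norm (\<theta> - \<theta>s j))\<^sup>2 * (1 / e)"
    using S_bound[OF n k] s1 C1_nonneg by (intro mult_mono) auto
  finally have 1: "\<bar>M k b \<theta> - of_bool (k = j) * ?s\<bar> \<le> C1 / e * (norm (\<theta> - \<theta>s j))\<^sup>2" by simp
  have 2: "\<bar>of_bool (k = j) * ?s - (if k = j then (\<theta> - \<theta>s j) \<bullet> b else 0)\<bar> \<le> e * (norm (\<theta> - \<theta>s j))\<^sup>2"
  proof (cases "k = j")
    case True
    have ez: "e * \<bar>?z\<bar> \<le> 1"
    proof -
      have "e * \<bar>?z\<bar> \<le> e * norm (\<theta> - \<theta>s k)" using e b by (intro mult_left_mono Basis_le_norm) auto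
      also have "\<dots> \<le> 1" using n k by (simp add: nearest_def)
      finally show ?thesis .
    qed
    have "?s - ?z = (sin (e * ?z) - e * ?z) / e" using e by (simp add: diff_divide_distrib)
    then have "\<bar>?s - ?z\<bar> = \<bar>sin (e * ?z) - e * ?z\<bar> / e" using e by (simp add: abs_divide)
    also have "\<dots> \<le> (\<bar>e * ?z\<bar> ^ 3 / 6) / e"
      using e by (intro divide_right_mono sin_minus_id_bound) auto
    also have "\<dots> = e * \<bar>?z\<bar>\<^sup>2 * (e * \<bar>?z\<bar>) / 6"
      using e by (simp add: abs_mult power3_eq_cube power2_eq_square)
    also have "\<dots> \<le> e * \<bar>?z\<bar>\<^sup>2 * 1 / 1"
      using e ez by (intro frac_le mult_left_mono) auto
    also have "\<dots> \<le> e * (norm (\<theta> - \<theta>s k))\<^sup>2 * 1 / 1"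
      using e b Basis_le_norm[OF b, of "\<theta> - \<theta>s k"] by (intro divide_right_mono mult_right_mono mult_left_mono power_mono) auto
    finally show ?thesis using True by simp
  qed (use e in simp)
  have "C2 * (norm (\<theta> - \<theta>s j))\<^sup>2 = C1 / e * (norm (\<theta> - \<theta>s j))\<^sup>2 + e * (norm (\<theta> - \<theta>s j))\<^sup>2"
    by (simp add: C2_def algebra_simps)
  with 1 2 show ?thesis by linarith
qed

lemma trig_H0: "trig (real K * e) H0"
  unfolding H0_def[abs_def]
  using trig_prod[of "{..<K}" e "\<lambda>i. hump e (\<theta>s i)"] trig_hump[OF e] e by auto

lemma trig_S: "k < K \<Longrightarrow> trig (real K * (2 * e)) (S k)"
proof -
  assume k: "k < K"
  have u: "trig e (u k i)" for i
    using trig_scale[OF trig_hump[OF e], of "1 / hump e (\<theta>s i) (\<theta>s k)"] by (simp add: u_def[abs_def])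
  have "trig (real (card ({..<K} - {k})) * (2 * e)) (S k)"
    unfolding S_def[abs_def]
  proof (intro trig_prod)
    show "trig (2 * e) (\<lambda>\<theta>. u k i \<theta> * (2 - u k i \<theta>))" for i
      using trig_mult[OF u trig_diff[OF trig_const u], of i 2 i] e by simp
  qed (use e in auto)
  then show ?thesis
  proof (rule trig_mono)
    show "real (card ({..<K} - {k})) * (2 * e) \<le> real K * (2 * e)"
      using e k by (intro mult_right_mono) auto
  qed
qed

lemma trig_M: "k < K \<Longrightarrow> b \<in> Basis \<Longrightarrow> trig (real K * (2 * e) + e) (M k b)"
  unfolding M_def[abs_def]
  using trig_mult[OF trig_S trig_scale[OF trig_coord(2)[OF e], of b "1 / e"], of k "\<theta>s k"] by simp

end

section \<open>Cluster structure\<close>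

text \<open>Three errors add up: \<open>t\<close> from the test, \<open>C * T\<close> from replacing
  the smooth test function \<open>G\<close> by the cluster functional \<open>I\<close>, and
  \<open>L\<close> times the remaining mass from truncation after \<open>M\<close> atoms.\<close>

lemma suminf_approx:
  fixes w G I q :: "nat \<Rightarrow> real"
  assumes w: "\<And>k. 0 \<le> w k" "w sums 1"
    and GI: "\<And>k. \<bar>G k - I k\<bar> \<le> C * q k" and I: "\<And>k. \<bar>I k\<bar> \<le> L"
    and q: "summable (\<lambda>k. w k * q k)" "(\<Sum>k. w k * q k) \<le> T" and C: "C \<ge> 0"
    and z: "\<bar>(\<Sum>k. w k * G k) - z\<bar> \<le> t"
  shows "\<bar>(\<Sum>k<M. w k * I k) - z\<bar> \<le> t + C * T + L * (1 - (\<Sum>k<M. w k))"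
proof -
  have sw: "summable w" using w by (simp add: sums_iff)
  have sI: "summable (\<lambda>k. w k * I k)"
  proof (rule summable_comparison_test'[OF summable_mult[OF sw, of L]])
    show "norm (w k * I k) \<le> L * w k" for k
      using mult_left_mono[OF I[of k] w(1)[of k]] w(1)[of k] by (simp add: abs_mult mult.commute)
  qed
  have b: "\<bar>w k * (G k - I k)\<bar> \<le> C * (w k * q k)" for k
    using mult_left_mono[OF GI[of k] w(1)[of k]] w(1)[of k] by (simp add: abs_mult mult_ac)
  have sCq: "summable (\<lambda>k. C * (w k * q k))" by (intro summable_mult q)
  have sGI: "summable (\<lambda>k. w k * (G k - I k))"
    using b by (intro summable_comparison_test'[OF sCq]) auto
  have "(\<Sum>k. w k * G k) = (\<Sum>k. w k * I k + w k * (G k - I k))"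
    by (simp add: algebra_simps)
  also have "\<dots> = (\<Sum>k. w k * I k) + (\<Sum>k. w k * (G k - I k))"
    using suminf_add[OF sI sGI] by simp
  finally have 1: "(\<Sum>k. w k * G k) = (\<Sum>k. w k * I k) + (\<Sum>k. w k * (G k - I k))" .
  have "\<bar>\<Sum>k. w k * (G k - I k)\<bar> \<le> (\<Sum>k. C * (w k * q k))"
    using norm_suminf_le[of "\<lambda>k. w k * (G k - I k)" "\<lambda>k. C * (w k * q k)"] b sCq by simp
  also have "\<dots> = C * (\<Sum>k. w k * q k)" by (intro suminf_mult q)
  also have "\<dots> \<le> C * T" using q C by (intro mult_left_mono)
  finally have 2: "\<bar>\<Sum>k. w k * (G k - I k)\<bar> \<le> C * T" .
  have 3: "(\<Sum>k. w k * I k) = (\<Sum>k. w (k + M) * I (k + M)) + (\<Sum>k<M. w k * I k)"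
    by (rule suminf_split_initial_segment[OF sI])
  have sM: "summable (\<lambda>k. L * w (k + M))" using sw by (intro summable_mult) (simp add: summable_iff_shift)
  have "\<bar>\<Sum>k. w (k + M) * I (k + M)\<bar> \<le> (\<Sum>k. L * w (k + M))"
  proof (rule norm_suminf_le[of "\<lambda>k. w (k + M) * I (k + M)", unfolded real_norm_def])
    show "\<bar>w (k + M) * I (k + M)\<bar> \<le> L * w (k + M)" for k
      using mult_left_mono[OF I[of "k + M"] w(1)[of "k + M"]] w(1)[of "k + M"] by (simp add: abs_mult mult.commute)
  qed (rule sM)
  also have "\<dots> = L * (1 - (\<Sum>k<M. w k))"
    using suminf_split_initial_segment[OF sw, of M] w sw by (simp add: suminf_mult summable_iff_shift sums_iff)
  finally have 4: "\<bar>\<Sum>k. w (k + M) * I (k + M)\<bar> \<le> L * (1 - (\<Sum>k<M. w k))" .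
  show ?thesis using z 1 2 3 4 by linarith
qed

lemma sum_of_bool_eq:
  fixes w :: "nat \<Rightarrow> real" and M :: nat
  shows
  "(\<Sum>k<M. w k * of_bool (l k = j)) = (\<Sum>k\<in>{k. k < M \<and> l k = j}. w k)"
proof -
  have "(\<Sum>k\<in>{k. k < M \<and> l k = j}. w k) = (\<Sum>k\<in>{k. k < M \<and> l k = j}. w k * of_bool (l k = j))"
    by (intro sum.cong) auto
  also have "\<dots> = (\<Sum>k<M. w k * of_bool (l k = j))"
    by (intro sum.mono_neutral_left) auto
  finally show ?thesis by simp
qed

context separated
begin

definition c1 where "c1 = (e\<^sup>2 * \<sigma>\<^sup>2 / 8) ^ (K - 1) * (e\<^sup>2 / 8)"

lemma c1_pos: "c1 > 0" using e \<sigma> by (simp add: c1_def)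

text \<open>One constant for the three conclusions of \<open>cluster_structure\<close>: second
  moments, cluster masses and first moments. The dimension enters the last entry because the norm is
  bounded by the sum of the coordinates.\<close>

definition Bc where
  "Bc = Max {1 / c1, 1 + C1 / c1 + 1, real DIM('a) * (1 + C2 / c1 + 1 / e)}"

lemma Bc: "1 / c1 \<le> Bc" "1 + C1 / c1 + 1 \<le> Bc" "real DIM('a) * (1 + C2 / c1 + 1 / e) \<le> Bc"
  unfolding Bc_def by (intro Max_ge; simp)+

lemma Bc_pos: "Bc > 0" using Bc(1) c1_pos by (smt (verit) zero_less_divide_1_iff)

lemma C2_nonneg: "C2 \<ge> 0" using C1_nonneg e by (simp add: C2_def)

text \<open>The test with \<open>H0\<close> bounds the mean squared distance to the nearest true
  atoms by a multiple of \<open>t\<close>. Since \<open>S\<close> and \<open>M\<close> differ from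
  the cluster indicators and moments by at most that squared distance, their tests transfer to
  masses and first moments. Truncation at \<open>m\<close> then costs \<rho>, which explains \<rho>
  in place of \<open>t\<close> in the last two conclusions.\<close>

lemma cluster_structure:
  fixes w :: "nat \<Rightarrow> real" and \<theta> :: "nat \<Rightarrow> 'a"
  assumes w: "\<And>k. 0 \<le> w k" "w sums 1" and l: "\<And>k. nearest (\<theta> k) (l k)"
    and H: "(\<Sum>k. w k * H0 (\<theta> k)) \<le> t"
    and S: "\<And>j. j < K \<Longrightarrow> \<bar>(\<Sum>k. w k * S j (\<theta> k)) - ws j\<bar> \<le> t"
    and M: "\<And>j b. j < K \<Longrightarrow> b \<in> Basis \<Longrightarrow> \<bar>\<Sum>k. w k * M j b (\<theta> k)\<bar> \<le> t"
    and t: "0 < t" "t \<le> \<rho>" and R: "1 - (\<Sum>k<m. w k) \<le> \<rho>"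
  shows "w k * (norm (\<theta> k - \<theta>s (l k)))\<^sup>2 \<le> Bc * t"
    and "j < K \<Longrightarrow> \<bar>(\<Sum>k\<in>{k. k < m \<and> l k = j}. w k) - ws j\<bar> \<le> Bc * \<rho>"
    and "j < K \<Longrightarrow> norm (\<Sum>k\<in>{k. k < m \<and> l k = j}. w k *\<^sub>R (\<theta> k - \<theta>s j)) \<le> Bc * \<rho>"
proof -
  define q where "q k = (norm (\<theta> k - \<theta>s (l k)))\<^sup>2" for k
  have sw: "summable w" using w by (simp add: sums_iff)
  have lK: "l k < K" for k using l by (simp add: nearest_def)
  have d1: "norm (\<theta> k - \<theta>s j) \<le> 1 / e" if "j < K" for k j
    using l[of k] that e by (simp add: nearest_def field_simps)
  have q1: "q k \<le> (1 / e)\<^sup>2" for k unfolding q_def using d1[OF lK] by (intro power_mono) auto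
  have sq: "summable (\<lambda>k. w k * q k)"
  proof (rule summable_comparison_test'[OF summable_mult[OF sw, of "(1 / e)\<^sup>2"]])
    show "norm (w k * q k) \<le> (1 / e)\<^sup>2 * w k" for k
      using mult_left_mono[OF q1[of k] w(1)[of k]] w(1)[of k] by (simp add: q_def abs_mult mult.commute)
  qed
  have H0_le: "H0 x \<le> (2 * DIM('a)) ^ K" for x
  proof -
    have "H0 x \<le> (\<Prod>i<K. real (2 * DIM('a)))" unfolding H0_def
      using hump_le_DIM[of e] hump_nonneg by (intro prod_mono) auto
    then show ?thesis by simp
  qed
  have H0_nn: "0 \<le> H0 x" for x unfolding H0_def by (intro prod_nonneg ballI hump_nonneg)
  have sH: "summable (\<lambda>k. w k * H0 (\<theta> k))"
  proof (rule summable_comparison_test'[OF summable_mult[OF sw, of "real ((2 * DIM('a)) ^ K)"]])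
    show "norm (w k * H0 (\<theta> k)) \<le> real ((2 * DIM('a)) ^ K) * w k" for k
      using mult_left_mono[OF H0_le[of "\<theta> k"] w(1)[of k]] w(1)[of k] H0_nn[of "\<theta> k"] by (simp add: abs_mult mult.commute)
  qed
  \<comment> \<open>The lower bound \<open>H0_ge\<close> holds at every atom, so the single number
    tested with \<open>H0\<close> controls all squared distances at once.\<close>
  have "c1 * (\<Sum>k. w k * q k) = (\<Sum>k. c1 * (w k * q k))" by (rule suminf_mult[OF sq, symmetric])
  also have "\<dots> \<le> (\<Sum>k. w k * H0 (\<theta> k))"
  proof (intro suminf_le sH summable_mult sq)
    show "c1 * (w k * q k) \<le> w k * H0 (\<theta> k)" for k
      using mult_left_mono[OF H0_ge[OF l[of k]] w(1)[of k]] by (simp add: c1_def q_def mult_ac)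
  qed
  also have "\<dots> \<le> t" by (rule H)
  finally have T: "(\<Sum>k. w k * q k) \<le> t / c1" using c1_pos by (simp add: field_simps)
  have \<rho>: "\<rho> > 0" using t by simp
  show "w k * (norm (\<theta> k - \<theta>s (l k)))\<^sup>2 \<le> Bc * t"
  proof -
    have "w k * q k \<le> (\<Sum>k. w k * q k)"
      using sum_le_suminf[OF sq, of "{k}"] w(1) by (auto simp: q_def)
    also have "\<dots> \<le> (1 / c1) * t" using T by simp
    also have "\<dots> \<le> Bc * t" using Bc(1) t by (intro mult_right_mono) auto
    finally show ?thesis by (simp add: q_def)
  qed
  show "\<bar>(\<Sum>k\<in>{k. k < m \<and> l k = j}. w k) - ws j\<bar> \<le> Bc * \<rho>" if j: "j < K"
  proof -
    have "\<bar>(\<Sum>k<m. w k * of_bool (l k = j)) - ws j\<bar> \<le> t + C1 * (t / c1) + 1 * (1 - (\<Sum>k<m. w k))"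
    proof (rule suminf_approx[where G = "\<lambda>k. S j (\<theta> k)" and q = q])
      show "\<bar>S j (\<theta> k) - of_bool (l k = j)\<bar> \<le> C1 * q k" for k
        using S_bound[OF l[of k] j] by (auto simp: q_def eq_commute[of j])
    qed (use w sq T C1_nonneg S[OF j] in auto)
    also have "\<dots> \<le> \<rho> + C1 * (\<rho> / c1) + 1 * \<rho>"
      using t R C1_nonneg c1_pos by (intro add_mono mult_left_mono divide_right_mono) auto
    also have "\<dots> = (1 + C1 / c1 + 1) * \<rho>" by (simp add: algebra_simps)
    also have "\<dots> \<le> Bc * \<rho>" using Bc(2) \<rho> by (intro mult_right_mono) auto
    finally show ?thesis by (simp add: sum_of_bool_eq)
  qed
  show "norm (\<Sum>k\<in>{k. k < m \<and> l k = j}. w k *\<^sub>R (\<theta> k - \<theta>s j)) \<le> Bc * \<rho>" if j: "j < K"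
  proof -
    let ?v = "\<Sum>k\<in>{k. k < m \<and> l k = j}. w k *\<^sub>R (\<theta> k - \<theta>s j)"
    have b: "\<bar>?v \<bullet> b\<bar> \<le> (1 + C2 / c1 + 1 / e) * \<rho>" if b: "b \<in> Basis" for b
    proof -
      have "?v \<bullet> b = (\<Sum>k\<in>{k. k < m \<and> l k = j}. w k * ((\<theta> k - \<theta>s j) \<bullet> b))"
        by (simp add: inner_sum_left)
      also have "\<dots> = (\<Sum>k\<in>{k. k < m \<and> l k = j}. w k * ((\<theta> k - \<theta>s j) \<bullet> b) * 1)" by simp
      also have "\<dots> = (\<Sum>k<m. w k * (if j = l k then (\<theta> k - \<theta>s (l k)) \<bullet> b else 0))"
        by (intro sum.mono_neutral_cong_left) auto
      finally have eq: "?v \<bullet> b = (\<Sum>k<m. w k * (if j = l k then (\<theta> k - \<theta>s (l k)) \<bullet> b else 0))" .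
      have "\<bar>(\<Sum>k<m. w k * (if j = l k then (\<theta> k - \<theta>s (l k)) \<bullet> b else 0)) - 0\<bar> \<le> t + C2 * (t / c1) + (1 / e) * (1 - (\<Sum>k<m. w k))"
      proof (rule suminf_approx[where G = "\<lambda>k. M j b (\<theta> k)" and q = q])
        show "\<bar>M j b (\<theta> k) - (if j = l k then (\<theta> k - \<theta>s (l k)) \<bullet> b else 0)\<bar> \<le> C2 * q k" for k
          using M_bound[OF l[of k] j b] by (auto simp: q_def)
        show "\<bar>if j = l k then (\<theta> k - \<theta>s (l k)) \<bullet> b else 0\<bar> \<le> 1 / e" for k
          using order_trans[OF Basis_le_norm[OF b] d1[OF lK[of k], of k]] e by auto
      qed (use w sq T C2_nonneg M[OF j b] in auto)
      also have "\<dots> \<le> \<rho> + C2 * (\<rho> / c1) + (1 / e) * \<rho>"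
        using t R C2_nonneg c1_pos e by (intro add_mono mult_left_mono divide_right_mono) auto
      also have "\<dots> = (1 + C2 / c1 + 1 / e) * \<rho>" by (simp add: algebra_simps)
      finally show ?thesis using eq by simp
    qed
    have "norm ?v \<le> (\<Sum>b\<in>Basis. \<bar>?v \<bullet> b\<bar>)" by (rule norm_le_l1)
    also have "\<dots> \<le> (\<Sum>b\<in>(Basis :: 'a set). (1 + C2 / c1 + 1 / e) * \<rho>)" by (intro sum_mono b)
    also have "\<dots> = real DIM('a) * (1 + C2 / c1 + 1 / e) * \<rho>" by simp
    also have "\<dots> \<le> Bc * \<rho>" using Bc(3) \<rho> by (intro mult_right_mono) auto
    finally show ?thesis .
  qed
qed

text \<open>All labellings of the first \<open>m\<close> atoms by clusters together with all choices
  of one heavy atom per cluster; extensional functions make the index set finite. The threshold is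
  what pigeonhole gives: at most \<open>m\<close> atoms share a mass of at least half the smallest
  true weight.\<close>

definition cover where
  "cover m ws \<rho> \<epsilon> = (\<Union>(l, \<kappa>)\<in>{(l, \<kappa>). l \<in> PiE {..<m} (\<lambda>_. {..<K}) \<and> \<kappa> \<in> PiE {..<K} (\<lambda>_. {..<m}) \<and> (\<forall>j<K. l (\<kappa> j) = j)}.
      cluster_event K m l \<kappa> ws \<theta>s ((MIN j\<in>{..<K}. ws j) / (2 * m)) (Bc * \<rho>) \<rho> \<epsilon>)"

lemma finite_cover_index:
  "finite {(l, \<kappa>). l \<in> PiE {..<m} (\<lambda>_. {..<K}) \<and> \<kappa> \<in> PiE {..<K} (\<lambda>_. {..<m::nat}) \<and> (\<forall>j<K. l (\<kappa> j) = j)}"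
  by (rule finite_subset[of _ "PiE {..<m} (\<lambda>_. {..<K}) \<times> PiE {..<K} (\<lambda>_. {..<m})"])
     (auto intro!: finite_cartesian_product finite_PiE)

lemma sets_cover[measurable]:
  "cover m ws \<rho> \<epsilon> \<in> sets (PiM UNIV (\<lambda>_. borel) \<Otimes>\<^sub>M PiM UNIV (\<lambda>_. borel :: 'a measure))"
  unfolding cover_def by (intro sets.finite_UN finite_cover_index) auto

text \<open>If more than \<rho> of the stick is left after \<open>m\<close> atoms, only the
  second-moment conclusion is retained, for use with \<open>emeasure_many_atoms\<close>. Otherwise
  the cluster masses of the first \<open>m\<close> atoms are nearly correct, and every cluster
  contains a heavy atom.\<close>

lemma in_cover:
  assumes v: "v \<in> stick_dom" "stick_breaking v sums 1" and l: "\<And>k. \<exists>j. nearest (\<theta> k) j"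
    and K: "K \<ge> 1" and ws: "\<And>j. j < K \<Longrightarrow> ws j > 0"
    and H: "(\<Sum>k. stick_breaking v k * H0 (\<theta> k)) \<le> t"
    and S: "\<And>j. j < K \<Longrightarrow> \<bar>(\<Sum>k. stick_breaking v k * S j (\<theta> k)) - ws j\<bar> \<le> t"
    and M: "\<And>j b. j < K \<Longrightarrow> b \<in> Basis \<Longrightarrow> \<bar>\<Sum>k. stick_breaking v k * M j b (\<theta> k)\<bar> \<le> t"
    and t: "0 < t" "t \<le> \<rho>" and \<rho>: "Bc * \<rho> \<le> (MIN j\<in>{..<K}. ws j) / 2"
    and tail: "stick_rest v K > \<epsilon>"
  shows "(stick_rest v m > \<rho> \<and> (\<forall>k<m. \<exists>j<K. stick_breaking v k * (norm (\<theta> k - \<theta>s j))\<^sup>2 \<le> Bc * t)) \<or>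
    (v, \<theta>) \<in> cover m ws \<rho> \<epsilon>"
proof -
  obtain l0 where l0: "\<And>k. nearest (\<theta> k) (l0 k)" using l by metis
  have l0K: "l0 k < K" for k using l0 by (simp add: nearest_def)
  let ?w = "stick_breaking v"
  let ?mw = "MIN j\<in>{..<K}. ws j"
  have ne: "{..<K} \<noteq> {}" using K by (auto simp: lessThan_empty_iff)
  have wpos: "0 \<le> ?w k" for k using stick_breaking_pos[OF v(1)] by (simp add: less_imp_le)
  have rest: "1 - (\<Sum>k<i. ?w k) = stick_rest v i" for i by (simp add: sum_stick_breaking)
  show ?thesis
  proof (cases "stick_rest v m > \<rho>")
    case True
    \<comment> \<open>The second-moment conclusion does not involve the truncation point, so
      truncation at 0 with the trivial remainder 1 may be used.\<close>
    have "1 - (\<Sum>k<(0::nat). ?w k) \<le> max \<rho> 1" by simp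
    from cluster_structure(1)[OF wpos v(2) l0 H S M t(1) _ this] t
    have "?w k * (norm (\<theta> k - \<theta>s (l0 k)))\<^sup>2 \<le> Bc * t" for k by (auto simp: le_max_iff_disj)
    with True l0K show ?thesis by blast
  next
    case False
    have R: "1 - (\<Sum>k<m. ?w k) \<le> \<rho>" using False unfolding rest by simp
    have st1: "?w k * (norm (\<theta> k - \<theta>s (l0 k)))\<^sup>2 \<le> Bc * t" for k
      by (rule cluster_structure(1)[OF wpos v(2) l0 H S M t R]) auto
    have st2: "\<bar>(\<Sum>k\<in>{k. k < m \<and> l0 k = j}. ?w k) - ws j\<bar> \<le> Bc * \<rho>" if "j < K" for j
      by (rule cluster_structure(2)[OF wpos v(2) l0 H S M t R]) (use that in auto)
    have st3: "norm (\<Sum>k\<in>{k. k < m \<and> l0 k = j}. ?w k *\<^sub>R (\<theta> k - \<theta>s j)) \<le> Bc * \<rho>" if "j < K" for j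
      by (rule cluster_structure(3)[OF wpos v(2) l0 H S M t R]) (use that in auto)
    have mwpos: "?mw > 0" using ne ws by (subst Min_gr_iff) auto
    \<comment> \<open>Pigeonhole: the mass of cluster \<open>j\<close> is at least half the smallest
      true weight, because \<rho> is small. A nonempty index set is checked first, since the
      comparison of sums must be strict.\<close>
    have "\<exists>k<m. l0 k = j \<and> ?mw / (2 * m) \<le> ?w k" if j: "j < K" for j
    proof (rule ccontr)
      assume neg: "\<not> ?thesis"
      have "(\<Sum>k\<in>{k. k < m \<and> l0 k = j}. ?w k) \<ge> ws j - Bc * \<rho>"
        using st2[OF j] by (auto simp: abs_le_iff)
      moreover have "ws j \<ge> ?mw" using j by (intro Min_le) auto
      ultimately have ge: "(\<Sum>k\<in>{k. k < m \<and> l0 k = j}. ?w k) \<ge> ?mw / 2" using \<rho> by linarith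
      have nonempty: "{k. k < m \<and> l0 k = j} \<noteq> {}"
      proof
        assume "{k. k < m \<and> l0 k = j} = {}"
        with ge have "?mw / 2 \<le> 0" by (simp only: sum.empty)
        with mwpos show False by linarith
      qed
      have "(\<Sum>k\<in>{k. k < m \<and> l0 k = j}. ?w k) < (\<Sum>k\<in>{k. k < m \<and> l0 k = j}. ?mw / (2 * m))"
        using nonempty neg by (intro sum_strict_mono) (auto simp: not_le)
      also have "\<dots> = real (card {k. k < m \<and> l0 k = j}) * (?mw / (2 * m))" by simp
      also have "\<dots> \<le> real m * (?mw / (2 * m))"
        using mwpos card_mono[of "{..<m}" "{k. k < m \<and> l0 k = j}"] by (intro mult_right_mono) auto
      also have "\<dots> \<le> ?mw / 2" using mwpos by auto
      finally show False using ge by simp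
    qed
    then obtain k0 where k0: "\<And>j. j < K \<Longrightarrow> k0 j < m \<and> l0 (k0 j) = j \<and> ?mw / (2 * m) \<le> ?w (k0 j)" by metis
    define l where "l = restrict l0 {..<m}"
    define \<kappa> where "\<kappa> = restrict k0 {..<K}"
    have lset: "{k. k < m \<and> l k = j} = {k. k < m \<and> l0 k = j}" for j by (auto simp: l_def)
    have "(v, \<theta>) \<in> cluster_event K m l \<kappa> ws \<theta>s (?mw / (2 * m)) (Bc * \<rho>) \<rho> \<epsilon>"
      unfolding cluster_event_def lset
    proof (clarsimp, intro conjI allI impI)
      show "?mw / (2 * real m) \<le> ?w (\<kappa> j)" if "j < K" for j using k0[OF that] that by (simp add: \<kappa>_def)
      show "\<bar>sum ?w {k. k < m \<and> l0 k = j} - ws j\<bar> \<le> Bc * \<rho>" if "j < K" for j using st2[OF that] .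
      show "norm (\<Sum>k | k < m \<and> l0 k = j. ?w k *\<^sub>R (\<theta> k - \<theta>s j)) \<le> Bc * \<rho>" if "j < K" for j
        using st3[OF that] .
      show "?w k * (norm (\<theta> k - \<theta>s (l k)))\<^sup>2 \<le> Bc * \<rho>" if "k < m" for k
      proof -
        have "?w k * (norm (\<theta> k - \<theta>s (l0 k)))\<^sup>2 \<le> Bc * t" by (rule st1)
        also have "\<dots> \<le> Bc * \<rho>" using t Bc_pos by (intro mult_left_mono) auto
        finally show ?thesis using that by (simp add: l_def)
      qed
      show "stick_rest v m \<le> \<rho>" using False by simp
      show "\<epsilon> < stick_rest v K" by (rule tail)
    qed
    moreover have "l \<in> PiE {..<m} (\<lambda>_. {..<K})" "\<kappa> \<in> PiE {..<K} (\<lambda>_. {..<m})" "\<forall>j<K. l (\<kappa> j) = j"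
      using l0K k0 by (auto simp: l_def \<kappa>_def)
    ultimately show ?thesis unfolding cover_def by blast
  qed
qed

lemma emeasure_cover:
  fixes P0 :: "'a measure"
  assumes \<alpha>: "\<alpha> > 0" and a: "0 < a0" "a0 < \<alpha>"
    and P0: "prob_space P0" "sets P0 = sets borel"
    and b: "b \<ge> 1" "\<And>x r. r \<ge> 0 \<Longrightarrow> emeasure P0 (cball x r) \<le> ennreal (b * r ^ DIM('a))"
    and K: "K \<ge> 1" and ws: "\<And>j. j < K \<Longrightarrow> ws j > 0" and m: "m > 0"
  shows "\<exists>C\<ge>0. \<forall>\<rho> \<epsilon>. 0 < \<rho> \<longrightarrow> 2 * \<rho> \<le> \<epsilon> \<longrightarrow> \<epsilon> \<le> 1 \<longrightarrow>
    emeasure (stick_prior \<alpha> \<Otimes>\<^sub>M PiM UNIV (\<lambda>_. P0)) (cover m ws \<rho> \<epsilon>)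
      \<le> ennreal (C * (\<rho> ^ (DIM('a) * K + K - 1) * \<rho> powr a0 * sqrt (\<rho> / \<epsilon>)))"
proof -
  define I where "I = {(l, \<kappa>). l \<in> PiE {..<m} (\<lambda>_. {..<K}) \<and> \<kappa> \<in> PiE {..<K} (\<lambda>_. {..<m}) \<and> (\<forall>j<K. l (\<kappa> j) = j)}"
  let ?c = "(MIN j\<in>{..<K}. ws j) / (2 * m)"
  let ?N = "stick_prior \<alpha> \<Otimes>\<^sub>M PiM UNIV (\<lambda>_::nat. P0)"
  have S: "sets (PiM UNIV (\<lambda>_::nat. P0)) = sets (PiM UNIV (\<lambda>_. borel))"
    by (rule sets_PiM_borel) (rule P0)
  have sN: "sets ?N = sets (PiM UNIV (\<lambda>_. borel) \<Otimes>\<^sub>M PiM UNIV (\<lambda>_. borel :: 'a measure))"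
    by (rule sets_pair_measure_cong[OF sets_stick_prior S])
  have c: "?c > 0"
  proof -
    have "{..<K} \<noteq> {}" using K by (auto simp: lessThan_empty_iff)
    then have "(MIN j\<in>{..<K}. ws j) > 0" using ws by (subst Min_gr_iff) auto
    then show ?thesis using m by simp
  qed
  have ex: "\<forall>i\<in>I. \<exists>C. C \<ge> 0 \<and> (\<forall>B \<rho> \<epsilon>. 0 < B \<longrightarrow> 0 < \<rho> \<longrightarrow> 2 * \<rho> \<le> \<epsilon> \<longrightarrow> \<epsilon> \<le> 1 \<longrightarrow>
    emeasure ?N (cluster_event K m (fst i) (snd i) ws \<theta>s ?c B \<rho> \<epsilon>)
      \<le> ennreal (C * (B ^ (DIM('a) * K + K - 1) * \<rho> powr a0 * sqrt (B / \<epsilon>))))"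
  proof
    fix i assume i: "i \<in> I"
    have "\<exists>C\<ge>0. \<forall>B \<rho> \<epsilon>. 0 < B \<longrightarrow> 0 < \<rho> \<longrightarrow> 2 * \<rho> \<le> \<epsilon> \<longrightarrow> \<epsilon> \<le> 1 \<longrightarrow>
      emeasure ?N (cluster_event K m (fst i) (snd i) ws \<theta>s ?c B \<rho> \<epsilon>)
      \<le> ennreal (C * (B ^ (DIM('a) * K + K - 1) * \<rho> powr a0 * sqrt (B / \<epsilon>)))"
      by (rule emeasure_cluster_event[OF \<alpha> a P0 b K _ c]) (use i in \<open>auto simp: I_def PiE_iff\<close>)
    then show "\<exists>C. C \<ge> 0 \<and> (\<forall>B \<rho> \<epsilon>. 0 < B \<longrightarrow> 0 < \<rho> \<longrightarrow> 2 * \<rho> \<le> \<epsilon> \<longrightarrow> \<epsilon> \<le> 1 \<longrightarrow>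
      emeasure ?N (cluster_event K m (fst i) (snd i) ws \<theta>s ?c B \<rho> \<epsilon>)
      \<le> ennreal (C * (B ^ (DIM('a) * K + K - 1) * \<rho> powr a0 * sqrt (B / \<epsilon>))))" by blast
  qed
  from bchoice[OF ex] obtain C where C: "\<And>i. i \<in> I \<Longrightarrow> C i \<ge> 0"
    "\<And>i B \<rho> \<epsilon>. i \<in> I \<Longrightarrow> 0 < B \<Longrightarrow> 0 < \<rho> \<Longrightarrow> 2 * \<rho> \<le> \<epsilon> \<Longrightarrow> \<epsilon> \<le> 1 \<Longrightarrow>
      emeasure ?N (cluster_event K m (fst i) (snd i) ws \<theta>s ?c B \<rho> \<epsilon>)
      \<le> ennreal (C i * (B ^ (DIM('a) * K + K - 1) * \<rho> powr a0 * sqrt (B / \<epsilon>)))" by blast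
  have fin: "finite I" unfolding I_def by (rule finite_cover_index)
  have "emeasure ?N (cover m ws \<rho> \<epsilon>)
      \<le> ennreal ((\<Sum>i\<in>I. C i) * (Bc ^ (DIM('a) * K + K - 1) * sqrt Bc) * (\<rho> ^ (DIM('a) * K + K - 1) * \<rho> powr a0 * sqrt (\<rho> / \<epsilon>)))"
    if \<rho>: "0 < \<rho>" and \<epsilon>: "2 * \<rho> \<le> \<epsilon>" "\<epsilon> \<le> 1" for \<rho> \<epsilon>
  proof -
    let ?X = "(Bc * \<rho>) ^ (DIM('a) * K + K - 1) * \<rho> powr a0 * sqrt (Bc * \<rho> / \<epsilon>)"
    have B: "Bc * \<rho> > 0" using Bc_pos \<rho> by simp
    have X: "?X \<ge> 0" using B \<rho> \<epsilon> by auto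
    have "emeasure ?N (cover m ws \<rho> \<epsilon>) = emeasure ?N (\<Union>i\<in>I. cluster_event K m (fst i) (snd i) ws \<theta>s ?c (Bc * \<rho>) \<rho> \<epsilon>)"
      unfolding cover_def I_def by (simp add: split_beta)
    also have "\<dots> \<le> (\<Sum>i\<in>I. emeasure ?N (cluster_event K m (fst i) (snd i) ws \<theta>s ?c (Bc * \<rho>) \<rho> \<epsilon>))"
      by (intro emeasure_subadditive_finite fin) (auto simp: sN)
    also have "\<dots> \<le> (\<Sum>i\<in>I. ennreal (C i * ?X))"
      using C B \<rho> \<epsilon> by (intro sum_mono) auto
    also have "\<dots> = ennreal ((\<Sum>i\<in>I. C i) * ?X)"
      using C X by (simp only: sum_distrib_right) (intro sum_ennreal, auto intro!: mult_nonneg_nonneg)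
    also have "(\<Sum>i\<in>I. C i) * ?X = (\<Sum>i\<in>I. C i) * (Bc ^ (DIM('a) * K + K - 1) * sqrt Bc) * (\<rho> ^ (DIM('a) * K + K - 1) * \<rho> powr a0 * sqrt (\<rho> / \<epsilon>))"
      by (simp add: power_mult_distrib real_sqrt_mult real_sqrt_divide)
    finally show ?thesis .
  qed
  moreover have "(\<Sum>i\<in>I. C i) * (Bc ^ (DIM('a) * K + K - 1) * sqrt Bc) \<ge> 0"
    using C(1) Bc_pos by (intro mult_nonneg_nonneg sum_nonneg) auto
  ultimately show ?thesis by blast
qed

end

section \<open>Likelihood ratios and tests\<close>

locale mixture_model = kernel f for f :: "'a::euclidean_space \<Rightarrow> real" +
  fixes F :: real and K :: nat and ws :: "nat \<Rightarrow> real" and \<theta>s :: "nat \<Rightarrow> 'a"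
  assumes f_le: "\<And>x. f x \<le> F"
    and ws_pos: "\<And>k. k < K \<Longrightarrow> ws k > 0" and ws_sum: "(\<Sum>k<K. ws k) = 1"
begin

definition ps :: "'a \<Rightarrow> real" where
  "ps x = (\<Sum>k<K. ws k * f (x - \<theta>s k))"

definition Q :: "'a measure" where
  "Q = density lborel (\<lambda>x. ennreal (ps x))"

text \<open>The mixture density with values in \<open>ennreal\<close>: Tonelli then applies to sums,
  parameters and data before any summability is known.\<close>

definition nmix :: "(nat \<Rightarrow> real) \<Rightarrow> (nat \<Rightarrow> 'a) \<Rightarrow> 'a \<Rightarrow> ennreal" where
  "nmix w \<theta> x = (\<Sum>k. ennreal (w k) * ennreal (f (x - \<theta> k)))"

definition LR :: "nat \<Rightarrow> ('a \<Rightarrow> ennreal) \<Rightarrow> (nat \<Rightarrow> 'a) \<Rightarrow> ennreal" where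
  "LR n u X = (\<Prod>i<n. u (X i) * ennreal (1 / ps (X i)))"

lemma K_pos: "K \<ge> 1"
  using ws_sum by (cases K) auto

lemma ps_pos: "ps x > 0"
  unfolding ps_def using ws_pos f_pos K_pos by (intro sum_pos) (auto simp: lessThan_empty_iff)

lemma ps_meas[measurable]: "ps \<in> borel_measurable borel"
  unfolding ps_def by measurable

lemma sets_Q[measurable_cong, simp]: "sets Q = sets borel"
  by (simp add: Q_def)

lemma space_Q[simp]: "space Q = UNIV"
  by (simp add: Q_def)

lemma nn_integral_f_shift: "(\<integral>\<^sup>+x. ennreal (f (x - \<theta>)) \<partial>lborel) = 1"
  using nn_integral_lborel_shift[of "\<lambda>x. ennreal (f x)" \<theta>] f_nn by simp

lemma nn_integral_ps: "(\<integral>\<^sup>+x. ennreal (ps x) \<partial>lborel) = 1"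
proof -
  have "(\<integral>\<^sup>+x. ennreal (ps x) \<partial>lborel) = (\<integral>\<^sup>+x. (\<Sum>k<K. ennreal (ws k) * ennreal (f (x - \<theta>s k))) \<partial>lborel)"
  proof (intro nn_integral_cong)
    fix x
    have "(\<Sum>k<K. ennreal (ws k) * ennreal (f (x - \<theta>s k))) = (\<Sum>k<K. ennreal (ws k * f (x - \<theta>s k)))"
      using ws_pos f_pos by (intro sum.cong) (auto simp: ennreal_mult less_imp_le)
    also have "\<dots> = ennreal (ps x)"
      unfolding ps_def using ws_pos f_pos by (intro sum_ennreal) (auto simp: less_imp_le)
    finally show "ennreal (ps x) = (\<Sum>k<K. ennreal (ws k) * ennreal (f (x - \<theta>s k)))" by simp
  qed
  also have "\<dots> = (\<Sum>k<K. ennreal (ws k))"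
    by (simp add: nn_integral_sum nn_integral_cmult nn_integral_f_shift)
  also have "\<dots> = 1" using ws_pos ws_sum by (subst sum_ennreal) (auto simp: less_imp_le)
  finally show ?thesis .
qed

lemma prob_space_Q: "prob_space Q"
  by standard (simp add: Q_def emeasure_density nn_integral_ps)

lemma mixture_discrete:
  assumes \<theta>: "\<theta> \<in> measurable (count_space I) borel"
  shows "mixture (discrete_measure I w \<theta>) f x = enn2real (\<integral>\<^sup>+k. ennreal (w k) * ennreal (f (x - \<theta> k)) \<partial>count_space I)"
proof -
  have "mixture (discrete_measure I w \<theta>) f x = (\<integral>k. f (x - \<theta> k) \<partial>density (count_space I) (\<lambda>k. ennreal (w k)))"
    unfolding mixture_def discrete_measure_def using \<theta> by (subst integral_distr) auto
  also have "\<dots> = enn2real (\<integral>\<^sup>+k. ennreal (f (x - \<theta> k)) \<partial>density (count_space I) (\<lambda>k. ennreal (w k)))"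
    using f_pos by (intro integral_eq_nn_integral) (auto simp: less_imp_le)
  also have "(\<integral>\<^sup>+k. ennreal (f (x - \<theta> k)) \<partial>density (count_space I) (\<lambda>k. ennreal (w k))) =
     (\<integral>\<^sup>+k. ennreal (w k) * ennreal (f (x - \<theta> k)) \<partial>count_space I)"
    by (subst nn_integral_density) auto
  finally show ?thesis .
qed

text \<open>This holds for arbitrary weights: where the series diverges, the Bochner integral and
  \<open>enn2real\<close> of infinity both have the default value 0.\<close>

lemma mixture_nmix: "mixture (discrete_measure UNIV w \<theta>) f x = enn2real (nmix w \<theta> x)"
  by (subst mixture_discrete) (auto simp: nmix_def nn_integral_count_space_nat)

lemma mixture_ps: "mixture (discrete_measure {..<K} ws \<theta>s) f x = ps x"
proof -
  have "(\<integral>\<^sup>+k. ennreal (ws k) * ennreal (f (x - \<theta>s k)) \<partial>count_space {..<K}) =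
     (\<Sum>k<K. ennreal (ws k * f (x - \<theta>s k)))"
    using ws_pos f_pos
    by (subst nn_integral_count_space_finite) (auto simp: ennreal_mult less_imp_le intro!: sum.cong)
  also have "\<dots> = ennreal (ps x)"
    unfolding ps_def using ws_pos f_pos by (intro sum_ennreal) (auto simp: less_imp_le)
  finally show ?thesis using ps_pos[of x] by (subst mixture_discrete) auto
qed

lemma nmix_meas[measurable]: "nmix w \<theta> \<in> borel_measurable borel"
  unfolding nmix_def[abs_def] by measurable

lemma nmix_eq:
  assumes w: "\<And>k. 0 \<le> w k" "w sums 1"
  shows "nmix w \<theta> x = ennreal (\<Sum>k. w k * f (x - \<theta> k))" "summable (\<lambda>k. w k * f (x - \<theta> k))"
    "(\<Sum>k. w k * f (x - \<theta> k)) \<le> F"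
proof -
  have sw: "summable w" using w by (simp add: sums_iff)
  have le: "w k * f (x - \<theta> k) \<le> F * w k" for k
    using mult_left_mono[OF f_le[of "x - \<theta> k"] w(1)[of k]] by (simp add: mult.commute)
  have nn: "0 \<le> w k * f (x - \<theta> k)" for k using w f_pos by (simp add: less_imp_le)
  show s: "summable (\<lambda>k. w k * f (x - \<theta> k))"
    using le nn by (intro summable_comparison_test'[OF summable_mult[OF sw, of F]]) auto
  show "nmix w \<theta> x = ennreal (\<Sum>k. w k * f (x - \<theta> k))"
    unfolding nmix_def using w f_pos nn s
    by (subst suminf_ennreal2[symmetric]) (auto simp: ennreal_mult less_imp_le)
  have "(\<Sum>k. w k * f (x - \<theta> k)) \<le> (\<Sum>k. F * w k)"
    by (intro suminf_le le s summable_mult sw)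
  also have "\<dots> = F" using w sw by (simp add: suminf_mult sums_iff)
  finally show "(\<Sum>k. w k * f (x - \<theta> k)) \<le> F" .
qed

lemma suminf_weights:
  assumes w: "\<And>k. 0 \<le> w k" "w sums 1" shows "(\<Sum>k. ennreal (w k)) = 1"
  using w by (subst suminf_ennreal2) (auto simp: sums_iff)

lemma nn_integral_nmix:
  assumes w: "\<And>k. 0 \<le> w k" "w sums 1"
  shows "(\<integral>\<^sup>+x. nmix w \<theta> x \<partial>lborel) = 1"
proof -
  have "(\<integral>\<^sup>+x. nmix w \<theta> x \<partial>lborel) = (\<Sum>k. (\<integral>\<^sup>+x. ennreal (w k) * ennreal (f (x - \<theta> k)) \<partial>lborel))"
    unfolding nmix_def by (intro nn_integral_suminf) auto
  also have "\<dots> = (\<Sum>k. ennreal (w k))"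
    by (simp add: nn_integral_cmult nn_integral_f_shift)
  also have "\<dots> = 1" using w by (rule suminf_weights)
  finally show ?thesis .
qed

text \<open>Adding \<open>B\<close> makes the test function nonnegative, so that sum and integral
  may be exchanged by monotone convergence; the constant is subtracted again at the end, the weights
  having sum 1.\<close>

lemma integral_nmix:
  assumes w: "\<And>k. 0 \<le> w k" "w sums 1"
    and g[measurable]: "g \<in> borel_measurable borel" and B: "\<And>x. \<bar>g x\<bar> \<le> B"
    and H: "\<And>\<theta>. (\<integral>x. g x * f (x - \<theta>) \<partial>lborel) = H \<theta>"
  shows "(\<integral>x. g x \<partial>density lborel (nmix w \<theta>)) = (\<Sum>k. w k * H (\<theta> k))"
proof -
  let ?N = "density lborel (nmix w \<theta>)"
  interpret N: prob_space ?N
    by standard (simp add: emeasure_density nn_integral_nmix[OF w])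
  have gB: "0 \<le> g x + B" for x using B[of x] by linarith
  have ig: "integrable ?N g" by (intro N.integrable_const_bound[of _ B]) (auto simp: B)
  have HB: "(\<integral>\<^sup>+x. ennreal (g x + B) * ennreal (f (x - t)) \<partial>lborel) = ennreal (H t + B)" "0 \<le> H t + B" "H t \<le> B" for t
  proof -
    have i: "integrable lborel (\<lambda>x. g x * f (x - t))" by (rule f_bdd_integrable[OF g B])
    have eq: "(\<integral>x. (g x + B) * f (x - t) \<partial>lborel) = H t + B"
      using i f_shift_integrable[of t] H[of t] integral_lborel_shift[of f t] f_integral by (simp add: distrib_right)
    have nn: "0 \<le> (g x + B) * f (x - t)" for x using gB f_pos by (simp add: less_imp_le)
    have "(\<integral>\<^sup>+x. ennreal (g x + B) * ennreal (f (x - t)) \<partial>lborel) = (\<integral>\<^sup>+x. ennreal ((g x + B) * f (x - t)) \<partial>lborel)"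
      using gB f_pos by (intro nn_integral_cong) (simp add: ennreal_mult less_imp_le)
    also have "\<dots> = ennreal (\<integral>x. (g x + B) * f (x - t) \<partial>lborel)"
      using i f_shift_integrable[of t] nn by (intro nn_integral_eq_integral) (auto simp: distrib_right)
    finally show "(\<integral>\<^sup>+x. ennreal (g x + B) * ennreal (f (x - t)) \<partial>lborel) = ennreal (H t + B)" by (simp add: eq)
    show "0 \<le> H t + B" unfolding eq[symmetric] using nn by (intro integral_nonneg_AE) auto
    have "H t \<le> (\<integral>x. B * f (x - t) \<partial>lborel)"
      unfolding H[symmetric]
    proof (intro integral_mono i integrable_mult_right f_shift_integrable mult_right_mono)
      show "g x \<le> B" for x using B[of x] by linarith
    qed (use f_pos in \<open>auto simp: less_imp_le\<close>)
    then show "H t \<le> B" using integral_lborel_shift[of f t] f_integral by simp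
  qed
  have sw: "summable w" using w by (simp add: sums_iff)
  have sHB: "summable (\<lambda>k. w k * (H (\<theta> k) + B))"
  proof (rule summable_comparison_test'[OF summable_mult[OF sw, of "2 * B"]])
    show "norm (w k * (H (\<theta> k) + B)) \<le> 2 * B * w k" for k
      using mult_left_mono[of "H (\<theta> k) + B" "2 * B" "w k"] HB(2,3)[of "\<theta> k"] w(1)[of k] by (simp add: abs_mult mult_ac)
  qed
  have "(\<integral>\<^sup>+x. ennreal (g x + B) \<partial>?N) = (\<integral>\<^sup>+x. (\<Sum>k. ennreal (w k) * (ennreal (g x + B) * ennreal (f (x - \<theta> k)))) \<partial>lborel)"
    by (subst nn_integral_density) (auto simp: nmix_def ennreal_suminf_multc[symmetric] ennreal_suminf_cmult[symmetric] mult_ac intro!: nn_integral_cong)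
  also have "\<dots> = (\<Sum>k. (\<integral>\<^sup>+x. ennreal (w k) * (ennreal (g x + B) * ennreal (f (x - \<theta> k))) \<partial>lborel))"
    by (intro nn_integral_suminf) auto
  also have "\<dots> = (\<Sum>k. ennreal (w k * (H (\<theta> k) + B)))"
    using w HB by (simp add: nn_integral_cmult ennreal_mult)
  also have "\<dots> = ennreal (\<Sum>k. w k * (H (\<theta> k) + B))"
    using w HB(2) sHB by (intro suminf_ennreal2) auto
  finally have e: "(\<integral>\<^sup>+x. ennreal (g x + B) \<partial>?N) = ennreal (\<Sum>k. w k * (H (\<theta> k) + B))" .
  have "0 \<le> (\<Sum>k. w k * (H (\<theta> k) + B))"
    using w HB(2) by (intro suminf_nonneg sHB) auto
  then have "(\<integral>x. g x + B \<partial>?N) = (\<Sum>k. w k * (H (\<theta> k) + B))"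
    using gB e by (subst integral_eq_nn_integral) auto
  moreover have "(\<integral>x. g x + B \<partial>?N) = (\<integral>x. g x \<partial>?N) + B"
    using ig N.prob_space by simp
  moreover have "(\<Sum>k. w k * (H (\<theta> k) + B)) = (\<Sum>k. w k * H (\<theta> k)) + B"
  proof -
    have sH: "summable (\<lambda>k. w k * H (\<theta> k))"
      using summable_diff[OF sHB summable_mult[OF sw, of B]] by (simp add: algebra_simps)
    have "(\<Sum>k. w k * (H (\<theta> k) + B)) = (\<Sum>k. w k * H (\<theta> k) + B * w k)" by (simp add: algebra_simps)
    also have "\<dots> = (\<Sum>k. w k * H (\<theta> k)) + (\<Sum>k. B * w k)"
      using suminf_add[OF sH summable_mult[OF sw, of B]] by simp
    also have "(\<Sum>k. B * w k) = B" using w sw by (simp add: suminf_mult sums_iff)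
    finally show ?thesis .
  qed
  ultimately show ?thesis by simp
qed

lemma integral_ps:
  assumes g[measurable]: "g \<in> borel_measurable borel" and B: "\<And>x. \<bar>g x\<bar> \<le> B"
    and H: "\<And>\<theta>. (\<integral>x. g x * f (x - \<theta>) \<partial>lborel) = H \<theta>"
  shows "(\<integral>x. g x \<partial>Q) = (\<Sum>k<K. ws k * H (\<theta>s k))"
proof -
  have "(\<integral>x. g x \<partial>Q) = (\<integral>x. ps x * g x \<partial>lborel)"
    unfolding Q_def using ps_pos by (subst integral_density) (auto simp: less_imp_le)
  also have "\<dots> = (\<integral>x. (\<Sum>k<K. ws k * (g x * f (x - \<theta>s k))) \<partial>lborel)"
    unfolding ps_def by (simp add: sum_distrib_left sum_distrib_right mult_ac)
  also have "\<dots> = (\<Sum>k<K. ws k * H (\<theta>s k))"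
    using f_bdd_integrable[OF g B] by (subst Bochner_Integration.integral_sum) (auto simp: H)
  finally show ?thesis .
qed

section \<open>Change of measure and exponential tests\<close>

lemma LR_meas[measurable]:
  assumes [measurable]: "u \<in> borel_measurable borel"
  shows "LR n u \<in> borel_measurable (PiM UNIV (\<lambda>_. Q))"
  unfolding LR_def[abs_def] by measurable

text \<open>The true density cancels: weighting with \<open>LR n u\<close> turns the first n
  observations into a sample from the density \<open>u\<close>, and independence gives the
  power.\<close>

lemma nn_integral_LR_prod:
  assumes [measurable]: "u \<in> borel_measurable borel" "h \<in> borel_measurable borel"
  shows "(\<integral>\<^sup>+X. LR n u X * (\<Prod>i<n. h (X i)) \<partial>PiM UNIV (\<lambda>_. Q)) = (\<integral>\<^sup>+x. u x * h x \<partial>lborel) ^ n"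
proof -
  have "(\<integral>\<^sup>+X. LR n u X * (\<Prod>i<n. h (X i)) \<partial>PiM UNIV (\<lambda>_. Q)) =
    (\<integral>\<^sup>+X. (\<Prod>i<n. u (X i) * ennreal (1 / ps (X i)) * h (X i)) \<partial>PiM UNIV (\<lambda>_. Q))"
    unfolding LR_def by (simp add: prod.distrib)
  also have "\<dots> = (\<Prod>i<n. (\<integral>\<^sup>+x. u x * ennreal (1 / ps x) * h x \<partial>Q))"
    by (intro nn_integral_PiM_prod prob_space_Q) auto
  also have "(\<integral>\<^sup>+x. u x * ennreal (1 / ps x) * h x \<partial>Q) = (\<integral>\<^sup>+x. u x * h x \<partial>lborel)"
    unfolding Q_def
  proof (subst nn_integral_density)
    show "(\<integral>\<^sup>+x. ennreal (ps x) * (u x * ennreal (1 / ps x) * h x) \<partial>lborel) = (\<integral>\<^sup>+x. u x * h x \<partial>lborel)"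
    proof (intro nn_integral_cong)
      fix x
      have "ennreal (ps x) * ennreal (1 / ps x) = 1" using ps_pos[of x] by (simp add: ennreal_mult[symmetric])
      then show "ennreal (ps x) * (u x * ennreal (1 / ps x) * h x) = u x * h x"
        by (metis (no_types, lifting) mult.commute mult.left_commute mult_1)
    qed
  qed auto
  finally show ?thesis by simp
qed

lemma nn_integral_LR:
  assumes "u \<in> borel_measurable borel" "(\<integral>\<^sup>+x. u x \<partial>lborel) = 1"
  shows "(\<integral>\<^sup>+X. LR n u X \<partial>PiM UNIV (\<lambda>_. Q)) = 1"
  using nn_integral_LR_prod[OF assms(1), of "\<lambda>_. 1" n] assms(2) by simp

text \<open>Through this identity the tests for an alternative density also apply to the truth
  itself.\<close>

lemma LR_ps: "LR n (\<lambda>x. ennreal (ps x)) X = 1"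
proof -
  have "ennreal (ps x) * ennreal (1 / ps x) = 1" for x
    using ps_pos[of x] by (simp add: ennreal_mult[symmetric])
  then show ?thesis by (simp add: LR_def)
qed

text \<open>The Chernoff bound under the density \<open>u\<close>, written as a likelihood ratio
  integral under the truth, with the moment generating function bounded by Hoeffding's
  lemma.\<close>

lemma exponential_test:
  assumes u[measurable]: "u \<in> borel_measurable borel" and u1: "(\<integral>\<^sup>+x. u x \<partial>lborel) = 1"
    and g[measurable]: "g \<in> borel_measurable borel" and B: "\<And>x. \<bar>g x\<bar> \<le> B" "B > 0" and s: "s > 0"
  shows "(\<integral>\<^sup>+X. indicator {X. real n * ((\<integral>x. g x \<partial>density lborel u) + s) \<le> (\<Sum>i<n. g (X i))} X * LR n u X \<partial>PiM UNIV (\<lambda>_. Q))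
    \<le> ennreal (exp (- (real n * s\<^sup>2 / (2 * B\<^sup>2))))"
proof -
  let ?N = "density lborel u"
  let ?e = "\<integral>x. g x \<partial>?N"
  interpret N: prob_space ?N by standard (simp add: emeasure_density u1)
  interpret H: interval_bounded_random_variable ?N g "- B" B
  proof
    show "AE x in ?N. g x \<in> {- B..B}" using B(1) by (intro always_eventually allI) (auto simp: abs_le_iff minus_le_iff)
  qed auto
  \<comment> \<open>This minimises -lam s + lam^2 B^2 / 2, with minimum -s^2 / (2 B^2).\<close>
  define lam where "lam = s / B\<^sup>2"
  have lam: "lam > 0" using s B by (simp add: lam_def)
  define h where "h x = ennreal (exp (lam * (g x - ?e - s)))" for x
  have [measurable]: "h \<in> borel_measurable borel" unfolding h_def by measurable
  have "(\<integral>\<^sup>+X. indicator {X. real n * (?e + s) \<le> (\<Sum>i<n. g (X i))} X * LR n u X \<partial>PiM UNIV (\<lambda>_. Q))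
    \<le> (\<integral>\<^sup>+X. LR n u X * (\<Prod>i<n. h (X i)) \<partial>PiM UNIV (\<lambda>_. Q))"
  proof (intro nn_integral_mono)
    fix X :: "nat \<Rightarrow> 'a"
    have "(\<Prod>i<n. h (X i)) = ennreal (exp (lam * ((\<Sum>i<n. g (X i)) - real n * (?e + s))))"
      unfolding h_def by (subst prod_ennreal) (auto simp: exp_sum[symmetric] sum_distrib_left[symmetric] sum_subtractf algebra_simps)
    then have "indicator {X. real n * (?e + s) \<le> (\<Sum>i<n. g (X i))} X \<le> (\<Prod>i<n. h (X i))"
      using lam by (auto simp: indicator_def intro!: ennreal_leI[of 1, simplified] mult_nonneg_nonneg)
    then show "indicator {X. real n * (?e + s) \<le> (\<Sum>i<n. g (X i))} X * LR n u X \<le> LR n u X * (\<Prod>i<n. h (X i))"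
      by (subst mult.commute) (auto intro!: mult_left_mono)
  qed
  also have "\<dots> = (\<integral>\<^sup>+x. u x * h x \<partial>lborel) ^ n" by (rule nn_integral_LR_prod) auto
  also have "(\<integral>\<^sup>+x. u x * h x \<partial>lborel) = (\<integral>\<^sup>+x. h x \<partial>?N)"
    by (subst nn_integral_density) auto
  also have "(\<integral>\<^sup>+x. h x \<partial>?N) = ennreal (exp (- (lam * s))) * (\<integral>\<^sup>+x. ennreal (exp (lam * (g x - ?e))) \<partial>?N)"
    unfolding h_def
    by (subst nn_integral_cmult[symmetric]) (auto simp: ennreal_mult[symmetric] exp_add[symmetric] algebra_simps)
  also have "(\<integral>\<^sup>+x. ennreal (exp (lam * (g x - ?e))) \<partial>?N) \<le> ennreal (exp (lam\<^sup>2 * (B - - B)\<^sup>2 / 8))"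
    by (rule H.Hoeffdings_lemma_nn_integral[OF lam])
  finally have "(\<integral>\<^sup>+X. indicator {X. real n * (?e + s) \<le> (\<Sum>i<n. g (X i))} X * LR n u X \<partial>PiM UNIV (\<lambda>_. Q))
    \<le> (ennreal (exp (- (lam * s))) * ennreal (exp (lam\<^sup>2 * (B - - B)\<^sup>2 / 8))) ^ n"
    by (simp add: mult_left_mono power_mono)
  also have "\<dots> = ennreal (exp (real n * (- (lam * s) + lam\<^sup>2 * (B - - B)\<^sup>2 / 8)))"
    by (simp add: ennreal_mult[symmetric] ennreal_power exp_add[symmetric] exp_of_nat_mult[symmetric])
  also have "- (lam * s) + lam\<^sup>2 * (B - - B)\<^sup>2 / 8 = - (s\<^sup>2 / (2 * B\<^sup>2))"
    using B unfolding lam_def by (simp add: field_simps power2_eq_square)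
  finally show ?thesis by simp
qed

text \<open>One event for all alternatives at once: the averages of the finitely many test functions
  are within t / 2 of their true means.\<close>

definition good :: "'i set \<Rightarrow> ('i \<Rightarrow> 'a \<Rightarrow> real) \<Rightarrow> nat \<Rightarrow> real \<Rightarrow> (nat \<Rightarrow> 'a) set" where
  "good L g n t = {X. \<forall>l\<in>L. \<bar>(\<Sum>i<n. g l (X i)) - real n * (\<integral>x. g l x \<partial>Q)\<bar> < real n * (t / 2)}"

lemma sets_good[measurable]:
  assumes "finite L" "\<And>l. l \<in> L \<Longrightarrow> g l \<in> borel_measurable borel"
  shows "good L g n t \<in> sets (PiM UNIV (\<lambda>_. Q))"
proof -
  note [measurable] = assms(2)
  have "good L g n t = {X \<in> space (PiM UNIV (\<lambda>_. Q)). \<forall>l\<in>L. \<bar>(\<Sum>i<n. g l (X i)) - real n * (\<integral>x. g l x \<partial>Q)\<bar> < real n * (t / 2)}"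
    by (auto simp: good_def space_PiM)
  also have "\<dots> \<in> sets (PiM UNIV (\<lambda>_. Q))" using assms(1) by measurable
  finally show ?thesis .
qed

text \<open>The left side is the probability of \<open>good\<close> under sampling from
  \<open>u\<close>. If one mean under \<open>u\<close> is off by more than \<open>t\<close>,
  averages close to the true mean are at least t / 2 away from the mean under \<open>u\<close>; the
  direction of the shift decides whether \<open>g l\<close> or its negative is tested.\<close>

lemma test_power:
  assumes u[measurable]: "u \<in> borel_measurable borel" and u1: "(\<integral>\<^sup>+x. u x \<partial>lborel) = 1"
    and g[measurable]: "g l \<in> borel_measurable borel" and B: "\<And>x. \<bar>g l x\<bar> \<le> B" "B > 0" and t: "t > 0"
    and l: "l \<in> L" and sep: "\<bar>(\<integral>x. g l x \<partial>density lborel u) - (\<integral>x. g l x \<partial>Q)\<bar> > t"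
  shows "(\<integral>\<^sup>+X. indicator (good L g n t) X * LR n u X \<partial>PiM UNIV (\<lambda>_. Q)) \<le> ennreal (exp (- (real n * t\<^sup>2 / (8 * B\<^sup>2))))"
proof -
  let ?e = "\<integral>x. g l x \<partial>density lborel u" and ?q = "\<integral>x. g l x \<partial>Q"
  have eq: "real n * (t / 2)\<^sup>2 / (2 * B\<^sup>2) = real n * t\<^sup>2 / (8 * B\<^sup>2)" by (simp add: power_divide)
  show ?thesis
  proof (cases "?e + t < ?q")
    case True
    have "indicator (good L g n t) X \<le> (indicator {X. real n * (?e + t / 2) \<le> (\<Sum>i<n. g l (X i))} X :: ennreal)" for X
    proof (cases "X \<in> good L g n t")
      case 1: True
      then have "\<bar>(\<Sum>i<n. g l (X i)) - real n * ?q\<bar> < real n * (t / 2)" using l by (auto simp: good_def)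
      then have "real n * ?q - real n * (t / 2) \<le> (\<Sum>i<n. g l (X i))" by linarith
      moreover have "real n * (?e + t / 2) \<le> real n * (?q - t / 2)" using True by (intro mult_left_mono) auto
      ultimately have "real n * (?e + t / 2) \<le> (\<Sum>i<n. g l (X i))" by (simp add: right_diff_distrib)
      then show ?thesis using 1 by simp
    qed simp
    then have "(\<integral>\<^sup>+X. indicator (good L g n t) X * LR n u X \<partial>PiM UNIV (\<lambda>_. Q)) \<le>
      (\<integral>\<^sup>+X. indicator {X. real n * (?e + t / 2) \<le> (\<Sum>i<n. g l (X i))} X * LR n u X \<partial>PiM UNIV (\<lambda>_. Q))"
      by (intro nn_integral_mono mult_right_mono) auto
    also have "\<dots> \<le> ennreal (exp (- (real n * (t / 2)\<^sup>2 / (2 * B\<^sup>2))))"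
      using t by (intro exponential_test u u1 g B) auto
    finally show ?thesis unfolding eq .
  next
    case False
    then have T: "?q + t < ?e" using sep by linarith
    have e: "(\<integral>x. - g l x \<partial>density lborel u) = - ?e" by simp
    have "indicator (good L g n t) X \<le> (indicator {X. real n * (- ?e + t / 2) \<le> (\<Sum>i<n. - g l (X i))} X :: ennreal)" for X
    proof (cases "X \<in> good L g n t")
      case 1: True
      then have "\<bar>(\<Sum>i<n. g l (X i)) - real n * ?q\<bar> < real n * (t / 2)" using l by (auto simp: good_def)
      then have "(\<Sum>i<n. g l (X i)) \<le> real n * ?q + real n * (t / 2)" by linarith
      moreover have "real n * (?q + t / 2) \<le> real n * (?e - t / 2)" using T by (intro mult_left_mono) auto
      ultimately have "real n * (- ?e + t / 2) \<le> (\<Sum>i<n. - g l (X i))" by (simp add: algebra_simps sum_negf)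
      then show ?thesis using 1 by simp
    qed simp
    then have "(\<integral>\<^sup>+X. indicator (good L g n t) X * LR n u X \<partial>PiM UNIV (\<lambda>_. Q)) \<le>
      (\<integral>\<^sup>+X. indicator {X. real n * (- ?e + t / 2) \<le> (\<Sum>i<n. - g l (X i))} X * LR n u X \<partial>PiM UNIV (\<lambda>_. Q))"
      by (intro nn_integral_mono mult_right_mono) auto
    also have "\<dots> \<le> ennreal (exp (- (real n * (t / 2)\<^sup>2 / (2 * B\<^sup>2))))"
      using exponential_test[OF u u1, of "\<lambda>x. - g l x" B "t / 2" n] B t unfolding e by simp
    finally show ?thesis unfolding eq .
  qed
qed

text \<open>The exponential bound with likelihood ratio 1, applied to each test function and to its
  negative, whence the factor 2.\<close>

lemma test_level:
  assumes L: "finite L" and g[measurable]: "\<And>l. l \<in> L \<Longrightarrow> g l \<in> borel_measurable borel"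
    and B: "\<And>l x. l \<in> L \<Longrightarrow> \<bar>g l x\<bar> \<le> B" "B > 0" and t: "t > 0"
  shows "emeasure (PiM UNIV (\<lambda>_. Q)) (- good L g n t) \<le> ennreal (2 * real (card L) * exp (- (real n * t\<^sup>2 / (8 * B\<^sup>2))))"
proof -
  let ?P = "PiM UNIV (\<lambda>_::nat. Q)"
  let ?q = "\<lambda>l. \<integral>x. g l x \<partial>Q"
  let ?A = "\<lambda>l. {X. real n * (?q l + t / 2) \<le> (\<Sum>i<n. g l (X i))}"
  let ?B = "\<lambda>l. {X. real n * (- ?q l + t / 2) \<le> (\<Sum>i<n. - g l (X i))}"
  let ?x = "ennreal (exp (- (real n * t\<^sup>2 / (8 * B\<^sup>2))))"
  have eq: "real n * (t / 2)\<^sup>2 / (2 * B\<^sup>2) = real n * t\<^sup>2 / (8 * B\<^sup>2)" by (simp add: power_divide)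
  have m: "?A l \<in> sets ?P" "?B l \<in> sets ?P" if "l \<in> L" for l
  proof -
    note [measurable] = g[OF that]
    have 1: "?A l = {X \<in> space ?P. real n * (?q l + t / 2) \<le> (\<Sum>i<n. g l (X i))}"
      "?B l = {X \<in> space ?P. real n * (- ?q l + t / 2) \<le> (\<Sum>i<n. - g l (X i))}"
      by (auto simp: space_PiM)
    show "?A l \<in> sets ?P" unfolding 1(1) by measurable
    show "?B l \<in> sets ?P" unfolding 1(2) by measurable
  qed
  have A: "emeasure ?P (?A l) \<le> ?x" if l: "l \<in> L" for l
    using exponential_test[of "\<lambda>x. ennreal (ps x)" "g l" B "t / 2" n] g[OF l] B l t m[OF l]
    by (simp add: LR_ps nn_integral_ps Q_def[symmetric] eq)
  have B': "emeasure ?P (?B l) \<le> ?x" if l: "l \<in> L" for l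
    using exponential_test[of "\<lambda>x. ennreal (ps x)" "\<lambda>x. - g l x" B "t / 2" n] g[OF l] B l t m[OF l]
    by (simp add: LR_ps nn_integral_ps Q_def[symmetric] eq)
  have "- good L g n t \<subseteq> (\<Union>l\<in>L. ?A l \<union> ?B l)"
  proof
    fix X assume "X \<in> - good L g n t"
    then obtain l where l: "l \<in> L" "\<bar>(\<Sum>i<n. g l (X i)) - real n * ?q l\<bar> \<ge> real n * (t / 2)"
      by (auto simp: good_def not_less)
    then have "X \<in> ?A l \<union> ?B l" by (auto simp: sum_negf algebra_simps abs_le_iff le_max_iff_disj abs_if split: if_splits)
    with l show "X \<in> (\<Union>l\<in>L. ?A l \<union> ?B l)" by blast
  qed
  then have "emeasure ?P (- good L g n t) \<le> emeasure ?P (\<Union>l\<in>L. ?A l \<union> ?B l)"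
    using m by (intro emeasure_mono sets.finite_UN L) auto
  also have "\<dots> \<le> (\<Sum>l\<in>L. emeasure ?P (?A l \<union> ?B l))"
    using m by (intro emeasure_subadditive_finite L) auto
  also have "\<dots> \<le> (\<Sum>l\<in>L. ?x + ?x)"
    using m A B' by (intro sum_mono order_trans[OF emeasure_subadditive] add_mono) auto
  also have "\<dots> = ennreal (2 * real (card L) * exp (- (real n * t\<^sup>2 / (8 * B\<^sup>2))))"
    by (simp add: ennreal_plus[symmetric] ennreal_of_nat_eq_real_of_nat ennreal_mult[symmetric] del: ennreal_plus)
  finally show ?thesis .
qed

end

section \<open>Evidence and numerator of the posterior\<close>

definition valid :: "'a::euclidean_space set \<Rightarrow> (nat \<Rightarrow> real) \<times> (nat \<Rightarrow> 'a) \<Rightarrow> bool" where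
  "valid \<Theta> p \<longleftrightarrow> fst p \<in> stick_dom \<and> stick_breaking (fst p) sums 1 \<and> (\<forall>k. snd p k \<in> \<Theta>)"

context mixture_model
begin

abbreviation Lr :: "nat \<Rightarrow> (nat \<Rightarrow> real) \<times> (nat \<Rightarrow> 'a) \<Rightarrow> (nat \<Rightarrow> 'a) \<Rightarrow> ennreal" where
  "Lr n p X \<equiv> LR n (nmix (stick_breaking (fst p)) (snd p)) X"

lemma measurable_Lr:
  assumes N: "sets N = sets (PiM UNIV (\<lambda>_. borel) \<Otimes>\<^sub>M PiM UNIV (\<lambda>_. borel))"
  shows "(\<lambda>z. Lr n (fst z) (snd z)) \<in> borel_measurable (N \<Otimes>\<^sub>M PiM UNIV (\<lambda>_. Q))"
proof -
  note [measurable_cong] = N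
  have [measurable_cong]: "sets (PiM UNIV (\<lambda>_::nat. Q)) = sets (PiM UNIV (\<lambda>_. borel))"
    by (rule sets_PiM_borel) simp
  show ?thesis unfolding LR_def nmix_def by measurable
qed

text \<open>The relative error \<tau> h bounds the chi-square distance of one observation by
  \<tau>^2 I, so n independent observations have second moment at most (1 + \<tau>^2 I)^n. This is
  near 1 when n \<tau>^2 is small, and \<kappa> converts the squared deviation into an absolute
  one.\<close>

lemma second_moment_ratio:
  assumes r[measurable]: "r \<in> borel_measurable borel" and r0: "\<And>x. 0 \<le> r x"
    and r1: "(\<integral>\<^sup>+x. ennreal (r x) \<partial>lborel) = 1"
    and h[measurable]: "h \<in> borel_measurable borel" and I: "(\<integral>\<^sup>+x. ennreal ((h x)\<^sup>2) \<partial>Q) \<le> ennreal I" "I \<ge> 0"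
    and close: "\<And>x. \<bar>r x / ps x - 1\<bar> \<le> \<tau> * h x" and \<kappa>: "\<kappa> > 0"
  shows "(\<integral>\<^sup>+X. ennreal \<bar>(\<Prod>i<n. r (X i) / ps (X i)) - 1\<bar> \<partial>PiM UNIV (\<lambda>_. Q)) \<le> ennreal (\<kappa> + ((1 + \<tau>\<^sup>2 * I) ^ n - 1) / \<kappa>)"
proof -
  let ?P = "PiM UNIV (\<lambda>_::nat. Q)"
  interpret Q: prob_space Q by (rule prob_space_Q)
  interpret P: prob_space ?P by (intro prob_space_PiM prob_space_Q)
  define q where "q x = r x / ps x" for x
  have [measurable]: "q \<in> borel_measurable borel" unfolding q_def by measurable
  have q0: "q x \<ge> 0" for x using r0 ps_pos[of x] by (simp add: q_def)
  have q1: "(\<integral>\<^sup>+x. ennreal (q x) \<partial>Q) = 1"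
  proof -
    have "(\<integral>\<^sup>+x. ennreal (q x) \<partial>Q) = (\<integral>\<^sup>+x. ennreal (ps x) * ennreal (q x) \<partial>lborel)"
      unfolding Q_def by (subst nn_integral_density) auto
    also have "\<dots> = (\<integral>\<^sup>+x. ennreal (r x) \<partial>lborel)"
    proof (intro nn_integral_cong)
      fix x
      have "ps x * q x = r x" using ps_pos[of x] by (simp add: q_def)
      then show "ennreal (ps x) * ennreal (q x) = ennreal (r x)"
        using ps_pos[of x] q0[of x] by (simp add: ennreal_mult[symmetric])
    qed
    finally show ?thesis using r1 by simp
  qed
  have square: "ennreal ((a - 1)\<^sup>2) + 2 * ennreal a = ennreal (a\<^sup>2) + 1" if "a \<ge> 0" for a :: real
  proof -
    have "ennreal ((a - 1)\<^sup>2) + 2 * ennreal a = ennreal ((a - 1)\<^sup>2 + 2 * a)"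
      using that by (simp add: ennreal_plus ennreal_mult)
    also have "(a - 1)\<^sup>2 + 2 * a = a\<^sup>2 + 1" by (simp add: power2_eq_square algebra_simps)
    finally show ?thesis by (simp add: ennreal_plus)
  qed
  \<comment> \<open>The identity E (g - 1)^2 = E g^2 - 1 in additive form, which avoids subtraction
    in \<open>ennreal\<close>.\<close>
  have dev: "(\<integral>\<^sup>+x. ennreal ((g x - 1)\<^sup>2) \<partial>M) + 2 = (\<integral>\<^sup>+x. ennreal ((g x)\<^sup>2) \<partial>M) + 1"
    if M: "prob_space M" and [measurable]: "g \<in> borel_measurable M" and g: "\<And>x. g x \<ge> 0" "(\<integral>\<^sup>+x. ennreal (g x) \<partial>M) = 1"
    for g :: "'z \<Rightarrow> real" and M
  proof -
    interpret M: prob_space M by (rule M)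
    have "(\<integral>\<^sup>+x. ennreal ((g x - 1)\<^sup>2) \<partial>M) + 2 = (\<integral>\<^sup>+x. ennreal ((g x - 1)\<^sup>2) + 2 * ennreal (g x) \<partial>M)"
      by (subst nn_integral_add) (auto simp: nn_integral_cmult g)
    also have "\<dots> = (\<integral>\<^sup>+x. ennreal ((g x)\<^sup>2) + 1 \<partial>M)" using g by (simp add: square)
    also have "\<dots> = (\<integral>\<^sup>+x. ennreal ((g x)\<^sup>2) \<partial>M) + 1"
      by (subst nn_integral_add) (auto simp: M.emeasure_space_1)
    finally show ?thesis .
  qed
  have "(\<integral>\<^sup>+x. ennreal ((q x - 1)\<^sup>2) \<partial>Q) \<le> (\<integral>\<^sup>+x. ennreal (\<tau>\<^sup>2) * ennreal ((h x)\<^sup>2) \<partial>Q)"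
  proof (intro nn_integral_mono)
    fix x
    have "\<bar>q x - 1\<bar>\<^sup>2 \<le> (\<tau> * h x)\<^sup>2" using close[of x] by (intro power_mono) (auto simp: q_def)
    then show "ennreal ((q x - 1)\<^sup>2) \<le> ennreal (\<tau>\<^sup>2) * ennreal ((h x)\<^sup>2)"
      by (simp add: ennreal_mult[symmetric] power_mult_distrib ennreal_leI)
  qed
  also have "\<dots> = ennreal (\<tau>\<^sup>2) * (\<integral>\<^sup>+x. ennreal ((h x)\<^sup>2) \<partial>Q)" by (intro nn_integral_cmult) auto
  also have "\<dots> \<le> ennreal (\<tau>\<^sup>2) * ennreal I" by (intro mult_left_mono I) auto
  also have "\<dots> = ennreal (\<tau>\<^sup>2 * I)" using I by (simp add: ennreal_mult)
  finally have d1: "(\<integral>\<^sup>+x. ennreal ((q x - 1)\<^sup>2) \<partial>Q) \<le> ennreal (\<tau>\<^sup>2 * I)" .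
  have q2: "(\<integral>\<^sup>+x. ennreal ((q x)\<^sup>2) \<partial>Q) \<le> ennreal (1 + \<tau>\<^sup>2 * I)"
  proof -
    have "(\<integral>\<^sup>+x. ennreal ((q x)\<^sup>2) \<partial>Q) + 1 \<le> ennreal (\<tau>\<^sup>2 * I) + 2"
      unfolding dev[OF prob_space_Q _ q0 q1, symmetric, simplified] by (intro add_mono d1) auto
    also have "\<dots> = ennreal (1 + \<tau>\<^sup>2 * I) + 1"
      using I by (simp add: ennreal_plus[symmetric] ennreal_1[symmetric] ennreal_numeral[symmetric] del: ennreal_plus ennreal_1 ennreal_numeral)
    finally show ?thesis unfolding add.commute[of _ 1] ennreal_add_left_cancel_le by simp
  qed
  define Z where "Z X = (\<Prod>i<n. q (X i))" for X :: "nat \<Rightarrow> 'a"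
  have [measurable]: "Z \<in> borel_measurable ?P" unfolding Z_def by measurable
  have Z0: "Z X \<ge> 0" for X unfolding Z_def using q0 by (intro prod_nonneg) auto
  have Z1: "(\<integral>\<^sup>+X. ennreal (Z X) \<partial>?P) = 1"
  proof -
    have "(\<integral>\<^sup>+X. ennreal (Z X) \<partial>?P) = (\<integral>\<^sup>+X. (\<Prod>i<n. ennreal (q (X i))) \<partial>?P)"
      unfolding Z_def using q0 by (simp add: prod_ennreal)
    also have "\<dots> = (\<Prod>i<n. (\<integral>\<^sup>+x. ennreal (q x) \<partial>Q))" by (intro nn_integral_PiM_prod prob_space_Q) auto
    finally show ?thesis by (simp add: q1)
  qed
  have Z2: "(\<integral>\<^sup>+X. ennreal ((Z X)\<^sup>2) \<partial>?P) \<le> ennreal ((1 + \<tau>\<^sup>2 * I) ^ n)"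
  proof -
    have "(\<integral>\<^sup>+X. ennreal ((Z X)\<^sup>2) \<partial>?P) = (\<integral>\<^sup>+X. (\<Prod>i<n. ennreal ((q (X i))\<^sup>2)) \<partial>?P)"
      unfolding Z_def by (simp add: prod_ennreal prod_power_distrib)
    also have "\<dots> = (\<Prod>i<n. (\<integral>\<^sup>+x. ennreal ((q x)\<^sup>2) \<partial>Q))" by (intro nn_integral_PiM_prod prob_space_Q) auto
    also have "\<dots> \<le> (\<Prod>i<n. ennreal (1 + \<tau>\<^sup>2 * I))" by (intro prod_mono_ennreal q2)
    also have "\<dots> = ennreal ((1 + \<tau>\<^sup>2 * I) ^ n)" unfolding prod_constant card_lessThan by (rule ennreal_power) (use I in simp)
    finally show ?thesis .
  qed
  have A1: "1 \<le> (1 + \<tau>\<^sup>2 * I) ^ n" using I by (intro one_le_power) auto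
  have dZ: "(\<integral>\<^sup>+X. ennreal ((Z X - 1)\<^sup>2) \<partial>?P) \<le> ennreal ((1 + \<tau>\<^sup>2 * I) ^ n - 1)"
  proof -
    have "(\<integral>\<^sup>+X. ennreal ((Z X - 1)\<^sup>2) \<partial>?P) + 2 \<le> ennreal ((1 + \<tau>\<^sup>2 * I) ^ n) + 1"
      unfolding dev[OF P.prob_space_axioms _ Z0 Z1, simplified] by (intro add_mono Z2) auto
    also have "\<dots> = ennreal ((1 + \<tau>\<^sup>2 * I) ^ n - 1) + 2"
      using A1 by (simp add: ennreal_plus[symmetric] ennreal_1[symmetric] ennreal_numeral[symmetric] del: ennreal_plus ennreal_1 ennreal_numeral)
    finally show ?thesis unfolding add.commute[of _ 2] ennreal_add_left_cancel_le by simp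
  qed
  have "(\<integral>\<^sup>+X. ennreal \<bar>Z X - 1\<bar> \<partial>?P) \<le> (\<integral>\<^sup>+X. ennreal \<kappa> + ennreal (1 / \<kappa>) * ennreal ((Z X - 1)\<^sup>2) \<partial>?P)"
  proof (intro nn_integral_mono)
    fix X
    \<comment> \<open>Completing a square gives |z| \<le> \<kappa> + z^2 / \<kappa>.\<close>
    have "\<bar>Z X - 1\<bar> \<le> \<kappa> + (1 / \<kappa>) * (Z X - 1)\<^sup>2"
    proof -
      let ?a = "\<bar>Z X - 1\<bar>"
      have "0 \<le> (\<kappa> - ?a)\<^sup>2 + \<kappa> * ?a" using \<kappa> by simp
      also have "\<dots> = \<kappa> * \<kappa> - \<kappa> * ?a + ?a\<^sup>2" by (simp add: power2_eq_square algebra_simps)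
      finally have "\<kappa> * ?a \<le> \<kappa> * \<kappa> + (Z X - 1)\<^sup>2" by simp
      then show ?thesis using \<kappa> by (simp add: field_simps)
    qed
    then have "ennreal \<bar>Z X - 1\<bar> \<le> ennreal (\<kappa> + (1 / \<kappa>) * (Z X - 1)\<^sup>2)" by (rule ennreal_leI)
    also have "\<dots> = ennreal \<kappa> + ennreal (1 / \<kappa>) * ennreal ((Z X - 1)\<^sup>2)"
      using \<kappa> by (subst ennreal_mult[symmetric]) (auto simp: ennreal_plus)
    finally show "ennreal \<bar>Z X - 1\<bar> \<le> ennreal \<kappa> + ennreal (1 / \<kappa>) * ennreal ((Z X - 1)\<^sup>2)" .
  qed
  also have "\<dots> = ennreal \<kappa> + ennreal (1 / \<kappa>) * (\<integral>\<^sup>+X. ennreal ((Z X - 1)\<^sup>2) \<partial>?P)"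
    using P.emeasure_space_1 by (subst nn_integral_add) (auto simp: nn_integral_cmult)
  also have "\<dots> \<le> ennreal \<kappa> + ennreal (1 / \<kappa>) * ennreal ((1 + \<tau>\<^sup>2 * I) ^ n - 1)"
    by (intro add_mono mult_left_mono dZ) auto
  also have "\<dots> = ennreal (\<kappa> + ((1 + \<tau>\<^sup>2 * I) ^ n - 1) / \<kappa>)"
    using \<kappa> A1 by (simp add: ennreal_mult[symmetric] ennreal_plus)
  finally show ?thesis unfolding Z_def q_def .
qed

lemma LR_ennreal:
  assumes "\<And>x. u x = ennreal (r x)" "\<And>x. 0 \<le> r x"
  shows "LR n u X = ennreal (\<Prod>i<n. r (X i) / ps (X i))"
  unfolding LR_def using assms ps_pos
  by (subst prod_ennreal[symmetric]) (auto simp: ennreal_mult[symmetric] less_imp_le intro!: prod.cong)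

text \<open>If the evidence is below y / 2, the ratios on \<open>A\<close> must deviate from 1 by at
  least half the mass of \<open>A\<close> in total. By Fubini the expected total deviation is at
  most \<open>d\<close> times that mass, so Markov's inequality gives 2 d.\<close>

lemma denominator_bound:
  assumes N: "prob_space N" "sets N = sets (PiM UNIV (\<lambda>_. borel) \<Otimes>\<^sub>M PiM UNIV (\<lambda>_. borel))"
    and A: "A \<in> sets N" "emeasure N A \<ge> ennreal y" "y > 0"
    and dev: "AE p in N. p \<in> A \<longrightarrow> (\<integral>\<^sup>+X. ennreal \<bar>enn2real (Lr n p X) - 1\<bar> \<partial>PiM UNIV (\<lambda>_. Q)) \<le> ennreal d"
    and fin: "AE p in N. \<forall>X. Lr n p X < \<infinity>" and d: "d \<ge> 0"
  shows "emeasure (PiM UNIV (\<lambda>_. Q)) {X. (\<integral>\<^sup>+p. Lr n p X \<partial>N) < ennreal (y / 2)} \<le> ennreal (2 * d)"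
proof -
  let ?P = "PiM UNIV (\<lambda>_::nat. Q)"
  interpret N: prob_space N by (rule N)
  interpret P: prob_space ?P by (intro prob_space_PiM prob_space_Q)
  interpret pair_sigma_finite N ?P ..
  note mL = measurable_Lr[OF N(2), of n]
  have [measurable]: "A \<in> sets N" by (rule A)
  have [measurable]: "(\<lambda>(p, X). Lr n p X) \<in> borel_measurable (N \<Otimes>\<^sub>M ?P)"
    using mL by (simp add: split_beta)
  have [measurable]: "(\<lambda>(X, p). Lr n p X) \<in> borel_measurable (?P \<Otimes>\<^sub>M N)"
    using measurable_pair_swap[OF mL] by (simp add: split_beta)
  define D where "D p X = ennreal \<bar>enn2real (Lr n p X) - 1\<bar>" for p X
  have D1[measurable]: "(\<lambda>(p, X). D p X) \<in> borel_measurable (N \<Otimes>\<^sub>M ?P)"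
    unfolding D_def by measurable
  have D2[measurable]: "(\<lambda>(X, p). D p X) \<in> borel_measurable (?P \<Otimes>\<^sub>M N)"
    unfolding D_def by measurable
  define a where "a = measure N A"
  have a: "emeasure N A = ennreal a" unfolding a_def by (rule N.emeasure_eq_measure)
  have ya: "y \<le> a" using A(2) unfolding a a_def by (subst (asm) ennreal_le_iff) auto
  let ?DA = "\<lambda>X. \<integral>\<^sup>+p. indicator A p * D p X \<partial>N"
  \<comment> \<open>From 1 \<le> L + |L - 1|, integrated over \<open>A\<close>: the first term
    contributes less than y / 2 \<le> a / 2, so the second contributes at least a / 2.\<close>
  have key: "ennreal (a / 2) \<le> ?DA X" if X: "(\<integral>\<^sup>+p. Lr n p X \<partial>N) < ennreal (y / 2)" for X
  proof -
    have mX: "(\<lambda>p. Lr n p X) \<in> borel_measurable N"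
    proof -
      have "X \<in> space ?P" by (simp add: space_PiM)
      then show ?thesis using measurable_compose[OF measurable_Pair1' mL] by simp
    qed
    note [measurable] = mX
    have [measurable]: "(\<lambda>p. D p X) \<in> borel_measurable N" unfolding D_def by measurable
    have "ennreal a = (\<integral>\<^sup>+p. indicator A p \<partial>N)" using a by simp
    also have "\<dots> \<le> (\<integral>\<^sup>+p. Lr n p X + indicator A p * D p X \<partial>N)"
    proof (intro nn_integral_mono_AE, use fin in eventually_elim)
      case (elim p)
      have "(1 :: ennreal) \<le> Lr n p X + D p X"
      proof -
        have L: "Lr n p X = ennreal (enn2real (Lr n p X))" using elim by (simp add: less_top)
        have "ennreal 1 \<le> ennreal (enn2real (Lr n p X) + \<bar>enn2real (Lr n p X) - 1\<bar>)" by (intro ennreal_leI) auto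
        also have "\<dots> = Lr n p X + D p X" unfolding D_def by (subst L, subst ennreal_plus) auto
        finally show ?thesis by simp
      qed
      then show ?case by (auto simp: indicator_def)
    qed
    also have "\<dots> = (\<integral>\<^sup>+p. Lr n p X \<partial>N) + ?DA X" by (intro nn_integral_add) auto
    finally have le: "ennreal a \<le> (\<integral>\<^sup>+p. Lr n p X \<partial>N) + ?DA X" .
    show ?thesis
    proof (rule ccontr)
      assume "\<not> ?thesis"
      then have "(\<integral>\<^sup>+p. Lr n p X \<partial>N) + ?DA X < ennreal (y / 2) + ennreal (a / 2)"
        using X by (intro add_strict_mono) auto
      also have "\<dots> \<le> ennreal a" using ya A(3) by (subst ennreal_plus[symmetric]) (auto intro!: ennreal_leI simp del: ennreal_plus)
      finally show False using le by simp
    qed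
  qed
  have a0: "a > 0" using ya A(3) by simp
  have int: "(\<integral>\<^sup>+X. ?DA X \<partial>?P) \<le> ennreal (a * d)"
  proof -
    have "(\<integral>\<^sup>+X. ?DA X \<partial>?P) = (\<integral>\<^sup>+p. (\<integral>\<^sup>+X. indicator A p * D p X \<partial>?P) \<partial>N)"
      by (rule Fubini') measurable
    also have "\<dots> = (\<integral>\<^sup>+p. indicator A p * (\<integral>\<^sup>+X. D p X \<partial>?P) \<partial>N)"
      by (intro nn_integral_cong nn_integral_cmult) auto
    also have "\<dots> \<le> (\<integral>\<^sup>+p. ennreal d * indicator A p \<partial>N)"
      by (intro nn_integral_mono_AE, use dev in eventually_elim) (auto simp: D_def indicator_def)
    also have "\<dots> = ennreal d * ennreal a" by (simp add: nn_integral_cmult_indicator a)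
    finally show ?thesis using a0 d by (simp add: ennreal_mult mult.commute)
  qed
  have sub: "{X. (\<integral>\<^sup>+p. Lr n p X \<partial>N) < ennreal (y / 2)} \<subseteq> {X \<in> space ?P. 1 \<le> ennreal (2 / a) * ?DA X}"
  proof
    fix X assume "X \<in> {X. (\<integral>\<^sup>+p. Lr n p X \<partial>N) < ennreal (y / 2)}"
    then have "ennreal (2 / a) * ennreal (a / 2) \<le> ennreal (2 / a) * ?DA X" using key by (intro mult_left_mono) auto
    moreover have "ennreal (2 / a) * ennreal (a / 2) = 1" using a0 by (simp add: ennreal_mult[symmetric])
    ultimately show "X \<in> {X \<in> space ?P. 1 \<le> ennreal (2 / a) * ?DA X}" by (simp add: space_PiM)
  qed
  have "emeasure ?P {X. (\<integral>\<^sup>+p. Lr n p X \<partial>N) < ennreal (y / 2)} \<le> emeasure ?P {X \<in> space ?P. 1 \<le> ennreal (2 / a) * ?DA X}"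
    by (intro emeasure_mono sub) measurable
  also have "\<dots> \<le> ennreal (2 / a) * (\<integral>\<^sup>+X. ?DA X \<partial>?P)"
    using nn_integral_Markov_inequality[where u="?DA" and M="?P" and A="space ?P" and c="ennreal (2 / a)"] by simp
  also have "\<dots> \<le> ennreal (2 / a) * ennreal (a * d)" by (intro mult_left_mono int) auto
  also have "\<dots> = ennreal (2 * d)" using a0 d by (subst ennreal_mult[symmetric]) auto
  finally show ?thesis .
qed

text \<open>In expectation over the data, a parameter in \<open>C\<close> costs at most 1, because
  likelihood ratios integrate to 1, so \<open>C\<close> costs its prior mass; the other parameters
  of \<open>B\<close> are rejected on \<open>G\<close> up to \<open>x\<close>. Fubini and Markov's
  inequality finish.\<close>

lemma numerator_bound:
  assumes N: "prob_space N" "sets N = sets (PiM UNIV (\<lambda>_. borel) \<Otimes>\<^sub>M PiM UNIV (\<lambda>_. borel))"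
    and B: "B \<in> sets N" and C: "C \<in> sets N" "emeasure N C \<le> ennreal c" "c \<ge> 0"
    and G: "G \<in> sets (PiM UNIV (\<lambda>_. Q))"
    and one: "AE p in N. (\<integral>\<^sup>+X. Lr n p X \<partial>PiM UNIV (\<lambda>_. Q)) = 1"
    and test: "AE p in N. p \<in> B \<longrightarrow> p \<notin> C \<longrightarrow> (\<integral>\<^sup>+X. indicator G X * Lr n p X \<partial>PiM UNIV (\<lambda>_. Q)) \<le> ennreal x"
    and x: "x \<ge> 0" and y: "y > 0"
  shows "emeasure (PiM UNIV (\<lambda>_. Q)) {X \<in> G. ennreal y \<le> (\<integral>\<^sup>+p. indicator B p * Lr n p X \<partial>N)} \<le> ennreal ((c + x) / y)"
proof -
  let ?P = "PiM UNIV (\<lambda>_::nat. Q)"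
  interpret N: prob_space N by (rule N)
  interpret P: prob_space ?P by (intro prob_space_PiM prob_space_Q)
  interpret pair_sigma_finite N ?P ..
  note mL = measurable_Lr[OF N(2), of n]
  have [measurable]: "B \<in> sets N" "C \<in> sets N" "G \<in> sets ?P" by (fact B C G)+
  have [measurable]: "(\<lambda>(p, X). Lr n p X) \<in> borel_measurable (N \<Otimes>\<^sub>M ?P)"
    using mL by (simp add: split_beta)
  have [measurable]: "(\<lambda>(X, p). Lr n p X) \<in> borel_measurable (?P \<Otimes>\<^sub>M N)"
    using measurable_pair_swap[OF mL] by (simp add: split_beta)
  let ?NB = "\<lambda>X. \<integral>\<^sup>+p. indicator B p * Lr n p X \<partial>N"
  have "emeasure ?P {X \<in> G. ennreal y \<le> ?NB X} = emeasure ?P {X \<in> G. 1 \<le> ennreal (1 / y) * ?NB X}"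
  proof -
    have iff: "ennreal y \<le> z \<longleftrightarrow> 1 \<le> ennreal (1 / y) * z" for z
    proof
      assume "ennreal y \<le> z"
      then have "ennreal (1 / y) * ennreal y \<le> ennreal (1 / y) * z" by (intro mult_left_mono) auto
      then show "1 \<le> ennreal (1 / y) * z" using y by (simp add: ennreal_mult[symmetric])
    next
      assume "1 \<le> ennreal (1 / y) * z"
      then have "ennreal y * 1 \<le> ennreal y * (ennreal (1 / y) * z)" by (intro mult_left_mono) auto
      also have "\<dots> = z" using y by (simp add: mult.assoc[symmetric] ennreal_mult[symmetric])
      finally show "ennreal y \<le> z" by simp
    qed
    show ?thesis by (simp only: iff)
  qed
  also have "{X \<in> G. 1 \<le> ennreal (1 / y) * ?NB X} = {X \<in> G. 1 \<le> ennreal (1 / y) * ?NB X} \<inter> space ?P" by (auto simp: space_PiM)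
  also have "emeasure ?P ({X \<in> G. 1 \<le> ennreal (1 / y) * ?NB X} \<inter> space ?P) \<le> ennreal (1 / y) * (\<integral>\<^sup>+X. ?NB X * indicator G X \<partial>?P)"
    using nn_integral_Markov_inequality[where u="?NB" and M="?P" and A="G" and c="ennreal (1 / y)"] sets.sets_into_space[OF G] by (simp add: space_PiM)
  also have "(\<integral>\<^sup>+X. ?NB X * indicator G X \<partial>?P) = (\<integral>\<^sup>+X. (\<integral>\<^sup>+p. indicator B p * Lr n p X * indicator G X \<partial>N) \<partial>?P)"
  proof (intro nn_integral_cong nn_integral_multc[symmetric])
    fix X
    have "(\<lambda>p. Lr n p X) \<in> borel_measurable N"
    proof -
      have "X \<in> space ?P" by (simp add: space_PiM)
      then show ?thesis using measurable_compose[OF measurable_Pair1' mL] by simp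
    qed
    then show "(\<lambda>p. indicator B p * Lr n p X) \<in> borel_measurable N" by measurable
  qed
  also have "\<dots> = (\<integral>\<^sup>+p. (\<integral>\<^sup>+X. indicator B p * Lr n p X * indicator G X \<partial>?P) \<partial>N)"
    by (rule Fubini') measurable
  also have "\<dots> \<le> (\<integral>\<^sup>+p. indicator C p + ennreal x \<partial>N)"
  proof (intro nn_integral_mono_AE, use one test in eventually_elim)
    case (elim p)
    have "(\<integral>\<^sup>+X. indicator B p * Lr n p X * indicator G X \<partial>?P) \<le> indicator B p * (\<integral>\<^sup>+X. indicator G X * Lr n p X \<partial>?P)"
      by (auto simp: indicator_def intro!: nn_integral_mono)
    also have "\<dots> \<le> indicator C p + ennreal x"
    proof (cases "p \<in> C")
      case True
      have "(\<integral>\<^sup>+X. indicator G X * Lr n p X \<partial>?P) \<le> (\<integral>\<^sup>+X. Lr n p X \<partial>?P)"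
        by (intro nn_integral_mono) (auto simp: indicator_def)
      then have "indicator B p * (\<integral>\<^sup>+X. indicator G X * Lr n p X \<partial>?P) \<le> 1" using elim(1) by (auto simp: indicator_def)
      also have "\<dots> \<le> indicator C p + ennreal x" using True by simp
      finally show ?thesis .
    next
      case False
      then show ?thesis using elim(2) by (auto simp: indicator_def)
    qed
    finally show ?case .
  qed
  also have "\<dots> = emeasure N C + ennreal x"
    by (subst nn_integral_add) (auto simp: N.emeasure_space_1)
  finally have "emeasure ?P {X \<in> G. ennreal y \<le> ?NB X} \<le> ennreal (1 / y) * (emeasure N C + ennreal x)"
    by (simp add: mult_left_mono)
  also have "\<dots> \<le> ennreal (1 / y) * (ennreal c + ennreal x)" by (intro mult_left_mono add_mono C) auto
  also have "\<dots> = ennreal ((c + x) / y)" using C x y by (simp add: ennreal_plus[symmetric] ennreal_mult[symmetric] del: ennreal_plus)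
  finally show ?thesis .
qed

end

section \<open>The kernel near the truth\<close>

text \<open>The mean value inequality for ln f on the ball of radius L + norm x, which contains both
  shifted points and on which the growth bound for the logarithmic gradient is uniform.\<close>

lemma ln_diff_bound:
  fixes f :: "'a::euclidean_space \<Rightarrow> real"
  assumes diff: "f differentiable_on UNIV" and pos: "\<And>x. f x > 0"
    and R: "R > 0" "\<gamma> \<ge> 0" and B: "\<And>x. norm (total_deriv (\<lambda>y. ln (f y)) x) \<le> R * (1 + norm x) powr \<gamma>"
    and L: "norm \<theta> \<le> L" "norm \<theta>' \<le> L"
  shows "\<bar>ln (f (x - \<theta>)) - ln (f (x - \<theta>'))\<bar> \<le> R * (1 + L + norm x) powr \<gamma> * norm (\<theta> - \<theta>')"
proof -
  let ?g = "\<lambda>y. ln (f y)"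
  have d: "?g differentiable (at y)" for y
  proof -
    have "f differentiable (at y)" using diff by (simp add: differentiable_on_def)
    then obtain f' where "(f has_derivative f') (at y)" by (auto simp: differentiable_def)
    from has_derivative_ln[OF pos this] show ?thesis by (auto simp: differentiable_def)
  qed
  have D: "(?g has_derivative frechet_derivative ?g (at y)) (at y)" for y
    using d frechet_derivative_works by blast
  have on: "onorm (frechet_derivative ?g (at y)) \<le> R * (1 + norm y) powr \<gamma>" for y
  proof -
    have "bounded_linear (frechet_derivative ?g (at y))" using D has_derivative_bounded_linear by blast
    then have "norm (total_deriv ?g y) = onorm (frechet_derivative ?g (at y))"
      by (simp add: total_deriv_def norm_blinfun.rep_eq bounded_linear_Blinfun_apply)
    with B[of y] show ?thesis by simp
  qed
  let ?S = "cball 0 (L + norm x)"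
  have "norm (?g (x - \<theta>) - ?g (x - \<theta>')) \<le> R * (1 + L + norm x) powr \<gamma> * norm ((x - \<theta>) - (x - \<theta>'))"
  proof (rule differentiable_bound[of ?S ?g "\<lambda>y. frechet_derivative ?g (at y)"])
    show "(?g has_derivative frechet_derivative ?g (at y)) (at y within ?S)" for y
      using D has_derivative_at_withinI by blast
    show "onorm (frechet_derivative ?g (at y)) \<le> R * (1 + L + norm x) powr \<gamma>" if "y \<in> ?S" for y
    proof -
      have "onorm (frechet_derivative ?g (at y)) \<le> R * (1 + norm y) powr \<gamma>" by (rule on)
      also have "\<dots> \<le> R * (1 + L + norm x) powr \<gamma>"
        using that R by (intro mult_left_mono powr_mono2) auto
      finally show ?thesis .
    qed
    show "x - \<theta> \<in> ?S" "x - \<theta>' \<in> ?S"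
      using L norm_triangle_ineq4[of x \<theta>] norm_triangle_ineq4[of x \<theta>'] by auto
  qed simp
  then show ?thesis by (simp add: norm_minus_commute)
qed

lemma abs_exp_minus_one_le: "\<bar>exp z - 1\<bar> \<le> \<bar>z\<bar> * exp \<bar>z\<bar>" for z :: real
proof (cases "z \<ge> 0")
  case True
  have "1 - z \<le> exp (- z)" using exp_ge_add_one_self[of "- z"] by simp
  then have "exp z * (1 - z) \<le> exp z * exp (- z)" by (intro mult_left_mono) auto
  then have "exp z - 1 \<le> z * exp z" by (simp add: exp_minus algebra_simps)
  then show ?thesis using True by simp
next
  case False
  have "1 - exp z \<le> - z" using exp_ge_add_one_self[of z] by linarith
  also have "\<dots> \<le> - z * exp (- z)" using False by simp
  finally show ?thesis using False by simp
qed

lemma powr_add_le: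
  fixes a b \<gamma> :: real
  assumes "a \<ge> 0" "b \<ge> 0" "\<gamma> \<ge> 0"
  shows "(a + b) powr \<gamma> \<le> (2 * a) powr \<gamma> + (2 * b) powr \<gamma>"
proof (cases "a \<le> b")
  case True
  then have "(a + b) powr \<gamma> \<le> (2 * b) powr \<gamma>" using assms by (intro powr_mono2) auto
  then show ?thesis by (simp add: add_increasing)
next
  case False
  then have "(a + b) powr \<gamma> \<le> (2 * a) powr \<gamma>" using assms by (intro powr_mono2) auto
  then show ?thesis by (simp add: add_increasing2)
qed

text \<open>Exponentiating the Lipschitz bound for ln f gives one function \<open>E\<close> that
  bounds all ratios of translates over \<Theta> and also their relative Lipschitz constants. Its
  exponent grows like norm x powr \<gamma>, so its square is integrable by the exponential
  moments.\<close>

lemma envelope_exists: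
  fixes f :: "'a::euclidean_space \<Rightarrow> real"
  assumes diff: "f differentiable_on UNIV" and pos: "\<And>x. f x > 0"
    and R: "R > 0" "\<gamma> \<ge> 0" and B: "\<And>x. norm (total_deriv (\<lambda>y. ln (f y)) x) \<le> R * (1 + norm x) powr \<gamma>"
    and int: "\<forall>M>0. integrable lborel (\<lambda>x. exp (M * norm x powr \<gamma>) * f x)"
    and \<Theta>: "bounded \<Theta>"
  shows "\<exists>E. E \<in> borel_measurable borel \<and> (\<forall>x. E x \<ge> 0) \<and>
    (\<forall>x. \<forall>\<theta>\<in>\<Theta>. \<forall>\<theta>'\<in>\<Theta>. f (x - \<theta>) \<le> E x * f (x - \<theta>')) \<and>
    (\<forall>x. \<forall>\<theta>\<in>\<Theta>. \<forall>\<theta>'\<in>\<Theta>. norm (\<theta> - \<theta>') \<le> 1 \<longrightarrow> \<bar>f (x - \<theta>) - f (x - \<theta>')\<bar> \<le> norm (\<theta> - \<theta>') * E x * f (x - \<theta>')) \<and>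
    (\<exists>I\<ge>0. \<forall>\<theta>\<in>\<Theta>. (\<integral>\<^sup>+x. ennreal ((E x)\<^sup>2) * ennreal (f (x - \<theta>)) \<partial>lborel) \<le> ennreal I)"
proof -
  obtain L0 where L0: "\<forall>\<theta>\<in>\<Theta>. norm \<theta> \<le> L0" using \<Theta> by (auto simp: bounded_iff)
  define L where "L = max 0 L0"
  have L: "L \<ge> 0" "norm \<theta> \<le> L" if "\<theta> \<in> \<Theta>" for \<theta> using L0 that by (auto simp: L_def)
  have L0': "L \<ge> 0" by (simp add: L_def)
  have fm[measurable]: "f \<in> borel_measurable borel"
    using diff by (intro borel_measurable_continuous_onI differentiable_imp_continuous_on)
  define G where "G x = R * (1 + L + norm x) powr \<gamma>" for x :: 'a
  \<comment> \<open>The part 2 L covers the distance of two points of \<Theta>; the extra 2 absorbs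
    the factor in G exp G \<le> exp (2 G).\<close>
  define E where "E x = exp ((2 * L + 2) * G x)" for x
  have G0: "G x \<ge> 0" for x using R by (simp add: G_def)
  have lb: "\<bar>ln (f (x - \<theta>)) - ln (f (x - \<theta>'))\<bar> \<le> G x * norm (\<theta> - \<theta>')" if "\<theta> \<in> \<Theta>" "\<theta>' \<in> \<Theta>" for x \<theta> \<theta>'
    unfolding G_def using L that by (intro ln_diff_bound diff pos R B) auto
  have ratio: "f (x - \<theta>) = f (x - \<theta>') * exp (ln (f (x - \<theta>)) - ln (f (x - \<theta>')))" for x \<theta> \<theta>'
    using pos[of "x - \<theta>"] pos[of "x - \<theta>'"] by (simp add: exp_diff)
  have e1: "f (x - \<theta>) \<le> E x * f (x - \<theta>')" if "\<theta> \<in> \<Theta>" "\<theta>' \<in> \<Theta>" for x \<theta> \<theta>'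
  proof -
    have "norm (\<theta> - \<theta>') \<le> 2 * L" using L(2)[OF that(1)] L(2)[OF that(2)] norm_triangle_ineq4[of \<theta> \<theta>'] by linarith
    then have "G x * norm (\<theta> - \<theta>') \<le> G x * (2 * L + 2)" using G0 by (intro mult_left_mono) auto
    then have "ln (f (x - \<theta>)) - ln (f (x - \<theta>')) \<le> (2 * L + 2) * G x" using lb[OF that, of x] by (simp add: mult.commute)
    then have "exp (ln (f (x - \<theta>)) - ln (f (x - \<theta>'))) \<le> E x" by (simp add: E_def)
    then have "f (x - \<theta>') * exp (ln (f (x - \<theta>)) - ln (f (x - \<theta>'))) \<le> f (x - \<theta>') * E x"
      using pos[of "x - \<theta>'"] by (intro mult_left_mono) auto
    then show ?thesis unfolding ratio[of x \<theta> \<theta>', symmetric] by (simp add: mult.commute)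
  qed
  have e2: "\<bar>f (x - \<theta>) - f (x - \<theta>')\<bar> \<le> norm (\<theta> - \<theta>') * E x * f (x - \<theta>')"
    if "\<theta> \<in> \<Theta>" "\<theta>' \<in> \<Theta>" "norm (\<theta> - \<theta>') \<le> 1" for x \<theta> \<theta>'
  proof -
    define z where "z = ln (f (x - \<theta>)) - ln (f (x - \<theta>'))"
    have z: "\<bar>z\<bar> \<le> G x * norm (\<theta> - \<theta>')" unfolding z_def by (rule lb[OF that(1,2)])
    have z2: "\<bar>z\<bar> \<le> G x" using z mult_left_mono[OF that(3) G0[of x]] by simp
    have "\<bar>exp z - 1\<bar> \<le> \<bar>z\<bar> * exp \<bar>z\<bar>" by (rule abs_exp_minus_one_le)
    also have "\<dots> \<le> (G x * norm (\<theta> - \<theta>')) * exp (G x)" using z z2 G0[of x] by (intro mult_mono) auto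
    also have "\<dots> = norm (\<theta> - \<theta>') * (G x * exp (G x))" by simp
    also have "\<dots> \<le> norm (\<theta> - \<theta>') * E x"
    proof (intro mult_left_mono)
      have "G x \<le> exp (G x)" using exp_ge_add_one_self[of "G x"] by linarith
      then have "G x * exp (G x) \<le> exp (G x) * exp (G x)" by (intro mult_right_mono) auto
      also have "\<dots> = exp (2 * G x)" by (simp add: exp_add[symmetric])
      also have "\<dots> \<le> E x" unfolding E_def using G0[of x] L0' by (auto intro!: mult_right_mono)
      finally show "G x * exp (G x) \<le> E x" .
    qed simp
    finally have "f (x - \<theta>') * \<bar>exp z - 1\<bar> \<le> f (x - \<theta>') * (norm (\<theta> - \<theta>') * E x)"
      using pos[of "x - \<theta>'"] by (intro mult_left_mono) auto
    moreover have "\<bar>f (x - \<theta>) - f (x - \<theta>')\<bar> = f (x - \<theta>') * \<bar>exp z - 1\<bar>"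
    proof -
      have "f (x - \<theta>) - f (x - \<theta>') = f (x - \<theta>') * (exp z - 1)"
        using ratio[of x \<theta> \<theta>'] by (simp add: z_def right_diff_distrib)
      then show ?thesis using pos[of "x - \<theta>'"] by (simp add: abs_mult)
    qed
    ultimately show ?thesis by (simp add: mult_ac)
  qed
  \<comment> \<open>Squaring doubles the exponent, and \<open>powr_add_le\<close> separates the
    growing part, which becomes \<open>M\<close> times norm y powr \<gamma>, from a constant that
    goes into \<open>c\<close>.\<close>
  define M where "M = 2 * (2 * L + 2) * R * 2 powr \<gamma>"
  define c where "c = exp (2 * (2 * L + 2) * R * (2 * (1 + 2 * L)) powr \<gamma>)"
  have Mpos: "M > 0" using R L0' by (simp add: M_def)
  have EE: "(E (y + \<theta>))\<^sup>2 \<le> c * exp (M * norm y powr \<gamma>)" if "\<theta> \<in> \<Theta>" for y \<theta>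
  proof -
    have "(1 + L + norm (y + \<theta>)) powr \<gamma> \<le> ((1 + 2 * L) + norm y) powr \<gamma>"
      using L(2)[OF that] norm_triangle_ineq[of y \<theta>] L0' R by (intro powr_mono2) auto
    also have "\<dots> \<le> (2 * (1 + 2 * L)) powr \<gamma> + (2 * norm y) powr \<gamma>"
      using L0' R by (intro powr_add_le) auto
    also have "(2 * norm y) powr \<gamma> = 2 powr \<gamma> * norm y powr \<gamma>" by (simp add: powr_mult)
    finally have "2 * (2 * L + 2) * R * (1 + L + norm (y + \<theta>)) powr \<gamma> \<le>
       2 * (2 * L + 2) * R * ((2 * (1 + 2 * L)) powr \<gamma> + 2 powr \<gamma> * norm y powr \<gamma>)"
      using L0' R by (intro mult_left_mono) auto
    then have "2 * ((2 * L + 2) * G (y + \<theta>)) \<le> 2 * (2 * L + 2) * R * (2 * (1 + 2 * L)) powr \<gamma> + M * norm y powr \<gamma>"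
      by (simp add: G_def M_def algebra_simps)
    then have "exp (2 * ((2 * L + 2) * G (y + \<theta>))) \<le> c * exp (M * norm y powr \<gamma>)"
      unfolding c_def exp_add[symmetric] by simp
    then show ?thesis unfolding E_def by (simp add: exp_double)
  qed
  let ?w = "\<lambda>y. exp (M * norm y powr \<gamma>) * f y"
  have "\<exists>I\<ge>0. \<forall>\<theta>\<in>\<Theta>. (\<integral>\<^sup>+x. ennreal ((E x)\<^sup>2) * ennreal (f (x - \<theta>)) \<partial>lborel) \<le> ennreal I"
  proof (intro exI[of _ "c * (\<integral>y. ?w y \<partial>lborel)"] conjI ballI)
    show "0 \<le> c * (\<integral>y. ?w y \<partial>lborel)" using pos by (auto simp: c_def less_imp_le intro!: integral_nonneg_AE)
    fix \<theta> assume \<theta>: "\<theta> \<in> \<Theta>"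
    have [measurable]: "E \<in> borel_measurable borel" unfolding E_def G_def by measurable
    have "(\<integral>\<^sup>+x. ennreal ((E x)\<^sup>2) * ennreal (f (x - \<theta>)) \<partial>lborel) = (\<integral>\<^sup>+y. ennreal ((E (y + \<theta>))\<^sup>2) * ennreal (f y) \<partial>lborel)"
      using nn_integral_lborel_shift[of "\<lambda>y. ennreal ((E (y + \<theta>))\<^sup>2) * ennreal (f y)" \<theta>] by simp
    also have "\<dots> \<le> (\<integral>\<^sup>+y. ennreal (c * ?w y) \<partial>lborel)"
    proof (intro nn_integral_mono)
      fix y
      have "(E (y + \<theta>))\<^sup>2 * f y \<le> c * exp (M * norm y powr \<gamma>) * f y"
        using EE[OF \<theta>, of y] pos[of y] by (intro mult_right_mono) auto
      then show "ennreal ((E (y + \<theta>))\<^sup>2) * ennreal (f y) \<le> ennreal (c * ?w y)"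
        using pos[of y] by (subst ennreal_mult[symmetric]) (auto intro!: ennreal_leI simp: mult.assoc)
    qed
    also have "\<dots> = ennreal (\<integral>y. c * ?w y \<partial>lborel)"
      using pos int Mpos by (intro nn_integral_eq_integral) (auto simp: c_def less_imp_le)
    finally show "(\<integral>\<^sup>+x. ennreal ((E x)\<^sup>2) * ennreal (f (x - \<theta>)) \<partial>lborel) \<le> ennreal (c * (\<integral>y. ?w y \<partial>lborel))" by simp
  qed
  moreover have "E \<in> borel_measurable borel" unfolding E_def G_def by measurable
  moreover have "\<forall>x. E x \<ge> 0" by (simp add: E_def)
  ultimately show ?thesis using e1 e2 by (intro exI[of _ E]) auto
qed

context mixture_model
begin

lemma envelope_second_moment:
  assumes E[measurable]: "E \<in> borel_measurable borel" and I: "I \<ge> 0"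
    and le: "\<And>k. k < K \<Longrightarrow> (\<integral>\<^sup>+x. ennreal ((E x)\<^sup>2) * ennreal (f (x - \<theta>s k)) \<partial>lborel) \<le> ennreal I"
  shows "(\<integral>\<^sup>+x. ennreal ((E x)\<^sup>2) \<partial>Q) \<le> ennreal I"
proof -
  have "(\<integral>\<^sup>+x. ennreal ((E x)\<^sup>2) \<partial>Q) = (\<integral>\<^sup>+x. (\<Sum>k<K. ennreal (ws k) * (ennreal ((E x)\<^sup>2) * ennreal (f (x - \<theta>s k)))) \<partial>lborel)"
    unfolding Q_def
  proof (subst nn_integral_density)
    show "(\<integral>\<^sup>+x. ennreal (ps x) * ennreal ((E x)\<^sup>2) \<partial>lborel) =
      (\<integral>\<^sup>+x. (\<Sum>k<K. ennreal (ws k) * (ennreal ((E x)\<^sup>2) * ennreal (f (x - \<theta>s k)))) \<partial>lborel)"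
    proof (intro nn_integral_cong)
      fix x
      have "(\<Sum>k<K. ennreal (ws k) * (ennreal ((E x)\<^sup>2) * ennreal (f (x - \<theta>s k)))) =
        (\<Sum>k<K. ennreal (ws k * ((E x)\<^sup>2 * f (x - \<theta>s k))))"
        using ws_pos f_pos by (intro sum.cong) (auto simp: ennreal_mult less_imp_le)
      also have "\<dots> = ennreal (\<Sum>k<K. ws k * ((E x)\<^sup>2 * f (x - \<theta>s k)))"
        using ws_pos f_pos by (intro sum_ennreal) (auto simp: less_imp_le)
      also have "(\<Sum>k<K. ws k * ((E x)\<^sup>2 * f (x - \<theta>s k))) = ps x * (E x)\<^sup>2"
        by (simp add: ps_def sum_distrib_left sum_distrib_right mult_ac)
      finally show "ennreal (ps x) * ennreal ((E x)\<^sup>2) = (\<Sum>k<K. ennreal (ws k) * (ennreal ((E x)\<^sup>2) * ennreal (f (x - \<theta>s k))))"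
        using ps_pos[of x] by (simp add: ennreal_mult less_imp_le)
    qed
  qed auto
  also have "\<dots> = (\<Sum>k<K. ennreal (ws k) * (\<integral>\<^sup>+x. ennreal ((E x)\<^sup>2) * ennreal (f (x - \<theta>s k)) \<partial>lborel))"
    by (simp add: nn_integral_sum nn_integral_cmult)
  also have "\<dots> \<le> (\<Sum>k<K. ennreal (ws k) * ennreal I)"
    using le by (intro sum_mono mult_left_mono) auto
  also have "\<dots> = (\<Sum>k<K. ennreal (ws k * I))"
    using ws_pos I by (intro sum.cong) (auto simp: ennreal_mult less_imp_le)
  also have "\<dots> = ennreal (\<Sum>k<K. ws k * I)"
    using ws_pos I by (intro sum_ennreal) (auto simp: less_imp_le)
  also have "(\<Sum>k<K. ws k * I) = I" using ws_sum by (simp add: sum_distrib_right[symmetric])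
  finally show ?thesis .
qed

text \<open>The error has three parts: K weights each wrong by at most K \<tau>, locations wrong by
  \<tau>, and a tail of mass at most \<tau>. Each part is relative to E x times the true density,
  whence the constant K K + 2.\<close>

lemma near_ratio:
  assumes v: "valid \<Theta> (v, \<theta>)" and \<theta>s: "\<And>k. k < K \<Longrightarrow> \<theta>s k \<in> \<Theta>"
    and E0: "\<And>x. E x \<ge> 0"
    and E1: "\<And>x \<theta> \<theta>'. \<theta> \<in> \<Theta> \<Longrightarrow> \<theta>' \<in> \<Theta> \<Longrightarrow> f (x - \<theta>) \<le> E x * f (x - \<theta>')"
    and E2: "\<And>x \<theta> \<theta>'. \<theta> \<in> \<Theta> \<Longrightarrow> \<theta>' \<in> \<Theta> \<Longrightarrow> norm (\<theta> - \<theta>') \<le> 1 \<Longrightarrow>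
      \<bar>f (x - \<theta>) - f (x - \<theta>')\<bar> \<le> norm (\<theta> - \<theta>') * E x * f (x - \<theta>')"
    and near: "(v, \<theta>) \<in> near_event K (weight_sticks ws) \<theta>s \<tau>" and \<tau>: "\<tau> \<le> 1"
  shows "\<bar>(\<Sum>k. stick_breaking v k * f (x - \<theta> k)) / ps x - 1\<bar> \<le> \<tau> * ((real K * real K + 2) * E x)"
proof -
  have vd: "v \<in> stick_dom" and v1: "stick_breaking v sums 1" and \<theta>: "\<And>k. \<theta> k \<in> \<Theta>"
    using v by (auto simp: valid_def)
  let ?w = "stick_breaking v"
  have w0: "0 \<le> ?w k" for k using stick_breaking_pos[OF vd] by (simp add: less_imp_le)
  have ws: "\<forall>k<K. ws k > 0" using ws_pos by auto
  note ne = near_eventD[OF ws ws_sum K_pos vd near]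
  note s = nmix_eq(2)[OF w0 v1, where x=x and \<theta>=\<theta>]
  have sw: "summable ?w" using v1 by (simp add: sums_iff)
  \<comment> \<open>Averaging the ratio bound over the true weights compares a single translate of
    \<open>f\<close> with the whole true density.\<close>
  have env: "f (x - t) \<le> E x * ps x" if "t \<in> \<Theta>" for t
  proof -
    have "f (x - t) = (\<Sum>k<K. ws k * f (x - t))" using ws_sum by (simp add: sum_distrib_right[symmetric])
    also have "\<dots> \<le> (\<Sum>k<K. ws k * (E x * f (x - \<theta>s k)))"
      using ws_pos E1[OF that \<theta>s] by (intro sum_mono mult_left_mono) (auto simp: less_imp_le)
    also have "\<dots> = E x * ps x" by (simp add: ps_def sum_distrib_left mult_ac)
    finally show ?thesis .
  qed
  have a: "\<bar>\<Sum>k<K. (?w k - ws k) * f (x - \<theta> k)\<bar> \<le> real K * (real K * \<tau> * (E x * ps x))"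
  proof -
    have "\<bar>\<Sum>k<K. (?w k - ws k) * f (x - \<theta> k)\<bar> \<le> (\<Sum>k<K. \<bar>(?w k - ws k) * f (x - \<theta> k)\<bar>)" by (rule sum_abs)
    also have "\<dots> \<le> (\<Sum>k<K. real K * \<tau> * (E x * ps x))"
    proof (intro sum_mono)
      fix k assume k: "k \<in> {..<K}"
      have "\<bar>(?w k - ws k) * f (x - \<theta> k)\<bar> = \<bar>?w k - ws k\<bar> * f (x - \<theta> k)"
        using f_pos[of "x - \<theta> k"] by (simp add: abs_mult)
      also have "\<dots> \<le> real K * \<tau> * (E x * ps x)"
        using ne(1)[of k] k env[OF \<theta>[of k]] f_pos[of "x - \<theta> k"] order_trans[OF abs_ge_zero ne(1)[of k]]
        by (intro mult_mono) auto
      finally show "\<bar>(?w k - ws k) * f (x - \<theta> k)\<bar> \<le> real K * \<tau> * (E x * ps x)" .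
    qed
    finally show ?thesis by simp
  qed
  have b: "\<bar>\<Sum>k<K. ws k * (f (x - \<theta> k) - f (x - \<theta>s k))\<bar> \<le> \<tau> * (E x * ps x)"
  proof -
    have "\<bar>\<Sum>k<K. ws k * (f (x - \<theta> k) - f (x - \<theta>s k))\<bar> \<le> (\<Sum>k<K. \<bar>ws k * (f (x - \<theta> k) - f (x - \<theta>s k))\<bar>)" by (rule sum_abs)
    also have "\<dots> \<le> (\<Sum>k<K. ws k * (\<tau> * E x * f (x - \<theta>s k)))"
    proof (intro sum_mono)
      fix k assume k: "k \<in> {..<K}"
      have "\<bar>f (x - \<theta> k) - f (x - \<theta>s k)\<bar> \<le> norm (\<theta> k - \<theta>s k) * E x * f (x - \<theta>s k)"
        using ne(3)[of k] k \<tau> by (intro E2 \<theta> \<theta>s) auto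
      also have "\<dots> \<le> \<tau> * E x * f (x - \<theta>s k)"
        using ne(3)[of k] k E0 f_pos by (intro mult_right_mono) (auto simp: less_imp_le)
      finally show "\<bar>ws k * (f (x - \<theta> k) - f (x - \<theta>s k))\<bar> \<le> ws k * (\<tau> * E x * f (x - \<theta>s k))"
        using ws_pos[of k] k by (simp add: abs_mult)
    qed
    also have "\<dots> = \<tau> * (E x * ps x)" by (simp add: ps_def sum_distrib_left mult_ac)
    finally show ?thesis .
  qed
  have sK: "summable (\<lambda>k. ?w (k + K) * f (x - \<theta> (k + K)))" using s by (subst summable_iff_shift)
  have c: "\<bar>\<Sum>k. ?w (k + K) * f (x - \<theta> (k + K))\<bar> \<le> \<tau> * (E x * ps x)"
  proof -
    have nn: "0 \<le> (\<Sum>k. ?w (k + K) * f (x - \<theta> (k + K)))"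
      using w0 f_pos by (intro suminf_nonneg sK) (auto simp: less_imp_le)
    have "(\<Sum>k. ?w (k + K) * f (x - \<theta> (k + K))) \<le> (\<Sum>k. ?w (k + K) * (E x * ps x))"
      using w0 env \<theta> sw by (intro suminf_le sK summable_mult2 mult_left_mono) (auto simp: summable_iff_shift)
    also have "\<dots> = (\<Sum>k. ?w (k + K)) * (E x * ps x)"
      using sw by (intro suminf_mult2[symmetric]) (auto simp: summable_iff_shift)
    also have "\<dots> \<le> \<tau> * (E x * ps x)"
    proof (intro mult_right_mono)
      show "(\<Sum>k. ?w (k + K)) \<le> \<tau>" using suminf_stick_breaking_le[OF vd, of K] ne(2) by (simp add: add.commute)
    qed (use E0 ps_pos[of x] in auto)
    finally show ?thesis using nn by simp
  qed
  have split: "(\<Sum>k. ?w k * f (x - \<theta> k)) - ps x = (\<Sum>k<K. (?w k - ws k) * f (x - \<theta> k)) +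
     (\<Sum>k<K. ws k * (f (x - \<theta> k) - f (x - \<theta>s k))) + (\<Sum>k. ?w (k + K) * f (x - \<theta> (k + K)))"
    unfolding suminf_split_initial_segment[OF s, of K] ps_def
    by (simp add: algebra_simps sum_subtractf sum.distrib)
  have "\<bar>(\<Sum>k. ?w k * f (x - \<theta> k)) - ps x\<bar> \<le> real K * (real K * \<tau> * (E x * ps x)) + \<tau> * (E x * ps x) + \<tau> * (E x * ps x)"
    unfolding split using a b c by linarith
  also have "\<dots> = \<tau> * ((real K * real K + 2) * E x) * ps x" by (simp add: algebra_simps)
  finally have "\<bar>(\<Sum>k. ?w k * f (x - \<theta> k)) - ps x\<bar> / ps x \<le> \<tau> * ((real K * real K + 2) * E x)"
    using ps_pos[of x] by (simp add: divide_le_eq)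
  moreover have "\<bar>(\<Sum>k. ?w k * f (x - \<theta> k)) / ps x - 1\<bar> = \<bar>(\<Sum>k. ?w k * f (x - \<theta> k)) - ps x\<bar> / ps x"
  proof -
    have "(\<Sum>k. ?w k * f (x - \<theta> k)) / ps x - 1 = ((\<Sum>k. ?w k * f (x - \<theta> k)) - ps x) / ps x"
      using ps_pos[of x] by (simp add: diff_divide_distrib)
    then show ?thesis using ps_pos[of x] by (simp add: abs_divide)
  qed
  ultimately show ?thesis by simp
qed

end

section \<open>Posterior\<close>

text \<open>The scale \<open>e\<close> has to be below the inverse diameter bound of \<Theta>, for
  the quadratic hump bounds, and small enough that 2 K e + e, the largest frequency bound among the
  tests, stays below \<open>r\<close>, where the convolution can be inverted.\<close>

lemma exists_separated:
  fixes \<theta>s :: "nat \<Rightarrow> 'a::euclidean_space"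
  assumes inj: "inj_on \<theta>s {..<K}" and \<Theta>: "bounded \<Theta>" "\<And>k. k < K \<Longrightarrow> \<theta>s k \<in> \<Theta>" and K: "K \<ge> 1" and r: "r > 0"
  shows "\<exists>e \<sigma>. separated K \<theta>s e \<sigma> \<and> real K * (2 * e) + e \<le> r \<and>
    (\<forall>\<theta>\<in>\<Theta>. \<exists>j. separated.nearest K \<theta>s e \<theta> j)"
proof -
  \<comment> \<open>The inserted 1 keeps the minimum well defined when K = 1.\<close>
  let ?D = "insert 1 ((\<lambda>(i, j). norm (\<theta>s i - \<theta>s j)) ` {(i, j). i < K \<and> j < K \<and> i \<noteq> j})"
  have fin: "finite ?D"
  proof -
    have "finite {(i, j). i < K \<and> j < K \<and> i \<noteq> j}"
      by (rule finite_subset[of _ "{..<K} \<times> {..<K}"]) auto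
    then show ?thesis by simp
  qed
  define \<sigma> where "\<sigma> = Min ?D / 2"
  have pos: "0 < x" if "x \<in> ?D" for x using that inj by (auto dest: inj_onD)
  have \<sigma>: "\<sigma> > 0" unfolding \<sigma>_def using fin pos by (subst half_gt_zero_iff, subst Min_gr_iff) auto
  have sep: "2 * \<sigma> \<le> norm (\<theta>s i - \<theta>s j)" if "i < K" "j < K" "i \<noteq> j" for i j
  proof -
    have "norm (\<theta>s i - \<theta>s j) \<in> ?D" using that by force
    then show ?thesis unfolding \<sigma>_def using fin by (simp only: Min_le mult_2 field_sum_of_halves)
  qed
  obtain L0 where L0: "\<forall>\<theta>\<in>\<Theta>. norm \<theta> \<le> L0" using \<Theta>(1) by (auto simp: bounded_iff)
  define L where "L = max 1 (2 * L0)"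
  have L: "norm (\<theta> - \<theta>') \<le> L" if "\<theta> \<in> \<Theta>" "\<theta>' \<in> \<Theta>" for \<theta> \<theta>'
  proof -
    have "2 * L0 \<le> L" by (simp add: L_def)
    moreover have "norm \<theta> \<le> L0" "norm \<theta>' \<le> L0" using L0 that by auto
    ultimately show ?thesis using norm_triangle_ineq4[of \<theta> \<theta>'] by linarith
  qed
  define e where "e = min (1 / L) (r / (2 * real K + 1))"
  have L1: "L \<ge> 1" by (simp add: L_def)
  have e0: "e > 0" using L1 r by (simp add: e_def add_nonneg_pos)
  have eL: "e * norm (\<theta> - \<theta>') \<le> 1" if "\<theta> \<in> \<Theta>" "\<theta>' \<in> \<Theta>" for \<theta> \<theta>'
  proof -
    have "e * norm (\<theta> - \<theta>') \<le> (1 / L) * L"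
      using L[OF that] e0 L1 by (intro mult_mono) (auto simp: e_def)
    then show ?thesis using L1 by simp
  qed
  have sp: "separated K \<theta>s e \<sigma>"
    by unfold_locales (use e0 \<sigma> sep eL \<Theta>(2) in auto)
  have "(2 * real K + 1) * e \<le> (2 * real K + 1) * (r / (2 * real K + 1))"
    by (intro mult_left_mono) (auto simp: e_def)
  moreover have "(2 * real K + 1) * (r / (2 * real K + 1)) = r" by (simp add: add_nonneg_eq_0_iff)
  ultimately have er: "real K * (2 * e) + e \<le> r" by (simp add: algebra_simps)
  have near: "\<exists>j. separated.nearest K \<theta>s e \<theta> j" if \<theta>: "\<theta> \<in> \<Theta>" for \<theta>
  proof -
    let ?A = "(\<lambda>i. norm (\<theta> - \<theta>s i)) ` {..<K}"
    have "Min ?A \<in> ?A" using K by (intro Min_in) (auto simp: lessThan_empty_iff)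
    then obtain j where j: "j < K" "norm (\<theta> - \<theta>s j) = Min ?A" by auto
    then have "separated.nearest K \<theta>s e \<theta> j"
      unfolding separated.nearest_def[OF sp] using eL \<theta> \<Theta>(2) by auto
    then show ?thesis by blast
  qed
  show ?thesis using sp er near by blast
qed

lemma AE_pair_fstI:
  assumes "prob_space M1" "prob_space M2" "AE x in M1. P x"
  shows "AE z in M1 \<Otimes>\<^sub>M M2. P (fst z)"
proof -
  interpret M2: prob_space M2 by fact
  obtain N where N: "{x \<in> space M1. \<not> P x} \<subseteq> N" "emeasure M1 N = 0" "N \<in> sets M1" by (rule AE_E[OF assms(3)])
  show ?thesis
  proof (rule AE_I[where N = "N \<times> space M2"])
    show "emeasure (M1 \<Otimes>\<^sub>M M2) (N \<times> space M2) = 0"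
      using N by (subst M2.emeasure_pair_measure_Times) auto
  qed (use N in \<open>auto simp: space_pair_measure\<close>)
qed

lemma AE_pair_sndI:
  assumes "prob_space M1" "prob_space M2" "AE x in M2. P x"
  shows "AE z in M1 \<Otimes>\<^sub>M M2. P (snd z)"
proof -
  interpret M2: prob_space M2 by fact
  obtain N where N: "{x \<in> space M2. \<not> P x} \<subseteq> N" "emeasure M2 N = 0" "N \<in> sets M2" by (rule AE_E[OF assms(3)])
  show ?thesis
  proof (rule AE_I[where N = "space M1 \<times> N"])
    show "emeasure (M1 \<Otimes>\<^sub>M M2) (space M1 \<times> N) = 0"
      using N by (subst M2.emeasure_pair_measure_Times) auto
  qed (use N in \<open>auto simp: space_pair_measure\<close>)
qed

lemma AE_valid:
  fixes P0 :: "'a::euclidean_space measure"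
  assumes "\<alpha> > 0" "prob_space P0" "AE x in P0. x \<in> \<Theta>"
  shows "AE p in stick_prior \<alpha> \<Otimes>\<^sub>M PiM UNIV (\<lambda>_::nat. P0). valid \<Theta> p"
proof -
  have ps: "prob_space (stick_prior \<alpha>)" "prob_space (PiM UNIV (\<lambda>_::nat. P0))"
    using assms by (auto intro!: prob_space_PiM prob_space_beta_1)
  have 1: "AE v in stick_prior \<alpha>. v \<in> stick_dom \<and> stick_breaking v sums 1"
    using AE_stick_dom[OF assms(1)] AE_stick_breaking_sums[OF assms(1)] by eventually_elim simp
  have 2: "AE \<theta> in PiM UNIV (\<lambda>_::nat. P0). \<forall>k. \<theta> k \<in> \<Theta>"
    unfolding AE_all_countable by (intro allI AE_PiM_component assms) auto
  show ?thesis
    using AE_pair_fstI[OF ps 1] AE_pair_sndI[OF ps 2] by eventually_elim (auto simp: valid_def)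
qed

context mixture_model
begin

text \<open>Finitely many dual functions get a common bound; the inserted 1 makes it
  positive.\<close>

lemma test_family:
  assumes "finite HS" "\<And>H. H \<in> HS \<Longrightarrow> \<exists>r\<le>r0. trig r H" and pos: "\<And>\<xi>. norm \<xi> \<le> r0 \<Longrightarrow> cosf \<xi> > 0"
  shows "\<exists>g B. B > 0 \<and> (\<forall>H\<in>HS. g H \<in> borel_measurable borel \<and> (\<forall>x. \<bar>g H x\<bar> \<le> B) \<and>
     (\<forall>\<theta>. (\<integral>x. g H x * f (x - \<theta>) \<partial>lborel) = H \<theta>))"
proof -
  have "\<forall>H\<in>HS. \<exists>gB. fst gB \<in> borel_measurable borel \<and> (\<forall>x. \<bar>fst gB x\<bar> \<le> snd gB) \<and> (\<forall>\<theta>. (\<integral>x. fst gB x * f (x - \<theta>) \<partial>lborel) = H \<theta>)"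
  proof
    fix H assume "H \<in> HS"
    then obtain r where "r \<le> r0" "trig r H" using assms by blast
    then have "trig r0 H" by (auto intro: trig_mono)
    from trig_dual[OF this pos] obtain g B where "g \<in> borel_measurable borel" "\<forall>x. \<bar>g x\<bar> \<le> B" "\<forall>\<theta>. (\<integral>x. g x * f (x - \<theta>) \<partial>lborel) = H \<theta>"
      by blast
    then show "\<exists>gB. fst gB \<in> borel_measurable borel \<and> (\<forall>x. \<bar>fst gB x\<bar> \<le> snd gB) \<and> (\<forall>\<theta>. (\<integral>x. fst gB x * f (x - \<theta>) \<partial>lborel) = H \<theta>)"
      by (intro exI[of _ "(g, B)"]) auto
  qed
  from bchoice[OF this] obtain gB where gB: "\<And>H. H \<in> HS \<Longrightarrow> fst (gB H) \<in> borel_measurable borel"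
    "\<And>H x. H \<in> HS \<Longrightarrow> \<bar>fst (gB H) x\<bar> \<le> snd (gB H)" "\<And>H \<theta>. H \<in> HS \<Longrightarrow> (\<integral>x. fst (gB H) x * f (x - \<theta>) \<partial>lborel) = H \<theta>"
    by blast
  define B where "B = Max (insert 1 ((\<lambda>H. snd (gB H)) ` HS))"
  have "B \<ge> 1" unfolding B_def using assms(1) by (intro Max_ge) auto
  moreover have "\<bar>fst (gB H) x\<bar> \<le> B" if "H \<in> HS" for H x
  proof -
    have "snd (gB H) \<le> B" unfolding B_def using assms(1) that by (intro Max_ge) auto
    with gB(2)[OF that, of x] show ?thesis by linarith
  qed
  ultimately show ?thesis using gB by (intro exI[of _ "\<lambda>H. fst (gB H)"] exI[of _ B]) auto
qed

lemma Lr_finite: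
  assumes "valid \<Theta> p" shows "Lr n p X < \<infinity>"
proof -
  have w: "\<And>k. 0 \<le> stick_breaking (fst p) k" "stick_breaking (fst p) sums 1"
    using assms stick_breaking_pos by (auto simp: valid_def less_imp_le)
  have r0: "0 \<le> (\<Sum>k. stick_breaking (fst p) k * f (x - snd p k))" for x
    using w(1) f_pos nmix_eq(2)[OF w] by (intro suminf_nonneg) (auto simp: less_imp_le)
  show ?thesis unfolding LR_ennreal[OF nmix_eq(1)[OF w] r0] by simp
qed

lemma measurable_int_Lr:
  assumes N: "prob_space N" "sets N = sets (PiM UNIV (\<lambda>_. borel) \<Otimes>\<^sub>M PiM UNIV (\<lambda>_. borel))" and B[measurable]: "B \<in> sets N"
  shows "(\<lambda>X. \<integral>\<^sup>+p. indicator B p * Lr n p X \<partial>N) \<in> borel_measurable (PiM UNIV (\<lambda>_. Q))"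
    and "(\<lambda>p. Lr n p X) \<in> borel_measurable N"
proof -
  interpret N: prob_space N by (rule N)
  note mL = measurable_Lr[OF N(2), of n]
  have [measurable]: "(\<lambda>(X, p). Lr n p X) \<in> borel_measurable (PiM UNIV (\<lambda>_. Q) \<Otimes>\<^sub>M N)"
    using measurable_pair_swap[OF mL] by (simp add: split_beta)
  show "(\<lambda>X. \<integral>\<^sup>+p. indicator B p * Lr n p X \<partial>N) \<in> borel_measurable (PiM UNIV (\<lambda>_. Q))"
    by measurable
  have "X \<in> space (PiM UNIV (\<lambda>_::nat. Q))" by (simp add: space_PiM)
  then show "(\<lambda>p. Lr n p X) \<in> borel_measurable N" using measurable_compose[OF measurable_Pair1' mL] by simp
qed

text \<open>Numerator and denominator are divided by the true likelihood \<open>c\<close>, which is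
  positive and cancels, and are pulled back from weights to sticks. Off the null set of invalid
  parameters all quantities are finite, so nothing is lost in passing to
  \<open>ennreal\<close>.\<close>

lemma posterior_eq:
  fixes P0 :: "'a measure"
  assumes \<alpha>: "\<alpha> > 0" and P0: "prob_space P0" "sets P0 = sets borel" "AE x in P0. x \<in> \<Theta>"
    and B: "B \<in> sets (PiM UNIV (\<lambda>_. borel) \<Otimes>\<^sub>M PiM UNIV (\<lambda>_. borel))"
  defines "N \<equiv> stick_prior \<alpha> \<Otimes>\<^sub>M PiM UNIV (\<lambda>_::nat. P0)"
  shows "posterior (DP_prior \<alpha> P0) f n X B =
     enn2real (\<integral>\<^sup>+p. indicator {p. (stick_breaking (fst p), snd p) \<in> B} p * Lr n p X \<partial>N) / enn2real (\<integral>\<^sup>+p. Lr n p X \<partial>N)"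
proof -
  let ?BB = "PiM UNIV (\<lambda>_. borel) \<Otimes>\<^sub>M PiM UNIV (\<lambda>_. borel :: 'a measure)"
  have S: "sets (PiM UNIV (\<lambda>_::nat. P0)) = sets (PiM UNIV (\<lambda>_. borel))"
    by (rule sets_PiM_borel) (rule P0)
  have sN[measurable_cong]: "sets N = sets ?BB"
    unfolding N_def by (rule sets_pair_measure_cong[OF sets_stick_prior S])
  have [measurable]: "B \<in> sets ?BB" by (rule B)
  have st: "(\<lambda>v. stick_breaking v) \<in> measurable (PiM UNIV (\<lambda>_. borel)) (PiM UNIV (\<lambda>_. borel))"
    by (rule measurable_PiM_single') (auto simp: space_PiM)
  have T[measurable]: "(\<lambda>(v, \<theta>). (stick_breaking v, \<theta>)) \<in> measurable N ?BB"
    unfolding measurable_cong_sets[OF sN refl] using st by measurable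
  have pi: "DP_prior \<alpha> P0 = distr N ?BB (\<lambda>(v, \<theta>). (stick_breaking v, \<theta>))"
    unfolding DP_prior_def N_def by simp
  define l where "l p = likelihood f n X (discrete_measure UNIV (fst p) (snd p))" for p :: "(nat \<Rightarrow> real) \<times> (nat \<Rightarrow> 'a)"
  have l_eq: "l p = (\<Prod>i<n. enn2real (nmix (fst p) (snd p) (X i)))" for p
    unfolding l_def likelihood_def mixture_nmix ..
  have l0: "0 \<le> l p" for p unfolding l_eq by (intro prod_nonneg) auto
  have lm[measurable]: "l \<in> borel_measurable ?BB"
    unfolding l_eq[abs_def] nmix_def by measurable
  define c where "c = (\<Prod>i<n. ps (X i))"
  have c: "c > 0" unfolding c_def using ps_pos by (intro prod_pos) auto
  have conv: "(\<integral>p. indicator A p * l p \<partial>DP_prior \<alpha> P0) =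
    c * enn2real (\<integral>\<^sup>+p. indicator {p. (stick_breaking (fst p), snd p) \<in> A} p * Lr n p X \<partial>N)"
    if A[measurable]: "A \<in> sets ?BB" for A
  proof -
    have "(\<integral>p. indicator A p * l p \<partial>DP_prior \<alpha> P0) = enn2real (\<integral>\<^sup>+p. ennreal (indicator A p * l p) \<partial>DP_prior \<alpha> P0)"
      using l0 unfolding pi by (intro integral_eq_nn_integral) auto
    also have "(\<integral>\<^sup>+p. ennreal (indicator A p * l p) \<partial>DP_prior \<alpha> P0) =
      (\<integral>\<^sup>+p. ennreal (indicator A (stick_breaking (fst p), snd p) * l (stick_breaking (fst p), snd p)) \<partial>N)"
      unfolding pi by (subst nn_integral_distr) (auto simp: split_beta)
    also have "\<dots> = (\<integral>\<^sup>+p. ennreal c * (indicator {p. (stick_breaking (fst p), snd p) \<in> A} p * Lr n p X) \<partial>N)"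
    proof (intro nn_integral_cong_AE)
      show "AE p in N. ennreal (indicator A (stick_breaking (fst p), snd p) * l (stick_breaking (fst p), snd p)) =
        ennreal c * (indicator {p. (stick_breaking (fst p), snd p) \<in> A} p * Lr n p X)"
        using AE_valid[OF \<alpha> P0(1,3)] unfolding N_def[symmetric]
      proof eventually_elim
        case (elim p)
        have w: "\<And>k. 0 \<le> stick_breaking (fst p) k" "stick_breaking (fst p) sums 1"
          using elim stick_breaking_pos by (auto simp: valid_def less_imp_le)
        let ?r = "\<lambda>x. \<Sum>k. stick_breaking (fst p) k * f (x - snd p k)"
        have r0: "0 \<le> ?r x" for x
          using w(1) f_pos nmix_eq(2)[OF w] by (intro suminf_nonneg) (auto simp: less_imp_le)
        have "l (stick_breaking (fst p), snd p) = (\<Prod>i<n. ?r (X i))"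
          unfolding l_eq using r0 by (simp add: nmix_eq(1)[OF w])
        also have "\<dots> = c * (\<Prod>i<n. ?r (X i) / ps (X i))"
          unfolding c_def prod.distrib[symmetric] using ps_pos by (intro prod.cong) (auto simp: less_imp_neq[symmetric])
        finally have "ennreal (l (stick_breaking (fst p), snd p)) = ennreal c * Lr n p X"
          using LR_ennreal[OF nmix_eq(1)[OF w] r0, where n=n and X=X] c r0 ps_pos
          by (simp add: ennreal_mult prod_nonneg less_imp_le)
        then show ?case by (auto simp: indicator_def)
      qed
    qed
    also have "\<dots> = ennreal c * (\<integral>\<^sup>+p. indicator {p. (stick_breaking (fst p), snd p) \<in> A} p * Lr n p X \<partial>N)"
    proof (rule nn_integral_cmult)
      have pN: "prob_space N" unfolding N_def
        using \<alpha> P0 by (intro prob_space_pair prob_space_PiM prob_space_beta_1) auto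
      note [measurable] = measurable_int_Lr(2)[OF pN sN sets.top, where n=n and X=X]
      have "{p. (stick_breaking (fst p), snd p) \<in> A} = (\<lambda>(v, \<theta>). (stick_breaking v, \<theta>)) -` A \<inter> space N"
        unfolding N_def by (auto simp: space_pair_measure space_PiM P0(2)[THEN sets_eq_imp_space_eq])
      also have "\<dots> \<in> sets N" by (rule measurable_sets[OF T A])
      finally have [measurable]: "{p. (stick_breaking (fst p), snd p) \<in> A} \<in> sets N" .
      show "(\<lambda>p. indicator {p. (stick_breaking (fst p), snd p) \<in> A} p * Lr n p X) \<in> borel_measurable N" by measurable
    qed
    finally show ?thesis using c by (simp add: enn2real_mult)
  qed
  have num: "(LINT p:B|DP_prior \<alpha> P0. l p) = c * enn2real (\<integral>\<^sup>+p. indicator {p. (stick_breaking (fst p), snd p) \<in> B} p * Lr n p X \<partial>N)"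
    using conv[OF B] by (simp add: set_lebesgue_integral_def)
  have den: "(LINT p|DP_prior \<alpha> P0. l p) = c * enn2real (\<integral>\<^sup>+p. Lr n p X \<partial>N)"
  proof -
    have "UNIV \<in> sets ?BB" using sets.top[of ?BB] by (simp add: space_pair_measure space_PiM)
    from conv[OF this] show ?thesis by simp
  qed
  show ?thesis unfolding posterior_def l_def[symmetric] num den using c by simp
qed

end

section \<open>Powers of n\<close>

lemma rate_bound_tendsto:
  fixes \<eta> a1 a2 a3 c \<kappa> I L C1 C2 C3 :: real
  assumes "\<eta> > 0" "a1 < 0" "a2 < 0" "c > 0"
  shows "(\<lambda>n::nat. 2 * (\<kappa> + (exp (I * real n powr (- 2 * \<eta>)) - 1) / \<kappa>) + L * exp (- (real n powr (2 * \<eta>) / c))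
     + (C1 * real n powr a1 + C2 * real n powr a2 + C3 * (exp (- (real n powr (2 * \<eta>) / c)) * real n powr a3))) \<longlonglongrightarrow> 2 * \<kappa>"
proof -
  have 1: "(\<lambda>n::nat. exp (I * real n powr (- 2 * \<eta>)) - 1) \<longlonglongrightarrow> 0"
    using assms by real_asymp
  have 2: "(\<lambda>n::nat. exp (- (real n powr (2 * \<eta>) / c))) \<longlonglongrightarrow> 0"
    using assms by real_asymp
  have 3: "(\<lambda>n::nat. real n powr a1) \<longlonglongrightarrow> 0" "(\<lambda>n::nat. real n powr a2) \<longlonglongrightarrow> 0"
    using assms(2) by real_asymp (use assms(3) in real_asymp)
  have 4: "(\<lambda>n::nat. exp (- (real n powr (2 * \<eta>) / c)) * real n powr a3) \<longlonglongrightarrow> 0"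
    using assms by real_asymp
  have 5: "(\<lambda>n::nat. (exp (I * real n powr (- 2 * \<eta>)) - 1) / \<kappa>) \<longlonglongrightarrow> 0"
    using tendsto_mult_left[OF 1, of "1 / \<kappa>"] by simp
  have "(\<lambda>n::nat. 2 * (\<kappa> + (exp (I * real n powr (- 2 * \<eta>)) - 1) / \<kappa>) + L * exp (- (real n powr (2 * \<eta>) / c))
     + (C1 * real n powr a1 + C2 * real n powr a2 + C3 * (exp (- (real n powr (2 * \<eta>) / c)) * real n powr a3)))
     \<longlonglongrightarrow> 2 * (\<kappa> + 0) + L * 0 + (C1 * 0 + C2 * 0 + C3 * 0)"
    by (intro tendsto_intros 2 3 4 5)
  then show ?thesis by simp
qed

lemma powr_nat_power: "x > 0 \<Longrightarrow> (x powr a) ^ k = x powr (a * real k)" for x a :: real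
  by (simp add: powr_realpow[symmetric] powr_powr)

text \<open>All rates reduce to four identities: n t^2 = n^(2 \<eta>) drives the tests, n \<tau>^2 =
  n^(-2 \<eta>) the denominator, t / \<rho> = n^(-\<eta>) the event of many atoms, and \<rho> / en =
  n^(2 \<eta> - \<delta>') is the gain from the additional atom. Dividing by the prior mass of the
  neighbourhood multiplies the numerator terms by a constant times n^(h s).\<close>

lemma rate_computation:
  fixes \<eta> \<delta>' a0 \<alpha> h s e2 :: real and n m s0 :: nat
  defines "t \<equiv> real n powr (- (1 / 2) + \<eta>)" and "\<rho> \<equiv> real n powr (- (1 / 2) + 2 * \<eta>)"
    and "\<tau> \<equiv> real n powr (- (1 / 2) - \<eta>)" and "en \<equiv> real n powr (- (1 / 2) + \<delta>')"
  assumes n: "n \<ge> 1" and pos: "\<kappa> > 0" "\<epsilon> > 0" "cA > 0" "Bc > 0" "I' \<ge> 0"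
    and h: "h = 1 / 2 + \<eta>" and s: "s = real s0 + \<alpha>"
    and e2: "e2 = (- (1 / 2) + 2 * \<eta>) * (real s0 + a0) + (2 * \<eta> - \<delta>') / 2"
  shows "2 * (\<kappa> + ((1 + \<tau>\<^sup>2 * I') ^ n - 1) / \<kappa>) + L * exp (- (real n * t\<^sup>2 / b))
      + ((Cm * (Bc * t / \<rho>) powr (1/4)) ^ m + Cc * (\<rho> ^ s0 * \<rho> powr a0 * sqrt (\<rho> / en)) + exp (- (real n * t\<^sup>2 / b)))
        / (\<epsilon> * (cA * (\<tau> ^ s0 * \<tau> powr \<alpha>) / 2))
    \<le> 2 * (\<kappa> + (exp (I' * real n powr (- 2 * \<eta>)) - 1) / \<kappa>) + L * exp (- (real n powr (2 * \<eta>) / b))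
      + (2 / (\<epsilon> * cA) * (Cm ^ m * Bc powr (real m / 4)) * real n powr (h * s - \<eta> * (real m / 4))
        + 2 / (\<epsilon> * cA) * Cc * real n powr (h * s + e2)
        + 2 / (\<epsilon> * cA) * (exp (- (real n powr (2 * \<eta>) / b)) * real n powr (h * s)))"
proof -
  define N where "N = real n"
  have N: "N > 0" using n by (simp add: N_def)
  have t: "t = N powr (- (1 / 2) + \<eta>)" and \<rho>: "\<rho> = N powr (- (1 / 2) + 2 * \<eta>)"
    and \<tau>: "\<tau> = N powr (- (1 / 2) - \<eta>)" and en: "en = N powr (- (1 / 2) + \<delta>')"
    by (simp_all add: t_def \<rho>_def \<tau>_def en_def N_def)
  have sq: "N * (N powr a)\<^sup>2 = N powr (1 + a * 2)" for a
  proof -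
    have "(N powr a)\<^sup>2 = N powr (a * real 2)" using N by (rule powr_nat_power)
    then show ?thesis using N by (simp add: powr_add)
  qed
  have nt: "N * t\<^sup>2 = N powr (2 * \<eta>)" unfolding t sq by (rule arg_cong[where f = "\<lambda>z. N powr z"]) simp
  have n\<tau>: "N * \<tau>\<^sup>2 = N powr (- 2 * \<eta>)" unfolding \<tau> sq by (rule arg_cong[where f = "\<lambda>z. N powr z"]) simp
  have D: "(1 + \<tau>\<^sup>2 * I') ^ n \<le> exp (I' * N powr (- 2 * \<eta>))"
  proof -
    have "(1 + \<tau>\<^sup>2 * I') ^ n \<le> exp (\<tau>\<^sup>2 * I') ^ n"
      using pos exp_ge_add_one_self[of "\<tau>\<^sup>2 * I'"] by (intro power_mono) auto
    also have "\<dots> = exp (I' * (N * \<tau>\<^sup>2))" by (simp add: exp_of_nat_mult[symmetric] mult_ac N_def)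
    finally show ?thesis unfolding n\<tau> .
  qed
  then have D: "((1 + \<tau>\<^sup>2 * I') ^ n - 1) / \<kappa> \<le> (exp (I' * N powr (- 2 * \<eta>)) - 1) / \<kappa>"
    using pos by (intro divide_right_mono) auto
  have Y: "\<tau> ^ s0 * \<tau> powr \<alpha> = 1 / N powr (h * s)"
  proof -
    have "\<tau> ^ s0 * \<tau> powr \<alpha> = N powr ((- (1 / 2) - \<eta>) * real s0 + (- (1 / 2) - \<eta>) * \<alpha>)"
      unfolding \<tau> powr_add using N by (simp add: powr_nat_power powr_powr)
    also have "(- (1 / 2) - \<eta>) * real s0 + (- (1 / 2) - \<eta>) * \<alpha> = - (h * s)"
      unfolding h s by (simp add: field_simps)
    finally show ?thesis by (simp only: powr_minus_divide)
  qed
  have c1: "(Cm * (Bc * t / \<rho>) powr (1/4)) ^ m = Cm ^ m * Bc powr (real m / 4) * N powr (- (\<eta> * (real m / 4)))"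
  proof -
    have "t / \<rho> = N powr (- \<eta>)" unfolding t \<rho> powr_diff[symmetric] by (rule arg_cong[where f = "\<lambda>z. N powr z"]) simp
    then have "Bc * t / \<rho> = Bc * N powr (- \<eta>)" by (metis times_divide_eq_right)
    then have "((Bc * t / \<rho>) powr (1/4)) ^ m = (Bc powr (1/4)) ^ m * ((N powr (- \<eta>)) powr (1/4)) ^ m"
      by (simp add: powr_mult power_mult_distrib)
    also have "(Bc powr (1/4)) ^ m = Bc powr (real m / 4)" using pos by (simp add: powr_nat_power)
    also have "((N powr (- \<eta>)) powr (1/4)) ^ m = N powr (- (\<eta> * (real m / 4)))"
      using N by (simp add: powr_powr powr_nat_power)
    finally show ?thesis by (simp add: power_mult_distrib)
  qed
  have c2: "\<rho> ^ s0 * \<rho> powr a0 * sqrt (\<rho> / en) = N powr e2"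
  proof -
    have "\<rho> / en = N powr (2 * \<eta> - \<delta>')" unfolding \<rho> en powr_diff[symmetric] by (rule arg_cong[where f = "\<lambda>z. N powr z"]) simp
    then have 1: "sqrt (\<rho> / en) = N powr ((2 * \<eta> - \<delta>') / 2)" using N by (simp add: powr_half_sqrt[symmetric] powr_powr)
    have 2: "\<rho> ^ s0 = N powr ((- (1 / 2) + 2 * \<eta>) * real s0)" "\<rho> powr a0 = N powr ((- (1 / 2) + 2 * \<eta>) * a0)"
      unfolding \<rho> using N by (simp_all only: powr_nat_power powr_powr)
    show ?thesis unfolding 1 2 powr_add[symmetric] e2
      by (rule arg_cong[where f = "\<lambda>z. N powr z"]) (simp add: field_simps)
  qed
  define W where "W = N powr (h * s)"
  define x where "x = exp (- (N powr (2 * \<eta>) / b))"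
  have "(z1 + Cc * z2 + z3) / (\<epsilon> * (cA * (1 / W) / 2)) = 2 / (\<epsilon> * cA) * z1 * W + 2 / (\<epsilon> * cA) * Cc * (W * z2) + 2 / (\<epsilon> * cA) * (z3 * W)" for z1 z2 z3
    using pos N by (simp add: W_def field_simps)
  note R = this[of "Cm ^ m * Bc powr (real m / 4) * N powr (- (\<eta> * (real m / 4)))" "N powr e2" x]
  have W1: "W * N powr e2 = N powr (h * s + e2)" by (simp add: W_def powr_add)
  have W2: "N powr (- (\<eta> * (real m / 4))) * W = N powr (h * s - \<eta> * (real m / 4))"
    unfolding W_def powr_add[symmetric] by (rule arg_cong[where f = "\<lambda>z. N powr z"]) simp
  have "(Cm ^ m * Bc powr (real m / 4) * N powr (- (\<eta> * (real m / 4))) + Cc * N powr e2 + x) / (\<epsilon> * (cA * (1 / W) / 2)) =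
    2 / (\<epsilon> * cA) * (Cm ^ m * Bc powr (real m / 4)) * N powr (h * s - \<eta> * (real m / 4)) + 2 / (\<epsilon> * cA) * Cc * N powr (h * s + e2) + 2 / (\<epsilon> * cA) * (x * W)"
    unfolding R W1 W2[symmetric] by (simp only: mult.assoc)
  note E = this
  have "2 * (\<kappa> + P) + L * x + z \<le> 2 * (\<kappa> + P') + L * x + z" if "P \<le> P'" for P P' z :: real
    using that by simp
  then show ?thesis
    unfolding N_def[symmetric] nt c1 c2 Y x_def[symmetric] W_def[symmetric] E using D by blast
qed

context mixture_model
begin

text \<open>The posterior exceeds \<epsilon> only if the evidence is below y / 2, or the data leave
  \<open>G\<close>, or the numerator is at least \<epsilon> y / 2, or the evidence is infinite. The
  first three cases give the three summands, the last one is null.\<close>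

lemma posterior_bound:
  fixes P0 :: "'a measure"
  assumes \<alpha>: "\<alpha> > 0" and P0: "prob_space P0" "sets P0 = sets borel" "AE x in P0. x \<in> \<Theta>"
    and B: "B \<in> sets (PiM UNIV (\<lambda>_. borel) \<Otimes>\<^sub>M PiM UNIV (\<lambda>_. borel))"
    and N: "N = stick_prior \<alpha> \<Otimes>\<^sub>M PiM UNIV (\<lambda>_::nat. P0)"
    and A: "A \<in> sets N" "emeasure N A \<ge> ennreal y" "y > 0"
    and dev: "AE p in N. p \<in> A \<longrightarrow> (\<integral>\<^sup>+X. ennreal \<bar>enn2real (Lr n p X) - 1\<bar> \<partial>PiM UNIV (\<lambda>_. Q)) \<le> ennreal d"
    and d: "d \<ge> 0"
    and C: "C \<in> sets N" "emeasure N C \<le> ennreal c" "c \<ge> 0"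
    and G: "G \<in> sets (PiM UNIV (\<lambda>_. Q))" "emeasure (PiM UNIV (\<lambda>_. Q)) (- G) \<le> ennreal gl" "gl \<ge> 0"
    and test: "AE p in N. (stick_breaking (fst p), snd p) \<in> B \<longrightarrow> p \<notin> C \<longrightarrow>
      (\<integral>\<^sup>+X. indicator G X * Lr n p X \<partial>PiM UNIV (\<lambda>_. Q)) \<le> ennreal x"
    and x: "x \<ge> 0" and \<epsilon>: "\<epsilon> > 0"
  shows "measure (PiM UNIV (\<lambda>_. Q)) {X \<in> space (PiM UNIV (\<lambda>_. Q)). \<bar>posterior (DP_prior \<alpha> P0) f n X B - 0\<bar> > \<epsilon>}
    \<le> 2 * d + gl + (c + x) / (\<epsilon> * (y / 2))"
proof -
  let ?P = "PiM UNIV (\<lambda>_::nat. Q)"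
  interpret P: prob_space ?P by (intro prob_space_PiM prob_space_Q)
  have S: "sets (PiM UNIV (\<lambda>_::nat. P0)) = sets (PiM UNIV (\<lambda>_. borel))"
    by (rule sets_PiM_borel) (rule P0)
  have sN: "sets N = sets (PiM UNIV (\<lambda>_. borel) \<Otimes>\<^sub>M PiM UNIV (\<lambda>_. borel))"
    unfolding N by (rule sets_pair_measure_cong[OF sets_stick_prior S])
  have pN: "prob_space N" unfolding N
    using \<alpha> P0 by (intro prob_space_pair prob_space_PiM prob_space_beta_1) auto
  have valid: "AE p in N. valid \<Theta> p" unfolding N by (rule AE_valid[OF \<alpha> P0(1,3)])
  define B' where "B' = {p. (stick_breaking (fst p), snd p) \<in> B}"
  have B': "B' \<in> sets N"
  proof -
    have st: "(\<lambda>v. stick_breaking v) \<in> measurable (PiM UNIV (\<lambda>_. borel)) (PiM UNIV (\<lambda>_. borel))"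
      by (rule measurable_PiM_single') (auto simp: space_PiM)
    have "(\<lambda>(v, \<theta>). (stick_breaking v, \<theta>)) \<in> measurable N (PiM UNIV (\<lambda>_. borel) \<Otimes>\<^sub>M PiM UNIV (\<lambda>_. borel))"
      unfolding measurable_cong_sets[OF sN refl] using st by measurable
    from measurable_sets[OF this B] have "(\<lambda>(v, \<theta>). (stick_breaking v, \<theta>)) -` B \<inter> space N \<in> sets N" .
    also have "(\<lambda>(v, \<theta>). (stick_breaking v, \<theta>)) -` B \<inter> space N = B'"
      unfolding N B'_def by (auto simp: space_pair_measure space_PiM P0(2)[THEN sets_eq_imp_space_eq])
    finally show ?thesis .
  qed
  let ?Num = "\<lambda>X. \<integral>\<^sup>+p. indicator B' p * Lr n p X \<partial>N" and ?Den = "\<lambda>X. \<integral>\<^sup>+p. Lr n p X \<partial>N"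
  have mNum: "?Num \<in> borel_measurable ?P" by (rule measurable_int_Lr(1)[OF pN sN B'])
  have mDen: "?Den \<in> borel_measurable ?P"
  proof -
    have "(\<lambda>X. \<integral>\<^sup>+p. indicator (space N) p * Lr n p X \<partial>N) \<in> borel_measurable ?P"
      by (rule measurable_int_Lr(1)[OF pN sN sets.top])
    also have "(\<lambda>X. \<integral>\<^sup>+p. indicator (space N) p * Lr n p X \<partial>N) = ?Den"
      by (intro ext nn_integral_cong) auto
    finally show ?thesis .
  qed
  have fin: "AE p in N. \<forall>X. Lr n p X < \<infinity>"
    using valid by eventually_elim (use Lr_finite in blast)
  have one: "AE p in N. (\<integral>\<^sup>+X. Lr n p X \<partial>?P) = 1"
    using valid
  proof eventually_elim
    case (elim p)
    have w: "\<And>k. 0 \<le> stick_breaking (fst p) k" "stick_breaking (fst p) sums 1"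
      using elim stick_breaking_pos by (auto simp: valid_def less_imp_le)
    show ?case by (rule nn_integral_LR[OF nmix_meas nn_integral_nmix[OF w]])
  qed
  have test': "AE p in N. p \<in> B' \<longrightarrow> p \<notin> C \<longrightarrow> (\<integral>\<^sup>+X. indicator G X * Lr n p X \<partial>?P) \<le> ennreal x"
    using test by (simp add: B'_def)
  let ?y = "\<epsilon> * (y / 2)"
  let ?S1 = "{X. ?Den X < ennreal (y / 2)}" and ?S3 = "{X \<in> G. ennreal ?y \<le> ?Num X}"
  \<comment> \<open>Split off because \<open>enn2real\<close> sends an infinite evidence to 0, which
    would break the lower bound for the denominator. It is null since the evidence has expectation
    1.\<close>
  let ?S4 = "{X. ?Den X = \<infinity>}"
  have m1: "?S1 \<in> sets ?P"
  proof -
    have "?S1 = {X \<in> space ?P. ?Den X < ennreal (y / 2)}" by (simp add: space_PiM)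
    then show ?thesis using mDen by simp
  qed
  have m3: "?S3 \<in> sets ?P"
  proof -
    have "?S3 = G \<inter> {X \<in> space ?P. ennreal ?y \<le> ?Num X}" by (auto simp: space_PiM)
    then show ?thesis using mNum G by simp
  qed
  have m4: "?S4 \<in> sets ?P"
  proof -
    have "?S4 = {X \<in> space ?P. ?Den X = \<infinity>}" by (simp add: space_PiM)
    then show ?thesis using mDen by simp
  qed
  have mG: "- G \<in> sets ?P" using sets.compl_sets[OF G(1)] by (simp add: space_PiM Compl_eq_Diff_UNIV)
  have e1: "emeasure ?P ?S1 \<le> ennreal (2 * d)"
    by (rule denominator_bound[OF pN sN A dev fin d])
  have e3: "emeasure ?P ?S3 \<le> ennreal ((c + x) / ?y)"
    by (rule numerator_bound[OF pN sN B' C G(1) one test' x]) (use \<epsilon> A in simp)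
  have e4: "emeasure ?P ?S4 = 0"
  proof -
    interpret N: prob_space N by (rule pN)
    interpret pair_sigma_finite N ?P ..
    have "(\<integral>\<^sup>+X. ?Den X \<partial>?P) = (\<integral>\<^sup>+p. (\<integral>\<^sup>+X. Lr n p X \<partial>?P) \<partial>N)"
      by (rule Fubini') (use measurable_Lr[OF sN, of n] in \<open>simp add: split_beta\<close>)
    also have "\<dots> = (\<integral>\<^sup>+p. 1 \<partial>N)" by (intro nn_integral_cong_AE one)
    also have "\<dots> = 1" by (simp add: N.emeasure_space_1)
    finally have "AE X in ?P. ?Den X \<noteq> \<infinity>" by (intro nn_integral_PInf_AE mDen) simp
    moreover have "(AE X in ?P. ?Den X \<noteq> \<infinity>) \<longleftrightarrow> emeasure ?P ?S4 = 0"
      by (rule AE_iff_measurable[OF m4]) (auto simp: space_PiM)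
    ultimately show ?thesis by blast
  qed
  have sub: "{X \<in> space ?P. \<bar>posterior (DP_prior \<alpha> P0) f n X B - 0\<bar> > \<epsilon>} \<subseteq> ?S1 \<union> - G \<union> ?S3 \<union> ?S4"
  proof
    fix X assume X: "X \<in> {X \<in> space ?P. \<bar>posterior (DP_prior \<alpha> P0) f n X B - 0\<bar> > \<epsilon>}"
    show "X \<in> ?S1 \<union> - G \<union> ?S3 \<union> ?S4"
    proof (rule ccontr)
      assume neg: "X \<notin> ?S1 \<union> - G \<union> ?S3 \<union> ?S4"
      then have num: "?Num X < ennreal ?y" and den: "ennreal (y / 2) \<le> ?Den X" and "?Den X \<noteq> \<infinity>"
        unfolding Un_iff mem_Collect_eq Compl_iff de_Morgan_disj not_not not_less de_Morgan_conj not_le by blast+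
      then have fn: "?Den X < \<top>" by (simp add: top.not_eq_extremum)
      have "enn2real (?Num X) \<le> ?y" using num A \<epsilon> by (intro enn2real_leI) auto
      moreover have "y / 2 \<le> enn2real (?Den X)"
        using enn2real_mono[OF den fn] A by simp
      ultimately have "enn2real (?Num X) / enn2real (?Den X) \<le> ?y / (y / 2)"
        using A \<epsilon> by (intro frac_le) auto
      then have "posterior (DP_prior \<alpha> P0) f n X B \<le> \<epsilon>"
        unfolding posterior_eq[OF \<alpha> P0 B, of n X, folded N] B'_def[symmetric] using A by simp
      moreover have "0 \<le> posterior (DP_prior \<alpha> P0) f n X B"
        unfolding posterior_eq[OF \<alpha> P0 B, of n X, folded N] by simp
      ultimately show False using X by simp
    qed
  qed
  have "emeasure ?P {X \<in> space ?P. \<bar>posterior (DP_prior \<alpha> P0) f n X B - 0\<bar> > \<epsilon>} \<le> emeasure ?P (?S1 \<union> - G \<union> ?S3 \<union> ?S4)"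
    using m1 m3 m4 mG by (intro emeasure_mono sub) auto
  also have "\<dots> \<le> emeasure ?P ?S1 + emeasure ?P (- G) + emeasure ?P ?S3 + emeasure ?P ?S4"
    using m1 m3 m4 mG by (intro order_trans[OF emeasure_subadditive] add_mono order_refl) auto
  also have "\<dots> \<le> ennreal (2 * d) + ennreal gl + ennreal ((c + x) / ?y) + 0"
    by (intro add_mono e1 e3 G eq_refl[OF e4])
  also have "\<dots> = ennreal (2 * d + gl + (c + x) / ?y)"
    using d G C x A \<epsilon> by (simp add: ennreal_plus)
  finally show ?thesis
    using d G C x A \<epsilon> by (subst (asm) P.emeasure_eq_measure, subst (asm) ennreal_le_iff) auto
qed

lemma posterior_tail_tendsto:
  fixes P0 :: "'a measure"
  assumes \<alpha>: "\<alpha> > 0" and P0: "prob_space P0" "sets P0 = sets borel" "AE x in P0. x \<in> \<Theta>"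
    and b: "b \<ge> 1" "\<And>x r. r \<ge> 0 \<Longrightarrow> emeasure P0 (cball x r) \<le> ennreal (b * r ^ DIM('a))"
    and lower: "\<And>k. k < K \<Longrightarrow> \<exists>c>0. \<exists>d>0. \<forall>\<tau>. 0 < \<tau> \<longrightarrow> \<tau> < d \<longrightarrow>
      ennreal (c * \<tau> ^ DIM('a)) \<le> emeasure P0 (ball (\<theta>s k) \<tau>)"
    and \<Theta>: "bounded \<Theta>" "\<And>k. k < K \<Longrightarrow> \<theta>s k \<in> \<Theta>" and inj: "inj_on \<theta>s {..<K}"
    and E: "E \<in> borel_measurable borel" "\<And>x. E x \<ge> 0"
      "\<And>x \<theta> \<theta>'. \<theta> \<in> \<Theta> \<Longrightarrow> \<theta>' \<in> \<Theta> \<Longrightarrow> f (x - \<theta>) \<le> E x * f (x - \<theta>')"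
      "\<And>x \<theta> \<theta>'. \<theta> \<in> \<Theta> \<Longrightarrow> \<theta>' \<in> \<Theta> \<Longrightarrow> norm (\<theta> - \<theta>') \<le> 1 \<Longrightarrow>
      \<bar>f (x - \<theta>) - f (x - \<theta>')\<bar> \<le> norm (\<theta> - \<theta>') * E x * f (x - \<theta>')"
    and I: "I \<ge> 0" "\<And>\<theta>. \<theta> \<in> \<Theta> \<Longrightarrow> (\<integral>\<^sup>+x. ennreal ((E x)\<^sup>2) * ennreal (f (x - \<theta>)) \<partial>lborel) \<le> ennreal I"
    and \<delta>: "\<delta> > 0"
  shows "tendsto_in_probability (PiM UNIV (\<lambda>_::nat. Q))
     (\<lambda>n X. posterior (DP_prior \<alpha> P0) f n X {(w, \<theta>). (\<Sum>k. w (K + k)) > 1 / real n powr (1 / 2 - \<delta>)}) 0"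
  unfolding tendsto_in_probability_def
proof (intro allI impI)
  fix \<epsilon> :: real assume \<epsilon>: "\<epsilon> > 0"
  let ?P = "PiM UNIV (\<lambda>_::nat. Q)"
  let ?N = "stick_prior \<alpha> \<Otimes>\<^sub>M PiM UNIV (\<lambda>_::nat. P0)"
  obtain r0 where r0: "r0 > 0" "\<And>\<xi>. norm \<xi> < r0 \<Longrightarrow> cosf \<xi> > 0" using cosf_pos_near_0 by blast
  obtain e \<sigma> where sp: "separated K \<theta>s e \<sigma>" and er: "real K * (2 * e) + e \<le> r0 / 2"
    and near: "\<And>\<theta>. \<theta> \<in> \<Theta> \<Longrightarrow> \<exists>j. separated.nearest K \<theta>s e \<theta> j"
    using exists_separated[OF inj \<Theta> K_pos, of "r0 / 2"] r0(1) by auto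
  interpret sep: separated K \<theta>s e \<sigma> by (rule sp)
  have e: "e > 0" by (rule sep.e)
  \<comment> \<open>The finite test family: one function for squared distances, K for cluster
    masses, and K D for the coordinates of the first moments.\<close>
  define HS where "HS = insert sep.H0 (sep.S ` {..<K} \<union> (\<lambda>(j, b). sep.M j b) ` ({..<K} \<times> Basis))"
  have finHS: "finite HS" unfolding HS_def by simp
  have trigHS: "\<exists>r\<le>r0 / 2. trig r H" if "H \<in> HS" for H
  proof -
    have "0 \<le> real K * e" using e by simp
    then have le: "real K * e \<le> r0 / 2" "real K * (2 * e) \<le> r0 / 2" using e er by linarith+
    consider "H = sep.H0" | j where "j < K" "H = sep.S j" | j b where "j < K" "b \<in> Basis" "H = sep.M j b"
      using \<open>H \<in> HS\<close> unfolding HS_def by auto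
    then show ?thesis
    proof cases
      case 1 then show ?thesis using sep.trig_H0 le(1) by (intro exI[of _ "real K * e"]) simp
    next
      case (2 j) then show ?thesis using sep.trig_S[of j] le(2) by (intro exI[of _ "real K * (2 * e)"]) simp
    next
      case (3 j b) then show ?thesis using sep.trig_M[of j b] er by (intro exI[of _ "real K * (2 * e) + e"]) simp
    qed
  qed
  have "\<exists>g B. B > 0 \<and> (\<forall>H\<in>HS. g H \<in> borel_measurable borel \<and> (\<forall>x. \<bar>g H x\<bar> \<le> B) \<and>
     (\<forall>\<theta>. (\<integral>x. g H x * f (x - \<theta>) \<partial>lborel) = H \<theta>))"
    by (rule test_family[OF finHS trigHS]) (use r0 in auto)
  then obtain g B where B: "B > 0" and gm: "\<And>H. H \<in> HS \<Longrightarrow> g H \<in> borel_measurable borel"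
    and gB: "\<And>H x. H \<in> HS \<Longrightarrow> \<bar>g H x\<bar> \<le> B" and gH: "\<And>H \<theta>. H \<in> HS \<Longrightarrow> (\<integral>x. g H x * f (x - \<theta>) \<partial>lborel) = H \<theta>"
    by blast
  have nearest_self: "sep.nearest (\<theta>s j) j" if "j < K" for j
    using that sep.small by (auto simp: sep.nearest_def)
  have S_self: "sep.S k (\<theta>s j) = of_bool (k = j)" if "j < K" "k < K" for j k
    using sep.S_bound[OF nearest_self[OF that(1)] that(2)] by simp
  have M_self: "sep.M k b (\<theta>s j) = 0" if "j < K" "k < K" "b \<in> Basis" for j k b
    using sep.M_bound[OF nearest_self[OF that(1)] that(2,3)] by (simp split: if_splits)
  \<comment> \<open>The true mixture gives the tests their target values exactly, because the errors
    in \<open>S_bound\<close> and \<open>M_bound\<close> vanish at the true atoms.\<close>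
  have ev_S: "(\<Sum>k<K. ws k * sep.S j (\<theta>s k)) = ws j" if "j < K" for j
    using that by (simp add: S_self if_distrib[of "\<lambda>z. ws _ * z"] of_bool_def cong: if_cong)
  have ev_H0: "(\<Sum>k<K. ws k * sep.H0 (\<theta>s k)) = 0" by (simp add: sep.H0_zero)
  have ev_M: "(\<Sum>k<K. ws k * sep.M j b (\<theta>s k)) = 0" if "j < K" "b \<in> Basis" for j b
    using that by (simp add: M_self)
  \<comment> \<open>Lowering \<open>\<delta>\<close> enlarges the event; \<open>ga\<close> keeps the moment of order \<open>- a0\<close> of \<open>1 - v\<close> finite, and \<open>m\<close> is so large
    that \<open>m\<close> atoms near the truth with a stick left over are negligible.\<close>
  define \<delta>' where "\<delta>' = min \<delta> (1 / 4)"
  have \<delta>': "0 < \<delta>'" "\<delta>' \<le> \<delta>" "\<delta>' \<le> 1 / 4" using \<delta> by (auto simp: \<delta>'_def)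
  define s0 where "s0 = DIM('a) * K + K - 1"
  define s where "s = real s0 + \<alpha>"
  have s: "s > 0" using \<alpha> by (simp add: s_def)
  \<comment> \<open>Chosen so that the total loss \<eta> (3 s + 1) collected in \<open>he2\<close>
    is exactly \<delta>' / 8.\<close>
  define \<eta> where "\<eta> = \<delta>' / (8 * (3 * s + 1))"
  have \<eta>: "0 < \<eta>" using \<delta>' s by (simp add: \<eta>_def)
  have \<eta>s: "\<eta> * (3 * s + 1) = \<delta>' / 8" using s by (simp add: \<eta>_def field_simps)
  have \<eta>8: "\<eta> \<le> \<delta>' / 8"
  proof -
    have "\<eta> * 1 \<le> \<eta> * (3 * s + 1)" using \<eta> s by (intro mult_left_mono) auto
    then show ?thesis using \<eta>s by simp
  qed
  define ga where "ga = min (\<alpha> / 2) (\<delta>' / 4)"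
  define a0 where "a0 = \<alpha> - ga"
  have ga: "0 < ga" "ga \<le> \<delta>' / 4" and a0: "0 < a0" "a0 < \<alpha>" using \<alpha> \<delta>' by (auto simp: ga_def a0_def min_def)
  define h where "h = 1 / 2 + \<eta>"
  define m where "m = Suc (nat \<lceil>4 * (h * s) / \<eta>\<rceil>)"
  have m0: "m > 0" by (simp add: m_def)
  have mh: "h * s - \<eta> * (real m / 4) < 0"
  proof -
    have "4 * (h * s) / \<eta> < real m" unfolding m_def by linarith
    then show ?thesis using \<eta> by (simp add: field_simps)
  qed
  define e2 where "e2 = (- (1 / 2) + 2 * \<eta>) * (real s0 + a0) + (2 * \<eta> - \<delta>') / 2"
  \<comment> \<open>As s0 + a0 = s - ga, the leading terms s / 2 of numerator and denominator
    cancel. What remains is \<delta>' / 8 from \<eta> and at most \<delta>' / 8 from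
    \<open>ga\<close>, against -\<delta>' / 2 from the additional atom.\<close>
  have he2: "h * s + e2 < 0"
  proof -
    have "h * s + e2 = \<eta> * (3 * s + 1) - 2 * \<eta> * ga + ga / 2 - \<delta>' / 2"
      unfolding h_def e2_def a0_def s_def by (simp add: field_simps)
    also have "\<dots> < 0" using \<eta>s ga \<delta>' mult_pos_pos[OF \<eta> ga(1)] by linarith
    finally show ?thesis .
  qed
  have wsK: "\<forall>k<K. ws k > 0" using ws_pos by auto
  have "\<exists>c>0. \<exists>d>0. \<forall>\<tau>. 0 < \<tau> \<longrightarrow> \<tau> < d \<longrightarrow>
    ennreal (c * (\<tau> ^ s0 * \<tau> powr \<alpha>)) \<le> emeasure ?N (near_event K (weight_sticks ws) \<theta>s \<tau>)"
    unfolding s0_def by (rule emeasure_near_event[OF \<alpha> P0(1,2) wsK ws_sum K_pos]) (rule lower)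
  then obtain cA dA where cA: "cA > 0" and dA: "dA > 0" and A_lower: "\<And>\<tau>. 0 < \<tau> \<Longrightarrow> \<tau> < dA \<Longrightarrow>
    ennreal (cA * (\<tau> ^ s0 * \<tau> powr \<alpha>)) \<le> emeasure ?N (near_event K (weight_sticks ws) \<theta>s \<tau>)"
    by blast
  have "\<exists>C\<ge>0. \<forall>M B \<rho>. 0 < B \<longrightarrow> B \<le> \<rho> \<longrightarrow> emeasure ?N
      {(v, \<theta>). stick_rest v M > \<rho> \<and> (\<forall>k<M. \<exists>j<K. stick_breaking v k * (norm (\<theta> k - \<theta>s j))\<^sup>2 \<le> B)}
    \<le> ennreal ((C * (B / \<rho>) powr (1/4)) ^ M)"
    by (rule emeasure_many_atoms[OF \<alpha> P0(1,2) b])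
  then obtain Cm where Cm: "Cm \<ge> 0" and many: "\<And>M B \<rho>. 0 < B \<Longrightarrow> B \<le> \<rho> \<Longrightarrow> emeasure ?N
      {(v, \<theta>). stick_rest v M > \<rho> \<and> (\<forall>k<M. \<exists>j<K. stick_breaking v k * (norm (\<theta> k - \<theta>s j))\<^sup>2 \<le> B)}
    \<le> ennreal ((Cm * (B / \<rho>) powr (1/4)) ^ M)"
    by blast
  have "\<exists>C\<ge>0. \<forall>\<rho> \<epsilon>. 0 < \<rho> \<longrightarrow> 2 * \<rho> \<le> \<epsilon> \<longrightarrow> \<epsilon> \<le> 1 \<longrightarrow>
    emeasure ?N (sep.cover m ws \<rho> \<epsilon>) \<le> ennreal (C * (\<rho> ^ s0 * \<rho> powr a0 * sqrt (\<rho> / \<epsilon>)))"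
    unfolding s0_def by (rule sep.emeasure_cover[OF \<alpha> a0 P0(1,2) b K_pos ws_pos m0])
  then obtain Cc where Cc: "Cc \<ge> 0" and cover: "\<And>\<rho> \<epsilon>. 0 < \<rho> \<Longrightarrow> 2 * \<rho> \<le> \<epsilon> \<Longrightarrow> \<epsilon> \<le> 1 \<Longrightarrow>
    emeasure ?N (sep.cover m ws \<rho> \<epsilon>) \<le> ennreal (Cc * (\<rho> ^ s0 * \<rho> powr a0 * sqrt (\<rho> / \<epsilon>)))"
    by blast
  have S: "sets (PiM UNIV (\<lambda>_::nat. P0)) = sets (PiM UNIV (\<lambda>_. borel))"
    by (rule sets_PiM_borel) (rule P0)
  have sN: "sets ?N = sets (PiM UNIV (\<lambda>_. borel) \<Otimes>\<^sub>M PiM UNIV (\<lambda>_. borel :: 'a measure))"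
    by (rule sets_pair_measure_cong[OF sets_stick_prior S])
  have valid: "AE p in ?N. valid \<Theta> p" by (rule AE_valid[OF \<alpha> P0(1,3)])
  define mw where "mw = (MIN j\<in>{..<K}. ws j)"
  have mw: "mw > 0"
  proof -
    have "{..<K} \<noteq> {}" using K_pos by (auto simp: lessThan_empty_iff)
    then show ?thesis unfolding mw_def using ws_pos by (subst Min_gr_iff) auto
  qed
  define I' where "I' = (real K * real K + 2)\<^sup>2 * I"
  have I': "I' \<ge> 0" using I by (simp add: I'_def)
  define p where "p n = measure ?P {X \<in> space ?P. \<bar>posterior (DP_prior \<alpha> P0) f n X
      {(w, \<theta>). (\<Sum>k. w (K + k)) > 1 / real n powr (1 / 2 - \<delta>)} - 0\<bar> > \<epsilon>}" for n
  define bd where "bd \<kappa> n = 2 * (\<kappa> + (exp (I' * real n powr (- 2 * \<eta>)) - 1) / \<kappa>) + 2 * real (card HS) * exp (- (real n powr (2 * \<eta>) / (8 * B\<^sup>2)))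
     + (2 / (\<epsilon> * cA) * (Cm ^ m * sep.Bc powr (real m / 4)) * real n powr (h * s - \<eta> * (real m / 4)) + 2 / (\<epsilon> * cA) * Cc * real n powr (h * s + e2)
        + 2 / (\<epsilon> * cA) * (exp (- (real n powr (2 * \<eta>) / (8 * B\<^sup>2))) * real n powr (h * s)))" for \<kappa> and n :: nat
  \<comment> \<open>The side conditions hold for large n. \<open>n1\<close> and \<open>n2\<close>
    are what \<open>many\<close> and \<open>cover\<close> demand, \<open>n3\<close> is what the
    pigeonhole in \<open>in_cover\<close> demands, and \<open>n4\<close> brings \<tau> into the
    range of the prior mass bound and of the envelope.\<close>
  have bound: "p n \<le> bd \<kappa> n"
    if n: "n \<ge> 1" and \<kappa>: "\<kappa> > 0"
      and n1: "sep.Bc * real n powr (- (1 / 2) + \<eta>) \<le> real n powr (- (1 / 2) + 2 * \<eta>)"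
      and n2: "2 * real n powr (- (1 / 2) + 2 * \<eta>) \<le> real n powr (- (1 / 2) + \<delta>')"
      and n3: "sep.Bc * real n powr (- (1 / 2) + 2 * \<eta>) \<le> mw / 2"
      and n4: "real n powr (- (1 / 2) - \<eta>) < min dA 1"
    for n \<kappa>
  proof -
    define t where "t = real n powr (- (1 / 2) + \<eta>)"
    define \<rho> where "\<rho> = real n powr (- (1 / 2) + 2 * \<eta>)"
    define \<tau> where "\<tau> = real n powr (- (1 / 2) - \<eta>)"
    define en where "en = real n powr (- (1 / 2) + \<delta>')"
    have n0: "real n > 0" using n by simp
    have pos: "t > 0" "\<rho> > 0" "\<tau> > 0" "en > 0" using n0 by (auto simp: t_def \<rho>_def \<tau>_def en_def)
    have t\<rho>: "t \<le> \<rho>" unfolding t_def \<rho>_def using n \<eta> by (intro powr_mono) auto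
    have "en \<le> real n powr 0" unfolding en_def using n \<delta>' by (intro powr_mono) auto
    then have en1: "en \<le> 1" using n0 by simp
    have thr: "en \<le> 1 / real n powr (1 / 2 - \<delta>)"
    proof -
      have "en \<le> real n powr (- (1 / 2 - \<delta>))" unfolding en_def using n \<delta>' by (intro powr_mono) auto
      then show ?thesis by (simp only: powr_minus_divide)
    qed
    define BB where "BB = {(w, \<theta> :: nat \<Rightarrow> 'a). (\<Sum>k. w (K + k)) > 1 / real n powr (1 / 2 - \<delta>)}"
    define G where "G = good HS g n t"
    define C where "C = {(v, \<theta>). stick_rest v m > \<rho> \<and> (\<forall>k<m. \<exists>j<K. stick_breaking v k * (norm (\<theta> k - \<theta>s j))\<^sup>2 \<le> sep.Bc * t)} \<union> sep.cover m ws \<rho> en"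
    define cn where "cn = (Cm * (sep.Bc * t / \<rho>) powr (1/4)) ^ m + Cc * (\<rho> ^ s0 * \<rho> powr a0 * sqrt (\<rho> / en))"
    define xn where "xn = exp (- (real n * t\<^sup>2 / (8 * B\<^sup>2)))"
    define y where "y = cA * (\<tau> ^ s0 * \<tau> powr \<alpha>)"
    define d where "d = \<kappa> + ((1 + \<tau>\<^sup>2 * I') ^ n - 1) / \<kappa>"
    let ?E1 = "{(v, \<theta>). stick_rest v m > \<rho> \<and> (\<forall>k<m. \<exists>j<K. stick_breaking v k * (norm (\<theta> k - \<theta>s j))\<^sup>2 \<le> sep.Bc * t)}"
    let ?BM = "PiM UNIV (\<lambda>_. borel) \<Otimes>\<^sub>M PiM UNIV (\<lambda>_. borel :: 'a measure)"
    have BBm: "BB \<in> sets ?BM"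
    proof -
      have "BB = {q \<in> space ?BM. (\<Sum>k. fst q (K + k)) > 1 / real n powr (1 / 2 - \<delta>)}"
        by (auto simp: BB_def space_pair_measure space_PiM)
      also have "\<dots> \<in> sets ?BM" by measurable
      finally show ?thesis .
    qed
    have E1m: "?E1 \<in> sets ?N"
    proof -
      have "?E1 = {q \<in> space ?BM. stick_rest (fst q) m > \<rho> \<and> (\<forall>k<m. \<exists>j<K. stick_breaking (fst q) k * (norm (snd q k - \<theta>s j))\<^sup>2 \<le> sep.Bc * t)}"
        by (auto simp: space_pair_measure space_PiM)
      also have "\<dots> \<in> sets ?BM" by measurable
      finally show ?thesis unfolding sN .
    qed
    have cov: "sep.cover m ws \<rho> en \<in> sets ?N" unfolding sN by simp
    have "p n \<le> 2 * d + 2 * real (card HS) * exp (- (real n * t\<^sup>2 / (8 * B\<^sup>2))) + (cn + xn) / (\<epsilon> * (y / 2))"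
      unfolding p_def BB_def[symmetric]
    proof (rule posterior_bound[OF \<alpha> P0 BBm refl])
      show "near_event K (weight_sticks ws) \<theta>s \<tau> \<in> sets ?N" unfolding sN by simp
      show "ennreal y \<le> emeasure ?N (near_event K (weight_sticks ws) \<theta>s \<tau>)"
        unfolding y_def using pos n4 by (intro A_lower) (auto simp: \<tau>_def)
      show "y > 0" unfolding y_def using cA pos by simp
      have one: "1 \<le> (1 + \<tau>\<^sup>2 * I') ^ n" using I' by (intro one_le_power) auto
      show "0 \<le> d" unfolding d_def using \<kappa> one by simp
      show "AE q in ?N. q \<in> near_event K (weight_sticks ws) \<theta>s \<tau> \<longrightarrow>
          (\<integral>\<^sup>+X. ennreal \<bar>enn2real (Lr n q X) - 1\<bar> \<partial>?P) \<le> ennreal d"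
        using valid
      proof eventually_elim
        case (elim q)
        show ?case
        proof
          assume q: "q \<in> near_event K (weight_sticks ws) \<theta>s \<tau>"
          have w: "\<And>k. 0 \<le> stick_breaking (fst q) k" "stick_breaking (fst q) sums 1"
            using elim stick_breaking_pos by (auto simp: valid_def less_imp_le)
          let ?r = "\<lambda>x. \<Sum>k. stick_breaking (fst q) k * f (x - snd q k)"
          have r0: "0 \<le> ?r x" for x
            using w(1) f_pos nmix_eq(2)[OF w] by (intro suminf_nonneg) (auto simp: less_imp_le)
          have rm: "?r \<in> borel_measurable borel" by measurable
          have "(\<integral>\<^sup>+X. ennreal \<bar>(\<Prod>i<n. ?r (X i) / ps (X i)) - 1\<bar> \<partial>?P) \<le> ennreal (\<kappa> + ((1 + \<tau>\<^sup>2 * I') ^ n - 1) / \<kappa>)"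
          proof (rule second_moment_ratio[OF rm r0, where h = "\<lambda>x. (real K * real K + 2) * E x"])
            show "(\<integral>\<^sup>+x. ennreal (?r x) \<partial>lborel) = 1"
              using nn_integral_nmix[OF w, of "snd q"] by (simp add: nmix_eq(1)[OF w])
            show "(\<lambda>x. (real K * real K + 2) * E x) \<in> borel_measurable borel" using E(1) by measurable
            have "(\<integral>\<^sup>+x. ennreal (((real K * real K + 2) * E x)\<^sup>2) \<partial>Q) = (\<integral>\<^sup>+x. ennreal ((real K * real K + 2)\<^sup>2) * ennreal ((E x)\<^sup>2) \<partial>Q)"
              by (simp add: power_mult_distrib ennreal_mult)
            also have "\<dots> = ennreal ((real K * real K + 2)\<^sup>2) * (\<integral>\<^sup>+x. ennreal ((E x)\<^sup>2) \<partial>Q)"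
              using E(1) by (intro nn_integral_cmult) auto
            also have "\<dots> \<le> ennreal ((real K * real K + 2)\<^sup>2) * ennreal I"
              by (intro mult_left_mono envelope_second_moment[OF E(1) I(1)] I(2) \<Theta>(2)) auto
            also have "\<dots> = ennreal I'" unfolding I'_def using I by (simp add: ennreal_mult)
            finally show "(\<integral>\<^sup>+x. ennreal (((real K * real K + 2) * E x)\<^sup>2) \<partial>Q) \<le> ennreal I'" .
            show "\<bar>?r x / ps x - 1\<bar> \<le> \<tau> * ((real K * real K + 2) * E x)" for x
            proof (rule near_ratio[OF _ \<Theta>(2) E(2) E(3) E(4)])
              show "valid \<Theta> (fst q, snd q)" using elim by simp
              show "(fst q, snd q) \<in> near_event K (weight_sticks ws) \<theta>s \<tau>" using q by simp
              show "\<tau> \<le> 1" using n4 by (simp add: \<tau>_def)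
            qed auto
          qed (use I' \<kappa> in auto)
          moreover have "enn2real (Lr n q X) = (\<Prod>i<n. ?r (X i) / ps (X i))" for X
            unfolding LR_ennreal[OF nmix_eq(1)[OF w] r0]
            using r0 ps_pos by (intro enn2real_ennreal prod_nonneg divide_nonneg_pos) auto
          ultimately show "(\<integral>\<^sup>+X. ennreal \<bar>enn2real (Lr n q X) - 1\<bar> \<partial>?P) \<le> ennreal d"
            by (simp add: d_def)
        qed
      qed
      show "C \<in> sets ?N" unfolding C_def using E1m cov by (rule sets.Un)
      have nn1: "0 \<le> (Cm * (sep.Bc * t / \<rho>) powr (1/4)) ^ m" using Cm by simp
      have nn2: "0 \<le> Cc * (\<rho> ^ s0 * \<rho> powr a0 * sqrt (\<rho> / en))" using Cc pos by simp
      show "0 \<le> cn" unfolding cn_def using nn1 nn2 by simp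
      have "emeasure ?N C \<le> emeasure ?N ?E1 + emeasure ?N (sep.cover m ws \<rho> en)"
        unfolding C_def by (rule emeasure_subadditive[OF E1m cov])
      also have "\<dots> \<le> ennreal ((Cm * (sep.Bc * t / \<rho>) powr (1/4)) ^ m) + ennreal (Cc * (\<rho> ^ s0 * \<rho> powr a0 * sqrt (\<rho> / en)))"
      proof (intro add_mono many cover)
        show "0 < sep.Bc * t" using sep.Bc_pos pos by simp
        show "sep.Bc * t \<le> \<rho>" using n1 by (simp add: t_def \<rho>_def)
        show "2 * \<rho> \<le> en" using n2 by (simp add: en_def \<rho>_def)
      qed (use pos en1 in auto)
      also have "\<dots> = ennreal cn" unfolding cn_def using nn1 nn2 by (simp add: ennreal_plus)
      finally show "emeasure ?N C \<le> ennreal cn" .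
      show "G \<in> sets ?P" unfolding G_def using finHS gm by (rule sets_good)
      show "emeasure ?P (- G) \<le> ennreal (2 * real (card HS) * exp (- (real n * t\<^sup>2 / (8 * B\<^sup>2))))"
        unfolding G_def by (rule test_level[OF finHS gm gB B pos(1)])
      show "AE q in ?N. (stick_breaking (fst q), snd q) \<in> BB \<longrightarrow> q \<notin> C \<longrightarrow>
          (\<integral>\<^sup>+X. indicator G X * Lr n q X \<partial>?P) \<le> ennreal xn"
        using valid
      proof eventually_elim
        case (elim q)
        show ?case
        proof (intro impI)
          assume qB: "(stick_breaking (fst q), snd q) \<in> BB" and qC: "q \<notin> C"
          obtain v \<theta> where q: "q = (v, \<theta>)" by (cases q)
          have v: "v \<in> stick_dom" "stick_breaking v sums 1" "\<And>k. \<theta> k \<in> \<Theta>" using elim by (auto simp: valid_def q)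
          have w: "\<And>k. 0 \<le> stick_breaking v k" using stick_breaking_pos[OF v(1)] by (simp add: less_imp_le)
          have tail: "stick_rest v K > en"
            using qB thr suminf_stick_breaking_le[OF v(1), of K] by (auto simp: BB_def q)
          \<comment> \<open>The contrapositive of \<open>in_cover\<close>: a parameter with a long
            stick outside \<open>C\<close> must fail one of the tests by more than \<open>t\<close>,
            and that test then rejects it.\<close>
          have "\<exists>H\<in>HS. \<bar>(\<Sum>k. stick_breaking v k * H (\<theta> k)) - (\<Sum>k<K. ws k * H (\<theta>s k))\<bar> > t"
          proof (rule ccontr)
            assume "\<not> ?thesis"
            then have le: "\<bar>(\<Sum>k. stick_breaking v k * H (\<theta> k)) - (\<Sum>k<K. ws k * H (\<theta>s k))\<bar> \<le> t" if "H \<in> HS" for H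
              using that by (auto simp: not_less)
            have "(stick_rest v m > \<rho> \<and> (\<forall>k<m. \<exists>j<K. stick_breaking v k * (norm (\<theta> k - \<theta>s j))\<^sup>2 \<le> sep.Bc * t)) \<or>
                (v, \<theta>) \<in> sep.cover m ws \<rho> en"
            proof (rule sep.in_cover[OF v(1,2) _ K_pos ws_pos])
              show "\<exists>j. sep.nearest (\<theta> k) j" for k by (rule near[OF v(3)])
              show "(\<Sum>k. stick_breaking v k * sep.H0 (\<theta> k)) \<le> t"
                using le[of sep.H0] by (simp add: HS_def ev_H0 abs_le_iff)
              show "\<bar>(\<Sum>k. stick_breaking v k * sep.S j (\<theta> k)) - ws j\<bar> \<le> t" if "j < K" for j
                using le[of "sep.S j"] that by (simp add: HS_def ev_S)
              show "\<bar>\<Sum>k. stick_breaking v k * sep.M j b (\<theta> k)\<bar> \<le> t" if "j < K" "b \<in> Basis" for j b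
                using le[of "sep.M j b"] that by (force simp: HS_def ev_M)
              show "sep.Bc * \<rho> \<le> (MIN j\<in>{..<K}. ws j) / 2" using n3 by (simp add: \<rho>_def mw_def)
            qed (use pos t\<rho> tail in auto)
            with qC show False by (simp add: C_def q)
          qed
          then obtain H where H: "H \<in> HS" "\<bar>(\<Sum>k. stick_breaking v k * H (\<theta> k)) - (\<Sum>k<K. ws k * H (\<theta>s k))\<bar> > t" by blast
          have "(\<integral>\<^sup>+X. indicator (good HS g n t) X * LR n (nmix (stick_breaking v) \<theta>) X \<partial>?P) \<le> ennreal (exp (- (real n * t\<^sup>2 / (8 * B\<^sup>2))))"
          proof (rule test_power[where l = H])
            show "t < \<bar>(\<integral>x. g H x \<partial>density lborel (nmix (stick_breaking v) \<theta>)) - (\<integral>x. g H x \<partial>Q)\<bar>"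
              unfolding integral_nmix[OF w v(2) gm[OF H(1)] gB[OF H(1)] gH[OF H(1)]] integral_ps[OF gm[OF H(1)] gB[OF H(1)] gH[OF H(1)]]
              by (rule H(2))
          qed (use nn_integral_nmix[OF w v(2)] gm gB H B pos in auto)
          then show "(\<integral>\<^sup>+X. indicator G X * Lr n q X \<partial>?P) \<le> ennreal xn" by (simp add: G_def xn_def q)
        qed
      qed
      show "0 \<le> xn" by (simp add: xn_def)
    qed (use \<epsilon> in auto)
    also have "\<dots> \<le> bd \<kappa> n"
      unfolding bd_def d_def cn_def xn_def y_def t_def \<rho>_def \<tau>_def en_def
      by (rule rate_computation) (use n \<kappa> \<epsilon> cA sep.Bc_pos I' in \<open>auto simp: h_def s_def e2_def\<close>)
    finally show ?thesis .
  qed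
  have "p \<longlonglongrightarrow> 0"
  proof (rule LIMSEQ_I)
    fix r :: real assume r: "r > 0"
    \<comment> \<open>For fixed \<kappa> the bound tends to 2 \<kappa> rather than 0, so \<kappa> is
      chosen only after the target r.\<close>
    define \<kappa> where "\<kappa> = r / 4"
    have \<kappa>: "\<kappa> > 0" "2 * \<kappa> < r" using r by (auto simp: \<kappa>_def)
    have lim: "bd \<kappa> \<longlonglongrightarrow> 2 * \<kappa>"
      unfolding bd_def[abs_def] using \<eta> mh he2 B by (intro rate_bound_tendsto) auto
    have "eventually (\<lambda>n. bd \<kappa> n < r) sequentially" using order_tendstoD(2)[OF lim \<kappa>(2)] .
    moreover have "eventually (\<lambda>n. n \<ge> 1) sequentially" by (rule eventually_ge_at_top)
    moreover have "eventually (\<lambda>n::nat. sep.Bc * real n powr (- (1 / 2) + \<eta>) \<le> real n powr (- (1 / 2) + 2 * \<eta>)) sequentially"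
      using \<eta> by real_asymp
    moreover have "eventually (\<lambda>n::nat. 2 * real n powr (- (1 / 2) + 2 * \<eta>) \<le> real n powr (- (1 / 2) + \<delta>')) sequentially"
    proof -
      have "2 * \<eta> < \<delta>'" using \<eta>8 \<delta>' by simp
      then show ?thesis by real_asymp
    qed
    moreover have "eventually (\<lambda>n::nat. sep.Bc * real n powr (- (1 / 2) + 2 * \<eta>) < mw / 2) sequentially"
    proof -
      have "- (1 / 2) + 2 * \<eta> < 0" using \<eta>8 \<delta>' by simp
      then have "(\<lambda>n::nat. sep.Bc * real n powr (- (1 / 2) + 2 * \<eta>)) \<longlonglongrightarrow> 0" by real_asymp
      then show ?thesis by (rule order_tendstoD) (use mw in simp)
    qed
    moreover have "eventually (\<lambda>n::nat. real n powr (- (1 / 2) - \<eta>) < min dA 1) sequentially"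
    proof -
      have "(\<lambda>n::nat. real n powr (- (1 / 2) - \<eta>)) \<longlonglongrightarrow> 0" using \<eta> by real_asymp
      then show ?thesis by (rule order_tendstoD) (use dA in simp)
    qed
    ultimately have "eventually (\<lambda>n. norm (p n - 0) < r) sequentially"
    proof eventually_elim
      case (elim n)
      have "p n \<le> bd \<kappa> n" by (rule bound[OF elim(2) \<kappa>(1) elim(3,4) _ elim(6)]) (use elim(5) in simp)
      moreover have "p n \<ge> 0" by (simp add: p_def)
      ultimately show ?case using elim(1) by simp
    qed
    then show "\<exists>no. \<forall>n\<ge>no. norm (p n - 0) < r" by (simp add: eventually_sequentially)
  qed
  then show "(\<lambda>n. measure ?P {X \<in> space ?P. \<bar>posterior (DP_prior \<alpha> P0) f n X
      {(w, \<theta>). (\<Sum>k. w (K + k)) > 1 / real n powr (1 / 2 - \<delta>)} - 0\<bar> > \<epsilon>}) \<longlonglongrightarrow> 0"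
    unfolding p_def[abs_def] .
qed

end

theorem theorem2:
  fixes f :: "'a::euclidean_space \<Rightarrow> real"
    and \<alpha> :: real and P0 :: "'a measure" and \<Theta> :: "'a set" and p0 :: "'a \<Rightarrow> real"
    and K :: nat and ws :: "nat \<Rightarrow> real" and \<theta>s :: "nat \<Rightarrow> 'a"
    and Pstar :: "'a measure" and Q :: "'a measure" and \<delta> :: real
  assumes f_density: "(\<integral>\<^sup>+x. ennreal (f x) \<partial>lborel) = 1"
    and alpha_pos: "\<alpha> > 0"
    and P0_prob: "prob_space P0"
    and A1_Pstar: "Pstar = discrete_measure {..<K} ws \<theta>s"
    and A1_weights: "\<forall>k<K. ws k > 0" "(\<Sum>k<K. ws k) = 1"
    and A1_distinct: "inj_on \<theta>s {..<K}"
    and A1_Q: "Q = density lborel (\<lambda>x. ennreal (mixture Pstar f x))"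
    and A2: "compact \<Theta>" "\<forall>k<K. \<theta>s k \<in> \<Theta>"
    and Theta_thick: "\<forall>k<K. \<exists>c>0. \<forall>\<^sub>F \<epsilon> in at_right 0.
          measure lborel (\<Theta> \<inter> ball (\<theta>s k) \<epsilon>) \<ge> c * measure lborel (ball (\<theta>s k) \<epsilon>)"
    and A3_density: "P0 = density lborel (\<lambda>x. ennreal (p0 x) * indicator \<Theta> x)"
    and A3_p0: "continuous_on \<Theta> p0" "bounded (p0 ` \<Theta>)" "\<forall>x\<in>\<Theta>. p0 x \<ge> 0"
    and A3_pos: "\<forall>k<K. p0 (\<theta>s k) > 0"
    and B1: "C3 f" "\<exists>F. \<forall>x. 0 < f x \<and> f x < F"
    and B2: "\<exists>R>0. \<exists>\<gamma>\<ge>0.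
          (\<forall>x. norm (total_deriv (\<lambda>y. ln (f y)) x) \<le> R * (1 + norm x) powr \<gamma>) \<and>
          (\<forall>x. norm (total_deriv (total_deriv (\<lambda>y. ln (f y))) x) \<le> R * (1 + norm x) powr \<gamma>) \<and>
          (\<forall>M>0. integrable lborel (\<lambda>x. exp (M * norm x powr \<gamma>) * f x))"
    and B3: "\<exists>C>0. \<exists>r>0. \<forall>x.
          norm (total_deriv f x) \<le> C * (1 + norm x) powr (- (real DIM('a) + r)) \<and>
          norm (total_deriv (total_deriv f) x) \<le> C * (1 + norm x) powr (- (real DIM('a) + r)) \<and>
          norm (total_deriv (total_deriv (total_deriv f)) x)
            \<le> C * (1 + norm x) powr (- (real DIM('a) + r))"
    and delta_pos: "\<delta> > 0"
  shows "tendsto_in_probability (PiM UNIV (\<lambda>_::nat. Q))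
           (\<lambda>n X. posterior (DP_prior \<alpha> P0) f n X
                    {(w, \<theta>). (\<Sum>k. w (K + k)) > 1 / real n powr (1 / 2 - \<delta>)})
           0"
proof -
  obtain F where F: "\<And>x. 0 < f x" "\<And>x. f x < F" using B1(2) by blast
  have diff: "f differentiable_on UNIV" using B1(1) by (simp add: C3_def)
  have fm: "f \<in> borel_measurable borel"
    using diff by (intro borel_measurable_continuous_onI differentiable_imp_continuous_on)
  interpret M: mixture_model f F K ws \<theta>s
    by unfold_locales (use fm F f_density A1_weights in \<open>auto simp: less_imp_le\<close>)
  have Q: "Q = M.Q"
    unfolding A1_Q A1_Pstar M.Q_def M.mixture_ps ..
  obtain R \<gamma> where R: "R > 0" "\<gamma> \<ge> 0" "\<And>x. norm (total_deriv (\<lambda>y. ln (f y)) x) \<le> R * (1 + norm x) powr \<gamma>"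
    "\<forall>M>0. integrable lborel (\<lambda>x. exp (M * norm x powr \<gamma>) * f x)"
    using B2 by blast
  have bd: "bounded \<Theta>" using A2(1) by (rule compact_imp_bounded)
  \<comment> \<open>From the first logarithmic derivative bound and the exponential moments;
    compactness of \<Theta> makes the envelope uniform over all admissible atoms.\<close>
  obtain E I where E: "E \<in> borel_measurable borel" "\<forall>x. E x \<ge> 0"
      "\<forall>x. \<forall>\<theta>\<in>\<Theta>. \<forall>\<theta>'\<in>\<Theta>. f (x - \<theta>) \<le> E x * f (x - \<theta>')"
      "\<forall>x. \<forall>\<theta>\<in>\<Theta>. \<forall>\<theta>'\<in>\<Theta>. norm (\<theta> - \<theta>') \<le> 1 \<longrightarrow>
        \<bar>f (x - \<theta>) - f (x - \<theta>')\<bar> \<le> norm (\<theta> - \<theta>') * E x * f (x - \<theta>')"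
    and I: "I \<ge> 0" "\<forall>\<theta>\<in>\<Theta>. (\<integral>\<^sup>+x. ennreal ((E x)\<^sup>2) * ennreal (f (x - \<theta>)) \<partial>lborel) \<le> ennreal I"
    using envelope_exists[OF diff F(1) R bd] by (elim exE conjE) (rule that)
  note P0 = P0_density_bounds[OF A3_density A2(1) A3_p0]
  obtain b where b: "b \<ge> 1" "\<And>x r. r \<ge> 0 \<Longrightarrow> emeasure P0 (cball x r) \<le> ennreal (b * r ^ DIM('a))"
    using P0(3) by blast
  have lower: "\<exists>c>0. \<exists>d>0. \<forall>\<tau>. 0 < \<tau> \<longrightarrow> \<tau> < d \<longrightarrow> ennreal (c * \<tau> ^ DIM('a)) \<le> emeasure P0 (ball (\<theta>s k) \<tau>)"
    if k: "k < K" for k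
  proof -
    obtain c where "c > 0" "\<forall>\<^sub>F \<epsilon> in at_right 0.
        measure lborel (\<Theta> \<inter> ball (\<theta>s k) \<epsilon>) \<ge> c * measure lborel (ball (\<theta>s k) \<epsilon>)"
      using Theta_thick k by blast
    then show ?thesis using A2(2) A3_pos k by (intro P0(4)) auto
  qed
  show ?thesis
    unfolding Q
  proof (rule M.posterior_tail_tendsto[OF alpha_pos P0_prob P0(1,2) b lower bd])
    show "inj_on \<theta>s {..<K}" by (rule A1_distinct)
    show "E \<in> borel_measurable borel" by (rule E(1))
    show "I \<ge> 0" by (rule I(1))
  qed (use A2(2) E(2-4) I(2) delta_pos in blast)+
qed

end
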